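(* Let $N\geq 2$ be an integer, let $\frac{4-N}{2}<\alpha<2$, and put $2^{**}_{\alpha}=\frac{2N}{N-4+2\alpha}$. Then the radial nontrivial solutions in $\mathcal{D}^{2,2}_\alpha(\mathbb{R}^N)$ of the equation $$\mathrm{div}(|x|^{\alpha}\nabla(\mathrm{div}(|x|^\alpha\nabla u)))=|u|^{2^{**}_{\alpha}-2}u\quad \text{in } \mathbb{R}^N$$ are unique up to scalings $u\mapsto \lambda^{\frac{N-4+2\alpha}{2}}u(\lambda\,\cdot)$, $\lambda>0$, and change of sign: the equation has radial nontrivial solutions in $\mathcal{D}^{2,2}_\alpha(\mathbb{R}^N)$, and they are exactly the functions $\pm U_{\lambda,\alpha}$ with $\lambda>0$, where $$U_{\lambda,\alpha}(x)=\frac{C_{N,\alpha}\,\lambda^{\frac{N-4+2\alpha}{2}}}{(1+\lambda^{2-\alpha}|x|^{2-\alpha})^{\frac{N-4+2\alpha}{2-\alpha}}},\qquad C_{N,\alpha}=\left[(N-4+2\alpha)(N-2+\alpha)N(N+2-\alpha)\right]^{\frac{N-4+2\alpha}{8-4\alpha}}.$$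
   Context: $\mathcal{D}^{2,2}_\alpha(\mathbb{R}^N)$ is the completion of $\{u\in C^\infty_c(\mathbb{R}^N): \int_{\mathbb{R}^N} |\mathrm{div}(|x|^\alpha\nabla u)|^2 \,\mathrm{d}x<\infty\}$ with respect to the inner product $\langle u,v\rangle_\alpha=\int_{\mathbb{R}^N} \mathrm{div}(|x|^\alpha\nabla u)\,\mathrm{div}(|x|^\alpha\nabla v)\, \mathrm{d}x$, with norm $\|u\|_{\mathcal{D}^{2,2}_\alpha(\mathbb{R}^N)}=\langle u,u\rangle_\alpha^{1/2}$. A function $u$ is radial if $u(x)=u(|x|)$. A solution in $\mathcal{D}^{2,2}_\alpha(\mathbb{R}^N)$ is understood in the weak sense: $\langle u,\varphi\rangle_\alpha=\int_{\mathbb{R}^N}|u|^{2^{**}_\alpha-2}u\,\varphi\,\mathrm{d}x$ for all $\varphi\in C_c^\infty(\mathbb{R}^N)$ with $\int_{\mathbb{R}^N} |\mathrm{div}(|x|^\alpha\nabla \varphi)|^2\,\mathrm{d}x<\infty$. *)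

theory Defs
  imports "HOL-Analysis.Analysis"
begin

definition partial_deriv :: "'n \<Rightarrow> (real ^ 'n \<Rightarrow> real) \<Rightarrow> real ^ 'n \<Rightarrow> real" where
  "partial_deriv i f x = frechet_derivative f (at x) (axis i 1)"

definition grad :: "(real ^ 'n \<Rightarrow> real) \<Rightarrow> real ^ 'n \<Rightarrow> real ^ 'n" where
  "grad f x = (\<chi> i. partial_deriv i f x)"

definition divergence :: "(real ^ 'n \<Rightarrow> real ^ 'n) \<Rightarrow> real ^ 'n \<Rightarrow> real" where
  "divergence F x = (\<Sum>i\<in>UNIV. partial_deriv i (\<lambda>y. F y $ i) x)"

text \<open>All iterated partial derivatives exist and are (Frechet) differentiable, hence continuous.\<close>

definition smooth :: "(real ^ 'n \<Rightarrow> real) \<Rightarrow> bool" where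
  "smooth f \<longleftrightarrow> (\<forall>is x. fold partial_deriv is f differentiable (at x))"

definition compactly_supported :: "(real ^ 'n \<Rightarrow> real) \<Rightarrow> bool" where
  "compactly_supported f \<longleftrightarrow> (\<exists>K. compact K \<and> (\<forall>x. x \<notin> K \<longrightarrow> f x = 0))"

text \<open>This is only applied to smooth functions, where it is the classical derivative at every
  nonzero point; the value at the origin, where the weight may be singular, is irrelevant since
  it only occurs under integrals.\<close>

definition wdiv :: "real \<Rightarrow> (real ^ 'n \<Rightarrow> real) \<Rightarrow> real ^ 'n \<Rightarrow> real" where
  "wdiv \<alpha> u = divergence (\<lambda>x. (norm x powr \<alpha>) *\<^sub>R grad u x)"

definition test_fun :: "real \<Rightarrow> (real ^ 'n \<Rightarrow> real) set" where
  "test_fun \<alpha> = {u. smooth u \<and> compactly_supported u \<and>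
     integrable lebesgue (\<lambda>x. (wdiv \<alpha> u x)\<^sup>2)}"

definition test_inner :: "real \<Rightarrow> (real ^ 'n \<Rightarrow> real) \<Rightarrow> (real ^ 'n \<Rightarrow> real) \<Rightarrow> real" where
  "test_inner \<alpha> u v = (LINT x|lebesgue. wdiv \<alpha> u x * wdiv \<alpha> v x)"

definition test_norm :: "real \<Rightarrow> (real ^ 'n \<Rightarrow> real) \<Rightarrow> real" where
  "test_norm \<alpha> u = sqrt (test_inner \<alpha> u u)"

text \<open>The completion is realised as a space of functions: an element of the completion, given by
  a Cauchy sequence of test functions, is identified with the limit of that sequence in
  \<open>L\<^sup>1\<close> on compact sets. For \<open>(4 - N) / 2 < \<alpha> < 2\<close> this is a faithful model of the
  abstract completion. The limit exists by the weighted Rellich inequality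
  \[\int |\mathrm{div}(|x|^\alpha \nabla u)|^2 \ge c \int |x|^{2\alpha-4} u^2\]
  with \<open>c = (N * (N - 4 + 2 * \<alpha>) / 4)\<^sup>2 > 0\<close>. Distinct elements have distinct limits because
  a Cauchy sequence tending to \<open>0\<close> in this sense also tends to \<open>0\<close> in norm: test the
  \<open>L\<^sup>2\<close>-limit of the weighted divergences against smooth functions supported off the origin.\<close>

definition represents ::
    "real \<Rightarrow> (nat \<Rightarrow> real ^ 'n \<Rightarrow> real) \<Rightarrow> (real ^ 'n \<Rightarrow> real) \<Rightarrow> bool" where
  "represents \<alpha> w u \<longleftrightarrow>
     (\<forall>n. w n \<in> test_fun \<alpha>) \<and>
     (\<forall>e>0. \<exists>M. \<forall>m\<ge>M. \<forall>n\<ge>M. test_norm \<alpha> (\<lambda>x. w m x - w n x) < e) \<and>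
     (\<forall>K. compact K \<longrightarrow> u absolutely_integrable_on K \<and>
        (\<lambda>n. LINT x:K|lebesgue. \<bar>w n x - u x\<bar>) \<longlonglongrightarrow> 0)"

text \<open>Elements are individual functions; those agreeing almost everywhere are not identified
  here, so equality of elements has to be read as equality almost everywhere.\<close>

definition D22 :: "real \<Rightarrow> (real ^ 'n \<Rightarrow> real) set" where
  "D22 \<alpha> = {u. \<exists>w. represents \<alpha> w u}"

definition D22_inner :: "real \<Rightarrow> (real ^ 'n \<Rightarrow> real) \<Rightarrow> (real ^ 'n \<Rightarrow> real) \<Rightarrow> real" where
  "D22_inner \<alpha> u v = (THE c. \<forall>w z. represents \<alpha> w u \<longrightarrow> represents \<alpha> z v \<longrightarrow>
     (\<lambda>n. test_inner \<alpha> (w n) (z n)) \<longlonglongrightarrow> c)"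

definition crit_exp :: "nat \<Rightarrow> real \<Rightarrow> real" where
  "crit_exp N \<alpha> = 2 * real N / (real N - 4 + 2 * \<alpha>)"

text \<open>Integrability of the nonlinear term is required explicitly, since the Bochner integral of a
  non-integrable function is \<open>0\<close> by convention.\<close>

definition weak_solution :: "real \<Rightarrow> (real ^ 'n \<Rightarrow> real) \<Rightarrow> bool" where
  "weak_solution \<alpha> u \<longleftrightarrow> (\<forall>\<phi>\<in>test_fun \<alpha>.
     integrable lebesgue (\<lambda>x. \<bar>u x\<bar> powr (crit_exp CARD('n) \<alpha> - 2) * u x * \<phi> x) \<and>
     D22_inner \<alpha> u \<phi> =
       (LINT x|lebesgue. \<bar>u x\<bar> powr (crit_exp CARD('n) \<alpha> - 2) * u x * \<phi> x))"

definition radial :: "(real ^ 'n \<Rightarrow> real) \<Rightarrow> bool" where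
  "radial u \<longleftrightarrow> (\<exists>f :: real \<Rightarrow> real. AE x in lebesgue. u x = f (norm x))"

definition radial_nontrivial_solution :: "real \<Rightarrow> (real ^ 'n \<Rightarrow> real) \<Rightarrow> bool" where
  "radial_nontrivial_solution \<alpha> u \<longleftrightarrow>
     u \<in> D22 \<alpha> \<and> weak_solution \<alpha> u \<and> radial u \<and> \<not> (AE x in lebesgue. u x = 0)"

definition bubble_const :: "nat \<Rightarrow> real \<Rightarrow> real" where
  "bubble_const N \<alpha> =
     ((real N - 4 + 2 * \<alpha>) * (real N - 2 + \<alpha>) * real N * (real N + 2 - \<alpha>))
       powr ((real N - 4 + 2 * \<alpha>) / (8 - 4 * \<alpha>))"

definition bubble :: "real \<Rightarrow> real \<Rightarrow> real ^ 'n \<Rightarrow> real" where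
  "bubble \<alpha> l x =
     bubble_const CARD('n) \<alpha> * l powr ((real CARD('n) - 4 + 2 * \<alpha>) / 2) /
     (1 + l powr (2 - \<alpha>) * norm x powr (2 - \<alpha>))
       powr ((real CARD('n) - 4 + 2 * \<alpha>) / (2 - \<alpha>))"

end

theory Submission
  imports Defs
begin

text \<open>For radial functions the equation becomes a system of two second-order ordinary differential
  equations for \<open>u\<close> and \<open>v = div (|x|\<^sup>\<alpha> \<nabla> u)\<close>. Testing the weak equation with radial functions shows
  that a weak solution solves it away from the origin with \<open>v\<close> in \<open>L\<^sup>2\<close>, and a bootstrap bounds
  \<open>u\<close> and \<open>v\<close> near the origin, so that both have limits there and their fluxes vanish. The system is
  cooperative: of two solutions with the same \<open>u(0)\<close>, the one with the larger \<open>v(0)\<close> keeps the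
  larger \<open>v\<close>, by at least a positive constant, which is impossible for two functions
  in \<open>L\<^sup>2\<close>. Hence \<open>u(0)\<close> determines the solution, and the values at the origin of the bubbles and
  their negatives are all the nonzero numbers.\<close>

subsection \<open>Smooth functions of one real variable\<close>

text \<open>The problem is critical. With \<open>aexp\<close> = (N-4+2\<alpha>)/2 and
  \<open>bexp\<close> = 2-\<alpha>, square integrability of v only yields u = o(r^-aexp), so the
  potential |u|^pexp is o(r^(-2 bexp)), exactly the scaling of the fourth-order operator. Iterating
  such a bound gains no power of r; what closes the bootstrap is that its coefficient is small and
  can be absorbed.

  The second obstacle is the origin, where the weight may be singular or degenerate. Smooth
  functions that are constant near 0 are admissible for every \<alpha> in the range, and unlike
  those vanishing near 0 they see a point source there. Testing with them forces the fluxes to be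
  integrals over balls, hence to tend to 0. The bubbles are functions of r^(2-\<alpha>), in general
  not smooth at 0, so they too must be reached through such functions.

  Finally, a radial function comes with a profile that is not known to be measurable, so u is
  identified with a continuous profile by testing on compact sets of radii.\<close>

definition smooth1 :: "real set \<Rightarrow> (real \<Rightarrow> real) \<Rightarrow> bool" where
  "smooth1 I f \<longleftrightarrow> (\<forall>n. \<forall>x\<in>I. (deriv ^^ n) f field_differentiable (at x))"

text \<open>It is enough to name a class of functions closed under differentiation on I. The
  induction compares the iterated derivatives of f with members of S only on I, and openness of I is
  what lets such an agreement pass to the next derivative.\<close>

lemma smooth1_coinduct:
  assumes "open I" and "f \<in> S"
    and S: "\<And>f. f \<in> S \<Longrightarrow> \<exists>f'\<in>S. \<forall>x\<in>I. (f has_field_derivative f' x) (at x)"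
  shows "smooth1 I f"
proof -
  have "\<exists>h\<in>S. \<forall>x\<in>I. (deriv ^^ n) f x = h x" for n
  proof (induction n)
    case 0
    then show ?case using assms(2) by auto
  next
    case (Suc n)
    then obtain h where h: "h \<in> S" "\<And>x. x \<in> I \<Longrightarrow> (deriv ^^ n) f x = h x" by blast
    from S[OF h(1)] obtain h' where h': "h' \<in> S" "\<And>x. x \<in> I \<Longrightarrow> (h has_field_derivative h' x) (at x)"
      by blast
    have "deriv ((deriv ^^ n) f) x = h' x" if "x \<in> I" for x
    proof (rule DERIV_imp_deriv)
      show "((deriv ^^ n) f has_field_derivative h' x) (at x)"
        by (rule has_field_derivative_transform_within_open[OF h'(2)[OF that] assms(1) that])
           (simp add: h(2))
    qed
    then show ?case using h'(1) by auto
  qed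
  then have *: "\<exists>h\<in>S. \<forall>x\<in>I. (deriv ^^ n) f x = h x" for n .
  show ?thesis unfolding smooth1_def
  proof (intro allI ballI)
    fix n x assume x: "x \<in> I"
    obtain h where h: "h \<in> S" "\<And>x. x \<in> I \<Longrightarrow> (deriv ^^ n) f x = h x" using * by blast
    from S[OF h(1)] obtain h' where h': "\<And>x. x \<in> I \<Longrightarrow> (h has_field_derivative h' x) (at x)"
      by blast
    have "((deriv ^^ n) f has_field_derivative h' x) (at x)"
        by (rule has_field_derivative_transform_within_open[OF h'[OF x] assms(1) x])
           (simp add: h(2))
    then show "(deriv ^^ n) f field_differentiable (at x)"
      by (auto simp: field_differentiable_def)
  qed
qed

lemma smooth1_DERIV: "smooth1 I f \<Longrightarrow> x \<in> I \<Longrightarrow> (f has_field_derivative deriv f x) (at x)"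
  by (metis DERIV_deriv_iff_field_differentiable funpow_0 smooth1_def)

lemma smooth1_deriv: "smooth1 I f \<Longrightarrow> smooth1 I (deriv f)"
  unfolding smooth1_def by (metis funpow_Suc_right comp_apply)

lemma smooth1_mono: "smooth1 J f \<Longrightarrow> I \<subseteq> J \<Longrightarrow> smooth1 I f"
  unfolding smooth1_def by auto

lemma smooth1_Un: "smooth1 I f \<Longrightarrow> smooth1 J f \<Longrightarrow> smooth1 (I \<union> J) f"
  unfolding smooth1_def by auto

lemma smooth1_continuous_on: "smooth1 I f \<Longrightarrow> continuous_on I f"
  by (meson DERIV_isCont continuous_at_imp_continuous_on smooth1_DERIV)

lemma smooth1_antideriv:
  assumes "open I" "smooth1 I g" "\<And>x. x \<in> I \<Longrightarrow> (f has_field_derivative g x) (at x)"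
  shows "smooth1 I f"
proof (rule smooth1_coinduct[OF assms(1), where S = "insert f {h. smooth1 I h}"])
  fix h assume "h \<in> insert f {h. smooth1 I h}"
  then consider "h = f" | "smooth1 I h" by blast
  then show "\<exists>f'\<in>insert f {h. smooth1 I h}. \<forall>x\<in>I. (h has_field_derivative f' x) (at x)"
  proof cases
    case 1
    then show ?thesis using assms by (intro bexI[of _ g]) auto
  next
    case 2
    then show ?thesis by (intro bexI[of _ "deriv h"]) (auto intro: smooth1_deriv smooth1_DERIV)
  qed
qed simp

lemma smooth1_cong:
  assumes "open I" "smooth1 I f" "\<And>x. x \<in> I \<Longrightarrow> f x = g x"
  shows "smooth1 I g"
proof (rule smooth1_antideriv[OF assms(1) smooth1_deriv[OF assms(2)]])
  fix x assume "x \<in> I"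
  then show "(g has_field_derivative deriv f x) (at x)"
    using has_field_derivative_transform_within_open[OF smooth1_DERIV[OF assms(2)] assms(1)] assms(3)
    by blast
qed

text \<open>The class handed to \<open>smooth1_coinduct\<close>. The chain rule turns a composition
  into a product and the product rule turns a product into a sum, so the three constructions must be
  closed up together.\<close>

inductive_set smooth1_closure :: "real set \<Rightarrow> real set \<Rightarrow> (real \<Rightarrow> real) set" for I J where
  base: "smooth1 I h \<Longrightarrow> h \<in> smooth1_closure I J"
| comp: "smooth1 J f \<Longrightarrow> smooth1 I g \<Longrightarrow> g ` I \<subseteq> J \<Longrightarrow> (\<lambda>x. f (g x)) \<in> smooth1_closure I J"
| add: "f \<in> smooth1_closure I J \<Longrightarrow> g \<in> smooth1_closure I J \<Longrightarrow> (\<lambda>x. f x + g x) \<in> smooth1_closure I J"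
| mult: "f \<in> smooth1_closure I J \<Longrightarrow> g \<in> smooth1_closure I J \<Longrightarrow> (\<lambda>x. f x * g x) \<in> smooth1_closure I J"

lemma smooth1_closure_smooth1:
  assumes "open I" "f \<in> smooth1_closure I J"
  shows "smooth1 I f"
proof (rule smooth1_coinduct[OF assms])
  fix f assume "f \<in> smooth1_closure I J"
  then show "\<exists>f'\<in>smooth1_closure I J. \<forall>x\<in>I. (f has_field_derivative f' x) (at x)"
  proof induction
    case (base h)
    then show ?case
      by (intro bexI[of _ "deriv h"]) (auto intro: smooth1_closure.base smooth1_deriv smooth1_DERIV)
  next
    case (comp f g)
    show ?case
    proof (intro bexI ballI)
      show "(\<lambda>x. deriv f (g x) * deriv g x) \<in> smooth1_closure I J"
        by (intro smooth1_closure.mult smooth1_closure.comp smooth1_closure.base comp smooth1_deriv)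
      fix x assume "x \<in> I"
      then show "((\<lambda>x. f (g x)) has_field_derivative deriv f (g x) * deriv g x) (at x)"
        using comp by (intro DERIV_chain2) (auto intro: smooth1_DERIV)
    qed
  next
    case (add f g)
    then obtain f' g' where "f' \<in> smooth1_closure I J" "g' \<in> smooth1_closure I J"
      "\<forall>x\<in>I. (f has_field_derivative f' x) (at x)" "\<forall>x\<in>I. (g has_field_derivative g' x) (at x)" by blast
    then show ?case
      by (intro bexI[of _ "\<lambda>x. f' x + g' x"]) (auto intro!: derivative_intros smooth1_closure.add)
  next
    case (mult f g)
    then obtain f' g' where *: "f' \<in> smooth1_closure I J" "g' \<in> smooth1_closure I J"
      "\<forall>x\<in>I. (f has_field_derivative f' x) (at x)" "\<forall>x\<in>I. (g has_field_derivative g' x) (at x)" by blast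
    show ?case
    proof (intro bexI ballI)
      show "(\<lambda>x. f' x * g x + g' x * f x) \<in> smooth1_closure I J"
        by (intro smooth1_closure.add smooth1_closure.mult mult * )
      fix x assume "x \<in> I"
      then show "((\<lambda>x. f x * g x) has_field_derivative f' x * g x + g' x * f x) (at x)"
        using * by (intro DERIV_mult) auto
    qed
  qed
qed

lemma smooth1_add [intro]:
  "open I \<Longrightarrow> smooth1 I f \<Longrightarrow> smooth1 I g \<Longrightarrow> smooth1 I (\<lambda>x. f x + g x)"
  by (rule smooth1_closure_smooth1[where J = UNIV]) (auto intro: smooth1_closure.base smooth1_closure.add)

lemma smooth1_mult [intro]:
  "open I \<Longrightarrow> smooth1 I f \<Longrightarrow> smooth1 I g \<Longrightarrow> smooth1 I (\<lambda>x. f x * g x)"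
  by (rule smooth1_closure_smooth1[where J = UNIV]) (auto intro: smooth1_closure.base smooth1_closure.mult)

lemma smooth1_comp:
  "open I \<Longrightarrow> smooth1 J f \<Longrightarrow> smooth1 I g \<Longrightarrow> g ` I \<subseteq> J \<Longrightarrow> smooth1 I (\<lambda>x. f (g x))"
  by (rule smooth1_closure_smooth1[where J = J]) (auto intro: smooth1_closure.comp)

lemma smooth1_affine [intro]:
  assumes "open I" shows "smooth1 I (\<lambda>x. a * x + b)"
proof (rule smooth1_coinduct[OF assms, where S = "{\<lambda>x. a * x + b |a b. True}"])
  fix f assume "f \<in> {\<lambda>x::real. a * x + b |a b. True}"
  then obtain a b where f: "f = (\<lambda>x. a * x + b)" by blast
  show "\<exists>f'\<in>{\<lambda>x. a * x + b |a b. True}. \<forall>x\<in>I. (f has_field_derivative f' x) (at x)"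
    unfolding f
    by (intro bexI[of _ "\<lambda>x. 0 * x + a"] CollectI exI[of _ 0] exI[of _ a])
       (auto intro!: derivative_eq_intros)
qed auto

lemma smooth1_const [intro]: "open I \<Longrightarrow> smooth1 I (\<lambda>x. c)"
  using smooth1_affine[of I 0 c] by simp

lemma smooth1_ident [intro]: "open I \<Longrightarrow> smooth1 I (\<lambda>x. x)"
  using smooth1_affine[of I 1 0] by simp

lemma smooth1_cmult [intro]: "open I \<Longrightarrow> smooth1 I f \<Longrightarrow> smooth1 I (\<lambda>x. c * f x)"
  by (intro smooth1_mult smooth1_const)

lemma smooth1_minus [intro]: "open I \<Longrightarrow> smooth1 I f \<Longrightarrow> smooth1 I (\<lambda>x. - f x)"
  using smooth1_cmult[of I f "-1"] by simp

lemma smooth1_diff [intro]: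
  "open I \<Longrightarrow> smooth1 I f \<Longrightarrow> smooth1 I g \<Longrightarrow> smooth1 I (\<lambda>x. f x - g x)"
  using smooth1_add[of I f "\<lambda>x. - g x"] by auto

lemma smooth1_powr [intro]:
  assumes "open I" "I \<subseteq> {0<..}"
  shows "smooth1 I (\<lambda>x. x powr s)"
proof (rule smooth1_coinduct[OF assms(1), where S = "{\<lambda>x. c * x powr s |c s. True}"])
  show "(\<lambda>x. x powr s) \<in> {\<lambda>x. c * x powr s |c s. True}"
    by (intro CollectI exI[of _ 1] exI[of _ s]) auto
  fix f assume "f \<in> {\<lambda>x::real. c * x powr s |c s. True}"
  then obtain c s where f: "f = (\<lambda>x. c * x powr s)" by blast
  show "\<exists>f'\<in>{\<lambda>x. c * x powr s |c s. True}. \<forall>x\<in>I. (f has_field_derivative f' x) (at x)"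
    unfolding f using assms(2)
    by (intro bexI[of _ "\<lambda>x. (c * s) * x powr (s - 1)"])
       (auto intro!: derivative_eq_intros has_real_derivative_powr)
qed

lemma smooth1_powr_comp:
  assumes "open I" "smooth1 I g" "\<And>x. x \<in> I \<Longrightarrow> 0 < g x"
  shows "smooth1 I (\<lambda>x. g x powr s)"
  by (rule smooth1_comp[where J = "{0<..}" and f = "\<lambda>y. y powr s"]) (use assms smooth1_powr in auto)

lemma smooth1_inverse_comp:
  assumes "open I" "smooth1 I g" "\<And>x. x \<in> I \<Longrightarrow> 0 < g x"
  shows "smooth1 I (\<lambda>x. inverse (g x))"
  by (rule smooth1_cong[OF assms(1) smooth1_powr_comp[OF assms, of "-1"]])
     (use assms(3) in \<open>auto simp: powr_minus less_imp_le\<close>)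

lemma smooth1_power: "open I \<Longrightarrow> smooth1 I f \<Longrightarrow> smooth1 I (\<lambda>x. f x ^ n)"
  by (induction n) (auto intro: smooth1_mult)

lemma smooth1_real_polynomial_function:
  assumes "open I" "real_polynomial_function f"
  shows "smooth1 I f"
  using assms(2)
proof induction
  case (linear f)
  have "f x = f 1 * x + 0" for x
    using bounded_linear.linear[OF linear, THEN linear_cmul, of x 1] by (simp add: mult.commute)
  then have "f = (\<lambda>x. f 1 * x + 0)" by (rule ext)
  then show ?case using smooth1_affine[OF assms(1), of "f 1" 0] by simp
qed (use assms(1) in auto)

section \<open>The flat exponential and a smooth step from 0 to 1\<close>

definition flat_exp :: "real \<Rightarrow> real" where
  "flat_exp x = (if x > 0 then exp (- (1 / x)) else 0)"

lemma poly_exp_decay: "((\<lambda>y::real. poly p y * exp (- y)) \<longlongrightarrow> 0) at_top"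
proof -
  have "((\<lambda>y::real. \<Sum>i\<le>degree p. coeff p i * (y ^ i / exp y)) \<longlongrightarrow> (\<Sum>i\<le>degree p. coeff p i * 0)) at_top"
    by (intro tendsto_intros tendsto_power_div_exp_0)
  then show ?thesis
    by (simp add: poly_altdef sum_distrib_right exp_minus divide_inverse mult.assoc)
qed

lemma smooth1_flat_exp: "smooth1 UNIV flat_exp"
proof (rule smooth1_coinduct[where
      S = "{\<lambda>x. if x > 0 then poly p (1/x) * exp (- (1 / x)) else 0 |p. True}"])
  show "flat_exp \<in> {\<lambda>x. if x > 0 then poly p (1/x) * exp (- (1 / x)) else 0 |p. True}"
    by (intro CollectI exI[of _ "1::real poly"]) (auto simp: flat_exp_def fun_eq_iff)
  fix f :: "real \<Rightarrow> real"
  assume "f \<in> {\<lambda>x. if x > 0 then poly p (1/x) * exp (- (1 / x)) else 0 |p. True}"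
  then obtain p where f: "f = (\<lambda>x. if x > 0 then poly p (1/x) * exp (- (1 / x)) else 0)" by blast
  \<comment> \<open>With y = 1/x, differentiating the exponential contributes the factor y^2, and
    differentiating p(1/x) contributes - y^2 p'(y).\<close>
  define q where "q = [:0, 0, 1:] * (p - pderiv p)"
  have pos: "((\<lambda>x. poly p (1/x) * exp (- (1 / x))) has_field_derivative
       poly q (1/x) * exp (- (1 / x))) (at x)" if "x > 0" for x
    using that unfolding q_def
    by (auto intro!: derivative_eq_intros DERIV_chain2[OF poly_DERIV]
             simp: field_simps power2_eq_square)
  show "\<exists>f'\<in>{\<lambda>x. if x > 0 then poly p (1/x) * exp (- (1 / x)) else 0 |p. True}.
          \<forall>x\<in>UNIV. (f has_field_derivative f' x) (at x)"
  proof (intro bexI[of _ "\<lambda>x. if x > 0 then poly q (1/x) * exp (- (1 / x)) else 0"] ballI)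
    fix x :: real
    consider "x > 0" | "x < 0" | "x = 0" by linarith
    then show "(f has_field_derivative (if x > 0 then poly q (1/x) * exp (- (1 / x)) else 0)) (at x)"
    proof cases
      case 1
      have "(f has_field_derivative poly q (1/x) * exp (- (1 / x))) (at x)"
        by (rule has_field_derivative_transform_within_open[OF pos[OF 1], of "{0<..}"])
           (use 1 in \<open>auto simp: f\<close>)
      then show ?thesis using 1 by simp
    next
      case 2
      have "(f has_field_derivative 0) (at x)"
        by (rule has_field_derivative_transform_within_open[of "\<lambda>x. 0" _ _ "{..<0}"])
           (use 2 in \<open>auto simp: f\<close>)
      then show ?thesis using 2 by simp
    next
      case 3
      \<comment> \<open>The difference quotient at 0 from the right is y p(y) exp(-y) with y =
        1/h.\<close>
      have "((\<lambda>y. poly ([:0,1:] * p) y * exp (-y)) \<longlongrightarrow> 0) at_top"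
        by (rule poly_exp_decay)
      then have "((\<lambda>h. poly ([:0,1:] * p) (1/h) * exp (-(1/h))) \<longlongrightarrow> 0) (at_right (0::real))"
        by (rule filterlim_compose) (simp add: filterlim_inverse_at_top_right flip: inverse_eq_divide)
      then have R: "((\<lambda>h. (f (0 + h) - f 0) / h) \<longlongrightarrow> 0) (at_right 0)"
        by (rule Lim_transform_eventually) (auto simp: eventually_at_right_field f intro!: exI[of _ 1])
      have L: "((\<lambda>h. (f (0 + h) - f 0) / h) \<longlongrightarrow> 0) (at_left 0)"
        by (rule Lim_transform_eventually[of "\<lambda>_. 0"])
           (auto simp: eventually_at_left_field f intro!: exI[of _ "-1"])
      have "(f has_field_derivative 0) (at 0)"
        unfolding DERIV_def using filterlim_split_at[OF L R] .
      then show ?thesis using 3 by simp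
    qed
  qed blast
qed simp

definition smooth_step :: "real \<Rightarrow> real" where
  "smooth_step x = flat_exp x * inverse (flat_exp x + flat_exp (1 - x))"

text \<open>The numbers x and 1 - x are never both nonpositive.\<close>

lemma flat_exp_denominator_pos: "0 < flat_exp x + flat_exp (1 - x)"
  by (auto simp: flat_exp_def add_pos_pos)

lemma smooth1_smooth_step: "smooth1 UNIV smooth_step"
proof -
  have "smooth1 UNIV (\<lambda>x. flat_exp (1 - x))"
    by (rule smooth1_comp[OF open_UNIV smooth1_flat_exp smooth1_diff]) auto
  then have "smooth1 UNIV (\<lambda>x. flat_exp x * inverse (flat_exp x + flat_exp (1 - x)))"
    by (intro smooth1_mult smooth1_inverse_comp smooth1_add smooth1_flat_exp)
       (auto simp: flat_exp_denominator_pos)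
  then show ?thesis unfolding smooth_step_def[abs_def] .
qed

lemma smooth_step_0 [simp]: "x \<le> 0 \<Longrightarrow> smooth_step x = 0"
  by (simp add: smooth_step_def flat_exp_def)

lemma smooth_step_1 [simp]: "x \<ge> 1 \<Longrightarrow> smooth_step x = 1"
  by (simp add: smooth_step_def flat_exp_def)

lemma smooth_step_nonneg: "0 \<le> smooth_step x" and smooth_step_le_1: "smooth_step x \<le> 1"
proof -
  have "0 \<le> flat_exp y" for y by (simp add: flat_exp_def)
  then show "0 \<le> smooth_step x" "smooth_step x \<le> 1"
    using flat_exp_denominator_pos[of x]
    by (simp_all add: smooth_step_def divide_simps flip: divide_inverse)
qed

lemma smooth1_smooth_step_affine: "open I \<Longrightarrow> smooth1 I (\<lambda>x. smooth_step (a * x + b))"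
  by (rule smooth1_comp[OF _ smooth1_smooth_step]) auto

lemma compact_support_bounded:
  fixes f :: "real \<Rightarrow> real"
  assumes "continuous_on UNIV f" "\<And>x. x \<notin> {a..b} \<Longrightarrow> f x = 0"
  shows "\<exists>B\<ge>0. \<forall>x. \<bar>f x\<bar> \<le> B"
proof -
  have "compact (f ` {a..b})"
    by (intro compact_continuous_image continuous_on_subset[OF assms(1)]) auto
  then obtain B where "\<forall>y\<in>f ` {a..b}. norm y \<le> B" using compact_imp_bounded bounded_iff by metis
  then show ?thesis using assms(2)
    by (intro exI[of _ "max B 0"]) (metis abs_zero image_eqI max.cobounded2 max.coboundedI1 real_norm_def)
qed

lemma smooth1_deriv_support:
  assumes "smooth1 UNIV f" "\<And>x. x \<notin> {a..b} \<Longrightarrow> f x = c" "x \<notin> {a..b}"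
  shows "deriv f x = 0"
  by (rule DERIV_imp_deriv, rule has_field_derivative_transform_within_open[of "\<lambda>_. c" _ _ "- {a..b}"])
     (use assms in auto)

lemma deriv_locally_const:
  fixes f :: "real \<Rightarrow> real"
  assumes "open S" "x \<in> S" "\<And>y. y \<in> S \<Longrightarrow> f y = c"
  shows "deriv f x = 0"
  by (rule DERIV_imp_deriv, rule has_field_derivative_transform_within_open[of "\<lambda>_. c" _ _ S])
     (use assms in auto)

lemma smooth_step_deriv_outside: "x < 0 \<or> x > 1 \<Longrightarrow> deriv smooth_step x = 0"
  by (elim disjE, rule deriv_locally_const[of "{..<0}" _ _ 0], auto)
     (rule deriv_locally_const[of "{1<..}" _ _ 1], auto)

text \<open>Both derivatives are continuous and vanish off \<open>{0..1}\<close>. Two of them are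
  controlled because the weighted divergence of a cutoff is of second order.\<close>

lemma smooth_step_derivs_bounded:
  obtains B where "B \<ge> 0" "\<And>x. \<bar>deriv smooth_step x\<bar> \<le> B" "\<And>x. \<bar>deriv (deriv smooth_step) x\<bar> \<le> B"
proof -
  have s: "smooth1 UNIV (deriv smooth_step)" "smooth1 UNIV (deriv (deriv smooth_step))"
    using smooth1_smooth_step smooth1_deriv by blast+
  have o: "deriv smooth_step x = 0" if "x \<notin> {0..1}" for x using smooth_step_deriv_outside that by force
  have o2: "deriv (deriv smooth_step) x = 0" if "x \<notin> {0..1}" for x
    using smooth1_deriv_support[OF s(1) o that] by simp
  obtain B1 B2 where "B1 \<ge> 0" "B2 \<ge> 0" "\<forall>x. \<bar>deriv smooth_step x\<bar> \<le> B1" "\<forall>x. \<bar>deriv (deriv smooth_step) x\<bar> \<le> B2"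
    using compact_support_bounded[OF smooth1_continuous_on[OF s(1)] o]
      compact_support_bounded[OF smooth1_continuous_on[OF s(2)] o2] by metis
  then show ?thesis by (intro that[of "max B1 B2"]) (auto simp: le_max_iff_disj)
qed

subsection \<open>Smooth functions and the weighted divergence\<close>

lemma partial_deriv_eq: "(f has_derivative f') (at x) \<Longrightarrow> partial_deriv i f x = f' (axis i 1)"
  unfolding partial_deriv_def using frechet_derivative_at by metis

text \<open>\<open>frechet_derivative\<close> is a choice among all derivatives at the point. The
  two functions have the same candidates there, so the choices coincide even where no derivative
  exists.\<close>

lemma partial_deriv_cong_open:
  assumes "open S" "x \<in> S" "\<And>y. y \<in> S \<Longrightarrow> f y = g y"
  shows "partial_deriv i f x = partial_deriv i g x"
proof -
  have "(f has_derivative D) (at x) \<longleftrightarrow> (g has_derivative D) (at x)" for D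
    using has_derivative_transform_within_open[of f D x UNIV S g]
      has_derivative_transform_within_open[of g D x UNIV S f] assms by auto
  then show ?thesis unfolding partial_deriv_def frechet_derivative_def by simp
qed

lemma partial_deriv_add:
  "f differentiable (at x) \<Longrightarrow> g differentiable (at x) \<Longrightarrow>
   partial_deriv i (\<lambda>x. f x + g x) x = partial_deriv i f x + partial_deriv i g x"
  unfolding differentiable_def
  by (elim exE, subst (1 2 3) partial_deriv_eq) (auto intro!: derivative_eq_intros)

lemma partial_deriv_mult:
  "f differentiable (at x) \<Longrightarrow> g differentiable (at x) \<Longrightarrow>
   partial_deriv i (\<lambda>x. f x * g x) x = f x * partial_deriv i g x + partial_deriv i f x * g x"
  unfolding differentiable_def
  by (elim exE, subst (1 2 3) partial_deriv_eq) (auto intro!: derivative_eq_intros)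

lemma partial_deriv_const [simp]: "partial_deriv i (\<lambda>x. c) x = 0"
  by (subst partial_deriv_eq[where f' = "\<lambda>_. 0"]) auto

lemma partial_deriv_coord: "partial_deriv i (\<lambda>x. x $ j) x = (if i = j then 1 else 0)"
  by (subst partial_deriv_eq[where f' = "\<lambda>h. h $ j"])
     (auto intro!: bounded_linear_imp_has_derivative bounded_linear_vec_nth simp: axis_def)

lemma has_derivative_radial_sq:
  assumes "(\<phi> has_field_derivative D) (at (x \<bullet> x))"
  shows "((\<lambda>x::real^'n. \<phi> (x \<bullet> x)) has_derivative (\<lambda>h. D * (2 * (x \<bullet> h)))) (at x)"
proof -
  have "((\<lambda>x::real^'n. x \<bullet> x) has_derivative (\<lambda>h. 2 * (x \<bullet> h))) (at x)"
    by (auto intro!: derivative_eq_intros simp: inner_commute)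
  from has_derivative_compose[OF this assms[unfolded has_field_derivative_def]]
  show ?thesis by simp
qed

lemma has_derivative_radial:
  assumes "(\<phi> has_field_derivative D) (at (norm x))" "x \<noteq> 0"
  shows "((\<lambda>x::real^'n. \<phi> (norm x)) has_derivative (\<lambda>h. D * (x \<bullet> h) / norm x)) (at x)"
proof -
  have "(norm has_derivative (\<lambda>h. h \<bullet> sgn x)) (at x)"
    by (rule has_derivative_norm) fact
  from has_derivative_compose[OF this assms(1)[unfolded has_field_derivative_def]]
  show ?thesis by (simp add: sgn_div_norm inner_commute divide_inverse mult_ac)
qed

lemma smooth_coinduct:
  assumes "f \<in> S" "\<And>f. f \<in> S \<Longrightarrow> (\<forall>x. f differentiable (at x)) \<and> (\<forall>i. partial_deriv i f \<in> S)"
  shows "smooth f"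
  unfolding smooth_def
proof (intro allI)
  fix "is" x
  have "fold partial_deriv is f \<in> S"
    using assms(1) by (induction "is" arbitrary: f) (auto simp: assms(2))
  then show "fold partial_deriv is f differentiable (at x)" using assms(2) by blast
qed

lemma smooth_differentiable: "smooth f \<Longrightarrow> f differentiable (at x)"
  unfolding smooth_def by (metis fold_simps(1))

lemma smooth_partial_deriv: "smooth f \<Longrightarrow> smooth (partial_deriv i f)"
  unfolding smooth_def by (metis fold_simps(2))

lemma smooth_continuous_on: "smooth f \<Longrightarrow> continuous_on S f"
  by (meson continuous_at_imp_continuous_on differentiable_imp_continuous_within smooth_differentiable)

lemma smooth_borel: "smooth f \<Longrightarrow> f \<in> borel_measurable borel"
  by (intro borel_measurable_continuous_onI smooth_continuous_on)

text \<open>The class for \<open>smooth_coinduct\<close>. Radial functions enter through x \<bullet>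
  x, which is smooth at the origin, unlike the norm; the coordinates are included because
  differentiating \<phi>(x \<bullet> x) produces the factor 2 \<open>x $ i\<close>.\<close>

inductive_set smooth_closure :: "(real ^ 'n \<Rightarrow> real) set" where
  base: "smooth f \<Longrightarrow> f \<in> smooth_closure"
| radial_sq: "smooth1 UNIV \<phi> \<Longrightarrow> (\<lambda>x. \<phi> (x \<bullet> x)) \<in> smooth_closure"
| coord: "(\<lambda>x. x $ i) \<in> smooth_closure"
| add: "f \<in> smooth_closure \<Longrightarrow> g \<in> smooth_closure \<Longrightarrow> (\<lambda>x. f x + g x) \<in> smooth_closure"
| mult: "f \<in> smooth_closure \<Longrightarrow> g \<in> smooth_closure \<Longrightarrow> (\<lambda>x. f x * g x) \<in> smooth_closure"

lemma smooth_closure_const: "(\<lambda>x. c) \<in> smooth_closure"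
  using smooth_closure.radial_sq[OF smooth1_const[OF open_UNIV, of c]] by simp

lemma smooth_closure_smooth: "f \<in> smooth_closure \<Longrightarrow> smooth f"
proof (erule smooth_coinduct)
  fix f :: "real ^ 'n \<Rightarrow> real" assume "f \<in> smooth_closure"
  then show "(\<forall>x. f differentiable (at x)) \<and> (\<forall>i. partial_deriv i f \<in> smooth_closure)"
  proof induction
    case (base f)
    then show ?case by (auto intro: smooth_closure.base smooth_partial_deriv smooth_differentiable)
  next
    case (radial_sq \<phi>)
    have d: "((\<lambda>x::real^'n. \<phi> (x \<bullet> x)) has_derivative (\<lambda>h. deriv \<phi> (x \<bullet> x) * (2 * (x \<bullet> h)))) (at x)" for x
      by (intro has_derivative_radial_sq smooth1_DERIV[OF radial_sq]) auto
    have "partial_deriv i (\<lambda>x::real^'n. \<phi> (x \<bullet> x)) = (\<lambda>x. deriv \<phi> (x \<bullet> x) * (2 * x $ i))" for i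
      by (rule ext, subst partial_deriv_eq[OF d]) (simp add: inner_axis)
    moreover have "(\<lambda>x::real^'n. deriv \<phi> (x \<bullet> x) * (2 * x $ i)) \<in> smooth_closure" for i
      by (intro smooth_closure.mult smooth_closure.radial_sq smooth1_deriv radial_sq
          smooth_closure.coord smooth_closure_const)
    ultimately show ?case using d by (auto simp: differentiable_def)
  next
    case (coord i)
    have "(\<lambda>x::real^'n. x $ i) differentiable (at x)" for x
      by (intro bounded_linear_imp_differentiable bounded_linear_vec_nth)
    moreover have "partial_deriv j (\<lambda>x::real^'n. x $ i) = (\<lambda>x. if j = i then 1 else 0)" for j
      by (rule ext) (rule partial_deriv_coord)
    ultimately show ?case by (auto intro: smooth_closure_const)
  next
    case (add f g)
    then have "partial_deriv i (\<lambda>x. f x + g x) = (\<lambda>x. partial_deriv i f x + partial_deriv i g x)" for i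
      by (auto simp: partial_deriv_add)
    with add show ?case by (auto intro: smooth_closure.add)
  next
    case (mult f g)
    then have "partial_deriv i (\<lambda>x. f x * g x) = (\<lambda>x. f x * partial_deriv i g x + partial_deriv i f x * g x)" for i
      by (auto simp: partial_deriv_mult)
    with mult show ?case by (auto intro!: smooth_closure.add smooth_closure.mult)
  qed
qed

lemma smooth_radial_sq: "smooth1 UNIV \<phi> \<Longrightarrow> smooth (\<lambda>x. \<phi> (x \<bullet> x))"
  by (intro smooth_closure_smooth smooth_closure.radial_sq)

lemma smooth_coord: "smooth (\<lambda>x. x $ i)"
  by (intro smooth_closure_smooth smooth_closure.coord)

lemma smooth_const: "smooth (\<lambda>x. c)"
  by (intro smooth_closure_smooth smooth_closure_const)

lemma smooth_add: "smooth f \<Longrightarrow> smooth g \<Longrightarrow> smooth (\<lambda>x. f x + g x)"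
  by (rule smooth_closure_smooth, rule smooth_closure.add; rule smooth_closure.base)

lemma smooth_mult: "smooth f \<Longrightarrow> smooth g \<Longrightarrow> smooth (\<lambda>x. f x * g x)"
  by (rule smooth_closure_smooth, rule smooth_closure.mult; rule smooth_closure.base)

lemma smooth_cmult: "smooth f \<Longrightarrow> smooth (\<lambda>x. c * f x)"
  by (intro smooth_mult smooth_const)

lemma smooth_minus: "smooth f \<Longrightarrow> smooth (\<lambda>x. - f x)"
  using smooth_cmult[of f "-1"] by simp

lemma smooth_diff: "smooth f \<Longrightarrow> smooth g \<Longrightarrow> smooth (\<lambda>x. f x - g x)"
  using smooth_add[of f "\<lambda>x. - g x"] smooth_minus by auto

lemma smooth_sum: "(\<And>i. i \<in> A \<Longrightarrow> smooth (f i)) \<Longrightarrow> smooth (\<lambda>x. \<Sum>i\<in>A. f i x)"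
  by (induction A rule: infinite_finite_induct) (auto intro: smooth_const smooth_add)

text \<open>The profile is rewritten as a function of s = |x|^2. That function is smooth for s > 0
  and constant for s < a^2, and these two open sets cover the line.\<close>

lemma smooth_radial:
  assumes "smooth1 {0<..} \<phi>" "0 < a" "\<And>r. 0 \<le> r \<Longrightarrow> r \<le> a \<Longrightarrow> \<phi> r = c"
  shows "smooth (\<lambda>x::real^'n. \<phi> (norm x))"
proof -
  define \<psi> where "\<psi> s = (if s > 0 then \<phi> (s powr (1/2)) else c)" for s
  have "smooth1 {0<..} \<psi>"
    by (rule smooth1_cong[OF _ smooth1_comp[where J = "{0<..}" and f = \<phi> and g = "\<lambda>s. s powr (1/2)"]])
       (auto simp: \<psi>_def intro!: assms)
  moreover have "smooth1 {..<a^2} \<psi>"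
  proof (rule smooth1_cong[OF _ smooth1_const])
    fix s assume s: "s \<in> {..<a\<^sup>2}"
    then have "s powr (1/2) \<le> a" if "s > 0"
      using that assms(2) by (simp add: powr_half_sqrt real_le_lsqrt)
    then show "c = \<psi> s" by (auto simp: \<psi>_def assms(3))
  qed auto
  ultimately have "smooth1 ({0<..} \<union> {..<a^2}) \<psi>" by (rule smooth1_Un)
  moreover have "{0<..} \<union> {..<a^2} = UNIV" using assms(2) by (auto simp: not_less) (smt (verit) zero_less_power)
  ultimately have "smooth1 UNIV \<psi>" by simp
  then have "smooth (\<lambda>x::real^'n. \<psi> (x \<bullet> x))" by (rule smooth_radial_sq)
  moreover have "\<psi> (x \<bullet> x) = \<phi> (norm x)" for x :: "real^'n"
    using assms(2,3) by (auto simp: \<psi>_def norm_eq_sqrt_inner powr_half_sqrt)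
  ultimately show ?thesis by simp
qed

lemma wdiv_cong_open:
  fixes f :: "real^'n \<Rightarrow> real"
  assumes "open S" "x \<in> S" "\<And>y. y \<in> S \<Longrightarrow> f y = g y"
  shows "wdiv \<alpha> f x = wdiv \<alpha> g x"
  unfolding wdiv_def divergence_def
  by (intro sum.cong refl partial_deriv_cong_open[OF assms(1,2)])
     (use partial_deriv_cong_open[OF assms(1) _ assms(3)] in \<open>simp add: grad_def\<close>)

lemma differentiable_norm_powr:
  "x \<noteq> 0 \<Longrightarrow> ((\<lambda>x::real^'n. norm x powr \<alpha>) has_derivative
     (\<lambda>h. (\<alpha> * norm x powr (\<alpha> - 1)) * (x \<bullet> h) / norm x)) (at x)"
  by (rule has_derivative_radial) (auto intro!: has_real_derivative_powr)

text \<open>The expanded form, valid off the origin, from which linearity and measurability of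
  \<open>wdiv\<close> and smoothness of its cut-off versions are read off.\<close>

lemma wdiv_smooth:
  fixes u :: "real^'n \<Rightarrow> real"
  assumes "smooth u" "x \<noteq> 0"
  shows "wdiv \<alpha> u x = norm x powr \<alpha> * (\<Sum>i\<in>UNIV. partial_deriv i (partial_deriv i u) x) +
           \<alpha> * norm x powr (\<alpha> - 2) * (\<Sum>i\<in>UNIV. x $ i * partial_deriv i u x)"
proof -
  have "partial_deriv i (\<lambda>x. norm x powr \<alpha>) x = \<alpha> * norm x powr (\<alpha> - 2) * x $ i" for i
    by (subst partial_deriv_eq[OF differentiable_norm_powr[OF assms(2)]])
       (use assms(2) in \<open>simp add: inner_axis powr_diff power2_eq_square powr_numeral powr_mult_base field_simps\<close>)
  moreover have "partial_deriv i (\<lambda>y. norm y powr \<alpha> * partial_deriv i u y) x =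
      norm x powr \<alpha> * partial_deriv i (partial_deriv i u) x +
      partial_deriv i (\<lambda>x. norm x powr \<alpha>) x * partial_deriv i u x" for i
  proof (rule partial_deriv_mult)
    show "(\<lambda>x. norm x powr \<alpha>) differentiable (at x)"
      using differentiable_norm_powr[OF assms(2)] by (auto simp: differentiable_def)
    show "partial_deriv i u differentiable (at x)"
      by (intro smooth_differentiable smooth_partial_deriv assms)
  qed
  ultimately show ?thesis
    unfolding wdiv_def divergence_def
    by (simp add: grad_def sum.distrib sum_distrib_left mult_ac)
qed

lemma partial_deriv_smooth_add:
  "smooth f \<Longrightarrow> smooth g \<Longrightarrow> partial_deriv i (\<lambda>x. f x + g x) = (\<lambda>x. partial_deriv i f x + partial_deriv i g x)"
  by (intro ext partial_deriv_add smooth_differentiable)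

lemma partial_deriv_smooth_mult:
  "smooth f \<Longrightarrow> smooth g \<Longrightarrow>
    partial_deriv i (\<lambda>x. f x * g x) = (\<lambda>x. f x * partial_deriv i g x + partial_deriv i f x * g x)"
  by (intro ext partial_deriv_mult smooth_differentiable)

lemma partial_deriv_smooth_cmult:
  "smooth g \<Longrightarrow> partial_deriv i (\<lambda>x. c * g x) = (\<lambda>x. c * partial_deriv i g x)"
  using partial_deriv_smooth_mult[OF smooth_const, of g i c] by simp

lemma wdiv_add: "smooth u \<Longrightarrow> smooth v \<Longrightarrow> x \<noteq> 0 \<Longrightarrow>
    wdiv \<alpha> (\<lambda>x. u x + v x) x = wdiv \<alpha> u x + wdiv \<alpha> v x"
  by (simp add: wdiv_smooth smooth_add partial_deriv_smooth_add smooth_partial_deriv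
       sum.distrib algebra_simps)

lemma wdiv_cmult: "smooth u \<Longrightarrow> x \<noteq> 0 \<Longrightarrow> wdiv \<alpha> (\<lambda>x. c * u x) x = c * wdiv \<alpha> u x"
  by (simp add: wdiv_smooth smooth_cmult partial_deriv_smooth_cmult smooth_partial_deriv
       sum_distrib_left algebra_simps)

lemma wdiv_diff: "smooth u \<Longrightarrow> smooth v \<Longrightarrow> x \<noteq> 0 \<Longrightarrow>
    wdiv \<alpha> (\<lambda>x. u x - v x) x = wdiv \<alpha> u x - wdiv \<alpha> v x"
  using wdiv_add[of u "\<lambda>x. (-1) * v x" x \<alpha>] wdiv_cmult[of v x \<alpha> "-1"] smooth_cmult[of v "-1"] by simp

lemma wdiv_const: "x \<noteq> 0 \<Longrightarrow> wdiv \<alpha> (\<lambda>x. c) x = 0"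
  by (simp add: wdiv_smooth smooth_const fun_eq_iff partial_deriv_const[abs_def])

lemma wdiv_borel:
  fixes u :: "real^'n \<Rightarrow> real"
  assumes "smooth u"
  shows "wdiv \<alpha> u \<in> borel_measurable borel"
proof -
  have [measurable]: "partial_deriv i (partial_deriv i u) \<in> borel_measurable borel"
      "partial_deriv i u \<in> borel_measurable borel" for i
    using assms by (auto intro: smooth_borel smooth_partial_deriv)
  \<comment> \<open>The value at the origin is kept as it is, because the expanded formula is only
    known elsewhere.\<close>
  have "wdiv \<alpha> u = (\<lambda>x. if x = 0 then wdiv \<alpha> u 0 else
      norm x powr \<alpha> * (\<Sum>i\<in>UNIV. partial_deriv i (partial_deriv i u) x) +
           \<alpha> * norm x powr (\<alpha> - 2) * (\<Sum>i\<in>UNIV. x $ i * partial_deriv i u x))"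
    by (auto simp: wdiv_smooth[OF assms])
  also have "\<dots> \<in> borel_measurable borel" by measurable
  finally show ?thesis .
qed

text \<open>In polar form the equation \<open>div (|x|\<^sup>\<alpha> \<nabla> u) = g\<close> for radial \<open>u\<close> reads
  \<open>u' = r powr (1 - N - \<alpha>) * P\<close> and \<open>P' = r ^ (N - 1) * g\<close>.\<close>

definition radial_sys :: "nat \<Rightarrow> real \<Rightarrow> (real \<Rightarrow> real) \<Rightarrow> (real \<Rightarrow> real) \<Rightarrow> (real \<Rightarrow> real) \<Rightarrow> bool" where
  "radial_sys N \<alpha> f P g \<longleftrightarrow>
     (\<forall>r>0. (f has_field_derivative r powr (1 - real N - \<alpha>) * P r) (at r)) \<and>
     (\<forall>r>0. (P has_field_derivative r powr (real N - 1) * g r) (at r))"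

lemma wdiv_radial:
  fixes x :: "real^'n"
  assumes sys: "radial_sys CARD('n) \<alpha> f P g" and x: "x \<noteq> 0"
  shows "wdiv \<alpha> (\<lambda>x. f (norm x)) x = g (norm x)"
proof -
  \<comment> \<open>The weighted gradient of a radial function is the field m(r) y: its length
    r^\<alpha> f'(r) equals r^(1-N) P(r), and the unit direction is y / r.\<close>
  define m where "m r = r powr (- real CARD('n)) * P r" for r
  have f': "(f has_field_derivative r powr (1 - real CARD('n) - \<alpha>) * P r) (at r)" if "r > 0" for r
    using sys that by (auto simp: radial_sys_def)
  have pf: "partial_deriv i (\<lambda>x::real^'n. f (norm x)) y = norm y powr (- real CARD('n) - \<alpha>) * P (norm y) * y $ i"
    if "y \<noteq> 0" for y i
    using that
    by (subst partial_deriv_eq[OF has_derivative_radial[OF f']])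
       (auto simp: inner_axis powr_diff powr_minus powr_add field_simps)
  have eq: "(\<chi> i. norm y powr \<alpha> * partial_deriv i (\<lambda>x::real^'n. f (norm x)) y) $ i = m (norm y) * y $ i"
    if "y \<in> - {0}" for y i
    using that by (simp add: pf m_def powr_diff field_simps)
  have dm: "(m has_field_derivative (- real CARD('n)) * r powr (- real CARD('n) - 1) * P r + g r / r) (at r)"
    if "r > 0" for r
  proof -
    have "(P has_field_derivative r powr (real CARD('n) - 1) * g r) (at r)"
      using sys that by (auto simp: radial_sys_def)
    then have "(m has_field_derivative (- real CARD('n)) * r powr (- real CARD('n) - 1) * P r +
        r powr (real CARD('n) - 1) * g r * r powr (- real CARD('n))) (at r)"
      unfolding m_def using that by (intro DERIV_mult has_real_derivative_powr)
    also have "r powr (real CARD('n) - 1) * g r * r powr (- real CARD('n)) = g r / r"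
      using that by (simp add: powr_diff powr_minus field_simps)
    finally show ?thesis .
  qed
  have "wdiv \<alpha> (\<lambda>x. f (norm x)) x = (\<Sum>i\<in>UNIV. partial_deriv i (\<lambda>y::real^'n. m (norm y) * y $ i) x)"
    unfolding wdiv_def divergence_def
    by (intro sum.cong refl partial_deriv_cong_open[of "- {0}"])
       (use x eq in \<open>auto simp: grad_def\<close>)
  also have "\<dots> = (\<Sum>i\<in>UNIV. m (norm x) + ((- real CARD('n)) * norm x powr (- real CARD('n) - 1) * P (norm x)
      + g (norm x) / norm x) / norm x * (x $ i)\<^sup>2)"
  proof (intro sum.cong refl)
    fix i
    have "((\<lambda>y::real^'n. m (norm y) * y $ i) has_derivative (\<lambda>h. m (norm x) * h $ i +
      ((- real CARD('n)) * norm x powr (- real CARD('n) - 1) * P (norm x) + g (norm x) / norm x) * (x \<bullet> h) / norm x * x $ i)) (at x)"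
      using x by (intro has_derivative_mult has_derivative_radial dm
        bounded_linear_imp_has_derivative bounded_linear_vec_nth) auto
    from partial_deriv_eq[OF this, of i]
    show "partial_deriv i (\<lambda>y::real^'n. m (norm y) * y $ i) x =
      m (norm x) + ((- real CARD('n)) * norm x powr (- real CARD('n) - 1) * P (norm x)
      + g (norm x) / norm x) / norm x * (x $ i)\<^sup>2"
      by (simp add: inner_axis power2_eq_square)
  qed
  also have "\<dots> = real CARD('n) * m (norm x) + ((- real CARD('n)) * norm x powr (- real CARD('n) - 1) * P (norm x)
      + g (norm x) / norm x) / norm x * (\<Sum>i\<in>UNIV. (x $ i)\<^sup>2)"
    by (simp add: sum.distrib sum_distrib_left)
  also have "(\<Sum>i\<in>UNIV. (x $ i)\<^sup>2) = (norm x)\<^sup>2"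
    by (simp add: norm_vec_def L2_set_def sum_nonneg)
  \<comment> \<open>This is N m + r m', the divergence of m(r) y. The part of r m' coming from the
    power r^(-N) cancels N m, and g remains.\<close>
  also have "real CARD('n) * m (norm x) + ((- real CARD('n)) * norm x powr (- real CARD('n) - 1) * P (norm x)
      + g (norm x) / norm x) / norm x * (norm x)\<^sup>2 = g (norm x)"
    using x by (simp add: m_def powr_diff power2_eq_square field_simps)
  finally show ?thesis .
qed

subsection \<open>Integration by parts away from the origin\<close>

lemma compactly_supportedE:
  fixes f :: "real^'n \<Rightarrow> real"
  assumes "compactly_supported f"
  obtains R where "R > 0" "\<And>x. norm x \<ge> R \<Longrightarrow> f x = 0"
proof -
  obtain K where K: "compact K" "\<And>x. x \<notin> K \<Longrightarrow> f x = 0"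
    using assms by (auto simp: compactly_supported_def)
  obtain B where "\<And>x. x \<in> K \<Longrightarrow> norm x \<le> B"
    using compact_imp_bounded[OF K(1)] by (auto simp: bounded_iff)
  then show ?thesis
    by (intro that[of "max 1 (B + 1)"]) (use K(2) in force)+
qed

lemma compactly_supportedI:
  fixes f :: "real^'n \<Rightarrow> real"
  shows "(\<And>x. norm x > R \<Longrightarrow> f x = 0) \<Longrightarrow> compactly_supported f"
  unfolding compactly_supported_def by (intro exI[of _ "cball 0 R"]) auto

lemma integrable_continuous_ball:
  fixes f :: "real^'n \<Rightarrow> real"
  assumes "continuous_on UNIV f" "\<And>x. norm x \<ge> R \<Longrightarrow> f x = 0"
  shows "integrable lborel f"
proof -
  have "integrable lborel (\<lambda>x. indicator (cball 0 R) x *\<^sub>R f x)"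
    by (intro borel_integrable_compact compact_cball continuous_on_subset[OF assms(1)]) auto
  also have "(\<lambda>x. indicator (cball 0 R) x *\<^sub>R f x) = f"
    using assms(2) by (auto simp: fun_eq_iff indicator_def)
  finally show ?thesis .
qed

lemma integrable_smooth:
  fixes f :: "real^'n \<Rightarrow> real"
  assumes "smooth f" "compactly_supported f"
  shows "integrable lborel f"
  using assms by (elim compactly_supportedE) (intro integrable_continuous_ball smooth_continuous_on, auto)

lemma partial_deriv_outside:
  assumes "\<And>x. norm x \<ge> R \<Longrightarrow> f x = 0" "norm x > R"
  shows "partial_deriv i f x = 0"
proof -
  have "open {x::real^'n. norm x > R}" by (intro open_Collect_less continuous_intros)
  from partial_deriv_cong_open[OF this, of x f "\<lambda>_. 0" i] assms show ?thesis by auto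
qed

lemma compactly_supported_partial_deriv:
  "compactly_supported f \<Longrightarrow> compactly_supported (partial_deriv i f)"
  by (erule compactly_supportedE, rule compactly_supportedI, rule partial_deriv_outside) auto

lemma continuous_ball_bounded:
  fixes f :: "real^'n \<Rightarrow> real"
  assumes "continuous_on UNIV f" "\<And>x. norm x \<ge> R \<Longrightarrow> f x = 0"
  obtains B where "B > 0" "\<And>x. \<bar>f x\<bar> \<le> B"
proof -
  have "compact (f ` cball 0 R)"
    by (intro compact_continuous_image continuous_on_subset[OF assms(1)]) auto
  then obtain B where B: "\<forall>y\<in>f ` cball 0 R. norm y \<le> B" using compact_imp_bounded bounded_iff by metis
  show ?thesis
  proof (rule that[of "max B 1"])
    fix x show "\<bar>f x\<bar> \<le> max B 1"
      by (cases "norm x \<le> R") (use B assms(2)[of x] in \<open>auto simp: le_max_iff_disj\<close>)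
  qed auto
qed

lemma smooth_compactly_supported_bounded:
  fixes f :: "real^'n \<Rightarrow> real"
  assumes "smooth f" "compactly_supported f"
  obtains B where "B > 0" "\<And>x. \<bar>f x\<bar> \<le> B"
  using assms by (elim compactly_supportedE) (metis continuous_ball_bounded smooth_continuous_on)

lemma DERIV_along_axis:
  assumes "smooth f"
  shows "((\<lambda>t. f (x + t *\<^sub>R axis i 1)) has_field_derivative partial_deriv i f (x + t *\<^sub>R axis i 1)) (at t)"
proof -
  let ?y = "x + t *\<^sub>R axis i 1"
  have "(f has_derivative frechet_derivative f (at ?y)) (at ?y)"
    using smooth_differentiable[OF assms] frechet_derivative_works by blast
  moreover have "((\<lambda>t. x + t *\<^sub>R axis i 1) has_derivative (\<lambda>h. h *\<^sub>R axis i 1)) (at t)"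
    by (auto intro!: derivative_eq_intros)
  ultimately have "((\<lambda>t. f (x + t *\<^sub>R axis i 1)) has_derivative
      (\<lambda>h. frechet_derivative f (at ?y) (h *\<^sub>R axis i 1))) (at t)"
    using has_derivative_compose by blast
  moreover have "(\<lambda>h. frechet_derivative f (at ?y) (h *\<^sub>R axis i 1)) = (*) (partial_deriv i f ?y)"
    using linear_frechet_derivative[OF smooth_differentiable[OF assms], of ?y]
    by (auto simp: partial_deriv_def linear_cmul fun_eq_iff)
  ultimately show ?thesis by (simp add: has_field_derivative_def)
qed

lemma integral_lborel_translate:
  fixes f :: "'a::euclidean_space \<Rightarrow> real"
  assumes [measurable]: "f \<in> borel_measurable borel"
  shows "(\<integral>x. f (x + c) \<partial>lborel) = (\<integral>x. f x \<partial>lborel)"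
proof -
  have "(\<integral>x. f x \<partial>lborel) = (\<integral>x. f x \<partial>distr lborel borel ((+) c))"
    by (simp add: lborel_distr_plus)
  also have "\<dots> = (\<integral>x. f (c + x) \<partial>lborel)"
    by (rule integral_distr) auto
  finally show ?thesis by (simp add: add.commute)
qed

text \<open>By translation invariance the difference quotients have integral zero.\<close>

lemma integral_partial_deriv_zero:
  fixes f :: "real^'n \<Rightarrow> real"
  assumes f: "smooth f" "compactly_supported f"
  shows "(\<integral>x. partial_deriv i f x \<partial>lborel) = 0"
proof -
  define h where "h n = 1 / (real n + 1)" for n
  have h: "0 < h n" "h n \<le> 1" for n by (auto simp: h_def)
  define q where "q n x = (f (x + h n *\<^sub>R axis i 1) - f x) / h n" for n x
  have [measurable]: "f \<in> borel_measurable borel" "partial_deriv i f \<in> borel_measurable borel"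
    using f by (auto intro: smooth_borel smooth_partial_deriv)
  obtain R where R: "R > 0" "\<And>x. norm x \<ge> R \<Longrightarrow> f x = 0" using compactly_supportedE[OF f(2)] by blast
  obtain B where B: "B > 0" "\<And>x. \<bar>partial_deriv i f x\<bar> \<le> B"
    using smooth_compactly_supported_bounded[OF smooth_partial_deriv[OF f(1)]
        compactly_supported_partial_deriv[OF f(2)]] by blast
  have int_f: "integrable lborel f" by (rule integrable_smooth[OF f])
  have int_ft: "integrable lborel (\<lambda>x. f (x + c))" for c
  proof (rule integrable_continuous_ball)
    show "continuous_on UNIV (\<lambda>x. f (x + c))"
      by (rule continuous_on_compose2[OF smooth_continuous_on[OF f(1), of UNIV]]) (auto intro: continuous_intros)
    show "f (x + c) = 0" if "norm x \<ge> R + norm c" for x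
      using that norm_triangle_ineq2[of x "-c"] by (intro R) simp
  qed
  have zero: "(\<integral>x. q n x \<partial>lborel) = 0" for n
    using int_f int_ft by (simp add: q_def integral_lborel_translate)
  have "(\<lambda>n. \<integral>x. q n x \<partial>lborel) \<longlonglongrightarrow> (\<integral>x. partial_deriv i f x \<partial>lborel)"
  \<comment> \<open>All increments are at most 1, so every difference quotient vanishes off the ball
    of radius R + 1; inside it the mean value theorem gives the bound B.\<close>
  proof (rule integral_dominated_convergence[where w = "\<lambda>x. indicator (cball 0 (R + 1)) x * B"])
    show "integrable lborel (\<lambda>x::real^'n. indicator (cball 0 (R + 1)) x * B)"
      by (intro integrable_mult_left integrable_real_indicator)
         (simp_all add: emeasure_lborel_cball_finite[unfolded infinity_ennreal_def])
    show "AE x in lborel. (\<lambda>n. q n x) \<longlonglongrightarrow> partial_deriv i f x"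
    proof (rule AE_I2)
      fix x
      have "((\<lambda>t. (f (x + (0 + t) *\<^sub>R axis i 1) - f (x + 0 *\<^sub>R axis i 1)) / t) \<longlongrightarrow> partial_deriv i f (x + 0 *\<^sub>R axis i 1)) (at 0)"
        using DERIV_along_axis[OF f(1), of x i 0] unfolding DERIV_def .
      moreover have "filterlim h (at 0) sequentially"
        unfolding h_def using LIMSEQ_inverse_real_of_nat
        by (auto simp: filterlim_at inverse_eq_divide add.commute eventually_sequentially)
      ultimately have "(\<lambda>n. (f (x + (0 + h n) *\<^sub>R axis i 1) - f (x + 0 *\<^sub>R axis i 1)) / h n) \<longlonglongrightarrow> partial_deriv i f (x + 0 *\<^sub>R axis i 1)"
        by (rule filterlim_compose)
      then show "(\<lambda>n. q n x) \<longlonglongrightarrow> partial_deriv i f x" by (simp add: q_def)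
    qed
    fix n
    show "AE x in lborel. norm (q n x) \<le> indicator (cball 0 (R + 1)) x * B"
    proof (rule AE_I2)
      fix x :: "real^'n"
      show "norm (q n x) \<le> indicator (cball 0 (R + 1)) x * B"
      proof (cases "norm x \<le> R + 1")
        case True
        obtain z where "f (x + h n *\<^sub>R axis i 1) - f (x + 0 *\<^sub>R axis i 1) = (h n - 0) * partial_deriv i f (x + z *\<^sub>R axis i 1)"
          using MVT2[of 0 "h n" "\<lambda>t. f (x + t *\<^sub>R axis i 1)", OF h(1) DERIV_along_axis[OF f(1)]] by blast
        then have "q n x = partial_deriv i f (x + z *\<^sub>R axis i 1)"
          using h(1)[of n] by (simp add: q_def)
        then show ?thesis using True B by simp
      next
        case False
        have "norm (h n *\<^sub>R axis i 1 :: real^'n) \<le> 1" using h[of n] by simp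
        then have "norm (x + h n *\<^sub>R axis i 1) \<ge> R"
          using False norm_triangle_ineq2[of x "- (h n *\<^sub>R axis i 1)"] by simp
        then show ?thesis using False R by (simp add: q_def)
      qed
    qed
  qed (auto simp: q_def)
  then show ?thesis by (simp add: zero LIMSEQ_const_iff)
qed

section \<open>Square-integrable functions\<close>

text \<open>A set of functions rather than of classes, so \<open>L2_norm\<close> is a seminorm on it
  and equality almost everywhere is transferred by hand through \<open>L2_cong_AE\<close>.\<close>

definition L2 :: "'a measure \<Rightarrow> ('a \<Rightarrow> real) set" where
  "L2 M = {f. f \<in> borel_measurable M \<and> integrable M (\<lambda>x. (f x)\<^sup>2)}"

lemma L2_measurable: "f \<in> L2 M \<Longrightarrow> f \<in> borel_measurable M"
  and L2_integrable_sq: "f \<in> L2 M \<Longrightarrow> integrable M (\<lambda>x. (f x)\<^sup>2)"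
  by (auto simp: L2_def)

lemma L2_mult_integrable:
  assumes "f \<in> L2 M" "g \<in> L2 M" shows "integrable M (\<lambda>x. f x * g x)"
proof (rule Bochner_Integration.integrable_bound[of M "\<lambda>x. (f x)\<^sup>2 + (g x)\<^sup>2"])
  show "integrable M (\<lambda>x. (f x)\<^sup>2 + (g x)\<^sup>2)" using assms by (auto simp: L2_def)
  show "(\<lambda>x. f x * g x) \<in> borel_measurable M" using assms by (auto simp: L2_def)
  have "\<bar>a * b\<bar> \<le> a\<^sup>2 + b\<^sup>2" for a b :: real
  proof -
    have "0 \<le> \<bar>a * b\<bar>" "2 * \<bar>a * b\<bar> \<le> a\<^sup>2 + b\<^sup>2"
      using sum_squares_bound[of "\<bar>a\<bar>" "\<bar>b\<bar>"] by (simp_all add: abs_mult)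
    then show ?thesis by linarith
  qed
  then show "AE x in M. norm (f x * g x) \<le> norm ((f x)\<^sup>2 + (g x)\<^sup>2)" by auto
qed

lemma L2_dominated:
  assumes "g \<in> L2 M" "f \<in> borel_measurable M" "AE x in M. \<bar>f x\<bar> \<le> \<bar>g x\<bar>"
  shows "f \<in> L2 M"
  unfolding L2_def
proof (intro CollectI conjI assms(2))
  show "integrable M (\<lambda>x. (f x)\<^sup>2)"
  proof (rule Bochner_Integration.integrable_bound)
    show "integrable M (\<lambda>x. (g x)\<^sup>2)" by (rule L2_integrable_sq[OF assms(1)])
    show "AE x in M. norm ((f x)\<^sup>2) \<le> norm ((g x)\<^sup>2)"
      using assms(3) by eventually_elim (simp add: abs_le_square_iff)
  qed (use assms(2) in measurable)
qed

lemma L2_cmult: "f \<in> L2 M \<Longrightarrow> (\<lambda>x. c * f x) \<in> L2 M"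
  by (auto simp: L2_def power_mult_distrib)

lemma L2_add:
  assumes "f \<in> L2 M" "g \<in> L2 M" shows "(\<lambda>x. f x + g x) \<in> L2 M"
  using assms L2_mult_integrable[OF assms]
  by (auto simp: L2_def power2_sum mult.assoc)

lemma L2_diff:
  assumes "f \<in> L2 M" "g \<in> L2 M" shows "(\<lambda>x. f x - g x) \<in> L2 M"
  using L2_add[OF assms(1) L2_cmult[OF assms(2), of "-1"]] by simp

definition L2_norm :: "'a measure \<Rightarrow> ('a \<Rightarrow> real) \<Rightarrow> real" where
  "L2_norm M f = sqrt (\<integral>x. (f x)\<^sup>2 \<partial>M)"

lemma L2_norm_nonneg: "0 \<le> L2_norm M f"
  by (simp add: L2_norm_def)

lemma L2_norm_sq: "(L2_norm M f)\<^sup>2 = (\<integral>x. (f x)\<^sup>2 \<partial>M)"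
  by (simp add: L2_norm_def)

text \<open>The discriminant argument for the nonnegative quadratic t \<mapsto> \<integral> (f - t
  g)^2.\<close>

lemma L2_Cauchy_Schwarz:
  assumes f: "f \<in> L2 M" and g: "g \<in> L2 M"
  shows "\<bar>\<integral>x. f x * g x \<partial>M\<bar> \<le> L2_norm M f * L2_norm M g"
proof -
  define A B C where "A = (\<integral>x. (f x)\<^sup>2 \<partial>M)" and "B = (\<integral>x. f x * g x \<partial>M)" and "C = (\<integral>x. (g x)\<^sup>2 \<partial>M)"
  have q: "0 \<le> A - 2 * t * B + t\<^sup>2 * C" for t
  proof -
    have "0 \<le> (\<integral>x. (f x - t * g x)\<^sup>2 \<partial>M)" by simp
    also have "\<dots> = (\<integral>x. ((f x)\<^sup>2 - (2 * t) * (f x * g x)) + t\<^sup>2 * (g x)\<^sup>2 \<partial>M)"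
      by (intro Bochner_Integration.integral_cong) (auto simp: power2_eq_square algebra_simps)
    also have "\<dots> = A - 2 * t * B + t\<^sup>2 * C"
      using L2_integrable_sq[OF f] L2_integrable_sq[OF g] L2_mult_integrable[OF f g]
      by (simp add: A_def B_def C_def)
    finally show ?thesis .
  qed
  have "C \<ge> 0" by (simp add: C_def)
  have "B\<^sup>2 \<le> A * C"
  proof (cases "C = 0")
    case True
    have "B = 0"
    proof (rule ccontr)
      assume "B \<noteq> 0"
      \<comment> \<open>When C = 0 the quadratic is affine in t, and this t gives it the value
        -1.\<close>
      then show False using q[of "(A + 1) / (2 * B)"] True by (simp add: field_simps)
    qed
    then show ?thesis using True by simp
  next
    case False
    \<comment> \<open>B / C is the minimiser of the quadratic.\<close>
    then have "0 \<le> (A - 2 * (B / C) * B + (B / C)\<^sup>2 * C) * C"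
      using q[of "B / C"] \<open>C \<ge> 0\<close> by (intro mult_nonneg_nonneg)
    also have "\<dots> = A * C - B\<^sup>2" using False by (simp add: power2_eq_square field_simps)
    finally show ?thesis by simp
  qed
  then have "\<bar>B\<bar> \<le> sqrt (A * C)" by (metis real_sqrt_abs real_sqrt_le_mono)
  then show ?thesis by (simp add: A_def B_def C_def L2_norm_def real_sqrt_mult)
qed

lemma L2_norm_triangle:
  assumes f: "f \<in> L2 M" and g: "g \<in> L2 M"
  shows "L2_norm M (\<lambda>x. f x + g x) \<le> L2_norm M f + L2_norm M g"
proof (rule power2_le_imp_le)
  have "(\<integral>x. (f x + g x)\<^sup>2 \<partial>M) = (\<integral>x. (f x)\<^sup>2 + (g x)\<^sup>2 + 2 * (f x * g x) \<partial>M)"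
    by (intro Bochner_Integration.integral_cong) (auto simp: power2_sum)
  also have "\<dots> = (L2_norm M f)\<^sup>2 + (L2_norm M g)\<^sup>2 + 2 * (\<integral>x. f x * g x \<partial>M)"
    using L2_integrable_sq[OF f] L2_integrable_sq[OF g] L2_mult_integrable[OF f g]
    by (simp add: L2_norm_sq)
  also have "\<dots> \<le> (L2_norm M f + L2_norm M g)\<^sup>2"
    using L2_Cauchy_Schwarz[OF f g] by (simp add: power2_sum)
  finally show "(L2_norm M (\<lambda>x. f x + g x))\<^sup>2 \<le> (L2_norm M f + L2_norm M g)\<^sup>2"
    by (simp add: L2_norm_sq)
qed (simp add: L2_norm_nonneg)

lemma L2_norm_diff_commute: "L2_norm M (\<lambda>x. f x - g x) = L2_norm M (\<lambda>x. g x - f x)"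
  by (simp add: L2_norm_def power2_commute)

section \<open>Radial cutoffs and Green's identity away from the origin\<close>

definition inner_cutoff :: "real \<Rightarrow> real \<Rightarrow> real" where
  "inner_cutoff e r = smooth_step (r / e - 1)"

definition outer_cutoff :: "real \<Rightarrow> real \<Rightarrow> real" where
  "outer_cutoff R r = smooth_step (2 - r / R)"

lemma smooth1_inner_cutoff: "open I \<Longrightarrow> smooth1 I (inner_cutoff e)"
  using smooth1_smooth_step_affine[of I "1/e" "-1"] by (simp add: inner_cutoff_def[abs_def])

lemma smooth1_outer_cutoff: "open I \<Longrightarrow> smooth1 I (outer_cutoff e)"
  using smooth1_smooth_step_affine[of I "-(1/e)" "2"] by (simp add: outer_cutoff_def[abs_def])

lemma inner_cutoff_0: "0 < e \<Longrightarrow> r \<le> e \<Longrightarrow> inner_cutoff e r = 0"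
  and inner_cutoff_1: "0 < e \<Longrightarrow> r \<ge> 2 * e \<Longrightarrow> inner_cutoff e r = 1"
  and outer_cutoff_1: "0 < e \<Longrightarrow> r \<le> e \<Longrightarrow> outer_cutoff e r = 1"
  and outer_cutoff_0: "0 < e \<Longrightarrow> r \<ge> 2 * e \<Longrightarrow> outer_cutoff e r = 0"
  by (auto simp: inner_cutoff_def outer_cutoff_def field_simps intro!: smooth_step_0 smooth_step_1)

lemma cutoff_bounds: "0 \<le> inner_cutoff e r" "inner_cutoff e r \<le> 1" "0 \<le> outer_cutoff e r" "outer_cutoff e r \<le> 1"
  by (auto simp: inner_cutoff_def outer_cutoff_def smooth_step_nonneg smooth_step_le_1)

lemma smooth_inner_cutoff: "0 < e \<Longrightarrow> smooth (\<lambda>x::real^'n. inner_cutoff e (norm x))"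
  by (rule smooth_radial[OF smooth1_inner_cutoff]) (auto intro: inner_cutoff_0)

text \<open>Cutting off the origin turns any power of the norm into a smooth coefficient, so the
  weight can be handled by ordinary calculus wherever the cutoff is 1.\<close>

lemma smooth_inner_cutoff_powr:
  assumes "0 < e" shows "smooth (\<lambda>x::real^'n. inner_cutoff e (norm x) * norm x powr s)"
  by (rule smooth_radial[where a = e and c = 0 and \<phi> = "\<lambda>r. inner_cutoff e r * r powr s"])
     (use assms in \<open>auto intro!: smooth1_mult smooth1_inner_cutoff smooth1_powr simp: inner_cutoff_0\<close>)

text \<open>Green's second identity. As \<psi> vanishes near the origin, the weight may be replaced
  there by a smooth one; the difference of the two integrands is then the divergence of a smooth
  compactly supported field, whose integral is 0.\<close>

lemma wdiv_by_parts_away: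
  fixes w \<psi> :: "real^'n \<Rightarrow> real"
  assumes w: "smooth w" "compactly_supported w" and \<psi>: "smooth \<psi>"
    and \<delta>: "\<delta> > 0" "\<And>x. norm x < \<delta> \<Longrightarrow> \<psi> x = 0"
  shows "integrable lborel (\<lambda>x. wdiv \<alpha> w x * \<psi> x)"
    and "integrable lborel (\<lambda>x. w x * wdiv \<alpha> \<psi> x)"
    and "(\<integral>x. wdiv \<alpha> w x * \<psi> x \<partial>lborel) = (\<integral>x. w x * wdiv \<alpha> \<psi> x \<partial>lborel)"
proof -
  \<comment> \<open>With parameter \<delta>/4 the cutoff is 1 from radius \<delta>/2 on, so a equals
    the weight on an open neighbourhood of the set where \<psi> may be nonzero.\<close>
  define a where "a x = inner_cutoff (\<delta>/4) (norm x) * norm x powr \<alpha>" for x :: "real^'n"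
  have a: "smooth a" unfolding a_def[abs_def] by (rule smooth_inner_cutoff_powr) (use \<delta> in auto)
  define W where "W u x = (\<Sum>i\<in>UNIV. partial_deriv i (\<lambda>y. a y * partial_deriv i u y) x)" for u x
  have W: "smooth (W u)" if "smooth u" for u
    unfolding W_def[abs_def] by (intro smooth_sum smooth_partial_deriv smooth_mult a that)
  have o: "open {x::real^'n. norm x > \<delta>/2}" "open {x::real^'n. norm x < \<delta>}"
    by (intro open_Collect_less continuous_intros)+
  have Weq: "wdiv \<alpha> u x = W u x" if "norm x > \<delta>/2" for u x
    unfolding wdiv_def W_def divergence_def
    by (intro sum.cong refl partial_deriv_cong_open[OF o(1)])
       (use that \<delta> in \<open>auto simp: grad_def a_def inner_cutoff_1\<close>)
  have z: "wdiv \<alpha> \<psi> x = 0" if "norm x < \<delta>" for x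
  proof -
    have p0: "partial_deriv i \<psi> y = 0" if "norm y < \<delta>" for y i
      using partial_deriv_cong_open[OF o(2), of y \<psi> "\<lambda>_. 0" i] that \<delta> by auto
    have "partial_deriv i (\<lambda>y. norm y powr \<alpha> * partial_deriv i \<psi> y) x = 0" for i
      using partial_deriv_cong_open[OF o(2), of x "\<lambda>y. norm y powr \<alpha> * partial_deriv i \<psi> y" "\<lambda>_. 0" i] that p0
      by auto
    then show ?thesis by (simp add: wdiv_def divergence_def grad_def)
  qed
  have z': "W \<psi> x = 0" if "norm x < \<delta>" for x
  proof -
    have p0: "partial_deriv i \<psi> y = 0" if "norm y < \<delta>" for y i
      using partial_deriv_cong_open[OF o(2), of y \<psi> "\<lambda>_. 0" i] that \<delta> by auto
    have "partial_deriv i (\<lambda>y. a y * partial_deriv i \<psi> y) x = 0" for i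
      using partial_deriv_cong_open[OF o(2), of x "\<lambda>y. a y * partial_deriv i \<psi> y" "\<lambda>_. 0" i] that p0
      by auto
    then show ?thesis by (simp add: W_def)
  qed
  have e1: "(\<lambda>x. wdiv \<alpha> w x * \<psi> x) = (\<lambda>x. W w x * \<psi> x)"
  proof
    fix x show "wdiv \<alpha> w x * \<psi> x = W w x * \<psi> x"
      using \<delta> Weq[of x w] by (cases "norm x < \<delta>") auto
  qed
  have e2: "(\<lambda>x. w x * wdiv \<alpha> \<psi> x) = (\<lambda>x. w x * W \<psi> x)"
  proof
    fix x show "w x * wdiv \<alpha> \<psi> x = w x * W \<psi> x"
      using \<delta> z z' Weq[of x \<psi>] by (cases "norm x < \<delta>") auto
  qed
  obtain R where R: "R > 0" "\<And>x. norm x \<ge> R \<Longrightarrow> w x = 0" using compactly_supportedE[OF w(2)] by blast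
  have pdR: "partial_deriv i w x = 0" if "norm x > R" for i x
    using partial_deriv_outside[OF R(2) that] by simp
  have oR: "open {x::real^'n. norm x > R}" by (intro open_Collect_less continuous_intros)
  have WR: "W w x = 0" if "norm x > R" for x
  proof -
    have "partial_deriv i (\<lambda>y. a y * partial_deriv i w y) x = 0" for i
      using partial_deriv_cong_open[OF oR, of x "\<lambda>y. a y * partial_deriv i w y" "\<lambda>_. 0" i] that pdR by auto
    then show ?thesis by (simp add: W_def)
  qed
  have i1: "integrable lborel (\<lambda>x. W w x * \<psi> x)"
    by (intro integrable_smooth smooth_mult W w \<psi> compactly_supportedI[of R]) (simp add: WR)
  have i2: "integrable lborel (\<lambda>x. w x * W \<psi> x)"
    by (intro integrable_smooth smooth_mult W w \<psi> compactly_supportedI[of R]) (simp add: R)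
  \<comment> \<open>The Green field a (\<psi> \<nabla>w - w \<nabla>\<psi>). In its divergence the
    products of first derivatives cancel.\<close>
  define F where "F i x = \<psi> x * (a x * partial_deriv i w x) - w x * (a x * partial_deriv i \<psi> x)" for i x
  have F: "smooth (F i)" for i
    unfolding F_def[abs_def] by (intro smooth_diff smooth_mult smooth_partial_deriv a w \<psi>)
  have Fc: "compactly_supported (F i)" for i
    by (rule compactly_supportedI[of R]) (simp add: F_def pdR R)
  have div: "W w x * \<psi> x - w x * W \<psi> x = (\<Sum>i\<in>UNIV. partial_deriv i (F i) x)" for x
  proof -
    have "partial_deriv i (F i) = (\<lambda>x. \<psi> x * partial_deriv i (\<lambda>y. a y * partial_deriv i w y) x -
       w x * partial_deriv i (\<lambda>y. a y * partial_deriv i \<psi> y) x)" for i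
    proof -
      have m: "(\<lambda>x. \<psi> x * (a x * partial_deriv i w x) - w x * (a x * partial_deriv i \<psi> x)) =
         (\<lambda>x. \<psi> x * (a x * partial_deriv i w x) + (-1) * (w x * (a x * partial_deriv i \<psi> x)))" by auto
      show ?thesis unfolding F_def[abs_def] m
        by (subst partial_deriv_smooth_add partial_deriv_smooth_cmult partial_deriv_smooth_mult;
            (intro smooth_mult smooth_cmult smooth_partial_deriv a w \<psi>)?)+
           (auto simp: algebra_simps)
    qed
    then show ?thesis by (simp add: W_def sum_distrib_left sum_distrib_right sum_subtractf mult_ac)
  qed
  have "(\<integral>x. W w x * \<psi> x \<partial>lborel) - (\<integral>x. w x * W \<psi> x \<partial>lborel) = (\<integral>x. (\<Sum>i\<in>UNIV. partial_deriv i (F i) x) \<partial>lborel)"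
    using i1 i2 by (simp flip: div)
  also have "\<dots> = (\<Sum>i\<in>UNIV. \<integral>x. partial_deriv i (F i) x \<partial>lborel)"
    by (intro Bochner_Integration.integral_sum integrable_smooth smooth_partial_deriv
        compactly_supported_partial_deriv F Fc)
  also have "\<dots> = 0" using integral_partial_deriv_zero[OF F Fc] by simp
  finally show "(\<integral>x. wdiv \<alpha> w x * \<psi> x \<partial>lborel) = (\<integral>x. w x * wdiv \<alpha> \<psi> x \<partial>lborel)"
    unfolding e1 e2 by simp
  show "integrable lborel (\<lambda>x. wdiv \<alpha> w x * \<psi> x)" "integrable lborel (\<lambda>x. w x * wdiv \<alpha> \<psi> x)"
    unfolding e1 e2 by (fact i1 i2)+
qed

subsection \<open>Polar coordinates\<close>

definition sphere_area :: "nat \<Rightarrow> real" where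
  "sphere_area N = real N * unit_ball_vol (real N)"

lemma sphere_area_pos: "0 < N \<Longrightarrow> 0 < sphere_area N"
  by (simp add: sphere_area_def)

text \<open>The volume of balls alone gives polar coordinates for radial integrands: both measures
  agree on the half-lines \<open>{..a}\<close>, which generate the Borel sets, because the density
  integrates to the volume of the ball of radius a.\<close>

lemma distr_norm_lborel:
  "distr (lborel :: (real^'n) measure) borel norm =
   density lborel (\<lambda>r. ennreal (sphere_area CARD('n) * r ^ (CARD('n) - 1) * indicator {0..} r))"
    (is "?M = density lborel ?d")
proof (rule measure_eqI_generator_eq[where E = "range (\<lambda>a::real. {..a})" and A = "\<lambda>i. {..real i}" and \<Omega> = UNIV])
  let ?N = "CARD('n)"
  have emM: "emeasure ?M {..a} = ennreal (if a < 0 then 0 else unit_ball_vol ?N * a ^ ?N)" for a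
  proof -
    have "emeasure ?M {..a} = emeasure lborel {x::real^'n. norm x \<le> a}"
      by (subst emeasure_distr) (auto simp: vimage_def)
    also have "{x::real^'n. norm x \<le> a} = (if a < 0 then {} else cball 0 a)"
      using norm_ge_zero[THEN order_trans] by (auto simp flip: not_le)
    also have "emeasure lborel \<dots> = ennreal (if a < 0 then 0 else unit_ball_vol ?N * a ^ ?N)"
      by (auto simp: emeasure_cball)
    finally show ?thesis .
  qed
  have emd: "emeasure (density lborel ?d) {..a} = ennreal (if a < 0 then 0 else unit_ball_vol ?N * a ^ ?N)" for a
  proof -
    have "emeasure (density lborel ?d) {..a} = (\<integral>\<^sup>+ r. ?d r * indicator {..a} r \<partial>lborel)"
      by (subst emeasure_density) auto
    also have "\<dots> = ennreal (if a < 0 then 0 else unit_ball_vol ?N * a ^ ?N)"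
    proof (cases "a < 0")
      case True
      then have "(\<lambda>r. ?d r * indicator {..a} r) = (\<lambda>_. 0)" by (auto simp: fun_eq_iff indicator_def)
      then show ?thesis using True by simp
    next
      case False
      have "(\<integral>\<^sup>+ r. ?d r * indicator {..a} r \<partial>lborel) =
         (\<integral>\<^sup>+ r. ennreal (sphere_area ?N * r ^ (?N - 1)) * indicator {0..a} r \<partial>lborel)"
        by (intro nn_integral_cong) (auto simp: indicator_def)
      also have "\<dots> = ennreal (unit_ball_vol ?N * a ^ ?N - unit_ball_vol ?N * 0 ^ ?N)"
        by (rule nn_integral_FTC_Icc)
           (use False in \<open>auto intro!: derivative_eq_intros mult_nonneg_nonneg simp: sphere_area_def\<close>)
      finally show ?thesis using False by simp
    qed
    finally show ?thesis .
  qed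
  show "Int_stable (range (\<lambda>a::real. {..a}))" by (auto simp: Int_stable_def)
  show "emeasure ?M X = emeasure (density lborel ?d) X" if "X \<in> range (\<lambda>a::real. {..a})" for X
    using that emM emd by auto
  have "sets borel = sigma_sets UNIV (range (\<lambda>a::real. {..a}))"
    unfolding borel_eq_atMost by simp
  then show "sets ?M = sigma_sets UNIV (range (\<lambda>a::real. {..a}))"
     "sets (density lborel ?d) = sigma_sets UNIV (range (\<lambda>a::real. {..a}))" by simp_all
  show "(\<Union>i. {..real i}) = UNIV" using real_nat_ceiling_ge by (auto simp: UN_iff)
  show "emeasure ?M {..real i} \<noteq> \<infinity>" for i by (simp add: emM)
qed auto

context
  fixes h :: "real \<Rightarrow> real" assumes h [measurable]: "h \<in> borel_measurable borel"
begin

lemma polar_integrable: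
  "integrable lborel (\<lambda>x::real^'n. h (norm x)) \<longleftrightarrow>
   integrable lborel (\<lambda>r. sphere_area CARD('n) * r ^ (CARD('n) - 1) * indicator {0..} r * h r)"
proof -
  have "integrable lborel (\<lambda>x::real^'n. h (norm x)) \<longleftrightarrow> integrable (distr (lborel :: (real^'n) measure) borel norm) h"
    by (subst integrable_distr_eq) auto
  also have "\<dots> \<longleftrightarrow> integrable lborel (\<lambda>r. sphere_area CARD('n) * r ^ (CARD('n) - 1) * indicator {0..} r * h r)"
    unfolding distr_norm_lborel
    by (subst integrable_density) (auto simp: sphere_area_def indicator_def)
  finally show ?thesis .
qed

lemma polar_integral:
  "integral\<^sup>L lborel (\<lambda>x::real^'n. h (norm x)) =
   (\<integral>r. sphere_area CARD('n) * r ^ (CARD('n) - 1) * indicator {0..} r * h r \<partial>lborel)"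
proof -
  have "integral\<^sup>L lborel (\<lambda>x::real^'n. h (norm x)) = integral\<^sup>L (distr (lborel :: (real^'n) measure) borel norm) h"
    by (subst integral_distr) auto
  also have "\<dots> = (\<integral>r. sphere_area CARD('n) * r ^ (CARD('n) - 1) * indicator {0..} r * h r \<partial>lborel)"
    unfolding distr_norm_lborel
    by (subst integral_density) (auto simp: sphere_area_def indicator_def)
  finally show ?thesis .
qed

end

lemma set_integrable_lborel_iff_lebesgue:
  fixes f :: "'a::euclidean_space \<Rightarrow> real"
  assumes [measurable]: "f \<in> borel_measurable borel" "A \<in> sets borel"
  shows "f absolutely_integrable_on A \<longleftrightarrow> integrable lborel (\<lambda>x. indicator A x * f x)"
  unfolding set_integrable_def by (subst integrable_completion) auto

lemma integrable_norm_powr_ball: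
  assumes "s > - real CARD('n)"
  shows "integrable lborel (\<lambda>x::real^'n. indicator (cball 0 R) x * norm x powr s)"
proof (cases "R \<ge> 0")
  case True
  let ?N = "CARD('n)"
  have "(\<lambda>r::real. r powr (real ?N - 1 + s)) integrable_on {0..R}"
    by (rule integrable_on_powr_from_0) (use assms True in auto)
  then have "(\<lambda>r::real. r powr (real ?N - 1 + s)) absolutely_integrable_on {0..R}"
    by (intro nonnegative_absolutely_integrable_1) auto
  then have "integrable lborel (\<lambda>r. indicator {0..R} r * r powr (real ?N - 1 + s))"
    by (subst (asm) set_integrable_lborel_iff_lebesgue) auto
  then have "integrable lborel (\<lambda>r. sphere_area ?N * (indicator {0..R} r * r powr (real ?N - 1 + s)))"
    by (rule integrable_mult_right)
  also have "(\<lambda>r. sphere_area ?N * (indicator {0..R} r * r powr (real ?N - 1 + s))) =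
     (\<lambda>r. sphere_area ?N * r ^ (?N - 1) * indicator {0..} r * (indicator {..R} r * r powr s))"
  proof
    fix r :: real
    have "r powr (real ?N - 1 + s) = r ^ (?N - 1) * r powr s" if "r > 0"
    proof -
      have "real (?N - 1) = real ?N - 1" by (subst of_nat_diff) auto
      then show ?thesis using that by (simp add: powr_add powr_diff flip: powr_realpow)
    qed
    then show "sphere_area ?N * (indicator {0..R} r * r powr (real ?N - 1 + s)) =
       sphere_area ?N * r ^ (?N - 1) * indicator {0..} r * (indicator {..R} r * r powr s)"
      by (cases "r > 0"; cases "r = 0") (auto simp: indicator_def)
  qed
  finally have "integrable lborel (\<lambda>x::real^'n. indicator {..R} (norm x) * norm x powr s)"
    by (subst polar_integrable) auto
  also have "(\<lambda>x::real^'n. indicator {..R} (norm x) * norm x powr s) = (\<lambda>x. indicator (cball 0 R) x * norm x powr s)"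
    by (auto simp: fun_eq_iff indicator_def)
  finally show ?thesis .
next
  case False
  then have "cball (0::real^'n) R = {}" by simp
  then show ?thesis by simp
qed

lemma integrable_norm_powr_outside:
  assumes "s < - real CARD('n)"
  shows "integrable lborel (\<lambda>x::real^'n. indicator {x. norm x \<ge> 1} x * norm x powr s)"
proof -
  let ?N = "CARD('n)"
  have "((\<lambda>r::real. r powr (real ?N - 1 + s)) has_integral -(1 powr (real ?N - 1 + s + 1)) / (real ?N - 1 + s + 1)) {1..}"
    by (rule has_integral_powr_to_inf) (use assms in auto)
  then have "(\<lambda>r::real. r powr (real ?N - 1 + s)) integrable_on {1..}" by blast
  then have "(\<lambda>r::real. r powr (real ?N - 1 + s)) absolutely_integrable_on {1..}"
    by (intro nonnegative_absolutely_integrable_1) auto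
  then have "integrable lborel (\<lambda>r. indicator {1..} r * r powr (real ?N - 1 + s))"
    by (subst (asm) set_integrable_lborel_iff_lebesgue) auto
  then have "integrable lborel (\<lambda>r. sphere_area ?N * (indicator {1..} r * r powr (real ?N - 1 + s)))"
    by (rule integrable_mult_right)
  also have "(\<lambda>r. sphere_area ?N * (indicator {1..} r * r powr (real ?N - 1 + s))) =
     (\<lambda>r. sphere_area ?N * r ^ (?N - 1) * indicator {0..} r * (indicator {1..} r * r powr s))"
  proof
    fix r :: real
    have "r powr (real ?N - 1 + s) = r ^ (?N - 1) * r powr s" if "r > 0"
    proof -
      have "real (?N - 1) = real ?N - 1" by (subst of_nat_diff) auto
      then show ?thesis using that by (simp add: powr_add powr_diff flip: powr_realpow)
    qed
    then show "sphere_area ?N * (indicator {1..} r * r powr (real ?N - 1 + s)) =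
       sphere_area ?N * r ^ (?N - 1) * indicator {0..} r * (indicator {1..} r * r powr s)"
      by (cases "r > 0"; cases "r = 0") (auto simp: indicator_def)
  qed
  finally have "integrable lborel (\<lambda>x::real^'n. indicator {1..} (norm x) * norm x powr s)"
    by (subst polar_integrable) auto
  also have "(\<lambda>x::real^'n. indicator {1..} (norm x) * norm x powr s) = (\<lambda>x. indicator {x. norm x \<ge> 1} x * norm x powr s)"
    by (auto simp: fun_eq_iff indicator_def)
  finally show ?thesis .
qed

subsection \<open>Test functions\<close>

text \<open>The type argument ties N to the index type of the vectors, which neither \<alpha> nor N
  mentions.\<close>

locale weight_range =
  fixes \<alpha> :: real and N :: nat and dim_type :: "'n::finite itself"
  assumes card_dim: "CARD('n) = N" and dim_ge_2: "N \<ge> 2"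
    and alpha_lower: "(4 - real N) / 2 < \<alpha>" and alpha_upper: "\<alpha> < 2"
begin

lemma N_pos: "real N > 0" "sphere_area N > 0"
  using dim_ge_2 by (auto intro: sphere_area_pos)

text \<open>The first inequality makes |x|^(\<alpha>-2) locally integrable; the second makes the
  decay exponent of the bubbles positive.\<close>

lemma N_alpha: "real N - 2 + \<alpha> > 0" "real N - 4 + 2 * \<alpha> > 0"
  using dim_ge_2 alpha_lower alpha_upper by auto

end

lemma AE_lborel_not_zero: "AE x in lborel. x \<noteq> (0 :: 'a::euclidean_space)"
  by (rule AE_I[of _ _ "{0}"]) auto

lemma smooth_cutoff_wdiv:
  fixes u :: "real^'n \<Rightarrow> real"
  assumes "0 < e" "smooth u"
  shows "smooth (\<lambda>x. inner_cutoff e (norm x) * wdiv \<alpha> u x)"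
proof -
  have "smooth (\<lambda>x. (inner_cutoff e (norm x) * norm x powr \<alpha>) * (\<Sum>i\<in>UNIV. partial_deriv i (partial_deriv i u) x) +
      \<alpha> * (inner_cutoff e (norm x) * norm x powr (\<alpha> - 2)) * (\<Sum>i\<in>UNIV. x $ i * partial_deriv i u x))"
    by (intro smooth_add smooth_mult smooth_const smooth_sum smooth_coord smooth_partial_deriv
        smooth_inner_cutoff_powr assms)
  also have "(\<lambda>x. (inner_cutoff e (norm x) * norm x powr \<alpha>) * (\<Sum>i\<in>UNIV. partial_deriv i (partial_deriv i u) x) +
      \<alpha> * (inner_cutoff e (norm x) * norm x powr (\<alpha> - 2)) * (\<Sum>i\<in>UNIV. x $ i * partial_deriv i u x)) =
      (\<lambda>x. inner_cutoff e (norm x) * wdiv \<alpha> u x)"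
  proof
    fix x show "(inner_cutoff e (norm x) * norm x powr \<alpha>) * (\<Sum>i\<in>UNIV. partial_deriv i (partial_deriv i u) x) +
      \<alpha> * (inner_cutoff e (norm x) * norm x powr (\<alpha> - 2)) * (\<Sum>i\<in>UNIV. x $ i * partial_deriv i u x) =
      inner_cutoff e (norm x) * wdiv \<alpha> u x"
      using assms by (cases "x = 0") (auto simp: wdiv_smooth inner_cutoff_0 algebra_simps)
  qed
  finally show ?thesis .
qed

lemma wdiv_locally_const:
  fixes \<psi> :: "real^'n \<Rightarrow> real"
  assumes "open S" "x \<in> S" "x \<noteq> 0" "\<And>y. y \<in> S \<Longrightarrow> \<psi> y = c"
  shows "wdiv \<alpha> \<psi> x = 0"
  using wdiv_cong_open[OF assms(1,2), of \<psi> "\<lambda>_. c" \<alpha>] assms by (simp add: wdiv_const)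

lemma open_norm_gt: "open {x::real^'n. norm x > R}" and open_norm_lt: "open {x::real^'n. norm x < R}"
  by (intro open_Collect_less continuous_intros)+

lemma wdiv_outside:
  fixes \<psi> :: "real^'n \<Rightarrow> real"
  assumes "\<And>x. norm x \<ge> R \<Longrightarrow> \<psi> x = 0" "R > 0" "norm x > R"
  shows "wdiv \<alpha> \<psi> x = 0"
  by (rule wdiv_locally_const[OF open_norm_gt]) (use assms in auto)

text \<open>Near the origin \<psi> is constant and its weighted divergence vanishes; from radius
  \<delta> on it coincides with the smooth function f. The origin itself is excluded because the
  weight may be singular there.\<close>

lemma wdiv_bounded:
  fixes \<psi> :: "real^'n \<Rightarrow> real"
  assumes "smooth \<psi>" "compactly_supported \<psi>" "\<delta> > 0" "\<And>x. norm x < \<delta> \<Longrightarrow> \<psi> x = c"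
  obtains B R where "B > 0" "R > 0" "\<And>x. x \<noteq> 0 \<Longrightarrow> \<bar>wdiv \<alpha> \<psi> x\<bar> \<le> B * indicator (cball 0 R) x"
proof -
  obtain R where R: "R > 0" "\<And>x. norm x \<ge> R \<Longrightarrow> \<psi> x = 0" using compactly_supportedE[OF assms(2)] by blast
  define f where "f x = inner_cutoff (\<delta>/4) (norm x) * wdiv \<alpha> \<psi> x" for x
  have sf: "smooth f" unfolding f_def[abs_def] by (rule smooth_cutoff_wdiv) (use assms in auto)
  have cf: "compactly_supported f"
    by (rule compactly_supportedI[of R]) (simp add: f_def wdiv_outside[OF R(2,1)])
  obtain B where B: "B > 0" "\<And>x. \<bar>f x\<bar> \<le> B" using smooth_compactly_supported_bounded[OF sf cf] by blast
  have "\<bar>wdiv \<alpha> \<psi> x\<bar> \<le> B * indicator (cball 0 R) x" if "x \<noteq> 0" for x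
  proof -
    consider "norm x > R" | "norm x < \<delta>" | "norm x \<le> R" "norm x \<ge> \<delta>" by linarith
    then show ?thesis
    proof cases
      case 1
      then show ?thesis using wdiv_outside[OF R(2,1)] B by simp
    next
      case 2
      then have "wdiv \<alpha> \<psi> x = 0"
        by (intro wdiv_locally_const[OF open_norm_lt[of \<delta>]]) (use that assms in auto)
      then show ?thesis using B by simp
    next
      case 3
      then have "f x = wdiv \<alpha> \<psi> x" using assms(3) by (simp add: f_def inner_cutoff_1)
      then show ?thesis using B(2)[of x] 3 by simp
    qed
  qed
  then show ?thesis using that B R by blast
qed

lemma radial_sys_smooth1:
  assumes "smooth1 {0<..} \<phi>"
  shows "radial_sys N \<alpha> \<phi> (\<lambda>r. r powr (real N - 1 + \<alpha>) * deriv \<phi> r)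
     (\<lambda>r. (real N - 1 + \<alpha>) * r powr (\<alpha> - 1) * deriv \<phi> r + r powr \<alpha> * deriv (deriv \<phi>) r)"
  unfolding radial_sys_def
proof (intro conjI allI impI)
  fix r :: real assume r: "r > 0"
  have "(\<phi> has_field_derivative deriv \<phi> r) (at r)" using smooth1_DERIV[OF assms] r by simp
  then show "(\<phi> has_field_derivative r powr (1 - real N - \<alpha>) * (r powr (real N - 1 + \<alpha>) * deriv \<phi> r)) (at r)"
    using r by (simp add: mult.assoc[symmetric] powr_add[symmetric])
  have "((\<lambda>r. r powr (real N - 1 + \<alpha>) * deriv \<phi> r) has_field_derivative
     ((real N - 1 + \<alpha>) * r powr (real N - 1 + \<alpha> - 1)) * deriv \<phi> r + deriv (deriv \<phi>) r * r powr (real N - 1 + \<alpha>)) (at r)"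
    using smooth1_DERIV[OF smooth1_deriv[OF assms], of r] r
    by (intro DERIV_mult has_real_derivative_powr) auto
  also have "((real N - 1 + \<alpha>) * r powr (real N - 1 + \<alpha> - 1)) * deriv \<phi> r + deriv (deriv \<phi>) r * r powr (real N - 1 + \<alpha>)
      = r powr (real N - 1) * ((real N - 1 + \<alpha>) * r powr (\<alpha> - 1) * deriv \<phi> r + r powr \<alpha> * deriv (deriv \<phi>) r)"
  proof -
    have "r powr (real N - 1 + \<alpha> - 1) = r powr (real N - 1) * r powr (\<alpha> - 1)"
         "r powr (real N - 1 + \<alpha>) = r powr (real N - 1) * r powr \<alpha>"
      by (simp_all add: powr_add[symmetric] algebra_simps)
    then show ?thesis by (simp add: algebra_simps)
  qed
  finally show "((\<lambda>r. r powr (real N - 1 + \<alpha>) * deriv \<phi> r) has_field_derivative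
     r powr (real N - 1) * ((real N - 1 + \<alpha>) * r powr (\<alpha> - 1) * deriv \<phi> r + r powr \<alpha> * deriv (deriv \<phi>) r)) (at r)" .
qed

lemma deriv_inner_cutoff:
  assumes "e > 0"
  shows "deriv (inner_cutoff e) r = deriv smooth_step (r / e - 1) / e"
    and "deriv (deriv (inner_cutoff e)) r = deriv (deriv smooth_step) (r / e - 1) / e\<^sup>2"
proof -
  have aff: "((\<lambda>r. r / e - 1) has_field_derivative 1 / e) (at r)" for r
    using assms by (auto intro!: derivative_eq_intros)
  have d: "deriv (inner_cutoff e) r = deriv smooth_step (r / e - 1) / e" for r
    unfolding inner_cutoff_def[abs_def]
    by (rule DERIV_imp_deriv)
       (use DERIV_chain2[OF smooth1_DERIV[OF smooth1_smooth_step] aff] in simp)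
  show "deriv (inner_cutoff e) r = deriv smooth_step (r / e - 1) / e" by (rule d)
  have "((\<lambda>r. deriv smooth_step (r / e - 1) * (1 / e)) has_field_derivative
       deriv (deriv smooth_step) (r / e - 1) * (1 / e) * (1 / e)) (at r)"
    by (intro DERIV_cmult_right DERIV_chain2[OF smooth1_DERIV[OF smooth1_deriv[OF smooth1_smooth_step]] aff]) auto
  then have "deriv (\<lambda>r. deriv smooth_step (r / e - 1) / e) r = deriv (deriv smooth_step) (r / e - 1) / e\<^sup>2"
    by (intro DERIV_imp_deriv) (simp add: power2_eq_square)
  then show "deriv (deriv (inner_cutoff e)) r = deriv (deriv smooth_step) (r / e - 1) / e\<^sup>2"
    by (simp add: ext[OF d])
qed

text \<open>By scaling, the weighted divergence of the cutoff is r^(\<alpha>-2) times a bounded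
  function of t = r/e that vanishes for t > 2; hence the constant does not depend on e.\<close>

lemma wdiv_inner_cutoff_bound:
  obtains C where "C \<ge> 0"
    "\<And>e x. e > 0 \<Longrightarrow> x \<noteq> 0 \<Longrightarrow>
      \<bar>wdiv \<alpha> (\<lambda>x::real^'n. inner_cutoff e (norm x)) x\<bar> \<le> C * (indicator (cball 0 (2 * e)) x * norm x powr (\<alpha> - 2))"
proof -
  obtain B where B: "B \<ge> 0" "\<And>x. \<bar>deriv smooth_step x\<bar> \<le> B" "\<And>x. \<bar>deriv (deriv smooth_step) x\<bar> \<le> B"
    using smooth_step_derivs_bounded by blast
  let ?N = "real CARD('n)"
  \<comment> \<open>With t at most 2, the first-order term contributes |N-1+\<alpha>| times 2 B and
    the second-order term t^2 B, at most 4 B.\<close>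
  define C where "C = (\<bar>?N - 1 + \<alpha>\<bar> * 2 + 4) * B"
  show ?thesis
  proof (rule that[of C])
    show "C \<ge> 0" using B by (simp add: C_def)
    fix e :: real and x :: "real^'n" assume e: "e > 0" and x: "x \<noteq> 0"
    let ?r = "norm x"
    have r: "?r > 0" using x by simp
    have eq: "wdiv \<alpha> (\<lambda>x. inner_cutoff e (norm x)) x =
       (?N - 1 + \<alpha>) * ?r powr (\<alpha> - 1) * deriv (inner_cutoff e) ?r + ?r powr \<alpha> * deriv (deriv (inner_cutoff e)) ?r"
      by (rule wdiv_radial[OF radial_sys_smooth1[OF smooth1_inner_cutoff] x]) auto
    show "\<bar>wdiv \<alpha> (\<lambda>x. inner_cutoff e (norm x)) x\<bar> \<le> C * (indicator (cball 0 (2 * e)) x * norm x powr (\<alpha> - 2))"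
    proof (cases "?r \<le> 2 * e")
      case False
      then have "wdiv \<alpha> (\<lambda>x. inner_cutoff e (norm x)) x = 0"
        by (intro wdiv_locally_const[OF open_norm_gt[of "2 * e"], where c = 1]) (use x e in \<open>auto simp: inner_cutoff_1\<close>)
      then show ?thesis using False by simp
    next
      case True
      define t where "t = ?r / e"
      have t: "0 \<le> t" "t \<le> 2" using True e by (auto simp: t_def field_simps)
      define s1 s2 where "s1 = deriv smooth_step (t - 1)" and "s2 = deriv (deriv smooth_step) (t - 1)"
      have "?r powr (\<alpha> - 1) = ?r powr (\<alpha> - 2) * ?r" "?r powr \<alpha> = ?r powr (\<alpha> - 2) * ?r\<^sup>2"
        using r by (simp_all add: powr_diff power2_eq_square powr_numeral)
      then have "wdiv \<alpha> (\<lambda>x. inner_cutoff e (norm x)) x = ?r powr (\<alpha> - 2) * ((?N - 1 + \<alpha>) * (t * s1) + t\<^sup>2 * s2)"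
        unfolding eq using e by (simp add: deriv_inner_cutoff s1_def s2_def t_def power_divide algebra_simps
            add_divide_distrib diff_divide_distrib)
      moreover have "\<bar>(?N - 1 + \<alpha>) * (t * s1) + t\<^sup>2 * s2\<bar> \<le> C"
      proof -
        have "\<bar>t * s1\<bar> \<le> 2 * B" using t B(2)[of "t - 1"] unfolding s1_def abs_mult by (intro mult_mono) auto
        then have "\<bar>(?N - 1 + \<alpha>) * (t * s1)\<bar> \<le> \<bar>?N - 1 + \<alpha>\<bar> * (2 * B)"
          unfolding abs_mult by (intro mult_left_mono) auto
        moreover have "t\<^sup>2 \<le> 2\<^sup>2" using t by (intro power_mono) auto
        then have "\<bar>t\<^sup>2 * s2\<bar> \<le> 4 * B" using B(3)[of "t - 1"] unfolding s2_def abs_mult by (intro mult_mono) auto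
        moreover have "C = \<bar>?N - 1 + \<alpha>\<bar> * (2 * B) + 4 * B" by (simp add: C_def algebra_simps)
        ultimately show ?thesis by linarith
      qed
      ultimately have "\<bar>wdiv \<alpha> (\<lambda>x. inner_cutoff e (norm x)) x\<bar> \<le> ?r powr (\<alpha> - 2) * C"
        by (simp only: abs_mult abs_of_nonneg[OF powr_ge_zero]) (intro mult_left_mono, auto)
      then show ?thesis using True by (simp add: mult.commute)
    qed
  qed
qed

lemma bounded_ball_L2:
  fixes f :: "real^'n \<Rightarrow> real"
  assumes [measurable]: "f \<in> borel_measurable borel" and "\<And>x. \<bar>f x\<bar> \<le> B * indicator (cball 0 R) x"
  shows "f \<in> L2 lborel"
proof (rule L2_dominated)
  have "integrable lborel (\<lambda>x::real^'n. indicator (cball 0 R) x :: real)"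
    by (intro integrable_real_indicator) (simp_all add: emeasure_lborel_cball_finite[unfolded infinity_ennreal_def])
  then have "integrable lborel (\<lambda>x::real^'n. B\<^sup>2 * indicator (cball 0 R) x)" by simp
  also have "(\<lambda>x::real^'n. B\<^sup>2 * indicator (cball 0 R) x) = (\<lambda>x. (B * indicator (cball 0 R) x)\<^sup>2)"
    by (auto simp: indicator_def fun_eq_iff)
  finally show "(\<lambda>x::real^'n. B * indicator (cball 0 R) x) \<in> L2 lborel"
    unfolding L2_def by (intro CollectI conjI borel_measurable_times borel_measurable_indicator) auto
  show "AE x in lborel. \<bar>f x\<bar> \<le> \<bar>B * indicator (cball 0 R) x\<bar>"
    using order_trans[OF assms(2) abs_ge_self] by simp
qed simp

text \<open>The definition integrates over \<open>lebesgue\<close>, while the calculus below is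
  carried out over \<open>lborel\<close>; since \<open>wdiv\<close> of a smooth function is Borel,
  integrability means the same for both.\<close>

lemma test_funD:
  assumes "u \<in> test_fun \<alpha>"
  shows "smooth u" "compactly_supported u" "wdiv \<alpha> u \<in> L2 lborel"
  using assms integrable_completion[of "\<lambda>x. (wdiv \<alpha> u x)\<^sup>2" lborel] wdiv_borel[of u \<alpha>]
  by (auto simp: test_fun_def L2_def)

lemma test_funI:
  assumes "smooth u" "compactly_supported u" "wdiv \<alpha> u \<in> L2 lborel"
  shows "u \<in> test_fun \<alpha>"
  using assms integrable_completion[of "\<lambda>x. (wdiv \<alpha> u x)\<^sup>2" lborel] wdiv_borel[of u \<alpha>]
  by (auto simp: test_fun_def L2_def)

lemma test_fun_wdiv_ball:
  assumes "u \<in> test_fun \<alpha>"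
  obtains R where "R > 0" "\<And>x. norm x > R \<Longrightarrow> wdiv \<alpha> u x = 0" "\<And>x. norm x \<ge> R \<Longrightarrow> u x = 0"
proof -
  obtain R where R: "R > 0" "\<And>x. norm x \<ge> R \<Longrightarrow> u x = 0"
    using compactly_supportedE[OF test_funD(2)[OF assms]] by blast
  then show ?thesis using wdiv_outside[OF R(2,1)]
    by (intro that[of R]) auto
qed

text \<open>Only square integrability of \<open>wdiv\<close> is known, and it may be unbounded near
  the origin. Cutting the bounded factor down to a ball that carries \<open>wdiv\<close> makes the
  integrand a product of two L^2 functions.\<close>

lemma test_fun_wdiv_mult_integrable:
  fixes u :: "real^'n \<Rightarrow> real"
  assumes u: "u \<in> test_fun \<alpha>" and [measurable]: "f \<in> borel_measurable borel" and "\<And>x. \<bar>f x\<bar> \<le> B"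
  shows "integrable lborel (\<lambda>x. wdiv \<alpha> u x * f x)"
proof -
  obtain R where R: "R > 0" "\<And>x. norm x > R \<Longrightarrow> wdiv \<alpha> u x = 0" "\<And>x. norm x \<ge> R \<Longrightarrow> u x = 0"
    by (rule test_fun_wdiv_ball[OF u]) (rule that)
  have "(\<lambda>x. f x * indicator (cball 0 R) x) \<in> L2 lborel"
  proof (rule bounded_ball_L2)
    show "(\<lambda>x. f x * indicator (cball 0 R) x) \<in> borel_measurable borel"
      by (intro borel_measurable_times borel_measurable_indicator assms) simp
    show "\<bar>f x * indicator (cball 0 R) x\<bar> \<le> B * indicator (cball 0 R) x" for x
      using assms(3)[of x] by (simp add: indicator_def)
  qed
  from L2_mult_integrable[OF test_funD(3)[OF u] this]
  have "integrable lborel (\<lambda>x. wdiv \<alpha> u x * (f x * indicator (cball 0 R) x))" .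
  moreover have "wdiv \<alpha> u x * (f x * indicator (cball 0 R) x) = wdiv \<alpha> u x * f x" for x
    using R(2)[of x] by (cases "norm x > R") auto
  ultimately show ?thesis by simp
qed

lemma null_sequence_approx:
  fixes a :: "nat \<Rightarrow> real"
  assumes "\<And>e. e > 0 \<Longrightarrow> \<exists>b. b \<longlonglongrightarrow> 0 \<and> (\<forall>n. \<bar>a n\<bar> \<le> b n + e)"
  shows "a \<longlonglongrightarrow> 0"
proof (rule LIMSEQ_I)
  fix r :: real assume r: "r > 0"
  obtain b where b: "b \<longlonglongrightarrow> 0" "\<And>n. \<bar>a n\<bar> \<le> b n + r / 2" using assms[of "r/2"] r by auto
  obtain no where "\<And>n. n \<ge> no \<Longrightarrow> norm (b n - 0) < r / 2" using LIMSEQ_D[OF b(1), of "r/2"] r by auto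
  then have "norm (a n - 0) < r" if "n \<ge> no" for n using b(2)[of n] that by fastforce
  then show "\<exists>no. \<forall>n\<ge>no. norm (a n - 0) < r" by blast
qed

section \<open>Integration by parts across the origin\<close>

context weight_range
begin

text \<open>Test functions have no flux through the origin. Integrating by parts against cutoffs
  that vanish near 0 leaves the weighted divergence of the cutoff, which is dominated by the locally
  integrable |x|^(\<alpha>-2) and lives on shrinking balls.\<close>

lemma integral_wdiv_zero:
  fixes w :: "real^'n \<Rightarrow> real"
  assumes w: "w \<in> test_fun \<alpha>"
  shows "(\<integral>x. wdiv \<alpha> w x \<partial>lborel) = 0"
proof -
  define e where "e n = 1 / (real n + 1)" for n
  have e: "0 < e n" "e n \<le> 1" for n by (auto simp: e_def)
  have e0: "e \<longlonglongrightarrow> 0" unfolding e_def using LIMSEQ_inverse_real_of_nat by (simp add: inverse_eq_divide add.commute)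
  define \<eta> where "\<eta> n x = inner_cutoff (e n) (norm x)" for n and x :: "real^'n"
  have s\<eta>: "smooth (\<eta> n)" for n unfolding \<eta>_def[abs_def] using e by (intro smooth_inner_cutoff)
  have [measurable]: "\<eta> n \<in> borel_measurable borel" "wdiv \<alpha> (\<eta> n) \<in> borel_measurable borel" for n
    using s\<eta> smooth_borel wdiv_borel by blast+
  have [measurable]: "w \<in> borel_measurable borel" "wdiv \<alpha> w \<in> borel_measurable borel"
    using smooth_borel wdiv_borel test_funD[OF w] by blast+
  have ev: "\<forall>\<^sub>F n in sequentially. 2 * e n < norm x" if "x \<noteq> 0" for x :: "real^'n"
    using tendsto_mult[OF tendsto_const[of 2] e0] that by (intro order_tendstoD(2)[where y = 0]) auto
  have eq: "(\<integral>x. wdiv \<alpha> w x * \<eta> n x \<partial>lborel) = (\<integral>x. w x * wdiv \<alpha> (\<eta> n) x \<partial>lborel)" for n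
    by (rule wdiv_by_parts_away(3)[OF test_funD(1,2)[OF w] s\<eta> e(1)[of n]])
       (use e in \<open>auto simp: \<eta>_def inner_cutoff_0\<close>)
  have L: "(\<lambda>n. \<integral>x. wdiv \<alpha> w x * \<eta> n x \<partial>lborel) \<longlonglongrightarrow> (\<integral>x. wdiv \<alpha> w x \<partial>lborel)"
  proof (rule integral_dominated_convergence[where w = "\<lambda>x. \<bar>wdiv \<alpha> w x\<bar>"])
    have "integrable lborel (\<lambda>x. wdiv \<alpha> w x * 1)"
      by (rule test_fun_wdiv_mult_integrable[OF w, of _ 1]) auto
    then show "integrable lborel (\<lambda>x. \<bar>wdiv \<alpha> w x\<bar>)" by simp
    show "AE x in lborel. (\<lambda>n. wdiv \<alpha> w x * \<eta> n x) \<longlonglongrightarrow> wdiv \<alpha> w x"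
      using AE_lborel_not_zero
    proof eventually_elim
      case (elim x)
      show ?case
        by (rule tendsto_eventually, use ev[OF elim] in eventually_elim)
           (use e in \<open>simp add: \<eta>_def inner_cutoff_1\<close>)
    qed
    show "AE x in lborel. norm (wdiv \<alpha> w x * \<eta> n x) \<le> \<bar>wdiv \<alpha> w x\<bar>" for n
      using cutoff_bounds by (intro AE_I2) (auto simp: \<eta>_def abs_mult mult_left_le)
  qed auto
  obtain C where C: "C \<ge> 0" "\<And>e x. e > 0 \<Longrightarrow> x \<noteq> 0 \<Longrightarrow>
      \<bar>wdiv \<alpha> (\<lambda>x::real^'n. inner_cutoff e (norm x)) x\<bar> \<le> C * (indicator (cball 0 (2 * e)) x * norm x powr (\<alpha> - 2))"
    using wdiv_inner_cutoff_bound by blast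
  obtain B where B: "B > 0" "\<And>x. \<bar>w x\<bar> \<le> B"
    using smooth_compactly_supported_bounded[OF test_funD(1,2)[OF w]] by blast
  have "(\<lambda>n. \<integral>x. w x * wdiv \<alpha> (\<eta> n) x \<partial>lborel) \<longlonglongrightarrow> integral\<^sup>L lborel (\<lambda>x::real^'n. 0)"
  proof (rule integral_dominated_convergence[where w = "\<lambda>x. B * (C * (indicator (cball 0 2) x * norm x powr (\<alpha> - 2)))"])
    show "integrable lborel (\<lambda>x::real^'n. B * (C * (indicator (cball 0 2) x * norm x powr (\<alpha> - 2))))"
      using N_alpha card_dim by (intro integrable_mult_right integrable_norm_powr_ball) auto
    show "AE x in lborel. (\<lambda>n. w x * wdiv \<alpha> (\<eta> n) x) \<longlonglongrightarrow> 0"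
      using AE_lborel_not_zero
    proof eventually_elim
      case (elim x)
      have "\<bar>wdiv \<alpha> (\<eta> n) x\<bar> \<le> C * (indicator (cball 0 (2 * e n)) x * norm x powr (\<alpha> - 2))" for n
        using C(2)[OF e(1) elim, of n] by (simp add: \<eta>_def[abs_def])
      then have "w x * wdiv \<alpha> (\<eta> n) x = 0" if "2 * e n < norm x" for n
        using that by (metis abs_le_zero_iff indicator_simps(2) mem_cball_0 mult_not_zero not_le)
      then have "\<forall>\<^sub>F n in sequentially. w x * wdiv \<alpha> (\<eta> n) x = 0"
        using ev[OF elim] by (rule eventually_mono[rotated])
      then show ?case by (rule tendsto_eventually)
    qed
    fix n
    show "AE x in lborel. norm (w x * wdiv \<alpha> (\<eta> n) x) \<le> B * (C * (indicator (cball 0 2) x * norm x powr (\<alpha> - 2)))"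
      using AE_lborel_not_zero
    proof eventually_elim
      case (elim x)
      have "\<bar>wdiv \<alpha> (\<eta> n) x\<bar> \<le> C * (indicator (cball 0 (2 * e n)) x * norm x powr (\<alpha> - 2))"
        using C(2)[OF e(1) elim] by (simp add: \<eta>_def[abs_def])
      also have "\<dots> \<le> C * (indicator (cball 0 2) x * norm x powr (\<alpha> - 2))"
        using C(1) e(2)[of n] by (intro mult_left_mono mult_right_mono) (auto simp: indicator_def)
      finally show ?case using B unfolding real_norm_def abs_mult by (intro mult_mono) auto
    qed
  qed auto
  then have "(\<lambda>n. \<integral>x. wdiv \<alpha> w x * \<eta> n x \<partial>lborel) \<longlonglongrightarrow> 0" by (simp add: eq)
  with L show ?thesis using LIMSEQ_unique by blast
qed

text \<open>Subtracting c reduces to a function vanishing near the origin; the constant itself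
  contributes nothing by \<open>integral_wdiv_zero\<close>.\<close>

lemma wdiv_by_parts:
  fixes w \<psi> :: "real^'n \<Rightarrow> real"
  assumes w: "w \<in> test_fun \<alpha>" and \<psi>: "smooth \<psi>"
    and \<delta>: "\<delta> > 0" "\<And>x. norm x < \<delta> \<Longrightarrow> \<psi> x = c"
  shows "(\<integral>x. wdiv \<alpha> w x * \<psi> x \<partial>lborel) = (\<integral>x. w x * wdiv \<alpha> \<psi> x \<partial>lborel)"
proof -
  have s: "smooth (\<lambda>x. \<psi> x - c)" by (intro smooth_diff \<psi> smooth_const)
  note ibp = wdiv_by_parts_away[OF test_funD(1,2)[OF w] s \<delta>(1)]
  have 1: "integrable lborel (\<lambda>x. wdiv \<alpha> w x * (\<psi> x - c))" by (rule ibp) (use \<delta> in auto)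
  have 2: "integrable lborel (\<lambda>x. wdiv \<alpha> w x * 1)"
    by (rule test_fun_wdiv_mult_integrable[OF w, of _ 1]) auto
  have "(\<integral>x. wdiv \<alpha> w x * \<psi> x \<partial>lborel) = (\<integral>x. wdiv \<alpha> w x * (\<psi> x - c) + c * (wdiv \<alpha> w x * 1) \<partial>lborel)"
    by (intro Bochner_Integration.integral_cong) (auto simp: algebra_simps)
  also have "\<dots> = (\<integral>x. wdiv \<alpha> w x * (\<psi> x - c) \<partial>lborel) + c * (\<integral>x. wdiv \<alpha> w x * 1 \<partial>lborel)"
    using 1 2 by (subst Bochner_Integration.integral_add) auto
  also have "\<dots> = (\<integral>x. w x * wdiv \<alpha> (\<lambda>x. \<psi> x - c) x \<partial>lborel)"
    using ibp(3) \<delta> integral_wdiv_zero[OF w] by simp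
  also have "\<dots> = (\<integral>x. w x * wdiv \<alpha> \<psi> x \<partial>lborel)"
  proof (rule integral_cong_AE)
    show "AE x in lborel. w x * wdiv \<alpha> (\<lambda>x. \<psi> x - c) x = w x * wdiv \<alpha> \<psi> x"
      using AE_lborel_not_zero
      by eventually_elim (simp add: wdiv_diff[OF \<psi> smooth_const] wdiv_const)
    have [measurable]: "w \<in> borel_measurable borel" "wdiv \<alpha> \<psi> \<in> borel_measurable borel"
      "wdiv \<alpha> (\<lambda>x. \<psi> x - c) \<in> borel_measurable borel"
      using smooth_borel wdiv_borel test_funD[OF w] \<psi> s by blast+
    show "(\<lambda>x. w x * wdiv \<alpha> (\<lambda>x. \<psi> x - c) x) \<in> borel_measurable lborel"
      "(\<lambda>x. w x * wdiv \<alpha> \<psi> x) \<in> borel_measurable lborel" by measurable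
  qed
  finally show ?thesis .
qed

end

subsection \<open>Elements of the completion\<close>

definition L2_Cauchy :: "'a measure \<Rightarrow> (nat \<Rightarrow> 'a \<Rightarrow> real) \<Rightarrow> bool" where
  "L2_Cauchy M g \<longleftrightarrow> (\<forall>n. g n \<in> L2 M) \<and>
     (\<forall>e>0. \<exists>k. \<forall>m\<ge>k. \<forall>n\<ge>k. L2_norm M (\<lambda>x. g m x - g n x) < e)"

lemma L2_Cauchy_bounded:
  assumes "L2_Cauchy M g"
  obtains C where "C > 0" "\<And>n. L2_norm M (g n) \<le> C"
proof -
  have g: "g n \<in> L2 M" for n using assms by (auto simp: L2_Cauchy_def)
  obtain k where k: "\<And>m n. m \<ge> k \<Longrightarrow> n \<ge> k \<Longrightarrow> L2_norm M (\<lambda>x. g m x - g n x) < 1"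
    using assms unfolding L2_Cauchy_def by (meson zero_less_one)
  have nn: "0 \<le> L2_norm M (g j)" for j by (rule L2_norm_nonneg)
  have "L2_norm M (g n) \<le> 1 + (\<Sum>j\<le>k. L2_norm M (g j))" for n
  proof (cases "n \<le> k")
    case True
    then have "L2_norm M (g n) \<le> (\<Sum>j\<le>k. L2_norm M (g j))"
      using nn by (intro member_le_sum) auto
    then show ?thesis by simp
  next
    case False
    have "L2_norm M (\<lambda>x. (g n x - g k x) + g k x) \<le> L2_norm M (\<lambda>x. g n x - g k x) + L2_norm M (g k)"
      by (intro L2_norm_triangle L2_diff g)
    moreover have "L2_norm M (g k) \<le> (\<Sum>j\<le>k. L2_norm M (g j))"
      using nn by (intro member_le_sum) auto
    ultimately show ?thesis using k[of n k] False by simp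
  qed
  moreover have "0 < 1 + (\<Sum>j\<le>k. L2_norm M (g j))" using nn by (intro add_pos_nonneg sum_nonneg) auto
  ultimately show ?thesis using that by blast
qed

lemma L2_inner_Cauchy_convergent:
  assumes f: "L2_Cauchy M f" and g: "L2_Cauchy M g"
  shows "convergent (\<lambda>n. \<integral>x. f n x * g n x \<partial>M)"
proof -
  obtain A where A: "A > 0" "\<And>n. L2_norm M (f n) \<le> A" using L2_Cauchy_bounded[OF f] by blast
  obtain B where B: "B > 0" "\<And>n. L2_norm M (g n) \<le> B" using L2_Cauchy_bounded[OF g] by blast
  have L: "f n \<in> L2 M" "g n \<in> L2 M" for n using f g by (auto simp: L2_Cauchy_def)
  have "Cauchy (\<lambda>n. \<integral>x. f n x * g n x \<partial>M)"
  proof (rule CauchyI)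
    fix e :: real assume e: "e > 0"
    \<comment> \<open>The two cross terms of the bilinear expansion are below d B and A d.\<close>
    define d where "d = e / (A + B)"
    have d: "d > 0" "d * (A + B) = e" using e A B by (auto simp: d_def)
    obtain k1 where k1: "\<And>m n. m \<ge> k1 \<Longrightarrow> n \<ge> k1 \<Longrightarrow> L2_norm M (\<lambda>x. f m x - f n x) < d"
      using f d(1) unfolding L2_Cauchy_def by blast
    obtain k2 where k2: "\<And>m n. m \<ge> k2 \<Longrightarrow> n \<ge> k2 \<Longrightarrow> L2_norm M (\<lambda>x. g m x - g n x) < d"
      using g d(1) unfolding L2_Cauchy_def by blast
    have "norm ((\<integral>x. f m x * g m x \<partial>M) - (\<integral>x. f n x * g n x \<partial>M)) < e"
      if mn: "m \<ge> max k1 k2" "n \<ge> max k1 k2" for m n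
    proof -
      have "(\<integral>x. f m x * g m x \<partial>M) - (\<integral>x. f n x * g n x \<partial>M) = (\<integral>x. f m x * g m x - f n x * g n x \<partial>M)"
        by (intro Bochner_Integration.integral_diff[symmetric] L2_mult_integrable L)
      also have "\<dots> = (\<integral>x. (f m x - f n x) * g m x + f n x * (g m x - g n x) \<partial>M)"
        by (intro Bochner_Integration.integral_cong) (auto simp: algebra_simps)
      also have "\<dots> = (\<integral>x. (f m x - f n x) * g m x \<partial>M) + (\<integral>x. f n x * (g m x - g n x) \<partial>M)"
        by (intro Bochner_Integration.integral_add L2_mult_integrable L2_diff L)
      finally have "\<bar>(\<integral>x. f m x * g m x \<partial>M) - (\<integral>x. f n x * g n x \<partial>M)\<bar> \<le>
         \<bar>\<integral>x. (f m x - f n x) * g m x \<partial>M\<bar> + \<bar>\<integral>x. f n x * (g m x - g n x) \<partial>M\<bar>" by linarith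
      also have "\<bar>\<integral>x. (f m x - f n x) * g m x \<partial>M\<bar> \<le> L2_norm M (\<lambda>x. f m x - f n x) * L2_norm M (g m)"
        by (intro L2_Cauchy_Schwarz L2_diff L)
      also have "\<dots> \<le> L2_norm M (\<lambda>x. f m x - f n x) * B"
        using B by (intro mult_left_mono L2_norm_nonneg) auto
      also have "\<dots> < d * B" using k1 mn B by (intro mult_strict_right_mono) auto
      also have "\<bar>\<integral>x. f n x * (g m x - g n x) \<partial>M\<bar> \<le> L2_norm M (f n) * L2_norm M (\<lambda>x. g m x - g n x)"
        by (intro L2_Cauchy_Schwarz L2_diff L)
      also have "\<dots> \<le> A * L2_norm M (\<lambda>x. g m x - g n x)"
        using A by (intro mult_right_mono L2_norm_nonneg) auto
      also have "\<dots> < A * d" using k2 mn A by (intro mult_strict_left_mono) auto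
      finally show ?thesis using d by (simp add: algebra_simps)
    qed
    then show "\<exists>k. \<forall>m\<ge>k. \<forall>n\<ge>k. norm ((\<integral>x. f m x * g m x \<partial>M) - (\<integral>x. f n x * g n x \<partial>M)) < e" by blast
  qed
  then show ?thesis by (simp add: Cauchy_convergent_iff)
qed

lemma test_norm_eq: "u \<in> test_fun \<alpha> \<Longrightarrow> test_norm \<alpha> u = L2_norm lborel (wdiv \<alpha> u)"
  using wdiv_borel[OF test_funD(1), of u \<alpha> \<alpha>]
  by (simp add: test_norm_def test_inner_def L2_norm_def integral_completion power2_eq_square)

lemma test_inner_eq:
  "u \<in> test_fun \<alpha> \<Longrightarrow> v \<in> test_fun \<alpha> \<Longrightarrow> test_inner \<alpha> u v = (\<integral>x. wdiv \<alpha> u x * wdiv \<alpha> v x \<partial>lborel)"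
  using wdiv_borel[OF test_funD(1), of u \<alpha> \<alpha>] wdiv_borel[OF test_funD(1), of v \<alpha> \<alpha>]
  by (simp add: test_inner_def integral_completion)

lemma L2_cong_AE:
  assumes "f \<in> L2 M" "g \<in> borel_measurable M" "AE x in M. f x = g x"
  shows "g \<in> L2 M" "L2_norm M f = L2_norm M g"
proof -
  show "g \<in> L2 M"
    by (rule L2_dominated[OF assms(1,2)]) (use assms(3) in eventually_elim, simp)
  have "(\<integral>x. (f x)\<^sup>2 \<partial>M) = (\<integral>x. (g x)\<^sup>2 \<partial>M)"
    by (rule integral_cong_AE) (use assms L2_measurable[OF assms(1)] in \<open>auto elim!: eventually_mono\<close>)
  then show "L2_norm M f = L2_norm M g" by (simp add: L2_norm_def)
qed

lemma test_fun_diff: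
  fixes u v :: "real^'n \<Rightarrow> real"
  assumes u: "u \<in> test_fun \<alpha>" and v: "v \<in> test_fun \<alpha>"
  shows "(\<lambda>x. u x - v x) \<in> test_fun \<alpha>"
    "test_norm \<alpha> (\<lambda>x. u x - v x) = L2_norm lborel (\<lambda>x. wdiv \<alpha> u x - wdiv \<alpha> v x)"
proof -
  have s: "smooth (\<lambda>x. u x - v x)" by (intro smooth_diff test_funD(1)[OF u] test_funD(1)[OF v])
  obtain R where R: "\<And>x. norm x \<ge> R \<Longrightarrow> u x = 0" using compactly_supportedE[OF test_funD(2)[OF u]] by blast
  obtain R' where R': "\<And>x. norm x \<ge> R' \<Longrightarrow> v x = 0" using compactly_supportedE[OF test_funD(2)[OF v]] by blast
  have c: "compactly_supported (\<lambda>x. u x - v x)"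
    by (rule compactly_supportedI[of "max R R'"]) (use R R' in auto)
  have ae: "AE x in lborel. wdiv \<alpha> u x - wdiv \<alpha> v x = wdiv \<alpha> (\<lambda>x. u x - v x) x"
    using AE_lborel_not_zero
    by eventually_elim (simp add: wdiv_diff[OF test_funD(1)[OF u] test_funD(1)[OF v]])
  have m: "wdiv \<alpha> (\<lambda>x. u x - v x) \<in> borel_measurable lborel" using wdiv_borel[OF s] by simp
  note * = L2_cong_AE[OF L2_diff[OF test_funD(3)[OF u] test_funD(3)[OF v]] m ae]
  show "(\<lambda>x. u x - v x) \<in> test_fun \<alpha>" by (rule test_funI[OF s c *(1)])
  from test_norm_eq[OF this] *(2)
  show "test_norm \<alpha> (\<lambda>x. u x - v x) = L2_norm lborel (\<lambda>x. wdiv \<alpha> u x - wdiv \<alpha> v x)" by simp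
qed

lemma representsD:
  fixes w :: "nat \<Rightarrow> real^'n \<Rightarrow> real"
  assumes "represents \<alpha> w u"
  shows "w n \<in> test_fun \<alpha>" "L2_Cauchy lborel (\<lambda>n. wdiv \<alpha> (w n))"
    "u absolutely_integrable_on cball 0 R"
    "(\<lambda>n. LINT x:cball 0 R|lebesgue. \<bar>w n x - u x\<bar>) \<longlonglongrightarrow> 0"
proof -
  have t: "w n \<in> test_fun \<alpha>" for n using assms by (auto simp: represents_def)
  show "w n \<in> test_fun \<alpha>" by (rule t)
  show "L2_Cauchy lborel (\<lambda>n. wdiv \<alpha> (w n))"
    using assms test_funD(3)[OF t] test_fun_diff(2)[OF t t]
    by (auto simp: L2_Cauchy_def represents_def)
  show "u absolutely_integrable_on cball 0 R"
    "(\<lambda>n. LINT x:cball 0 R|lebesgue. \<bar>w n x - u x\<bar>) \<longlonglongrightarrow> 0"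
    using assms compact_cball by (auto simp: represents_def)
qed

lemma L2_Cauchy_diff:
  assumes "L2_Cauchy M f" "L2_Cauchy M g"
  shows "L2_Cauchy M (\<lambda>n x. f n x - g n x)"
  unfolding L2_Cauchy_def
proof (intro conjI allI impI)
  have L: "f n \<in> L2 M" "g n \<in> L2 M" for n using assms by (auto simp: L2_Cauchy_def)
  show "(\<lambda>x. f n x - g n x) \<in> L2 M" for n by (intro L2_diff L)
  fix e :: real assume "e > 0"
  then have e2: "e/2 > 0" by simp
  obtain k1 where k1: "\<And>m n. m \<ge> k1 \<Longrightarrow> n \<ge> k1 \<Longrightarrow> L2_norm M (\<lambda>x. f m x - f n x) < e/2"
    using assms(1) e2 unfolding L2_Cauchy_def by blast
  obtain k2 where k2: "\<And>m n. m \<ge> k2 \<Longrightarrow> n \<ge> k2 \<Longrightarrow> L2_norm M (\<lambda>x. g m x - g n x) < e/2"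
    using assms(2) e2 unfolding L2_Cauchy_def by blast
  have "L2_norm M (\<lambda>x. f m x - g m x - (f n x - g n x)) < e" if "m \<ge> max k1 k2" "n \<ge> max k1 k2" for m n
  proof -
    have "L2_norm M (\<lambda>x. (f m x - f n x) + (g n x - g m x)) \<le> L2_norm M (\<lambda>x. f m x - f n x) + L2_norm M (\<lambda>x. g n x - g m x)"
      by (intro L2_norm_triangle L2_diff L)
    also have "(\<lambda>x. (f m x - f n x) + (g n x - g m x)) = (\<lambda>x. f m x - g m x - (f n x - g n x))" by auto
    finally show ?thesis using k1[of m n] k2[of n m] that by simp
  qed
  then show "\<exists>k. \<forall>m\<ge>k. \<forall>n\<ge>k. L2_norm M (\<lambda>x. f m x - g m x - (f n x - g n x)) < e" by blast
qed

lemma L2_cutoff_tendsto: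
  fixes f :: "real^'n \<Rightarrow> real"
  assumes f: "f \<in> L2 lborel"
  shows "(\<lambda>k. L2_norm lborel (\<lambda>x. f x - inner_cutoff (1 / (real k + 1)) (norm x) * f x)) \<longlonglongrightarrow> 0"
proof -
  have [measurable]: "f \<in> borel_measurable borel" using L2_measurable[OF f] by simp
  define e where "e n = 1 / (real n + 1)" for n
  have e: "0 < e n" for n by (auto simp: e_def)
  have e0: "e \<longlonglongrightarrow> 0" unfolding e_def using LIMSEQ_inverse_real_of_nat by (simp add: inverse_eq_divide add.commute)
  have ev: "\<forall>\<^sub>F n in sequentially. 2 * e n < norm x" if "x \<noteq> 0" for x :: "real^'n"
    using tendsto_mult[OF tendsto_const[of 2] e0] that by (intro order_tendstoD(2)[where y = 0]) auto
  have [measurable]: "(\<lambda>x::real^'n. inner_cutoff (e n) (norm x)) \<in> borel_measurable borel" for n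
    by (intro smooth_borel smooth_inner_cutoff e)
  have "(\<lambda>n. \<integral>x. (f x - inner_cutoff (e n) (norm x) * f x)\<^sup>2 \<partial>lborel) \<longlonglongrightarrow> integral\<^sup>L lborel (\<lambda>x::real^'n. 0)"
  proof (rule integral_dominated_convergence[where w = "\<lambda>x. (f x)\<^sup>2"])
    show "AE x in lborel. (\<lambda>n. (f x - inner_cutoff (e n) (norm x) * f x)\<^sup>2) \<longlonglongrightarrow> 0"
      using AE_lborel_not_zero
    proof eventually_elim
      case (elim x)
      show ?case
        by (rule tendsto_eventually, use ev[OF elim] in eventually_elim)
           (use e in \<open>simp add: inner_cutoff_1\<close>)
    qed
    fix n
    have "\<bar>f x - inner_cutoff (e n) (norm x) * f x\<bar> \<le> \<bar>f x\<bar>" for x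
    proof -
      have "f x - inner_cutoff (e n) (norm x) * f x = (1 - inner_cutoff (e n) (norm x)) * f x"
        by (simp add: algebra_simps)
      then show ?thesis using cutoff_bounds[of "e n" "norm x"] by (simp add: abs_mult mult_left_le_one_le)
    qed
    then show "AE x in lborel. norm ((f x - inner_cutoff (e n) (norm x) * f x)\<^sup>2) \<le> (f x)\<^sup>2"
      by (simp add: abs_le_square_iff)
  qed (use L2_integrable_sq[OF f] in auto)
  then have "(\<lambda>n. sqrt (\<integral>x. (f x - inner_cutoff (e n) (norm x) * f x)\<^sup>2 \<partial>lborel)) \<longlonglongrightarrow> sqrt 0"
    by (intro tendsto_real_sqrt) simp
  then show ?thesis by (simp add: L2_norm_def e_def)
qed

lemma integral_mult_ball_le:
  fixes f h :: "real^'n \<Rightarrow> real"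
  assumes f: "f absolutely_integrable_on cball 0 R" and hm: "h \<in> borel_measurable lebesgue"
    and h: "\<And>x. x \<noteq> 0 \<Longrightarrow> \<bar>h x\<bar> \<le> B * indicator (cball 0 R) x" and B: "B \<ge> 0"
  shows "integrable lebesgue (\<lambda>x. f x * h x)"
    and "\<bar>\<integral>x. f x * h x \<partial>lebesgue\<bar> \<le> B * (LINT x:cball 0 R|lebesgue. \<bar>f x\<bar>)"
proof -
  have i: "integrable lebesgue (\<lambda>x. indicator (cball 0 R) x * f x)" using f by (simp add: set_integrable_def)
  then have i': "integrable lebesgue (\<lambda>x. B * (indicator (cball 0 R) x * \<bar>f x\<bar>))"
    by (intro integrable_mult_right) (auto dest: integrable_abs simp: abs_mult)
  have nz: "AE x in lebesgue. x \<noteq> (0::real^'n)" using AE_lborel_not_zero by (rule AE_completion)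
  have ae: "AE x in lebesgue. \<bar>f x * h x\<bar> \<le> B * (indicator (cball 0 R) x * \<bar>f x\<bar>)"
    using nz
  proof eventually_elim
    case (elim x)
    have "\<bar>f x\<bar> * \<bar>h x\<bar> \<le> \<bar>f x\<bar> * (B * indicator (cball 0 R) x)" by (intro mult_left_mono h elim) auto
    then show ?case by (simp add: abs_mult mult_ac)
  qed
  \<comment> \<open>f is only known to be measurable on the ball. The product is measurable
    everywhere because h vanishes outside it.\<close>
  have "AE x in lebesgue. (indicator (cball 0 R) x * f x) * h x = f x * h x"
    using nz by eventually_elim (use h in \<open>force simp: indicator_def\<close>)
  moreover have "(\<lambda>x. (indicator (cball 0 R) x * f x) * h x) \<in> borel_measurable lebesgue"
    using i hm by measurable
  ultimately have m: "(\<lambda>x. f x * h x) \<in> borel_measurable lebesgue"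
    by (rule borel_measurable_AE[rotated])
  show int: "integrable lebesgue (\<lambda>x. f x * h x)"
    by (rule Bochner_Integration.integrable_bound[OF i' m]) (use ae in eventually_elim, auto)
  have "\<bar>\<integral>x. f x * h x \<partial>lebesgue\<bar> \<le> (\<integral>x. \<bar>f x * h x\<bar> \<partial>lebesgue)" by (rule integral_abs_bound)
  also have "\<dots> \<le> (\<integral>x. B * (indicator (cball 0 R) x * \<bar>f x\<bar>) \<partial>lebesgue)"
    by (rule integral_mono_AE[OF integrable_abs[OF int] i' ae])
  finally have "\<bar>\<integral>x. f x * h x \<partial>lebesgue\<bar> \<le> (\<integral>x. B * (indicator (cball 0 R) x * \<bar>f x\<bar>) \<partial>lebesgue)" .
  then show "\<bar>\<integral>x. f x * h x \<partial>lebesgue\<bar> \<le> B * (LINT x:cball 0 R|lebesgue. \<bar>f x\<bar>)"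
    by (simp add: set_lebesgue_integral_def)
qed

text \<open>Closability: pairing with the fixed test function \<open>w m\<close> is, up to a cutoff near the origin,
  an integration against \<open>w n\<close> of a bounded function.\<close>

lemma wdiv_pairing_tendsto_0:
  fixes w :: "nat \<Rightarrow> real^'n \<Rightarrow> real"
  assumes w: "\<And>n. w n \<in> test_fun \<alpha>" and C: "L2_Cauchy lborel (\<lambda>n. wdiv \<alpha> (w n))"
    and lim: "\<And>R. (\<lambda>n. LINT x:cball 0 R|lebesgue. \<bar>w n x\<bar>) \<longlonglongrightarrow> 0"
    and v: "v \<in> test_fun \<alpha>"
  shows "(\<lambda>n. \<integral>x. wdiv \<alpha> (w n) x * wdiv \<alpha> v x \<partial>lborel) \<longlonglongrightarrow> 0"
proof (rule null_sequence_approx)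
  fix e :: real assume e: "e > 0"
  obtain A where A: "A > 0" "\<And>n. L2_norm lborel (wdiv \<alpha> (w n)) \<le> A" using L2_Cauchy_bounded[OF C] by blast
  have g: "wdiv \<alpha> v \<in> L2 lborel" "\<And>n. wdiv \<alpha> (w n) \<in> L2 lborel" using test_funD(3) v w by blast+
  \<comment> \<open>A bounds all the norms of the weighted divergences of w n, so an L^2 error below
    e / A in the other factor changes the pairing by at most e.\<close>
  obtain k where k: "L2_norm lborel (\<lambda>x. wdiv \<alpha> v x - inner_cutoff (1 / (real k + 1)) (norm x) * wdiv \<alpha> v x) < e / A"
    using order_tendstoD(2)[OF L2_cutoff_tendsto[OF g(1)], of "e / A"] e A
    by (auto simp: eventually_sequentially)
  define d where "d = 1 / (real k + 1)"
  have d: "d > 0" by (simp add: d_def)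
  define \<psi> where "\<psi> x = inner_cutoff d (norm x) * wdiv \<alpha> v x" for x
  have s: "smooth \<psi>" unfolding \<psi>_def[abs_def] by (rule smooth_cutoff_wdiv[OF d test_funD(1)[OF v]])
  obtain R0 where R0: "R0 > 0" "\<And>x. norm x > R0 \<Longrightarrow> wdiv \<alpha> v x = 0" "\<And>x. norm x \<ge> R0 \<Longrightarrow> v x = 0"
    by (rule test_fun_wdiv_ball[OF v]) (rule that)
  have c: "compactly_supported \<psi>" by (rule compactly_supportedI[of R0]) (simp add: \<psi>_def R0)
  have z: "\<psi> x = 0" if "norm x < d" for x using that d by (simp add: \<psi>_def inner_cutoff_0)
  obtain B R where B: "B > 0" "R > 0" "\<And>x. x \<noteq> 0 \<Longrightarrow> \<bar>wdiv \<alpha> \<psi> x\<bar> \<le> B * indicator (cball 0 R) x"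
    using wdiv_bounded[OF s c d z] by blast
  have \<psi>L: "\<psi> \<in> L2 lborel"
  proof (rule L2_dominated[OF g(1)])
    show "\<psi> \<in> borel_measurable lborel" using smooth_borel[OF s] by simp
    show "AE x in lborel. \<bar>\<psi> x\<bar> \<le> \<bar>wdiv \<alpha> v x\<bar>"
      using cutoff_bounds by (intro AE_I2) (auto simp: \<psi>_def abs_mult mult_left_le_one_le)
  qed
  define b where "b n = B * (LINT x:cball 0 R|lebesgue. \<bar>w n x\<bar>)" for n
  have "b \<longlonglongrightarrow> B * 0" unfolding b_def by (intro tendsto_intros lim)
  then have b0: "b \<longlonglongrightarrow> 0" by simp
  have "\<bar>\<integral>x. wdiv \<alpha> (w n) x * wdiv \<alpha> v x \<partial>lborel\<bar> \<le> b n + e" for n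
  proof -
    have bw: "w n \<in> borel_measurable borel" "wdiv \<alpha> \<psi> \<in> borel_measurable borel"
      using smooth_borel[OF test_funD(1)[OF w]] wdiv_borel[OF s] by auto
    have "(\<integral>x. wdiv \<alpha> (w n) x * wdiv \<alpha> v x \<partial>lborel) =
        (\<integral>x. wdiv \<alpha> (w n) x * \<psi> x + wdiv \<alpha> (w n) x * (wdiv \<alpha> v x - \<psi> x) \<partial>lborel)"
      by (intro Bochner_Integration.integral_cong) (auto simp: algebra_simps)
    also have "\<dots> = (\<integral>x. wdiv \<alpha> (w n) x * \<psi> x \<partial>lborel) + (\<integral>x. wdiv \<alpha> (w n) x * (wdiv \<alpha> v x - \<psi> x) \<partial>lborel)"
      by (intro Bochner_Integration.integral_add L2_mult_integrable L2_diff g \<psi>L)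
    also have "(\<integral>x. wdiv \<alpha> (w n) x * \<psi> x \<partial>lborel) = (\<integral>x. w n x * wdiv \<alpha> \<psi> x \<partial>lborel)"
      by (rule wdiv_by_parts_away(3)[OF test_funD(1,2)[OF w] s d z])
    also have "\<dots> = (\<integral>x. w n x * wdiv \<alpha> \<psi> x \<partial>lebesgue)"
      using bw by (intro integral_completion[symmetric]) simp
    finally have eq: "(\<integral>x. wdiv \<alpha> (w n) x * wdiv \<alpha> v x \<partial>lborel) =
      (\<integral>x. w n x * wdiv \<alpha> \<psi> x \<partial>lebesgue) + (\<integral>x. wdiv \<alpha> (w n) x * (wdiv \<alpha> v x - \<psi> x) \<partial>lborel)" .
    have "w n absolutely_integrable_on cball 0 R"
    proof (subst set_integrable_lborel_iff_lebesgue)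
      show "integrable lborel (\<lambda>x. indicator (cball 0 R) x * w n x)"
        by (rule Bochner_Integration.integrable_bound[OF integrable_smooth[OF test_funD(1,2)[OF w, of n]]])
           (use bw in \<open>auto simp: indicator_def\<close>)
    qed (use bw in auto)
    moreover have "wdiv \<alpha> \<psi> \<in> borel_measurable lebesgue"
      using bw(2) by (intro measurable_completion) simp
    ultimately have 1: "\<bar>\<integral>x. w n x * wdiv \<alpha> \<psi> x \<partial>lebesgue\<bar> \<le> b n"
      unfolding b_def by (rule integral_mult_ball_le(2)[OF _ _ B(3) less_imp_le[OF B(1)]])
    have "\<bar>\<integral>x. wdiv \<alpha> (w n) x * (wdiv \<alpha> v x - \<psi> x) \<partial>lborel\<bar> \<le>
        L2_norm lborel (wdiv \<alpha> (w n)) * L2_norm lborel (\<lambda>x. wdiv \<alpha> v x - \<psi> x)"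
      by (intro L2_Cauchy_Schwarz L2_diff g \<psi>L)
    also have "\<dots> \<le> A * (e / A)"
      using A k by (intro mult_mono L2_norm_nonneg) (auto simp: \<psi>_def d_def)
    also have "\<dots> = e" using A by simp
    finally show ?thesis using 1 eq by linarith
  qed
  then show "\<exists>b. b \<longlonglongrightarrow> 0 \<and> (\<forall>n. \<bar>\<integral>x. wdiv \<alpha> (w n) x * wdiv \<alpha> v x \<partial>lborel\<bar> \<le> b n + e)"
    using b0 by blast
qed

text \<open>Write |g_n|^2 as <g_n, g_n - g_k> + <g_n, g_k>. The Cauchy property makes the first term
  small for a suitable fixed k, and \<open>wdiv_pairing_tendsto_0\<close> sends the second to 0 for
  that k.\<close>

lemma wdiv_closable:
  fixes w :: "nat \<Rightarrow> real^'n \<Rightarrow> real"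
  assumes w: "\<And>n. w n \<in> test_fun \<alpha>" and C: "L2_Cauchy lborel (\<lambda>n. wdiv \<alpha> (w n))"
    and lim: "\<And>R. (\<lambda>n. LINT x:cball 0 R|lebesgue. \<bar>w n x\<bar>) \<longlonglongrightarrow> 0"
  shows "(\<lambda>n. L2_norm lborel (wdiv \<alpha> (w n))) \<longlonglongrightarrow> 0"
proof -
  let ?g = "\<lambda>n. wdiv \<alpha> (w n)"
  obtain A where A: "A > 0" "\<And>n. L2_norm lborel (?g n) \<le> A" using L2_Cauchy_bounded[OF C] by blast
  have g: "?g n \<in> L2 lborel" for n using test_funD(3) w by blast
  have "(\<lambda>n. (L2_norm lborel (?g n))\<^sup>2) \<longlonglongrightarrow> 0"
  proof (rule LIMSEQ_I)
    fix e :: real assume e: "e > 0"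
    then have "e / (2 * A) > 0" using A by simp
    then obtain k where k: "\<And>m n. m \<ge> k \<Longrightarrow> n \<ge> k \<Longrightarrow> L2_norm lborel (\<lambda>x. ?g m x - ?g n x) < e / (2 * A)"
      using C unfolding L2_Cauchy_def by blast
    have "(\<lambda>n. \<integral>x. ?g n x * ?g k x \<partial>lborel) \<longlonglongrightarrow> 0"
      by (rule wdiv_pairing_tendsto_0[OF w C lim w])
    then obtain j where j: "\<And>n. n \<ge> j \<Longrightarrow> norm ((\<integral>x. ?g n x * ?g k x \<partial>lborel) - 0) < e / 2"
      using LIMSEQ_D[where r = "e/2"] e half_gt_zero by blast
    have "norm ((L2_norm lborel (?g n))\<^sup>2 - 0) < e" if n: "n \<ge> max j k" for n
    proof -
      have "(L2_norm lborel (?g n))\<^sup>2 = (\<integral>x. ?g n x * (?g n x - ?g k x) + ?g n x * ?g k x \<partial>lborel)"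
        unfolding L2_norm_sq by (intro Bochner_Integration.integral_cong) (auto simp: algebra_simps power2_eq_square)
      also have "\<dots> = (\<integral>x. ?g n x * (?g n x - ?g k x) \<partial>lborel) + (\<integral>x. ?g n x * ?g k x \<partial>lborel)"
        by (intro Bochner_Integration.integral_add L2_mult_integrable L2_diff g)
      finally have 1: "(L2_norm lborel (?g n))\<^sup>2 =
         (\<integral>x. ?g n x * (?g n x - ?g k x) \<partial>lborel) + (\<integral>x. ?g n x * ?g k x \<partial>lborel)" .
      have "\<bar>\<integral>x. ?g n x * (?g n x - ?g k x) \<partial>lborel\<bar> \<le> L2_norm lborel (?g n) * L2_norm lborel (\<lambda>x. ?g n x - ?g k x)"
        by (intro L2_Cauchy_Schwarz L2_diff g)
      also have "\<dots> \<le> A * (e / (2 * A))"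
        using A k[of n k] n by (intro mult_mono L2_norm_nonneg) auto
      also have "\<dots> = e / 2" using A by simp
      finally show ?thesis using 1 j[of n] n by simp
    qed
    then show "\<exists>no. \<forall>n\<ge>no. norm ((L2_norm lborel (?g n))\<^sup>2 - 0) < e" by blast
  qed
  then have "(\<lambda>n. sqrt ((L2_norm lborel (?g n))\<^sup>2)) \<longlonglongrightarrow> sqrt 0" by (rule tendsto_real_sqrt)
  then show ?thesis by (simp add: L2_norm_nonneg)
qed

lemma test_fun_absolutely_integrable:
  fixes u :: "real^'n \<Rightarrow> real"
  assumes "u \<in> test_fun \<alpha>"
  shows "u absolutely_integrable_on cball 0 R"
proof (subst set_integrable_lborel_iff_lebesgue)
  have [measurable]: "u \<in> borel_measurable borel" by (rule smooth_borel[OF test_funD(1)[OF assms]])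
  then show "u \<in> borel_measurable borel" .
  show "integrable lborel (\<lambda>x. indicator (cball 0 R) x * u x)"
    by (rule Bochner_Integration.integrable_bound[OF integrable_smooth[OF test_funD(1,2)[OF assms]]])
       (auto simp: indicator_def)
qed auto

text \<open>Closability applied to the differences, which are test functions tending to 0 in L^1 on
  balls. It is the reason why the inner product does not depend on the representing
  sequences.\<close>

lemma represents_unique:
  fixes w w' :: "nat \<Rightarrow> real^'n \<Rightarrow> real"
  assumes "represents \<alpha> w u" "represents \<alpha> w' u"
  shows "(\<lambda>n. L2_norm lborel (\<lambda>x. wdiv \<alpha> (w n) x - wdiv \<alpha> (w' n) x)) \<longlonglongrightarrow> 0"
proof -
  note 1 = representsD[OF assms(1)] and 2 = representsD[OF assms(2)]
  let ?v = "\<lambda>n x. w n x - w' n x"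
  have ae: "AE x in lborel. wdiv \<alpha> (w n) x - wdiv \<alpha> (w' n) x = wdiv \<alpha> (?v n) x" for n
    using AE_lborel_not_zero
    by eventually_elim (simp add: wdiv_diff[OF test_funD(1)[OF 1(1)] test_funD(1)[OF 2(1)]])
  have t: "?v n \<in> test_fun \<alpha>" for n by (rule test_fun_diff[OF 1(1) 2(1)])
  have m: "wdiv \<alpha> (?v n) \<in> borel_measurable lborel" for n using wdiv_borel[OF test_funD(1)[OF t]] by simp
  have L: "wdiv \<alpha> (w n) \<in> L2 lborel" "wdiv \<alpha> (w' n) \<in> L2 lborel" for n using 1(1) 2(1) test_funD(3) by blast+
  have eq: "L2_norm lborel (\<lambda>x. (wdiv \<alpha> (w m) x - wdiv \<alpha> (w' m) x) - (wdiv \<alpha> (w n) x - wdiv \<alpha> (w' n) x)) =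
     L2_norm lborel (\<lambda>x. wdiv \<alpha> (?v m) x - wdiv \<alpha> (?v n) x)" for m n
  proof (rule L2_cong_AE(2)[OF L2_diff[OF L2_diff[OF L] L2_diff[OF L]]])
    show "(\<lambda>x. wdiv \<alpha> (?v m) x - wdiv \<alpha> (?v n) x) \<in> borel_measurable lborel"
      using m[of m] m[of n] by simp
    show "AE x in lborel. (wdiv \<alpha> (w m) x - wdiv \<alpha> (w' m) x) - (wdiv \<alpha> (w n) x - wdiv \<alpha> (w' n) x) =
        wdiv \<alpha> (?v m) x - wdiv \<alpha> (?v n) x"
      using ae[of m] ae[of n] by eventually_elim simp
  qed
  have "L2_Cauchy lborel (\<lambda>n x. wdiv \<alpha> (w n) x - wdiv \<alpha> (w' n) x)"
    by (rule L2_Cauchy_diff[OF 1(2) 2(2)])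
  then have C: "L2_Cauchy lborel (\<lambda>n. wdiv \<alpha> (?v n))"
    using test_funD(3)[OF t] by (simp add: L2_Cauchy_def eq)
  have "(\<lambda>n. LINT x:cball 0 R|lebesgue. \<bar>?v n x\<bar>) \<longlonglongrightarrow> 0" for R
  proof (rule tendsto_sandwich[OF _ _ tendsto_const])
    have "(\<lambda>n. (LINT x:cball 0 R|lebesgue. \<bar>w n x - u x\<bar>) + (LINT x:cball 0 R|lebesgue. \<bar>w' n x - u x\<bar>)) \<longlonglongrightarrow> 0 + 0"
      by (intro tendsto_add 1 2)
    then show "(\<lambda>n. (LINT x:cball 0 R|lebesgue. \<bar>w n x - u x\<bar>) + (LINT x:cball 0 R|lebesgue. \<bar>w' n x - u x\<bar>)) \<longlonglongrightarrow> 0" by simp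
    show "\<forall>\<^sub>F n in sequentially. 0 \<le> (LINT x:cball 0 R|lebesgue. \<bar>?v n x\<bar>)"
      by (simp add: set_lebesgue_integral_def)
    have "(LINT x:cball 0 R|lebesgue. \<bar>?v n x\<bar>) \<le>
      (LINT x:cball 0 R|lebesgue. \<bar>w n x - u x\<bar>) + (LINT x:cball 0 R|lebesgue. \<bar>w' n x - u x\<bar>)" for n
    proof -
      have i: "set_integrable lebesgue (cball 0 R) (\<lambda>x. \<bar>w n x - u x\<bar>)" "set_integrable lebesgue (cball 0 R) (\<lambda>x. \<bar>w' n x - u x\<bar>)"
        "set_integrable lebesgue (cball 0 R) (\<lambda>x. \<bar>?v n x\<bar>)"
        by (intro set_integrable_abs set_integral_diff(1) test_fun_absolutely_integrable[OF 1(1)]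
          test_fun_absolutely_integrable[OF 2(1)] 1(3))+
      have "(LINT x:cball 0 R|lebesgue. \<bar>?v n x\<bar>) \<le> (LINT x:cball 0 R|lebesgue. \<bar>w n x - u x\<bar> + \<bar>w' n x - u x\<bar>)"
        by (intro set_integral_mono i set_integral_add(1)) auto
      also have "\<dots> = (LINT x:cball 0 R|lebesgue. \<bar>w n x - u x\<bar>) + (LINT x:cball 0 R|lebesgue. \<bar>w' n x - u x\<bar>)"
        by (intro set_integral_add(2) i)
      finally show ?thesis .
    qed
    then show "\<forall>\<^sub>F n in sequentially. (LINT x:cball 0 R|lebesgue. \<bar>?v n x\<bar>) \<le>
      (LINT x:cball 0 R|lebesgue. \<bar>w n x - u x\<bar>) + (LINT x:cball 0 R|lebesgue. \<bar>w' n x - u x\<bar>)" by simp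
  qed
  from wdiv_closable[OF t C this] have "(\<lambda>n. L2_norm lborel (wdiv \<alpha> (?v n))) \<longlonglongrightarrow> 0" .
  moreover have "L2_norm lborel (wdiv \<alpha> (?v n)) = L2_norm lborel (\<lambda>x. wdiv \<alpha> (w n) x - wdiv \<alpha> (w' n) x)" for n
    using L2_cong_AE(2)[OF L2_diff[OF L] m ae] by simp
  ultimately show ?thesis by simp
qed

lemma L2_inner_limit_cong:
  assumes f: "L2_Cauchy M f" and f': "L2_Cauchy M f'" and g: "L2_Cauchy M g"
    and "(\<lambda>n. L2_norm M (\<lambda>x. f n x - f' n x)) \<longlonglongrightarrow> 0"
  shows "(\<lambda>n. (\<integral>x. f n x * g n x \<partial>M) - (\<integral>x. f' n x * g n x \<partial>M)) \<longlonglongrightarrow> 0"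
proof -
  obtain B where B: "B > 0" "\<And>n. L2_norm M (g n) \<le> B" using L2_Cauchy_bounded[OF g] by blast
  have L: "f n \<in> L2 M" "f' n \<in> L2 M" "g n \<in> L2 M" for n using f f' g by (auto simp: L2_Cauchy_def)
  have "norm ((\<integral>x. f n x * g n x \<partial>M) - (\<integral>x. f' n x * g n x \<partial>M)) \<le> L2_norm M (\<lambda>x. f n x - f' n x) * B" for n
  proof -
    have "(\<integral>x. f n x * g n x \<partial>M) - (\<integral>x. f' n x * g n x \<partial>M) = (\<integral>x. (f n x - f' n x) * g n x \<partial>M)"
      unfolding left_diff_distrib by (intro Bochner_Integration.integral_diff[symmetric] L2_mult_integrable L)
    also have "norm \<dots> \<le> L2_norm M (\<lambda>x. f n x - f' n x) * L2_norm M (g n)"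
      unfolding real_norm_def by (intro L2_Cauchy_Schwarz L2_diff L)
    also have "\<dots> \<le> L2_norm M (\<lambda>x. f n x - f' n x) * B"
      using B by (intro mult_left_mono L2_norm_nonneg) auto
    finally show ?thesis .
  qed
  then have "\<forall>\<^sub>F n in sequentially. norm ((\<integral>x. f n x * g n x \<partial>M) - (\<integral>x. f' n x * g n x \<partial>M)) \<le> L2_norm M (\<lambda>x. f n x - f' n x) * B"
    by simp
  moreover have "(\<lambda>n. L2_norm M (\<lambda>x. f n x - f' n x) * B) \<longlonglongrightarrow> 0"
    using tendsto_mult[OF assms(4) tendsto_const[of B]] by simp
  ultimately show ?thesis by (rule Lim_null_comparison)
qed

text \<open>Shows that the definite description in \<open>D22_inner\<close> denotes: the limit
  exists by the Cauchy property, and it is unchanged when the two representing sequences are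
  replaced one after the other.\<close>

lemma D22_inner_LIMSEQ:
  fixes w z :: "nat \<Rightarrow> real^'n \<Rightarrow> real"
  assumes wu: "represents \<alpha> w u" and zv: "represents \<alpha> z v"
  shows "(\<lambda>n. \<integral>x. wdiv \<alpha> (w n) x * wdiv \<alpha> (z n) x \<partial>lborel) \<longlonglongrightarrow> D22_inner \<alpha> u v"
proof -
  let ?I = "\<lambda>w z n. \<integral>x. wdiv \<alpha> (w n) x * wdiv \<alpha> (z n) x \<partial>lborel"
  have eq: "test_inner \<alpha> (w n) (z n) = ?I w z n" if "represents \<alpha> w u" "represents \<alpha> z v" for w z n
    by (rule test_inner_eq[OF representsD(1)[OF that(1)] representsD(1)[OF that(2)]])
  obtain c where c: "?I w z \<longlonglongrightarrow> c"
    using L2_inner_Cauchy_convergent[OF representsD(2)[OF wu] representsD(2)[OF zv]] by (auto simp: convergent_def)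
  have lim: "?I w' z' \<longlonglongrightarrow> c" if r: "represents \<alpha> w' u" "represents \<alpha> z' v" for w' z'
  proof -
    have "(\<lambda>n. ?I w' z n - ?I w z n) \<longlonglongrightarrow> 0"
      by (rule L2_inner_limit_cong[OF representsD(2)[OF r(1)] representsD(2)[OF wu] representsD(2)[OF zv]
          represents_unique[OF r(1) wu]])
    from tendsto_add[OF this c] have 1: "?I w' z \<longlonglongrightarrow> c" by simp
    have "(\<lambda>n. ?I z' w' n - ?I z w' n) \<longlonglongrightarrow> 0"
      by (rule L2_inner_limit_cong[OF representsD(2)[OF r(2)] representsD(2)[OF zv] representsD(2)[OF r(1)]
          represents_unique[OF r(2) zv]])
    then have "(\<lambda>n. ?I w' z' n - ?I w' z n) \<longlonglongrightarrow> 0" by (simp add: mult.commute)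
    from tendsto_add[OF this 1] show ?thesis by simp
  qed
  have "D22_inner \<alpha> u v = c"
    unfolding D22_inner_def
  proof (rule the_equality)
    show "\<forall>w z. represents \<alpha> w u \<longrightarrow> represents \<alpha> z v \<longrightarrow> (\<lambda>n. test_inner \<alpha> (w n) (z n)) \<longlonglongrightarrow> c"
      using lim eq by simp
    fix c' assume "\<forall>w z. represents \<alpha> w u \<longrightarrow> represents \<alpha> z v \<longrightarrow> (\<lambda>n. test_inner \<alpha> (w n) (z n)) \<longlonglongrightarrow> c'"
    then have "?I w z \<longlonglongrightarrow> c'" using wu zv by (simp flip: eq[OF wu zv])
    then show "c' = c" using c LIMSEQ_unique by blast
  qed
  then show ?thesis using c by simp
qed

lemma represents_const:
  fixes \<phi> :: "real^'n \<Rightarrow> real"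
  assumes "\<phi> \<in> test_fun \<alpha>"
  shows "represents \<alpha> (\<lambda>_. \<phi>) \<phi>"
  unfolding represents_def
proof (intro conjI allI impI)
  show "\<exists>M. \<forall>m\<ge>M. \<forall>n\<ge>M. test_norm \<alpha> (\<lambda>x. \<phi> x - \<phi> x) < e" if "e > 0" for e
    using that test_fun_diff(2)[OF assms assms] by (simp add: L2_norm_def)
  fix K :: "(real^'n) set" assume K: "compact K"
  obtain R where "K \<subseteq> cball 0 R" using compact_imp_bounded[OF K] by (auto simp: bounded_iff subset_iff)
  then show "\<phi> absolutely_integrable_on K"
    using set_integrable_subset[OF test_fun_absolutely_integrable[OF assms, of R]] K by (auto simp: borel_compact)
qed (simp_all add: assms)

lemma D22_inner_test_fun_LIMSEQ:
  fixes w :: "nat \<Rightarrow> real^'n \<Rightarrow> real"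
  assumes "represents \<alpha> w u" "\<phi> \<in> test_fun \<alpha>"
  shows "(\<lambda>n. \<integral>x. wdiv \<alpha> (w n) x * wdiv \<alpha> \<phi> x \<partial>lborel) \<longlonglongrightarrow> D22_inner \<alpha> u \<phi>"
  by (rule D22_inner_LIMSEQ[OF assms(1) represents_const[OF assms(2)]])

subsection \<open>Fundamental lemma for radial test functions\<close>

text \<open>The support stays away from 0, so composition with the norm is smooth and negative
  powers of r are harmless factors.\<close>

definition bump :: "(real \<Rightarrow> real) \<Rightarrow> bool" where
  "bump \<Phi> \<longleftrightarrow> smooth1 UNIV \<Phi> \<and> (\<exists>a b. 0 < a \<and> a < b \<and> (\<forall>r. r \<notin> {a..b} \<longrightarrow> \<Phi> r = 0))"

lemma bumpE:
  assumes "bump \<Phi>"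
  obtains a b where "0 < a" "a < b" "\<And>r. r \<notin> {a..b} \<Longrightarrow> \<Phi> r = 0" "smooth1 UNIV \<Phi>"
  using assms unfolding bump_def by blast

lemma bump_combine:
  assumes "bump \<Phi>" "bump \<Psi>"
  shows "bump (\<lambda>r. c * \<Phi> r + \<Psi> r)"
proof -
  obtain a b where 1: "0 < a" "a < b" "\<And>r. r \<notin> {a..b} \<Longrightarrow> \<Phi> r = 0" "smooth1 UNIV \<Phi>"
    by (rule bumpE[OF assms(1)]) (rule that)
  obtain a' b' where 2: "0 < a'" "a' < b'" "\<And>r. r \<notin> {a'..b'} \<Longrightarrow> \<Psi> r = 0" "smooth1 UNIV \<Psi>"
    by (rule bumpE[OF assms(2)]) (rule that)
  have "smooth1 UNIV (\<lambda>r. c * \<Phi> r + \<Psi> r)" by (intro smooth1_add smooth1_cmult 1 2) auto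
  moreover have "0 < min a a'" "min a a' < max b b'" using 1 2 by auto
  moreover have "c * \<Phi> r + \<Psi> r = 0" if "r \<notin> {min a a'..max b b'}" for r
  proof -
    have "r \<notin> {a..b}" "r \<notin> {a'..b'}" using that by auto
    then show ?thesis using 1(3) 2(3) by simp
  qed
  ultimately show ?thesis unfolding bump_def by blast
qed

lemma smooth1_glue_0:
  assumes "smooth1 {0<..} f" "0 < a" "\<And>r. r < a \<Longrightarrow> f r = 0"
  shows "smooth1 UNIV f"
proof -
  have "smooth1 {..<a} f"
    by (rule smooth1_cong[OF _ smooth1_const[of _ 0]]) (use assms in auto)
  from smooth1_Un[OF assms(1) this] have "smooth1 ({0<..} \<union> {..<a}) f" .
  moreover have "{0<..} \<union> {..<a} = UNIV" using assms(2) by auto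
  ultimately show ?thesis by simp
qed

lemma continuous_on_glue_0:
  fixes f :: "real \<Rightarrow> real"
  assumes "continuous_on {0<..} f" "0 < a" "\<And>r. r < a \<Longrightarrow> f r = 0"
  shows "continuous_on UNIV f"
proof -
  have "continuous_on {..<a} f"
    using continuous_on_const[of _ 0] by (rule continuous_on_cong[THEN iffD1, rotated 2]) (use assms in auto)
  then have "continuous_on ({0<..} \<union> {..<a}) f" by (intro continuous_on_open_Un assms) auto
  moreover have "{0<..} \<union> {..<a} = UNIV" using assms(2) by auto
  ultimately show ?thesis by simp
qed

lemma smooth_bump_norm:
  assumes "bump \<Phi>" shows "smooth (\<lambda>x::real^'n. \<Phi> (norm x))"
proof -
  obtain a b where 1: "0 < a" "a < b" "\<And>r. r \<notin> {a..b} \<Longrightarrow> \<Phi> r = 0" "smooth1 UNIV \<Phi>"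
    by (rule bumpE[OF assms(1)]) (rule that)
  show ?thesis
    by (rule smooth_radial[OF smooth1_mono[OF 1(4)], of "a/2" 0]) (use 1 in auto)
qed

lemma integrable_mult_bump:
  fixes k :: "real \<Rightarrow> real"
  assumes k: "continuous_on {0<..} k" and "bump \<Phi>"
  shows "continuous_on UNIV (\<lambda>r. k r * \<Phi> r)" "integrable lborel (\<lambda>x::real^'n. k (norm x) * \<Phi> (norm x))"
proof -
  obtain a b where 1: "0 < a" "a < b" "\<And>r. r \<notin> {a..b} \<Longrightarrow> \<Phi> r = 0" "smooth1 UNIV \<Phi>"
    by (rule bumpE[OF assms(2)]) (rule that)
  show c: "continuous_on UNIV (\<lambda>r. k r * \<Phi> r)"
    by (rule continuous_on_glue_0[of _ a])
       (use 1 in \<open>auto intro!: continuous_on_mult k continuous_on_subset[OF smooth1_continuous_on[OF 1(4)]]\<close>)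
  show "integrable lborel (\<lambda>x::real^'n. k (norm x) * \<Phi> (norm x))"
    by (rule integrable_continuous_ball[of _ "b + 1"])
       (use 1 in \<open>auto intro!: continuous_on_compose2[OF c] continuous_on_norm_id\<close>)
qed

text \<open>The antiderivative is normalised to vanish to the right, so its constant value on the
  left is minus the total integral; mean zero therefore means compact support.\<close>

lemma compact_antiderivative:
  assumes h: "smooth1 UNIV h" "\<And>r. r \<notin> {a..b} \<Longrightarrow> h r = 0" and ab: "a \<le> b"
  obtains H where "smooth1 UNIV H" "\<And>r. (H has_field_derivative h r) (at r)"
    "\<And>r. r \<ge> b \<Longrightarrow> H r = 0" "\<And>r. r \<le> a \<Longrightarrow> H r = H a" "H a = - (\<integral>r. h r \<partial>lborel)"
proof -
  have cont: "isCont h x" for x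
    using smooth1_continuous_on[OF h(1)] by (simp add: continuous_on_eq_continuous_at)
  have "\<exists>F. \<forall>x::real. -\<infinity> < ereal x \<longrightarrow> ereal x < \<infinity> \<longrightarrow> (F has_vector_derivative h x) (at x)"
    by (rule einterval_antiderivative) (auto intro: cont)
  then obtain F where F: "\<And>x. (F has_vector_derivative h x) (at x)" by auto
  define H where "H r = F r - F b" for r
  have d: "(H has_field_derivative h r) (at r)" for r
    unfolding H_def using F[of r]
    by (auto intro!: derivative_eq_intros simp: has_real_derivative_iff_has_vector_derivative)
  have b: "H r = 0" if "r \<ge> b" for r
  proof (cases "r = b")
    case False
    then have "b < r" using that by simp
    then obtain z where "z > b" "H r - H b = (r - b) * h z"
      using MVT2[of b r H h] d by blast
    then show ?thesis using h(2)[of z] by (simp add: H_def)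
  qed (simp add: H_def)
  have a: "H r = H a" if "r \<le> a" for r
  proof (cases "r = a")
    case False
    then have "r < a" using that by simp
    then obtain z where "z < a" "H a - H r = (a - r) * h z"
      using MVT2[of r a H h] d by blast
    then show ?thesis using h(2)[of z] by simp
  qed simp
  have "(\<integral>x. h x * indicator {a..b} x \<partial>lborel) = H b - H a"
    by (rule integral_FTC_Icc_real[OF ab]) (auto intro: d cont)
  moreover have "(\<lambda>x. h x * indicator {a..b} x) = h" using h(2) by (auto simp: fun_eq_iff indicator_def)
  ultimately have "H a = - (\<integral>r. h r \<partial>lborel)" using b[of b] by simp
  then show ?thesis using that[of H] smooth1_antideriv[OF open_UNIV h(1)] d a b by blast
qed

text \<open>For radial F this is the flux of the radial system with source F, multiplied by
  \<open>sphere_area\<close>.\<close>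

definition ball_integral :: "(real^'n \<Rightarrow> real) \<Rightarrow> real \<Rightarrow> real" where
  "ball_integral F s = (\<integral>x. indicator (cball 0 s) x * F x \<partial>lebesgue)"

lemma AE_norm_neq: "AE x in lebesgue. norm (x::real^'n) \<noteq> s"
proof -
  have "sphere (0::real^'n) s \<in> null_sets lebesgue"
    using negligible_sphere[of "0::real^'n" s] by (simp add: negligible_iff_null_sets)
  then show ?thesis by (rule AE_I') auto
qed

text \<open>Spheres are null sets, so the indicators of the balls converge almost
  everywhere.\<close>

lemma ball_integral_isCont:
  fixes F :: "real^'n \<Rightarrow> real"
  assumes F: "\<And>R. F absolutely_integrable_on cball 0 R"
  shows "isCont (ball_integral F) s"
  unfolding continuous_at_sequentially
proof (intro allI impI)
  fix X :: "nat \<Rightarrow> real" assume X: "X \<longlonglongrightarrow> s"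
  then obtain M where M: "\<And>n. \<bar>X n\<bar> \<le> M"
    using Bseq_def convergent_imp_Bseq convergentI by (metis real_norm_def)
  have i: "integrable lebesgue (\<lambda>x. indicator (cball 0 R) x * F x)" for R using F by (simp add: set_integrable_def)
  have "(\<lambda>n. ball_integral F (X n)) \<longlonglongrightarrow> ball_integral F s"
    unfolding ball_integral_def
  proof (rule integral_dominated_convergence[where w = "\<lambda>x. \<bar>indicator (cball 0 M) x * F x\<bar>"])
    show "integrable lebesgue (\<lambda>x. \<bar>indicator (cball 0 M) x * F x\<bar>)" using i by (rule integrable_abs)
    show "AE x in lebesgue. (\<lambda>n. indicator (cball 0 (X n)) x * F x) \<longlonglongrightarrow> indicator (cball 0 s) x * F x"
      using AE_norm_neq[of s]
    proof eventually_elim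
      case (elim x)
      have "\<forall>\<^sub>F n in sequentially. indicator (cball 0 (X n)) x = (indicator (cball 0 s) x :: real)"
      proof (cases "norm x < s")
        case True
        from order_tendstoD(1)[OF X this] show ?thesis
          by eventually_elim (use True in auto)
      next
        case False
        then have "s < norm x" using elim by simp
        from order_tendstoD(2)[OF X this] show ?thesis
          by eventually_elim (use False elim in auto)
      qed
      then show ?case by (intro tendsto_eventually) (auto elim!: eventually_mono)
    qed
    fix n
    show "AE x in lebesgue. norm (indicator (cball 0 (X n)) x * F x) \<le> \<bar>indicator (cball 0 M) x * F x\<bar>"
      using M[of n] by (intro AE_I2) (auto simp: indicator_def)
  qed (use i in auto)
  then show "(ball_integral F \<circ> X) \<longlonglongrightarrow> ball_integral F s" by (simp add: o_def)
qed

text \<open>Layer-cake formula: Fubini for \<open>\<phi> (norm x) = - \<integral> \<psi>\<close> over \<open>norm x \<le> s \<le> b\<close>.\<close>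

lemma integral_radial_layers:
  fixes F :: "real^'n \<Rightarrow> real"
  assumes F: "\<And>R. F absolutely_integrable_on cball 0 R" and b: "0 \<le> b"
    and \<phi>: "\<And>r. (\<phi> has_field_derivative \<psi> r) (at r)" "\<And>r. r \<ge> b \<Longrightarrow> \<phi> r = 0"
    and \<psi>: "continuous_on UNIV \<psi>"
  shows "(\<integral>x. F x * \<phi> (norm x) \<partial>lebesgue) = - (\<integral>s. indicator {0..b} s * (\<psi> s * ball_integral F s) \<partial>lborel)"
proof -
  have i: "integrable lebesgue (\<lambda>x. indicator (cball 0 R) x * F x)" for R using F by (simp add: set_integrable_def)
  \<comment> \<open>F is only Lebesgue measurable, while Fubini is applied to the product of two
    copies of \<open>lborel\<close>; a Borel representative on the ball of radius b is used
    instead.\<close>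
  obtain F' where F'[measurable]: "F' \<in> borel_measurable lborel"
    and ae: "AE x in lborel. indicator (cball 0 b) x * F x = F' x"
    using completion_ex_borel_measurable_real[OF borel_measurable_integrable[OF i]] by blast
  have ae': "AE x in lebesgue. indicator (cball 0 b) x * F x = F' x" using ae by (rule AE_completion)
  have F'l: "F' \<in> borel_measurable lebesgue" using F' by (rule measurable_completion)
  have intF': "integrable lborel F'"
  proof -
    have "integrable lebesgue F'" using i[of b] integrable_cong_AE[OF _ F'l ae'] by (simp add: borel_measurable_integrable)
    then show ?thesis using integrable_completion[of F' lborel] F' by simp
  qed
  have [measurable]: "\<psi> \<in> borel_measurable borel" by (rule borel_measurable_continuous_onI[OF \<psi>])
  have "continuous_on UNIV \<phi>" by (meson \<phi>(1) DERIV_isCont continuous_at_imp_continuous_on)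
  then have [measurable]: "\<phi> \<in> borel_measurable borel" by (rule borel_measurable_continuous_onI)
  have eqL: "(\<integral>x. F x * \<phi> (norm x) \<partial>lebesgue) = (\<integral>x. F' x * \<phi> (norm x) \<partial>lborel)"
  proof -
    have m: "(\<lambda>x. F' x * \<phi> (norm x)) \<in> borel_measurable lborel" by measurable
    have "AE x in lebesgue. F' x * \<phi> (norm x) = F x * \<phi> (norm x)"
      using ae'
    proof eventually_elim
      case (elim x)
      then show ?case using \<phi>(2)[of "norm x"] by (cases "norm x \<le> b") auto
    qed
    then have "(\<integral>x. F' x * \<phi> (norm x) \<partial>lebesgue) = (\<integral>x. F x * \<phi> (norm x) \<partial>lebesgue)"
      using measurable_completion[OF m] borel_measurable_AE[OF measurable_completion[OF m]]
      by (intro integral_cong_AE) blast+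
    then have "(\<integral>x. F x * \<phi> (norm x) \<partial>lebesgue) = (\<integral>x. F' x * \<phi> (norm x) \<partial>lebesgue)" by simp
    also have "\<dots> = (\<integral>x. F' x * \<phi> (norm x) \<partial>lborel)" using m by (intro integral_completion) simp
    finally show ?thesis .
  qed
  have eqR: "ball_integral F s = (\<integral>x. indicator (cball 0 s) x * F' x \<partial>lborel)" if "s \<le> b" for s
  proof -
    have m: "(\<lambda>x. indicator (cball 0 s) x * F' x) \<in> borel_measurable lborel"
      by (intro borel_measurable_times borel_measurable_indicator F') simp
    have "AE x in lebesgue. indicator (cball 0 s) x * F x = indicator (cball 0 s) x * F' x"
      using ae' by eventually_elim (use that in \<open>auto simp: indicator_def split: if_splits\<close>)
    then have "ball_integral F s = (\<integral>x. indicator (cball 0 s) x * F' x \<partial>lebesgue)"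
      unfolding ball_integral_def using measurable_completion[OF m] i
      by (intro integral_cong_AE) auto
    also have "\<dots> = (\<integral>x. indicator (cball 0 s) x * F' x \<partial>lborel)" using m by (intro integral_completion) simp
    finally show ?thesis .
  qed
  define f where "f x s = (if norm x \<le> s \<and> s \<le> b then \<psi> s * F' x else 0)" for x :: "real^'n" and s
  have int1: "integrable lborel (\<lambda>s. if norm x \<le> s \<and> s \<le> b then h s else 0)" if "continuous_on UNIV h"
    for h :: "real \<Rightarrow> real" and x :: "real^'n"
  proof -
    have "integrable lborel (\<lambda>s. indicator {norm x..b} s *\<^sub>R h s)"
      by (intro borel_integrable_compact continuous_on_subset[OF that]) auto
    also have "(\<lambda>s. indicator {norm x..b} s *\<^sub>R h s) = (\<lambda>s. if norm x \<le> s \<and> s \<le> b then h s else 0)"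
      by (auto simp: indicator_def fun_eq_iff)
    finally show ?thesis .
  qed
  have abs\<psi>: "continuous_on UNIV (\<lambda>s. \<bar>\<psi> s\<bar>)" by (intro continuous_intros \<psi>)
  \<comment> \<open>The range \<open>{norm x..b}\<close> is largest for x = 0, so this value
    dominates the inner integral for every x.\<close>
  define C where "C = (\<integral>s. (if norm (0::real^'n) \<le> s \<and> s \<le> b then \<bar>\<psi> s\<bar> else 0) \<partial>lborel)"
  have meas[measurable]: "case_prod f \<in> borel_measurable (lborel \<Otimes>\<^sub>M lborel)"
    unfolding f_def by measurable
  have fub: "integrable (lborel \<Otimes>\<^sub>M lborel) (case_prod f)"
  proof (rule lborel_pair.Fubini_integrable)
    show "case_prod f \<in> borel_measurable (lborel \<Otimes>\<^sub>M lborel)" by (rule meas)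
    show "AE x in lborel. integrable lborel (\<lambda>s. case_prod f (x, s))"
    proof (rule AE_I2)
      fix x
      have "integrable lborel (\<lambda>s. (if norm x \<le> s \<and> s \<le> b then \<psi> s else 0) * F' x)"
        by (intro integrable_mult_left int1 \<psi>)
      also have "(\<lambda>s. (if norm x \<le> s \<and> s \<le> b then \<psi> s else 0) * F' x) = (\<lambda>s. case_prod f (x, s))"
        by (auto simp: f_def)
      finally show "integrable lborel (\<lambda>s. case_prod f (x, s))" .
    qed
    have eq: "(\<integral>s. norm (case_prod f (x, s)) \<partial>lborel) = (\<integral>s. (if norm x \<le> s \<and> s \<le> b then \<bar>\<psi> s\<bar> else 0) \<partial>lborel) * \<bar>F' x\<bar>" for x
    proof -
      have "(\<lambda>s. norm (case_prod f (x, s))) = (\<lambda>s. (if norm x \<le> s \<and> s \<le> b then \<bar>\<psi> s\<bar> else 0) * \<bar>F' x\<bar>)"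
        by (auto simp: f_def abs_mult)
      then show ?thesis by simp
    qed
    have le: "0 \<le> (\<integral>s. (if norm x \<le> s \<and> s \<le> b then \<bar>\<psi> s\<bar> else 0) \<partial>lborel)"
      "(\<integral>s. (if norm x \<le> s \<and> s \<le> b then \<bar>\<psi> s\<bar> else 0) \<partial>lborel) \<le> C" for x :: "real^'n"
    proof -
      show "0 \<le> (\<integral>s. (if norm x \<le> s \<and> s \<le> b then \<bar>\<psi> s\<bar> else 0) \<partial>lborel)"
        by (rule Bochner_Integration.integral_nonneg) auto
      show "(\<integral>s. (if norm x \<le> s \<and> s \<le> b then \<bar>\<psi> s\<bar> else 0) \<partial>lborel) \<le> C"
        unfolding C_def
      proof (rule integral_mono[OF int1[OF abs\<psi>] int1[OF abs\<psi>]])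
        fix s show "(if norm x \<le> s \<and> s \<le> b then \<bar>\<psi> s\<bar> else 0) \<le> (if norm (0::real^'n) \<le> s \<and> s \<le> b then \<bar>\<psi> s\<bar> else 0)"
        proof (cases "0 \<le> s")
          case False
          then have "\<not> norm x \<le> s" using norm_ge_zero[of x] by linarith
          then show ?thesis by auto
        qed auto
      qed
    qed
    show "integrable lborel (\<lambda>x. \<integral>s. norm (case_prod f (x, s)) \<partial>lborel)"
    proof (rule Bochner_Integration.integrable_bound)
      show "integrable lborel (\<lambda>x. C * \<bar>F' x\<bar>)" using intF' by simp
      show "(\<lambda>x. \<integral>s. norm (case_prod f (x, s)) \<partial>lborel) \<in> borel_measurable lborel" by measurable
      show "AE x in lborel. norm (\<integral>s. norm (case_prod f (x, s)) \<partial>lborel) \<le> norm (C * \<bar>F' x\<bar>)"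
      proof (rule AE_I2)
        fix x
        have "0 \<le> C" using le(1)[of 0] by (simp add: C_def)
        then show "norm (\<integral>s. norm (case_prod f (x, s)) \<partial>lborel) \<le> norm (C * \<bar>F' x\<bar>)"
          unfolding eq using le[of x] by (simp add: abs_mult mult_right_mono)
      qed
    qed
  qed
  have inner1: "(\<integral>x. f x s \<partial>lborel) = indicator {0..b} s * (\<psi> s * ball_integral F s)" for s
  proof (cases "0 \<le> s \<and> s \<le> b")
    case True
    then have "(\<lambda>x. f x s) = (\<lambda>x. \<psi> s * (indicator (cball 0 s) x * F' x))"
      by (auto simp: f_def indicator_def)
    then show ?thesis using True eqR[of s] by simp
  next
    case False
    then have "\<not> (norm x \<le> s \<and> s \<le> b)" for x :: "real^'n" using norm_ge_zero[of x] by linarith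
    then have "f x s = 0" for x unfolding f_def by (rule if_not_P)
    then show ?thesis using False by simp
  qed
  have inner2: "(\<integral>s. f x s \<partial>lborel) = - (F' x * \<phi> (norm x))" for x
  proof (cases "norm x \<le> b")
    case True
    have "(\<lambda>s. f x s) = (\<lambda>s. F' x * (\<psi> s * indicator {norm x..b} s))" by (auto simp: f_def indicator_def)
    moreover have "(\<integral>s. \<psi> s * indicator {norm x..b} s \<partial>lborel) = \<phi> b - \<phi> (norm x)"
      by (rule integral_FTC_Icc_real[OF True \<phi>(1)])
         (use \<psi> in \<open>auto simp: continuous_on_eq_continuous_at\<close>)
    ultimately show ?thesis using \<phi>(2)[of b] by simp
  next
    case False
    then have "(\<lambda>s. f x s) = (\<lambda>s. 0)" by (auto simp: f_def)
    then show ?thesis using False \<phi>(2)[of "norm x"] by simp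
  qed
  have "(\<integral>s. \<integral>x. f x s \<partial>lborel \<partial>lborel) = (\<integral>x. \<integral>s. f x s \<partial>lborel \<partial>lborel)"
    by (rule lborel_pair.Fubini_integral[OF fub])
  then show ?thesis unfolding inner1 inner2 eqL by simp
qed

lemma polar_integral_bump:
  fixes k :: "real \<Rightarrow> real"
  assumes k: "continuous_on {0<..} k" and "bump \<Phi>"
  shows "integral\<^sup>L lborel (\<lambda>x::real^'n. k (norm x) * \<Phi> (norm x)) =
    sphere_area CARD('n) * (\<integral>r. k r * (r ^ (CARD('n) - 1) * \<Phi> r) \<partial>lborel)"
proof -
  obtain a b where 1: "0 < a" "a < b" "\<And>r. r \<notin> {a..b} \<Longrightarrow> \<Phi> r = 0" "smooth1 UNIV \<Phi>"
    by (rule bumpE[OF assms(2)]) (rule that)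
  have "(\<lambda>r. k r * \<Phi> r) \<in> borel_measurable borel"
    by (intro borel_measurable_continuous_onI integrable_mult_bump(1) assms)
  from polar_integral[OF this, where 'n = 'n]
  have "integral\<^sup>L lborel (\<lambda>x::real^'n. k (norm x) * \<Phi> (norm x)) =
     (\<integral>r. sphere_area CARD('n) * r ^ (CARD('n) - 1) * indicator {0..} r * (k r * \<Phi> r) \<partial>lborel)" .
  also have "\<dots> = (\<integral>r. sphere_area CARD('n) * (k r * (r ^ (CARD('n) - 1) * \<Phi> r)) \<partial>lborel)"
    by (intro Bochner_Integration.integral_cong) (use 1 in \<open>auto simp: indicator_def\<close>)
  finally show ?thesis by simp
qed

text \<open>A functional T that turns each source \<Phi> into \<integral> F \<phi>, with \<phi> the
  solution for that source, is integration against a k whose own source is F. The solution \<phi> is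
  constant near 0 and zero far out only if \<Phi> has mean zero, so T is at first known on such
  bumps alone; this determines k up to an additive constant, which a single bump of nonzero mean
  then fixes. The lemma serves twice, once for v and once for u.\<close>

lemma (in weight_range) radial_du_Bois_Reymond:
  fixes F :: "real^'n \<Rightarrow> real" and T :: "(real \<Rightarrow> real) \<Rightarrow> real"
  assumes F: "\<And>R. F absolutely_integrable_on cball 0 R"
    and lin: "\<And>\<Phi> \<Psi> c. bump \<Phi> \<Longrightarrow> bump \<Psi> \<Longrightarrow> T (\<lambda>r. c * \<Phi> r + \<Psi> r) = c * T \<Phi> + T \<Psi>"
    and T: "\<And>\<Phi> \<phi> P a b. 0 < a \<Longrightarrow> a < b \<Longrightarrow> bump \<Phi> \<Longrightarrow> smooth1 UNIV \<phi> \<Longrightarrow> radial_sys N \<alpha> \<phi> P \<Phi> \<Longrightarrow>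
      (\<And>r. r \<le> a \<Longrightarrow> \<phi> r = \<phi> a) \<Longrightarrow> (\<And>r. r \<ge> b \<Longrightarrow> \<phi> r = 0) \<Longrightarrow>
      T \<Phi> = (\<integral>x. F x * \<phi> (norm x) \<partial>lebesgue)"
  obtains k where "\<And>r. r > 0 \<Longrightarrow> (k has_field_derivative r powr (1 - real N - \<alpha>) * (ball_integral F r / sphere_area N)) (at r)"
    "\<And>\<Phi>. bump \<Phi> \<Longrightarrow> T \<Phi> = integral\<^sup>L lborel (\<lambda>x::real^'n. k (norm x) * \<Phi> (norm x))"
proof -
  define \<omega> where "\<omega> = sphere_area N"
  have \<omega>: "\<omega> > 0" using dim_ge_2 by (simp add: \<omega>_def sphere_area_pos)
  let ?G = "ball_integral F"
  have "\<exists>k. \<forall>x::real. 0 < ereal x \<longrightarrow> ereal x < \<infinity> \<longrightarrow> (k has_vector_derivative x powr (1 - real N - \<alpha>) * (?G x / \<omega>)) (at x)"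
    by (rule einterval_antiderivative) (use \<omega> in \<open>auto intro!: continuous_intros ball_integral_isCont F\<close>)
  then obtain k where k: "\<And>r. r > 0 \<Longrightarrow> (k has_field_derivative r powr (1 - real N - \<alpha>) * (?G r / \<omega>)) (at r)"
    by (auto simp: has_real_derivative_iff_has_vector_derivative)
  have kc: "continuous_on {0<..} k"
    by (intro continuous_at_imp_continuous_on ballI DERIV_isCont[OF k]) auto
  have zero_mean: "T \<Phi> = integral\<^sup>L lborel (\<lambda>x::real^'n. k (norm x) * \<Phi> (norm x))"
    if bu: "bump \<Phi>" and mean: "integral\<^sup>L lborel (\<lambda>x::real^'n. 1 * \<Phi> (norm x)) = 0" for \<Phi>
  proof -
    obtain a b where ab: "0 < a" "a < b" "\<And>r. r \<notin> {a..b} \<Longrightarrow> \<Phi> r = 0" "smooth1 UNIV \<Phi>"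
      by (rule bumpE[OF bu]) (rule that)
    have sh: "smooth1 UNIV (\<lambda>r. r ^ (N - 1) * \<Phi> r)"
      by (intro smooth1_mult smooth1_power smooth1_ident ab) auto
    obtain \<eta> where \<eta>: "smooth1 UNIV \<eta>" "\<And>r. (\<eta> has_field_derivative r ^ (N - 1) * \<Phi> r) (at r)"
      "\<And>r. r \<ge> b \<Longrightarrow> \<eta> r = 0" "\<And>r. r \<le> a \<Longrightarrow> \<eta> r = \<eta> a" "\<eta> a = - (\<integral>r. r ^ (N - 1) * \<Phi> r \<partial>lborel)"
      by (rule compact_antiderivative[OF sh, of a b]) (use ab in \<open>auto intro: that\<close>)
    have "\<omega> * (\<integral>r. 1 * (r ^ (N - 1) * \<Phi> r) \<partial>lborel) = 0"
      using polar_integral_bump[OF continuous_on_const bu, where 'n = 'n, of 1] mean by (simp add: \<omega>_def card_dim)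
    \<comment> \<open>Mean zero makes the flux \<eta> vanish to the left of a as well, so that
      \<psi>, which carries a power singular at 0, extends smoothly by zero.\<close>
    then have \<eta>0: "\<eta> r = 0" if "r \<le> a" for r using \<omega> \<eta>(4)[OF that] \<eta>(5) by simp
    define \<psi> where "\<psi> r = r powr (1 - real N - \<alpha>) * \<eta> r" for r
    have s\<psi>: "smooth1 UNIV \<psi>"
      by (rule smooth1_glue_0[of _ a])
         (use ab \<eta>0 in \<open>auto simp: \<psi>_def[abs_def] intro!: smooth1_mult smooth1_powr smooth1_mono[OF \<eta>(1)]\<close>)
    have \<psi>0: "\<psi> r = 0" if "r \<notin> {a..b}" for r using that \<eta>(3) \<eta>0 by (auto simp: \<psi>_def not_le)
    obtain \<phi> where \<phi>: "smooth1 UNIV \<phi>" "\<And>r. (\<phi> has_field_derivative \<psi> r) (at r)"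
      "\<And>r. r \<ge> b \<Longrightarrow> \<phi> r = 0" "\<And>r. r \<le> a \<Longrightarrow> \<phi> r = \<phi> a" "\<phi> a = - (\<integral>r. \<psi> r \<partial>lborel)"
      by (rule compact_antiderivative[OF s\<psi> \<psi>0]) (use ab in \<open>auto intro: that\<close>)
    have Nr: "r ^ (N - 1) = r powr (real N - 1)" if "r > 0" for r
      using that dim_ge_2 by (simp add: powr_realpow[symmetric] of_nat_diff)
    have sys: "radial_sys N \<alpha> \<phi> \<eta> \<Phi>"
      unfolding radial_sys_def using \<phi>(2) \<eta>(2) by (auto simp: \<psi>_def simp flip: Nr)
    have "T \<Phi> = (\<integral>x. F x * \<phi> (norm x) \<partial>lebesgue)"
      by (rule T[OF ab(1,2) bu \<phi>(1) sys \<phi>(4,3)])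
    also have "\<dots> = - (\<integral>s. indicator {0..b} s * (\<psi> s * ?G s) \<partial>lborel)"
      by (rule integral_radial_layers[OF F _ \<phi>(2,3) smooth1_continuous_on[OF s\<psi>]]) (use ab in auto)
    also have "(\<integral>s. indicator {0..b} s * (\<psi> s * ?G s) \<partial>lborel) = (\<integral>s. indicator {a..b} s * (\<psi> s * ?G s) \<partial>lborel)"
      by (intro Bochner_Integration.integral_cong) (use \<psi>0 ab in \<open>auto simp: indicator_def\<close>)
    \<comment> \<open>Integration by parts: A + B is the derivative of k \<eta>, and \<eta> vanishes
      at both ends of the interval.\<close>
    also have "\<dots> = - \<omega> * (\<integral>r. k r * (r ^ (N - 1) * \<Phi> r) \<partial>lborel)"
    proof -
      define A where "A r = r powr (1 - real N - \<alpha>) * (?G r / \<omega>) * \<eta> r" for r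
      define B where "B r = k r * (r ^ (N - 1) * \<Phi> r)" for r
      have \<eta>c: "isCont \<eta> r" and \<Phi>c: "isCont \<Phi> r" for r
        using smooth1_continuous_on[OF \<eta>(1)] smooth1_continuous_on[OF ab(4)] by (auto simp: continuous_on_eq_continuous_at)
      have Ac: "isCont A r" and Bc: "isCont B r" if "r > 0" for r
        unfolding A_def B_def using that \<omega>
        by (auto intro!: continuous_intros ball_integral_isCont F \<eta>c \<Phi>c DERIV_isCont[OF k])
      have cont: "continuous_on {a..b} A" "continuous_on {a..b} B"
        using ab Ac Bc by (auto intro: continuous_at_imp_continuous_on)
      note int = borel_integrable_compact[OF compact_Icc cont(1)] borel_integrable_compact[OF compact_Icc cont(2)]
      have "(\<integral>r. (A r + B r) * indicator {a..b} r \<partial>lborel) = k b * \<eta> b - k a * \<eta> a"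
      proof (rule integral_FTC_Icc_real)
        fix r assume r: "a \<le> r" "r \<le> b"
        have "((\<lambda>r. k r * \<eta> r) has_field_derivative r powr (1 - real N - \<alpha>) * (?G r / \<omega>) * \<eta> r + (r ^ (N - 1) * \<Phi> r) * k r) (at r)"
          using r ab by (intro DERIV_mult k \<eta>(2)) auto
        then show "((\<lambda>r. k r * \<eta> r) has_field_derivative A r + B r) (at r)" by (simp add: A_def B_def mult.commute)
        show "isCont (\<lambda>r. A r + B r) r" using r ab by (intro continuous_intros Ac Bc) auto
      qed (use ab in auto)
      also have "\<dots> = 0" using \<eta>(3) \<eta>0 by simp
      also have "(\<integral>r. (A r + B r) * indicator {a..b} r \<partial>lborel) = (\<integral>r. indicator {a..b} r *\<^sub>R A r + indicator {a..b} r *\<^sub>R B r \<partial>lborel)"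
        by (intro Bochner_Integration.integral_cong) (auto simp: algebra_simps)
      also have "\<dots> = (\<integral>r. indicator {a..b} r *\<^sub>R A r \<partial>lborel) + (\<integral>r. indicator {a..b} r *\<^sub>R B r \<partial>lborel)"
        by (rule Bochner_Integration.integral_add[OF int])
      also have "(\<integral>r. indicator {a..b} r *\<^sub>R B r \<partial>lborel) = (\<integral>r. k r * (r ^ (N - 1) * \<Phi> r) \<partial>lborel)"
        by (intro Bochner_Integration.integral_cong) (use ab in \<open>auto simp: B_def indicator_def\<close>)
      also have "(\<integral>r. indicator {a..b} r *\<^sub>R A r \<partial>lborel) = (\<integral>r. (indicator {a..b} r * (\<psi> r * ?G r)) / \<omega> \<partial>lborel)"
        by (intro Bochner_Integration.integral_cong) (auto simp: A_def \<psi>_def)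
      also have "\<dots> = (\<integral>r. (indicator {a..b} r * (\<psi> r * ?G r)) \<partial>lborel) / \<omega>" by simp
      finally show ?thesis using \<omega> by (simp add: field_simps)
    qed
    finally show ?thesis
      using polar_integral_bump[OF kc bu, where 'n = 'n] by (simp add: \<omega>_def card_dim)
  qed
  have i1: "integrable lborel (\<lambda>x::real^'n. 1 * \<Phi> (norm x))" if "bump \<Phi>" for \<Phi>
    by (rule integrable_mult_bump(2)[OF continuous_on_const that])
  have ik: "integrable lborel (\<lambda>x::real^'n. k (norm x) * \<Phi> (norm x))" if "bump \<Phi>" for \<Phi>
    by (rule integrable_mult_bump(2)[OF kc that])
  show ?thesis
  \<comment> \<open>Distinguishing the two cases avoids constructing a bump of nonzero mean.\<close>
  proof (cases "\<forall>\<Phi>. bump \<Phi> \<longrightarrow> integral\<^sup>L lborel (\<lambda>x::real^'n. 1 * \<Phi> (norm x)) = 0")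
    case True
    then show ?thesis using that[of k] k zero_mean by (simp add: \<omega>_def)
  next
    case False
    then obtain \<Phi>1 where b1: "bump \<Phi>1" and ne: "integral\<^sup>L lborel (\<lambda>x::real^'n. 1 * \<Phi>1 (norm x)) \<noteq> 0"
      by blast
  define m1 where "m1 = integral\<^sup>L lborel (\<lambda>x::real^'n. 1 * \<Phi>1 (norm x))"
  have m1: "m1 \<noteq> 0" using ne by (simp add: m1_def)
  \<comment> \<open>Chosen so that k + c gives the right value on \<Phi>1; adding a multiple of
    \<Phi>1 to any other bump brings its mean to zero.\<close>
  define c where "c = (T \<Phi>1 - integral\<^sup>L lborel (\<lambda>x::real^'n. k (norm x) * \<Phi>1 (norm x))) / m1"
  show ?thesis
  proof (rule that[of "\<lambda>r. k r + c"])
    show "((\<lambda>r. k r + c) has_field_derivative r powr (1 - real N - \<alpha>) * (?G r / sphere_area N)) (at r)" if "r > 0" for r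
      using k[OF that] by (auto intro!: derivative_eq_intros simp: \<omega>_def)
    fix \<Phi> assume bu: "bump \<Phi>"
    define m where "m = integral\<^sup>L lborel (\<lambda>x::real^'n. 1 * \<Phi> (norm x))"
    define \<Psi> where "\<Psi> r = (- m / m1) * \<Phi>1 r + \<Phi> r" for r
    have b\<Psi>: "bump \<Psi>" unfolding \<Psi>_def[abs_def] by (rule bump_combine[OF b1 bu])
    have split: "integral\<^sup>L lborel (\<lambda>x::real^'n. q (norm x) * \<Psi> (norm x)) =
        (- m / m1) * integral\<^sup>L lborel (\<lambda>x::real^'n. q (norm x) * \<Phi>1 (norm x)) + integral\<^sup>L lborel (\<lambda>x::real^'n. q (norm x) * \<Phi> (norm x))"
      if q: "continuous_on {0<..} q" for q
    proof -
      have "integral\<^sup>L lborel (\<lambda>x::real^'n. q (norm x) * \<Psi> (norm x)) =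
        integral\<^sup>L lborel (\<lambda>x::real^'n. (- m / m1) * (q (norm x) * \<Phi>1 (norm x)) + q (norm x) * \<Phi> (norm x))"
        by (intro Bochner_Integration.integral_cong) (auto simp: \<Psi>_def algebra_simps)
      then show ?thesis
        using integrable_mult_bump(2)[OF q b1, where 'n='n] integrable_mult_bump(2)[OF q bu, where 'n='n] by simp
    qed
    have "integral\<^sup>L lborel (\<lambda>x::real^'n. 1 * \<Psi> (norm x)) = (- m / m1) * m1 + m"
      using split[OF continuous_on_const] unfolding m_def m1_def .
    also have "\<dots> = 0" using m1 by simp
    finally have "T \<Psi> = integral\<^sup>L lborel (\<lambda>x::real^'n. k (norm x) * \<Psi> (norm x))" by (rule zero_mean[OF b\<Psi>])
    moreover have "T \<Psi> = (- m / m1) * T \<Phi>1 + T \<Phi>" unfolding \<Psi>_def[abs_def] by (rule lin[OF b1 bu])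
    ultimately have "T \<Phi> = integral\<^sup>L lborel (\<lambda>x::real^'n. k (norm x) * \<Phi> (norm x)) + c * m"
      using split[OF kc] m1 by (simp add: c_def field_simps)
    also have "\<dots> = integral\<^sup>L lborel (\<lambda>x::real^'n. k (norm x) * \<Phi> (norm x) + c * (1 * \<Phi> (norm x)))"
      using ik[OF bu] i1[OF bu] unfolding m_def by simp
    finally show "T \<Phi> = integral\<^sup>L lborel (\<lambda>x::real^'n. (k (norm x) + c) * \<Phi> (norm x))"
      by (simp add: algebra_simps)
  qed
qed
qed

lemma negligible_radial_set:
  fixes E :: "(real^'n) set"
  assumes E: "E \<in> sets lebesgue" and rad: "\<And>x y. norm x = norm y \<Longrightarrow> x \<in> E \<Longrightarrow> y \<in> E" and "0 \<notin> E"
    and null: "\<And>C. compact C \<Longrightarrow> C \<subseteq> {0<..} \<Longrightarrow> {x. norm x \<in> C} \<subseteq> E \<Longrightarrow> negligible {x::real^'n. norm x \<in> C}"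
  shows "negligible E"
proof -
  obtain S T where S: "fsigma S" "T \<in> null_sets lebesgue" "S \<union> T = E" "disjnt S T"
    by (rule lebesgue_set_almost_fsigma[OF E]) (rule that)
  obtain K :: "nat \<Rightarrow> (real^'n) set" where K: "range K \<subseteq> Collect compact" "S = \<Union>(range K)"
    using S(1)[unfolded fsigma_Union_compact] by (elim exE conjE) (rule that)
  have "negligible (K n)" for n :: nat
  proof -
    have "compact (K n)" and sub: "K n \<subseteq> E" using K S by auto
    then have 1: "compact (norm ` K n)" by (intro compact_continuous_image[OF continuous_on_norm_id])
    have 2: "norm ` K n \<subseteq> {0<..}" using sub assms(3) by auto
    have 3: "{x. norm x \<in> norm ` K n} \<subseteq> E"
    proof
      fix x :: "real^'n" assume "x \<in> {x. norm x \<in> norm ` K n}"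
      then obtain y where "y \<in> K n" "norm y = norm x" by auto
      then show "x \<in> E" using rad[of y x] sub by blast
    qed
    have "negligible {x::real^'n. norm x \<in> norm ` K n}" by (rule null[OF 1 2 3])
    then show ?thesis by (rule negligible_subset) auto
  qed
  then have "negligible S" unfolding K(2) by (intro negligible_countable_Union) auto
  then show ?thesis using S(2,3) by (auto simp flip: negligible_iff_null_sets)
qed

text \<open>By the Weierstrass theorem, multiples of a fixed bump by polynomials approximate its
  multiple by any continuous function.\<close>

lemma bump_functionals_eq:
  fixes T1 T2 :: "(real \<Rightarrow> real) \<Rightarrow> real"
  assumes eq: "\<And>\<Phi>. bump \<Phi> \<Longrightarrow> T1 \<Phi> = T2 \<Phi>"
    and h: "continuous_on {0<..} h" and \<eta>: "bump \<eta>"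
    and T1: "\<And>\<Psi> e. bump \<Psi> \<Longrightarrow> e > 0 \<Longrightarrow> (\<And>r. \<bar>\<Psi> r - h r * \<eta> r\<bar> \<le> e * \<bar>\<eta> r\<bar>) \<Longrightarrow> \<bar>T1 \<Psi> - T1 (\<lambda>r. h r * \<eta> r)\<bar> \<le> C * e"
    and T2: "\<And>\<Psi> e. bump \<Psi> \<Longrightarrow> e > 0 \<Longrightarrow> (\<And>r. \<bar>\<Psi> r - h r * \<eta> r\<bar> \<le> e * \<bar>\<eta> r\<bar>) \<Longrightarrow> \<bar>T2 \<Psi> - T2 (\<lambda>r. h r * \<eta> r)\<bar> \<le> C * e"
  shows "T1 (\<lambda>r. h r * \<eta> r) = T2 (\<lambda>r. h r * \<eta> r)"
proof -
  let ?f = "\<lambda>r. h r * \<eta> r"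
  obtain a b where ab: "0 < a" "a < b" "\<And>r. r \<notin> {a..b} \<Longrightarrow> \<eta> r = 0" "smooth1 UNIV \<eta>"
    by (rule bumpE[OF \<eta>]) (rule that)
  have close: "\<bar>T1 ?f - T2 ?f\<bar> \<le> 2 * C * e" if e: "e > 0" for e
  proof -
    have "continuous_on {a..b} h" by (rule continuous_on_subset[OF h]) (use ab in auto)
    then obtain p where p: "real_polynomial_function p" "\<And>r. r \<in> {a..b} \<Longrightarrow> \<bar>h r - p r\<bar> < e"
      using Stone_Weierstrass_real_polynomial_function[OF compact_Icc _ e] by metis
    define \<Psi> where "\<Psi> r = p r * \<eta> r" for r
    have "smooth1 UNIV \<Psi>" unfolding \<Psi>_def[abs_def]
      by (intro smooth1_mult smooth1_real_polynomial_function p ab) auto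
    then have b: "bump \<Psi>" unfolding bump_def using ab by (auto simp: \<Psi>_def)
    have d: "\<bar>\<Psi> r - ?f r\<bar> \<le> e * \<bar>\<eta> r\<bar>" for r
    proof (cases "r \<in> {a..b}")
      case True
      have "\<Psi> r - ?f r = (p r - h r) * \<eta> r" by (simp add: \<Psi>_def algebra_simps)
      then have "\<bar>\<Psi> r - ?f r\<bar> = \<bar>h r - p r\<bar> * \<bar>\<eta> r\<bar>" by (simp add: abs_mult abs_minus_commute)
      also have "\<dots> \<le> e * \<bar>\<eta> r\<bar>" using p(2)[OF True] by (intro mult_right_mono) auto
      finally show ?thesis .
    next
      case False
      then show ?thesis using ab(3) by (simp add: \<Psi>_def)
    qed
    have "\<bar>T1 \<Psi> - T1 ?f\<bar> \<le> C * e" "\<bar>T2 \<Psi> - T2 ?f\<bar> \<le> C * e" by (rule T1[OF b e d] T2[OF b e d])+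
    then show ?thesis using eq[OF b] by linarith
  qed
  have "\<bar>T1 ?f - T2 ?f\<bar> \<le> 0"
  proof (rule field_le_epsilon)
    fix e :: real assume e: "e > 0"
    \<comment> \<open>The summand 1 keeps the denominator positive when C = 0, and the absolute
      value covers a C of unknown sign.\<close>
    define d where "d = e / (2 * \<bar>C\<bar> + 1)"
    have d: "d > 0" "(2 * \<bar>C\<bar> + 1) * d = e" using e by (auto simp: d_def)
    have "2 * C * d \<le> (2 * \<bar>C\<bar> + 1) * d" using d(1) by (intro mult_right_mono) auto
    then show "\<bar>T1 ?f - T2 ?f\<bar> \<le> 0 + e" using close[OF d(1)] d by linarith
  qed
  then show ?thesis by simp
qed

text \<open>Constancy near the origin makes the weighted divergence bounded with bounded support,
  however singular the weight is.\<close>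

lemma test_fun_const_near_0:
  fixes \<psi> :: "real^'n \<Rightarrow> real"
  assumes "smooth \<psi>" "compactly_supported \<psi>" "\<delta> > 0" "\<And>x. norm x < \<delta> \<Longrightarrow> \<psi> x = c"
  shows "\<psi> \<in> test_fun \<alpha>"
proof (rule test_funI[OF assms(1,2)])
  obtain B R where B: "B > 0" "R > 0" "\<And>x. x \<noteq> 0 \<Longrightarrow> \<bar>wdiv \<alpha> \<psi> x\<bar> \<le> B * indicator (cball 0 R) x"
    using wdiv_bounded[OF assms] by blast
  show "wdiv \<alpha> \<psi> \<in> L2 lborel"
  proof (rule L2_dominated)
    show "(\<lambda>x::real^'n. B * indicator (cball 0 R) x) \<in> L2 lborel"
    proof (rule bounded_ball_L2[of _ B R])
      show "(\<lambda>x::real^'n. B * indicator (cball 0 R) x) \<in> borel_measurable borel"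
        by (intro borel_measurable_times borel_measurable_indicator) auto
    qed (use B in \<open>simp add: abs_mult\<close>)
    show "AE x in lborel. \<bar>wdiv \<alpha> \<psi> x\<bar> \<le> \<bar>B * indicator (cball 0 R) x\<bar>"
      using AE_lborel_not_zero by eventually_elim (use order_trans[OF B(3) abs_ge_self] in simp)
  qed (use wdiv_borel[OF assms(1)] in simp)
qed

lemma test_fun_radial:
  assumes "smooth1 UNIV \<phi>" "0 < a" "\<And>r. r \<le> a \<Longrightarrow> \<phi> r = \<phi> a" "\<And>r. r \<ge> b \<Longrightarrow> \<phi> r = 0"
  shows "(\<lambda>x::real^'n. \<phi> (norm x)) \<in> test_fun \<alpha>" "smooth (\<lambda>x::real^'n. \<phi> (norm x))"
    "compactly_supported (\<lambda>x::real^'n. \<phi> (norm x))"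
proof -
  show s: "smooth (\<lambda>x::real^'n. \<phi> (norm x))"
    by (rule smooth_radial[OF smooth1_mono[OF assms(1) subset_UNIV] assms(2)]) (rule assms(3))
  show c: "compactly_supported (\<lambda>x::real^'n. \<phi> (norm x))"
    by (rule compactly_supportedI[of b]) (use assms(4) in auto)
  show "(\<lambda>x::real^'n. \<phi> (norm x)) \<in> test_fun \<alpha>"
    by (rule test_fun_const_near_0[OF s c assms(2)]) (rule assms(3), simp)
qed

definition nonlin :: "nat \<Rightarrow> real \<Rightarrow> real \<Rightarrow> real" where
  "nonlin N \<alpha> t = \<bar>t\<bar> powr (crit_exp N \<alpha> - 2) * t"

lemma L2_Cauchy_const: "f \<in> L2 M \<Longrightarrow> L2_Cauchy M (\<lambda>_. f)"
  by (auto simp: L2_Cauchy_def L2_norm_def)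

lemma borel_measurable_norm_comp:
  fixes g :: "real \<Rightarrow> real"
  assumes "continuous_on {0<..} g"
  shows "(\<lambda>x::real^'n. g (norm x)) \<in> borel_measurable borel"
proof -
  have "continuous_on (- {0}) (\<lambda>x::real^'n. g (norm x))"
    by (rule continuous_on_compose2[OF assms]) (auto intro: continuous_on_norm_id)
  then have "(\<lambda>x::real^'n. if x \<in> {0} then g 0 else g (norm x)) \<in> borel_measurable borel"
    by (intro borel_measurable_continuous_on_if) auto
  also have "(\<lambda>x::real^'n. if x \<in> {0} then g 0 else g (norm x)) = (\<lambda>x. g (norm x))" by auto
  finally show ?thesis .
qed

text \<open>The limit functional \<open>\<Lambda> f = lim \<integral> wdiv (w n) * f\<close> replaces the \<open>L\<^sup>2\<close>-limit of the weighted
  divergences, so that no completeness of \<open>L\<^sup>2\<close> is needed.\<close>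

definition wdiv_limit :: "real \<Rightarrow> (nat \<Rightarrow> real^'n \<Rightarrow> real) \<Rightarrow> (real^'n \<Rightarrow> real) \<Rightarrow> real" where
  "wdiv_limit \<alpha> w f = lim (\<lambda>n. \<integral>x. wdiv \<alpha> (w n) x * f x \<partial>lborel)"

context
  fixes \<alpha> :: real and w :: "nat \<Rightarrow> real^'n \<Rightarrow> real" and u :: "real^'n \<Rightarrow> real"
  assumes w: "represents \<alpha> w u"
begin

lemma wdiv_limit_LIMSEQ:
  "f \<in> L2 lborel \<Longrightarrow> (\<lambda>n. \<integral>x. wdiv \<alpha> (w n) x * f x \<partial>lborel) \<longlonglongrightarrow> wdiv_limit \<alpha> w f"
  using L2_inner_Cauchy_convergent[OF representsD(2)[OF w] L2_Cauchy_const[of f]]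
  by (simp add: wdiv_limit_def convergent_LIMSEQ_iff)

lemma wdiv_limit_linear:
  assumes f: "f \<in> L2 lborel" and g: "g \<in> L2 lborel"
  shows "wdiv_limit \<alpha> w (\<lambda>x. c * f x + g x) = c * wdiv_limit \<alpha> w f + wdiv_limit \<alpha> w g"
proof -
  have W: "wdiv \<alpha> (w n) \<in> L2 lborel" for n by (rule test_funD(3)[OF representsD(1)[OF w]])
  have "(\<integral>x. wdiv \<alpha> (w n) x * (c * f x + g x) \<partial>lborel) =
     c * (\<integral>x. wdiv \<alpha> (w n) x * f x \<partial>lborel) + (\<integral>x. wdiv \<alpha> (w n) x * g x \<partial>lborel)" for n
  proof -
    have "(\<integral>x. wdiv \<alpha> (w n) x * (c * f x + g x) \<partial>lborel) = (\<integral>x. c * (wdiv \<alpha> (w n) x * f x) + wdiv \<alpha> (w n) x * g x \<partial>lborel)"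
      by (intro Bochner_Integration.integral_cong) (auto simp: algebra_simps)
    then show ?thesis using L2_mult_integrable[OF W f] L2_mult_integrable[OF W g] by simp
  qed
  then have "(\<lambda>n. \<integral>x. wdiv \<alpha> (w n) x * (c * f x + g x) \<partial>lborel) \<longlonglongrightarrow> c * wdiv_limit \<alpha> w f + wdiv_limit \<alpha> w g"
    by (simp add: tendsto_add tendsto_mult_left wdiv_limit_LIMSEQ[OF f] wdiv_limit_LIMSEQ[OF g])
  moreover have "(\<lambda>x. c * f x + g x) \<in> L2 lborel" by (intro L2_add L2_cmult f g)
  ultimately show ?thesis using wdiv_limit_LIMSEQ LIMSEQ_unique by blast
qed

lemma wdiv_limit_bound:
  obtains C where "C > 0" "\<And>f. f \<in> L2 lborel \<Longrightarrow> \<bar>wdiv_limit \<alpha> w f\<bar> \<le> C * L2_norm lborel f"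
proof -
  obtain C where C: "C > 0" "\<And>n. L2_norm lborel (wdiv \<alpha> (w n)) \<le> C"
    using L2_Cauchy_bounded[OF representsD(2)[OF w]] by blast
  have "\<bar>wdiv_limit \<alpha> w f\<bar> \<le> C * L2_norm lborel f" if f: "f \<in> L2 lborel" for f
  proof (rule LIMSEQ_le_const2[OF tendsto_rabs[OF wdiv_limit_LIMSEQ[OF f]]])
    have "\<bar>\<integral>x. wdiv \<alpha> (w n) x * f x \<partial>lborel\<bar> \<le> C * L2_norm lborel f" for n
    proof -
      have "\<bar>\<integral>x. wdiv \<alpha> (w n) x * f x \<partial>lborel\<bar> \<le> L2_norm lborel (wdiv \<alpha> (w n)) * L2_norm lborel f"
        by (rule L2_Cauchy_Schwarz[OF test_funD(3)[OF representsD(1)[OF w]] f])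
      also have "\<dots> \<le> C * L2_norm lborel f" by (intro mult_right_mono C L2_norm_nonneg)
      finally show ?thesis .
    qed
    then show "\<exists>N. \<forall>n\<ge>N. \<bar>\<integral>x. wdiv \<alpha> (w n) x * f x \<partial>lborel\<bar> \<le> C * L2_norm lborel f" by blast
  qed
  then show ?thesis using that C by blast
qed

lemma wdiv_limit_diff:
  assumes f: "f \<in> L2 lborel" and g: "g \<in> L2 lborel"
  shows "wdiv_limit \<alpha> w (\<lambda>x. f x - g x) = wdiv_limit \<alpha> w f - wdiv_limit \<alpha> w g"
  using wdiv_limit_linear[OF g f, of "-1"] by simp

lemma integral_represents_LIMSEQ:
  assumes h: "h \<in> borel_measurable borel" "\<And>x. x \<noteq> 0 \<Longrightarrow> \<bar>h x\<bar> \<le> B * indicator (cball 0 R) x" "B \<ge> 0"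
  shows "(\<lambda>n. \<integral>x. w n x * h x \<partial>lborel) \<longlonglongrightarrow> (\<integral>x. u x * h x \<partial>lebesgue)"
proof -
  have hl: "h \<in> borel_measurable lebesgue" using h(1) by (intro measurable_completion) simp
  have wi: "w n absolutely_integrable_on cball 0 R" for n
    by (rule test_fun_absolutely_integrable[OF representsD(1)[OF w]])
  note ui = representsD(3)[OF w, of R]
  have di: "(\<lambda>x. w n x - u x) absolutely_integrable_on cball 0 R" for n
    by (rule set_integral_diff(1)[OF wi ui])
  have "\<bar>(\<integral>x. w n x * h x \<partial>lborel) - (\<integral>x. u x * h x \<partial>lebesgue)\<bar> \<le> B * (LINT x:cball 0 R|lebesgue. \<bar>w n x - u x\<bar>)" for n
  proof -
    have "(\<integral>x. w n x * h x \<partial>lborel) = (\<integral>x. w n x * h x \<partial>lebesgue)"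
      using smooth_borel[OF test_funD(1)[OF representsD(1)[OF w]], of n] h(1)
      by (intro integral_completion[symmetric]) simp
    then have "(\<integral>x. w n x * h x \<partial>lborel) - (\<integral>x. u x * h x \<partial>lebesgue) = (\<integral>x. (w n x - u x) * h x \<partial>lebesgue)"
      using integral_mult_ball_le(1)[OF wi hl h(2,3)] integral_mult_ball_le(1)[OF ui hl h(2,3)]
      by (simp add: left_diff_distrib)
    then show ?thesis using integral_mult_ball_le(2)[OF di hl h(2,3)] by simp
  qed
  then have le: "norm ((\<integral>x. w n x * h x \<partial>lborel) - (\<integral>x. u x * h x \<partial>lebesgue)) \<le> B * (LINT x:cball 0 R|lebesgue. \<bar>w n x - u x\<bar>)" for n
    by simp
  have "(\<lambda>n. (\<integral>x. w n x * h x \<partial>lborel) - (\<integral>x. u x * h x \<partial>lebesgue)) \<longlonglongrightarrow> 0"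
  proof (rule Lim_null_comparison)
    show "\<forall>\<^sub>F n in sequentially. norm ((\<integral>x. w n x * h x \<partial>lborel) - (\<integral>x. u x * h x \<partial>lebesgue)) \<le> B * (LINT x:cball 0 R|lebesgue. \<bar>w n x - u x\<bar>)"
      using le by simp
    show "(\<lambda>n. B * (LINT x:cball 0 R|lebesgue. \<bar>w n x - u x\<bar>)) \<longlonglongrightarrow> 0"
      using tendsto_mult_left[OF representsD(4)[OF w], of B R] by simp
  qed
  then show ?thesis by (simp add: LIM_zero_iff)
qed

end

lemma bump_L2:
  assumes "bump \<Phi>" shows "(\<lambda>x::real^'n. \<Phi> (norm x)) \<in> L2 lborel"
proof -
  obtain a b where 1: "0 < a" "a < b" "\<And>r. r \<notin> {a..b} \<Longrightarrow> \<Phi> r = 0" "smooth1 UNIV \<Phi>"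
    by (rule bumpE[OF assms]) (rule that)
  obtain B where B: "B \<ge> 0" "\<And>r. \<bar>\<Phi> r\<bar> \<le> B"
    using compact_support_bounded[OF smooth1_continuous_on[OF 1(4)] 1(3)] by blast
  show ?thesis
  proof (rule bounded_ball_L2)
    show "(\<lambda>x::real^'n. \<Phi> (norm x)) \<in> borel_measurable borel" by (rule smooth_borel[OF smooth_bump_norm[OF assms]])
    show "\<bar>\<Phi> (norm x)\<bar> \<le> B * indicator (cball 0 b) x" for x :: "real^'n"
      using B 1(3)[of "norm x"] by (auto simp: indicator_def)
  qed
qed

lemma continuous_mult_bump_L2:
  assumes "bump \<Phi>" "continuous_on {0<..} h" shows "(\<lambda>x::real^'n. h (norm x) * \<Phi> (norm x)) \<in> L2 lborel"
proof -
  obtain a b where 1: "0 < a" "a < b" "\<And>r. r \<notin> {a..b} \<Longrightarrow> \<Phi> r = 0" "smooth1 UNIV \<Phi>"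
    by (rule bumpE[OF assms(1)]) (rule that)
  have c: "continuous_on UNIV (\<lambda>r. h r * \<Phi> r)" by (rule integrable_mult_bump(1)[OF assms(2,1)])
  obtain B where B: "B \<ge> 0" "\<And>r. \<bar>h r * \<Phi> r\<bar> \<le> B"
    using compact_support_bounded[OF c, of a b] 1(3) by auto
  show ?thesis
  proof (rule bounded_ball_L2)
    show "(\<lambda>x::real^'n. h (norm x) * \<Phi> (norm x)) \<in> borel_measurable borel"
      by (rule borel_measurable_continuous_onI) (auto intro!: continuous_on_compose2[OF c] continuous_on_norm_id)
    show "\<bar>h (norm x) * \<Phi> (norm x)\<bar> \<le> B * indicator (cball 0 b) x" for x :: "real^'n"
      using B 1(3)[of "norm x"] by (auto simp: indicator_def)
  qed
qed

text \<open>Plateaus that exhaust the open half-line from both ends at once.\<close>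

definition bump_seq :: "nat \<Rightarrow> real \<Rightarrow> real" where
  "bump_seq n r = inner_cutoff (1 / (real n + 1)) r * outer_cutoff (real n + 1) r"

lemma bump_bump_seq: "bump (bump_seq n)"
proof -
  have "smooth1 UNIV (bump_seq n)" unfolding bump_seq_def[abs_def]
    by (intro smooth1_mult smooth1_inner_cutoff smooth1_outer_cutoff) auto
  moreover have "bump_seq n r = 0" if "r \<notin> {1 / (real n + 1)..2 * (real n + 1)}" for r
    using that inner_cutoff_0[of "1 / (real n + 1)" r] outer_cutoff_0[of "real n + 1" r]
    by (auto simp: bump_seq_def)
  moreover have "1 / (real n + 1) < 2 * (real n + 1)"
    by (smt (verit) divide_le_eq_1_pos of_nat_0_le_iff)
  moreover have "0 < 1 / (real n + 1)" by simp
  ultimately show ?thesis unfolding bump_def by blast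
qed

lemma bump_seq_bounds: "0 \<le> bump_seq n r" "bump_seq n r \<le> 1"
  using cutoff_bounds by (auto simp: bump_seq_def mult_le_one)

lemma bump_seq_eventually_1: "0 < r \<Longrightarrow> \<forall>\<^sub>F n in sequentially. bump_seq n r = 1"
proof -
  assume r: "0 < r"
  have "(\<lambda>n. 2 * (1 / (real n + 1))) \<longlonglongrightarrow> 2 * 0"
    using LIMSEQ_inverse_real_of_nat by (intro tendsto_mult_left) (simp add: inverse_eq_divide add.commute)
  then have "\<forall>\<^sub>F n in sequentially. 2 * (1 / (real n + 1)) < r" using r by (intro order_tendstoD(2)) auto
  moreover have "\<forall>\<^sub>F n in sequentially. real n \<ge> r"
    using filterlim_real_sequentially by (simp add: filterlim_at_top)
  ultimately show ?thesis
    by eventually_elim (auto simp: bump_seq_def inner_cutoff_1 outer_cutoff_1)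
qed

subsection \<open>The radial system\<close>

lemma deriv_bound_diff:
  fixes H B :: "real \<Rightarrow> real"
  assumes "r \<le> \<rho>" and H: "\<And>s. r \<le> s \<Longrightarrow> s \<le> \<rho> \<Longrightarrow> (H has_field_derivative H' s) (at s)"
    and B: "\<And>s. r \<le> s \<Longrightarrow> s \<le> \<rho> \<Longrightarrow> (B has_field_derivative B' s) (at s)"
    and le: "\<And>s. r \<le> s \<Longrightarrow> s \<le> \<rho> \<Longrightarrow> \<bar>H' s\<bar> \<le> B' s"
  shows "\<bar>H \<rho> - H r\<bar> \<le> B \<rho> - B r"
proof -
  have "(\<lambda>s. B s - H s) r \<le> (\<lambda>s. B s - H s) \<rho>"
    by (rule DERIV_nonneg_imp_nondecreasing[OF assms(1)])
       (use DERIV_diff[OF B H] le abs_le_D1 in \<open>fastforce\<close>)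
  moreover have "(\<lambda>s. B s + H s) r \<le> (\<lambda>s. B s + H s) \<rho>"
  proof (rule DERIV_nonneg_imp_nondecreasing[OF assms(1)])
    fix s assume s: "r \<le> s" "s \<le> \<rho>"
    show "\<exists>y. ((\<lambda>s. B s + H s) has_real_derivative y) (at s) \<and> 0 \<le> y"
      using DERIV_add[OF B H, OF s s] le[OF s] by (intro exI[of _ "B' s + H' s"]) auto
  qed
  ultimately show ?thesis by auto
qed

lemma deriv_bound_from_0:
  fixes H B :: "real \<Rightarrow> real"
  assumes "0 < r" and H: "\<And>s. 0 < s \<Longrightarrow> s \<le> r \<Longrightarrow> (H has_field_derivative H' s) (at s)"
    and B: "\<And>s. 0 < s \<Longrightarrow> s \<le> r \<Longrightarrow> (B has_field_derivative B' s) (at s)"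
    and le: "\<And>s. 0 < s \<Longrightarrow> s \<le> r \<Longrightarrow> \<bar>H' s\<bar> \<le> B' s"
    and lim: "(H \<longlongrightarrow> l) (at_right 0)" "(B \<longlongrightarrow> b) (at_right 0)"
  shows "\<bar>H r - l\<bar> \<le> B r - b"
proof (rule tendsto_le[OF trivial_limit_at_right_real])
  show "((\<lambda>s. B r - B s) \<longlongrightarrow> B r - b) (at_right 0)" by (intro tendsto_intros lim)
  show "((\<lambda>s. \<bar>H r - H s\<bar>) \<longlongrightarrow> \<bar>H r - l\<bar>) (at_right 0)" by (intro tendsto_intros lim)
  have "\<bar>H r - H s\<bar> \<le> B r - B s" if "0 < s" "s < r" for s
    by (rule deriv_bound_diff[of s r H H' B B']) (use that H B le in auto)
  then show "\<forall>\<^sub>F s in at_right 0. \<bar>H r - H s\<bar> \<le> B r - B s"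
    using assms(1) unfolding eventually_at_right_field by blast
qed

lemma powr_tendsto_0: "0 < q \<Longrightarrow> ((\<lambda>r::real. r powr q) \<longlongrightarrow> 0) (at_right 0)"
proof -
  assume q: "0 < q"
  have ev: "\<forall>\<^sub>F x in at_right 0. (0::real) \<le> x" unfolding eventually_at_right_field by (intro exI[of _ 1]) auto
  have "((\<lambda>r::real. r powr q) \<longlongrightarrow> 0 powr q) (at_right 0)"
    by (rule tendsto_powr'[OF tendsto_ident_at tendsto_const]) (use q ev in simp)
  then show ?thesis by simp
qed

text \<open>Since q > 0 the bound on the derivative is integrable at 0, so H satisfies the Cauchy
  condition there.\<close>

lemma deriv_power_limit:
  fixes H :: "real \<Rightarrow> real"
  assumes "0 < \<rho>" "0 < q" and H: "\<And>s. 0 < s \<Longrightarrow> s \<le> \<rho> \<Longrightarrow> (H has_field_derivative H' s) (at s)"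
    and le: "\<And>s. 0 < s \<Longrightarrow> s \<le> \<rho> \<Longrightarrow> \<bar>H' s\<bar> \<le> c * s powr (q - 1)"
  obtains l where "(H \<longlongrightarrow> l) (at_right 0)"
proof -
  have diff: "\<bar>H t - H s\<bar> \<le> c / q * t powr q - c / q * s powr q" if "0 < s" "s \<le> t" "t \<le> \<rho>" for s t
  proof (rule deriv_bound_diff[OF that(2)])
    fix x assume x: "s \<le> x" "x \<le> t"
    then have x': "0 < x" "x \<le> \<rho>" using that by auto
    show "(H has_field_derivative H' x) (at x)" "\<bar>H' x\<bar> \<le> c * x powr (q - 1)" using H le x' by auto
    show "((\<lambda>s. c / q * s powr q) has_field_derivative c * x powr (q - 1)) (at x)"
      using DERIV_cmult[OF has_real_derivative_powr[OF x'(1), of q], of "c / q"] assms(2) by simp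
  qed
  have c: "0 \<le> c / q * s powr q" if "0 < s" "s \<le> \<rho>" for s
  proof -
    have "0 \<le> c * s powr (q - 1)" using le[OF that] by linarith
    then have "0 \<le> c" using that by (simp add: zero_le_mult_iff)
    then show ?thesis using assms(2) by simp
  qed
  \<comment> \<open>The limit is first found along one sequence tending to 0; the same power bound
    then carries it over to all small r.\<close>
  define s where "s n = \<rho> / (real n + 1)" for n
  have s: "0 < s n" "s n \<le> \<rho>" for n using assms(1) by (auto simp: s_def field_simps)
  have "(\<lambda>n. \<rho> * inverse (real (Suc n))) \<longlonglongrightarrow> \<rho> * 0"
    by (intro tendsto_mult_left LIMSEQ_inverse_real_of_nat)
  then have s0: "s \<longlonglongrightarrow> 0" by (simp add: s_def[abs_def] divide_inverse add.commute)
  have sr: "filterlim s (at_right 0) sequentially"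
    unfolding filterlim_at using s0 s(1) by (auto simp: less_imp_neq[THEN not_sym])
  have lim0: "((\<lambda>t. c / q * t powr q) \<longlongrightarrow> 0) (at_right 0)"
    using tendsto_mult_left[OF powr_tendsto_0[OF assms(2)], of "c / q"] by simp
  have "Cauchy (\<lambda>n. H (s n))"
  proof (rule CauchyI)
    fix e :: real assume "e > 0"
    from order_tendstoD(2)[OF filterlim_compose[OF lim0 sr] this]
    obtain k where k: "\<And>n. n \<ge> k \<Longrightarrow> c / q * s n powr q < e" by (auto simp: eventually_sequentially)
    have main: "\<bar>H (s m) - H (s n)\<bar> < e" if "m \<ge> k" "n \<ge> k" "s n \<le> s m" for m n
      using diff[OF s(1) that(3) s(2)] k[OF that(1)] c[OF s[of n]] by linarith
    have "norm (H (s m) - H (s n)) < e" if "m \<ge> k" "n \<ge> k" for m n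
      using main[of m n] main[of n m] that by (cases "s n \<le> s m") (auto simp: abs_minus_commute)
    then show "\<exists>M. \<forall>m\<ge>M. \<forall>n\<ge>M. norm (H (s m) - H (s n)) < e" by blast
  qed
  then obtain l where l: "(\<lambda>n. H (s n)) \<longlonglongrightarrow> l" by (auto simp: Cauchy_convergent_iff convergent_def)
  have bound: "\<bar>H r - l\<bar> \<le> c / q * r powr q" if r: "0 < r" "r \<le> \<rho>" for r
  proof (rule LIMSEQ_le_const2)
    show "(\<lambda>n. \<bar>H r - H (s n)\<bar>) \<longlonglongrightarrow> \<bar>H r - l\<bar>" by (intro tendsto_intros l)
    obtain k where k: "\<And>n. n \<ge> k \<Longrightarrow> s n < r" using order_tendstoD(2)[OF s0 r(1)] by (auto simp: eventually_sequentially)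
    have "\<bar>H r - H (s n)\<bar> \<le> c / q * r powr q" if "n \<ge> k" for n
      using diff[OF s(1) less_imp_le[OF k[OF that]] r(2)] c[OF s[of n]] by linarith
    then show "\<exists>N. \<forall>n\<ge>N. \<bar>H r - H (s n)\<bar> \<le> c / q * r powr q" by blast
  qed
  have "((\<lambda>r. H r - l) \<longlongrightarrow> 0) (at_right 0)"
  proof (rule Lim_null_comparison[OF _ lim0])
    show "\<forall>\<^sub>F r in at_right 0. norm (H r - l) \<le> c / q * r powr q"
      unfolding eventually_at_right_field using bound assms(1) by (intro exI[of _ \<rho>]) auto
  qed
  then show ?thesis using that LIM_zero_iff by blast
qed

lemma tendsto_at_right_bounded:
  fixes f :: "real \<Rightarrow> real"
  assumes "(f \<longlongrightarrow> l) (at_right 0)" "\<And>r. r > 0 \<Longrightarrow> isCont f r"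
  obtains M where "M > 0" "\<And>r. 0 < r \<Longrightarrow> r \<le> R \<Longrightarrow> \<bar>f r\<bar> \<le> M"
proof -
  have "\<forall>\<^sub>F r in at_right 0. dist (f r) l < 1" using assms(1) by (rule tendstoD) simp
  then obtain \<rho> where \<rho>: "\<rho> > 0" "\<And>r. 0 < r \<Longrightarrow> r < \<rho> \<Longrightarrow> dist (f r) l < 1"
    unfolding eventually_at_right_field by blast
  have "compact (f ` {\<rho>/2..R})"
    by (intro compact_continuous_image continuous_at_imp_continuous_on ballI assms) (use \<rho>(1) in auto)
  then obtain M where M: "\<forall>y\<in>f ` {\<rho>/2..R}. norm y \<le> M" using compact_imp_bounded bounded_iff by metis
  show ?thesis
  proof (rule that[of "max (\<bar>l\<bar> + 1) M"])
    fix r assume r: "0 < r" "r \<le> R"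
    show "\<bar>f r\<bar> \<le> max (\<bar>l\<bar> + 1) M"
    proof (cases "r < \<rho>")
      case True
      then show ?thesis using \<rho>(2)[of r] r by (auto simp: dist_real_def)
    next
      case False
      then have "norm (f r) \<le> M" using M r \<rho>(1) by auto
      then show ?thesis by simp
    qed
  qed auto
qed

lemma radial_sysD:
  assumes "radial_sys N \<alpha> f P g" "r > 0"
  shows "(f has_field_derivative r powr (1 - real N - \<alpha>) * P r) (at r)"
    "(P has_field_derivative r powr (real N - 1) * g r) (at r)"
  using assms by (auto simp: radial_sys_def)

lemma radial_sys_isCont:
  assumes "radial_sys N \<alpha> f P g" "r > 0" shows "isCont f r" "isCont P r"
  using radial_sysD[OF assms] DERIV_isCont by blast+

text \<open>The sign of the derivative is asked for only strictly below R. In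
  \<open>regular_sol_comparison\<close> R is the first radius at which a sign might be lost, so this
  is all that is available.\<close>

lemma mono_from_0:
  fixes H :: "real \<Rightarrow> real"
  assumes "0 < R" and H: "\<And>s. 0 < s \<Longrightarrow> s \<le> R \<Longrightarrow> (H has_field_derivative H' s) (at s)"
    and nn: "\<And>s. 0 < s \<Longrightarrow> s < R \<Longrightarrow> 0 \<le> H' s" and lim: "(H \<longlongrightarrow> l) (at_right 0)"
    and r: "0 < r" "r \<le> R"
  shows "l \<le> H r"
proof (rule tendsto_upperbound[OF lim])
  have "H s \<le> H r" if s: "0 < s" "s < r" for s
  proof -
    obtain z where "z > s" "z < r" "H r - H s = (r - s) * H' z"
      using MVT2[of s r H H'] s r H by force
    then show ?thesis using nn[of z] s r by (simp add: zero_le_mult_iff) (smt (verit) mult_nonneg_nonneg)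
  qed
  then show "\<forall>\<^sub>F s in at_right 0. H s \<le> H r" using r unfolding eventually_at_right_field by blast
qed simp

lemma nonlin_minus: "nonlin N \<alpha> (- t) = - nonlin N \<alpha> t"
  by (simp add: nonlin_def)

context weight_range
begin

section \<open>Exponents and the nonlinearity\<close>

text \<open>\<open>aexp\<close> is the exponent of the scaling \<lambda>^aexp u(\<lambda> x).
  \<open>bexp\<close> is the power of r gained by solving one weighted second-order equation, and
  |u|^pexp is the potential when the nonlinearity is written as potential times u.\<close>

definition aexp :: real where "aexp = (real N - 4 + 2 * \<alpha>) / 2"
definition bexp :: real where "bexp = 2 - \<alpha>"
definition pexp :: real where "pexp = crit_exp N \<alpha> - 2"

text \<open>The fifth identity is criticality: for u of size r^-aexp the potential has size r^(-2
  bexp), and two successive solves of the system gain exactly r^(2 bexp).\<close>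

lemma exps: "aexp > 0" "bexp > 0" "pexp > 0" "real N = 2 * aexp + 2 * bexp"
  "aexp * pexp = 2 * bexp" "1 - real N - \<alpha> = -1 - 2 * aexp - bexp" "\<alpha> = 2 - bexp"
  using N_alpha alpha_upper by (auto simp: aexp_def bexp_def pexp_def crit_exp_def field_simps)

lemma nonlin_eq: "nonlin N \<alpha> t = \<bar>t\<bar> powr pexp * t"
  by (simp add: nonlin_def pexp_def)

lemma abs_nonlin: "\<bar>nonlin N \<alpha> t\<bar> = \<bar>t\<bar> powr pexp * \<bar>t\<bar>" "\<bar>nonlin N \<alpha> t\<bar> = \<bar>t\<bar> powr (pexp + 1)"
  by (auto simp: nonlin_eq abs_mult powr_add)

lemma nonlin_mono: assumes "x \<le> y" shows "nonlin N \<alpha> x \<le> nonlin N \<alpha> y"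
proof -
  have pos: "nonlin N \<alpha> x \<le> nonlin N \<alpha> y" if "0 \<le> x" "x \<le> y" for x y
    using that exps(3) unfolding nonlin_eq by (intro mult_mono powr_mono2) auto
  have sg: "0 \<le> nonlin N \<alpha> x" if "0 \<le> x" for x using that by (simp add: nonlin_eq)
  consider "0 \<le> x" | "y \<le> 0" | "x \<le> 0" "0 \<le> y" by linarith
  then show ?thesis
  proof cases
    case 1 then show ?thesis using pos assms by blast
  next
    case 2 then show ?thesis using pos[of "-y" "-x"] assms by (simp add: nonlin_minus)
  next
    case 3 then show ?thesis using sg[of y] sg[of "-x"] by (simp add: nonlin_minus)
  qed
qed

lemma nonlin_continuous: "isCont (nonlin N \<alpha>) t"
proof -
  have "continuous_on UNIV (\<lambda>t. \<bar>t\<bar> powr pexp * t)"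
    using exps(3) by (intro continuous_on_mult continuous_on_powr' continuous_intros) auto
  then show ?thesis unfolding nonlin_eq[abs_def] by (simp add: continuous_on_eq_continuous_at)
qed

text \<open>The derivative is (pexp + 1) |t|^pexp, bounded on bounded sets because pexp > 0, even
  when pexp < 1. The mean value theorem treats two arguments of the same sign; arguments of opposite
  signs are joined through 0.\<close>

lemma nonlin_Lipschitz:
  assumes "M > 0"
  obtains L where "L \<ge> 1" "\<And>x y. \<bar>x\<bar> \<le> M \<Longrightarrow> \<bar>y\<bar> \<le> M \<Longrightarrow> \<bar>nonlin N \<alpha> x - nonlin N \<alpha> y\<bar> \<le> L * \<bar>x - y\<bar>"
proof -
  \<comment> \<open>At least 1, so that in \<open>regular_sol_initial_unique\<close> the same factor
    also covers the equation whose source enters with coefficient 1.\<close>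
  define L where "L = max 1 ((pexp + 1) * M powr pexp)"
  have L1: "M powr pexp \<le> L" using exps(3) by (simp add: L_def le_max_iff_disj) (smt (verit) mult_le_cancel_right1 powr_ge_zero)
  have pos: "\<bar>nonlin N \<alpha> x - nonlin N \<alpha> y\<bar> \<le> L * \<bar>x - y\<bar>" if xy: "0 \<le> x" "x < y" "y \<le> M" for x y
  proof -
    have c: "continuous_on {x..y} (\<lambda>t. t powr (pexp + 1))"
      using xy exps(3) by (intro continuous_on_powr' continuous_intros) auto
    have d: "((\<lambda>t. t powr (pexp + 1)) has_derivative (\<lambda>h. (pexp + 1) * t powr pexp * h)) (at t)" if "x < t" "t < y" for t
    proof -
      have "((\<lambda>t. t powr (pexp + 1)) has_field_derivative (pexp + 1) * t powr (pexp + 1 - 1)) (at t)"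
        using that xy by (intro has_real_derivative_powr) auto
      then show ?thesis by (simp add: has_field_derivative_def)
    qed
    obtain z where z: "x < z" "z < y" "y powr (pexp + 1) - x powr (pexp + 1) = (pexp + 1) * z powr pexp * (y - x)"
      using mvt[OF xy(2) c d] by blast
    have "nonlin N \<alpha> t = t powr (pexp + 1)" if "0 \<le> t" for t using that by (simp add: nonlin_eq powr_add)
    then have "\<bar>nonlin N \<alpha> x - nonlin N \<alpha> y\<bar> = \<bar>(pexp + 1) * z powr pexp * (y - x)\<bar>"
      using xy z(3) by (simp add: abs_minus_commute)
    also have "\<dots> = (pexp + 1) * z powr pexp * \<bar>x - y\<bar>" using exps(3) xy by (simp add: abs_mult)
    also have "(pexp + 1) * z powr pexp \<le> (pexp + 1) * M powr pexp"
      using exps(3) xy z by (intro mult_left_mono powr_mono2) auto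
    also have "\<dots> \<le> L" by (simp add: L_def)
    finally show ?thesis by (simp add: mult_right_mono)
  qed
  have small: "\<bar>nonlin N \<alpha> t\<bar> \<le> L * \<bar>t\<bar>" if "\<bar>t\<bar> \<le> M" for t
  proof -
    have "\<bar>t\<bar> powr pexp \<le> M powr pexp" using that exps(3) by (intro powr_mono2) auto
    then show ?thesis unfolding abs_nonlin(1) using L1 by (intro mult_right_mono) auto
  qed
  have le: "\<bar>nonlin N \<alpha> x - nonlin N \<alpha> y\<bar> \<le> L * \<bar>x - y\<bar>" if "\<bar>x\<bar> \<le> M" "\<bar>y\<bar> \<le> M" "x \<le> y" for x y
  proof -
    consider "x = y" | "0 \<le> x" "x < y" | "y \<le> 0" "x < y" | "x \<le> 0" "0 \<le> y" using \<open>x \<le> y\<close> by linarith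
    then show ?thesis
    proof cases
      case 1 then show ?thesis by simp
    next
      case 2 then show ?thesis using pos that by auto
    next
      case 3 then show ?thesis using pos[of "-y" "-x"] that by (simp add: nonlin_minus abs_minus_commute)
    next
      case 4
      have "\<bar>nonlin N \<alpha> x - nonlin N \<alpha> y\<bar> \<le> L * \<bar>x\<bar> + L * \<bar>y\<bar>" using small[of x] small[of y] that by linarith
      also have "\<dots> = L * \<bar>x - y\<bar>" using 4 by (simp add: algebra_simps)
      finally show ?thesis .
    qed
  qed
  show ?thesis
  proof (rule that[of L])
    show "L \<ge> 1" by (simp add: L_def)
    fix x y assume "\<bar>x\<bar> \<le> M" "\<bar>y\<bar> \<le> M"
    then show "\<bar>nonlin N \<alpha> x - nonlin N \<alpha> y\<bar> \<le> L * \<bar>x - y\<bar>"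
      using le[of x y] le[of y x] by (cases "x \<le> y") (auto simp: abs_minus_commute)
  qed
qed

section \<open>Uniqueness for the initial value problem at the singular point 0\<close>

text \<open>Vanishing fluxes exclude point sources at the origin; together with the limits f0 and g0
  they are the initial data of the system at its singular point.\<close>

definition regular_sol :: "(real \<Rightarrow> real) \<Rightarrow> (real \<Rightarrow> real) \<Rightarrow> (real \<Rightarrow> real) \<Rightarrow> (real \<Rightarrow> real) \<Rightarrow> real \<Rightarrow> real \<Rightarrow> bool" where
  "regular_sol f P g Q f0 g0 \<longleftrightarrow> radial_sys N \<alpha> f P g \<and> radial_sys N \<alpha> g Q (\<lambda>r. nonlin N \<alpha> (f r)) \<and>
     (P \<longlongrightarrow> 0) (at_right 0) \<and> (Q \<longlongrightarrow> 0) (at_right 0) \<and> (f \<longlongrightarrow> f0) (at_right 0) \<and> (g \<longlongrightarrow> g0) (at_right 0)"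

text \<open>If two solutions agree at the origin but \<open>g0 < g0'\<close>, the difference of the \<open>g\<close>s can never
  decrease: as long as it is positive, so are all the other differences.\<close>

lemma regular_sol_comparison:
  assumes s1: "regular_sol f1 P1 g1 Q1 f0 c1" and s2: "regular_sol f2 P2 g2 Q2 f0 c2"
    and less: "c1 < c2" and r1: "r1 > 0"
  shows "(c2 - c1) / 2 \<le> g2 r1 - g1 r1"
proof (rule ccontr)
  \<comment> \<open>Half the initial gap: positive, yet strictly below the limit of the gap at
    0.\<close>
  define m where "m = (c2 - c1) / 2"
  assume "\<not> (c2 - c1) / 2 \<le> g2 r1 - g1 r1"
  then have bad: "g2 r1 - g1 r1 \<le> m" by (simp add: m_def)
  have sys: "radial_sys N \<alpha> f1 P1 g1" "radial_sys N \<alpha> g1 Q1 (\<lambda>r. nonlin N \<alpha> (f1 r))"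
    "radial_sys N \<alpha> f2 P2 g2" "radial_sys N \<alpha> g2 Q2 (\<lambda>r. nonlin N \<alpha> (f2 r))"
    using s1 s2 by (auto simp: regular_sol_def)
  have lim: "((\<lambda>r. f2 r - f1 r) \<longlongrightarrow> f0 - f0) (at_right 0)" "((\<lambda>r. P2 r - P1 r) \<longlongrightarrow> 0 - 0) (at_right 0)"
    "((\<lambda>r. g2 r - g1 r) \<longlongrightarrow> c2 - c1) (at_right 0)" "((\<lambda>r. Q2 r - Q1 r) \<longlongrightarrow> 0 - 0) (at_right 0)"
    using s1 s2 unfolding regular_sol_def by (intro tendsto_diff; blast)+
  have gc: "isCont (\<lambda>r. g2 r - g1 r) r" if "r > 0" for r
    using radial_sys_isCont(1)[OF sys(2) that] radial_sys_isCont(1)[OF sys(4) that] by (intro continuous_diff)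
  have "m < c2 - c1" using less by (simp add: m_def)
  from order_tendstoD(1)[OF lim(3) this]
  obtain \<rho> where \<rho>: "\<rho> > 0" "\<And>r. 0 < r \<Longrightarrow> r < \<rho> \<Longrightarrow> m < g2 r - g1 r"
    unfolding eventually_at_right_field by blast
  have \<rho>1: "\<rho> \<le> r1" using \<rho>(2)[OF r1] bad by force
  \<comment> \<open>The radii at which the gap has shrunk to m or less. S is compact and nonempty,
    so there is a first such radius R.\<close>
  define S where "S = {\<rho>..r1} \<inter> {r. g2 r - g1 r \<le> m}"
  have "continuous_on {\<rho>..r1} (\<lambda>r. g2 r - g1 r)"
    using gc \<rho>(1) by (intro continuous_at_imp_continuous_on) auto
  then have "closed ({\<rho>..r1} \<inter> (\<lambda>r. g2 r - g1 r) -` {..m})"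
    by (intro continuous_closed_preimage) auto
  then have "closed S" by (simp add: S_def vimage_def)
  then have "compact S" using compact_Int_closed[OF compact_Icc, of S \<rho> r1] by (simp add: S_def Int_absorb1 Int_assoc[symmetric])
  moreover have "r1 \<in> S" using \<rho>1 bad by (simp add: S_def)
  ultimately obtain R where R: "R \<in> S" "\<And>r. r \<in> S \<Longrightarrow> R \<le> r"
    using compact_attains_inf[of S] by blast
  have R0: "R > 0" "R \<le> r1" "g2 R - g1 R \<le> m" "\<rho> \<le> R" using R(1) \<rho>(1) by (auto simp: S_def)
  have h: "m < g2 r - g1 r" if "0 < r" "r < R" for r
  proof (cases "r < \<rho>")
    case False
    then have "r \<notin> S" using R(2)[of r] that by auto
    then show ?thesis using False that R0 by (auto simp: S_def)
  qed (use \<rho>(2) that in auto)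
  have mpos: "m > 0" using less by (simp add: m_def)
  \<comment> \<open>Up to R the positivity travels once around the system: from the gap of g to that
    of P, to that of f, through monotonicity of the nonlinearity to that of Q, and back to g, whose
    gap is thus at least its initial value c2 - c1 at R, contrary to the choice of R.\<close>
  have p: "0 \<le> P2 r - P1 r" if "0 < r" "r \<le> R" for r
  proof -
    have "0 - 0 \<le> P2 r - P1 r"
    proof (rule mono_from_0[OF R0(1) _ _ lim(2) that])
      fix s :: real assume s: "0 < s"
      show "((\<lambda>r. P2 r - P1 r) has_field_derivative s powr (real N - 1) * g2 s - s powr (real N - 1) * g1 s) (at s)"
        by (intro DERIV_diff radial_sysD(2)[OF sys(3) s] radial_sysD(2)[OF sys(1) s])
      assume "s < R"
      then have "0 \<le> s powr (real N - 1) * (g2 s - g1 s)" using h[OF s] mpos by (intro mult_nonneg_nonneg) auto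
      then show "0 \<le> s powr (real N - 1) * g2 s - s powr (real N - 1) * g1 s" by (simp add: algebra_simps)
    qed
    then show ?thesis by simp
  qed
  have d: "0 \<le> f2 r - f1 r" if "0 < r" "r \<le> R" for r
  proof -
    have "f0 - f0 \<le> f2 r - f1 r"
    proof (rule mono_from_0[OF R0(1) _ _ lim(1) that])
      fix s :: real assume s: "0 < s"
      show "((\<lambda>r. f2 r - f1 r) has_field_derivative s powr (1 - real N - \<alpha>) * P2 s - s powr (1 - real N - \<alpha>) * P1 s) (at s)"
        by (intro DERIV_diff radial_sysD(1)[OF sys(3) s] radial_sysD(1)[OF sys(1) s])
      assume "s < R"
      then have "0 \<le> s powr (1 - real N - \<alpha>) * (P2 s - P1 s)" using p[OF s] by (intro mult_nonneg_nonneg) auto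
      then show "0 \<le> s powr (1 - real N - \<alpha>) * P2 s - s powr (1 - real N - \<alpha>) * P1 s" by (simp add: algebra_simps)
    qed
    then show ?thesis by simp
  qed
  have q: "0 \<le> Q2 r - Q1 r" if "0 < r" "r \<le> R" for r
  proof -
    have "0 - 0 \<le> Q2 r - Q1 r"
    proof (rule mono_from_0[OF R0(1) _ _ lim(4) that])
      fix s :: real assume s: "0 < s"
      show "((\<lambda>r. Q2 r - Q1 r) has_field_derivative s powr (real N - 1) * nonlin N \<alpha> (f2 s) - s powr (real N - 1) * nonlin N \<alpha> (f1 s)) (at s)"
        by (intro DERIV_diff radial_sysD(2)[OF sys(4) s] radial_sysD(2)[OF sys(2) s])
      assume "s < R"
      then have "0 \<le> s powr (real N - 1) * (nonlin N \<alpha> (f2 s) - nonlin N \<alpha> (f1 s))"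
        using nonlin_mono[of "f1 s" "f2 s"] d[OF s] by (intro mult_nonneg_nonneg) auto
      then show "0 \<le> s powr (real N - 1) * nonlin N \<alpha> (f2 s) - s powr (real N - 1) * nonlin N \<alpha> (f1 s)" by (simp add: algebra_simps)
    qed
    then show ?thesis by simp
  qed
  have "c2 - c1 \<le> g2 R - g1 R"
  proof (rule mono_from_0[OF R0(1) _ _ lim(3) R0(1)])
    fix s :: real assume s: "0 < s"
    show "((\<lambda>r. g2 r - g1 r) has_field_derivative s powr (1 - real N - \<alpha>) * Q2 s - s powr (1 - real N - \<alpha>) * Q1 s) (at s)"
      by (intro DERIV_diff radial_sysD(1)[OF sys(4) s] radial_sysD(1)[OF sys(2) s])
    assume "s < R"
    then have "0 \<le> s powr (1 - real N - \<alpha>) * (Q2 s - Q1 s)" using q[OF s] by (intro mult_nonneg_nonneg) auto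
    then show "0 \<le> s powr (1 - real N - \<alpha>) * Q2 s - s powr (1 - real N - \<alpha>) * Q1 s" by (simp add: algebra_simps)
  qed simp
  then show False using R0(3) less by (simp add: m_def)
qed

lemma powr_N_bound:
  assumes "0 < s" shows "s powr (real N - 1) * s powr (real k * bexp) = s powr (real N + real k * bexp - 1)"
    "s powr (1 - real N - \<alpha>) * s powr (real N + real k * bexp) = s powr (real (Suc k) * bexp - 1)"
proof -
  have e: "real N - 1 + real k * bexp = real N + real k * bexp - 1"
    "1 - real N - \<alpha> + (real N + real k * bexp) = real (Suc k) * bexp - 1"
    using exps(7) by (auto simp: algebra_simps)
  show "s powr (real N - 1) * s powr (real k * bexp) = s powr (real N + real k * bexp - 1)"
    "s powr (1 - real N - \<alpha>) * s powr (real N + real k * bexp) = s powr (real (Suc k) * bexp - 1)"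
    by (simp_all only: powr_add[symmetric] e)
qed

text \<open>One solve of the system raises the power by bexp. Integrating the source gives a
  denominator N + k bexp, which is weakened to N; integrating the flux gives (k + 1) bexp, which is
  kept because it builds the factorial in the iteration below.\<close>

lemma radial_sys_power_bound:
  assumes "0 < R" and d: "\<And>s. 0 < s \<Longrightarrow> (d has_field_derivative s powr (1 - real N - \<alpha>) * p s) (at s)"
    and p: "\<And>s. 0 < s \<Longrightarrow> (p has_field_derivative s powr (real N - 1) * h s) (at s)"
    and lim: "(d \<longlongrightarrow> 0) (at_right 0)" "(p \<longlongrightarrow> 0) (at_right 0)"
    and h: "\<And>s. 0 < s \<Longrightarrow> s \<le> R \<Longrightarrow> \<bar>h s\<bar> \<le> A * s powr (real k * bexp)" and A: "A \<ge> 0"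
    and r: "0 < r" "r \<le> R"
  shows "\<bar>d r\<bar> \<le> A / (real N * bexp * real (Suc k)) * r powr (real (Suc k) * bexp)"
proof -
  have kb: "real k * bexp \<ge> 0" "real (Suc k) * bexp > 0" using exps by auto
  have Nk: "real N \<le> real N + real k * bexp" "real N > 0" using kb N_pos by auto
  have P: "\<bar>p s\<bar> \<le> A / real N * s powr (real N + real k * bexp)" if s: "0 < s" "s \<le> R" for s
  proof -
    have "\<bar>p s - 0\<bar> \<le> A / (real N + real k * bexp) * s powr (real N + real k * bexp) - 0"
    proof (rule deriv_bound_from_0[OF s(1) p _ _ lim(2)])
      fix t assume t: "0 < t" "t \<le> s"
      show "((\<lambda>s. A / (real N + real k * bexp) * s powr (real N + real k * bexp)) has_field_derivative
           A * t powr (real N + real k * bexp - 1)) (at t)"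
        using t Nk by (auto intro!: derivative_eq_intros simp: powr_diff)
      have "\<bar>t powr (real N - 1) * h t\<bar> \<le> t powr (real N - 1) * (A * t powr (real k * bexp))"
        using h[of t] t s by (simp add: abs_mult mult_left_mono)
      also have "\<dots> = A * t powr (real N + real k * bexp - 1)" using powr_N_bound(1)[OF t(1), of k] by (simp add: mult_ac)
      finally show "\<bar>t powr (real N - 1) * h t\<bar> \<le> A * t powr (real N + real k * bexp - 1)" .
    next
      show "((\<lambda>s. A / (real N + real k * bexp) * s powr (real N + real k * bexp)) \<longlongrightarrow> 0) (at_right 0)"
        using tendsto_mult_left[OF powr_tendsto_0, of "real N + real k * bexp" "A / (real N + real k * bexp)"] Nk by simp
    qed
    also have "A / (real N + real k * bexp) * s powr (real N + real k * bexp) - 0 \<le> A / real N * s powr (real N + real k * bexp)"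
      using Nk A by (simp add: mult_right_mono divide_left_mono)
    finally show ?thesis by simp
  qed
  have "\<bar>d r - 0\<bar> \<le> A / (real N * bexp * real (Suc k)) * r powr (real (Suc k) * bexp) - 0"
  proof (rule deriv_bound_from_0[OF r(1) d _ _ lim(1)])
    fix t assume t: "0 < t" "t \<le> r"
    show "((\<lambda>s. A / (real N * bexp * real (Suc k)) * s powr (real (Suc k) * bexp)) has_field_derivative
         A / real N * t powr (real (Suc k) * bexp - 1)) (at t)"
      using DERIV_cmult[OF has_real_derivative_powr[OF t(1), of "real (Suc k) * bexp"], of "A / (real N * bexp * real (Suc k))"] kb Nk exps(2)
      by (simp add: field_simps del: of_nat_Suc)
    have "\<bar>t powr (1 - real N - \<alpha>) * p t\<bar> \<le> t powr (1 - real N - \<alpha>) * (A / real N * t powr (real N + real k * bexp))"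
      unfolding abs_mult using P[of t] t r by (intro mult_mono) auto
    also have "\<dots> = A / real N * t powr (real (Suc k) * bexp - 1)" using powr_N_bound(2)[OF t(1), of k] by (simp add: mult_ac)
    finally show "\<bar>t powr (1 - real N - \<alpha>) * p t\<bar> \<le> A / real N * t powr (real (Suc k) * bexp - 1)" .
  next
    show "((\<lambda>s. A / (real N * bexp * real (Suc k)) * s powr (real (Suc k) * bexp)) \<longlongrightarrow> 0) (at_right 0)"
      using tendsto_mult_left[OF powr_tendsto_0[OF kb(2)], of "A / (real N * bexp * real (Suc k))"] by simp
  qed
  then show ?thesis by simp
qed

text \<open>Picard iteration at the singular point. Feeding the Lipschitz bound k times into
  \<open>radial_sys_power_bound\<close> bounds the differences by M times the k-th term of the
  exponential series of K r^bexp, and these terms tend to 0.\<close>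

lemma regular_sol_initial_unique:
  assumes s1: "regular_sol f1 P1 g1 Q1 f0 g0" and s2: "regular_sol f2 P2 g2 Q2 f0 g0" and R: "R > 0"
  shows "f1 R = f2 R"
proof -
  have sys: "radial_sys N \<alpha> f1 P1 g1" "radial_sys N \<alpha> g1 Q1 (\<lambda>r. nonlin N \<alpha> (f1 r))"
    "radial_sys N \<alpha> f2 P2 g2" "radial_sys N \<alpha> g2 Q2 (\<lambda>r. nonlin N \<alpha> (f2 r))"
    using s1 s2 by (auto simp: regular_sol_def)
  have lims: "(f1 \<longlongrightarrow> f0) (at_right 0)" "(f2 \<longlongrightarrow> f0) (at_right 0)" "(g1 \<longlongrightarrow> g0) (at_right 0)" "(g2 \<longlongrightarrow> g0) (at_right 0)"
    using s1 s2 by (auto simp: regular_sol_def)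
  define d p h q where "d r = f2 r - f1 r" and "p r = P2 r - P1 r" and "h r = g2 r - g1 r" and "q r = Q2 r - Q1 r" for r
  have "(d \<longlongrightarrow> f0 - f0) (at_right 0)" "(p \<longlongrightarrow> 0 - 0) (at_right 0)" "(h \<longlongrightarrow> g0 - g0) (at_right 0)" "(q \<longlongrightarrow> 0 - 0) (at_right 0)"
    unfolding d_def p_def h_def q_def using s1 s2 unfolding regular_sol_def by (intro tendsto_diff; blast)+
  then have lim: "(d \<longlongrightarrow> 0) (at_right 0)" "(p \<longlongrightarrow> 0) (at_right 0)" "(h \<longlongrightarrow> 0) (at_right 0)" "(q \<longlongrightarrow> 0) (at_right 0)"
    by simp_all
  have dd: "(d has_field_derivative s powr (1 - real N - \<alpha>) * p s) (at s)"
    "(p has_field_derivative s powr (real N - 1) * h s) (at s)"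
    "(h has_field_derivative s powr (1 - real N - \<alpha>) * q s) (at s)"
    "(q has_field_derivative s powr (real N - 1) * (nonlin N \<alpha> (f2 s) - nonlin N \<alpha> (f1 s))) (at s)" if "s > 0" for s
    unfolding d_def p_def h_def q_def right_diff_distrib
    by (intro DERIV_diff radial_sysD[OF sys(1) that] radial_sysD[OF sys(2) that] radial_sysD[OF sys(3) that] radial_sysD[OF sys(4) that])+
  obtain M1 where M1: "M1 > 0" "\<And>r. 0 < r \<Longrightarrow> r \<le> R \<Longrightarrow> \<bar>f1 r\<bar> \<le> M1"
    using tendsto_at_right_bounded[OF lims(1) radial_sys_isCont(1)[OF sys(1)]] by metis
  obtain M2 where M2: "M2 > 0" "\<And>r. 0 < r \<Longrightarrow> r \<le> R \<Longrightarrow> \<bar>f2 r\<bar> \<le> M2"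
    using tendsto_at_right_bounded[OF lims(2) radial_sys_isCont(1)[OF sys(3)]] by metis
  obtain M3 where M3: "M3 > 0" "\<And>r. 0 < r \<Longrightarrow> r \<le> R \<Longrightarrow> \<bar>d r\<bar> \<le> M3"
    using tendsto_at_right_bounded[OF lim(1) DERIV_isCont[OF dd(1)]] by metis
  obtain M4 where M4: "M4 > 0" "\<And>r. 0 < r \<Longrightarrow> r \<le> R \<Longrightarrow> \<bar>h r\<bar> \<le> M4"
    using tendsto_at_right_bounded[OF lim(3) DERIV_isCont[OF dd(3)]] by metis
  obtain L where L: "L \<ge> 1" "\<And>x y. \<bar>x\<bar> \<le> max M1 M2 \<Longrightarrow> \<bar>y\<bar> \<le> max M1 M2 \<Longrightarrow> \<bar>nonlin N \<alpha> x - nonlin N \<alpha> y\<bar> \<le> L * \<bar>x - y\<bar>"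
    using nonlin_Lipschitz[of "max M1 M2"] M1(1) by (metis max.strict_coboundedI1)
  define M where "M = max M3 M4"
  define K where "K = L / (real N * bexp)"
  have K: "K > 0" "M > 0" using L(1) N_pos exps(2) M3(1) by (auto simp: K_def M_def)
  have ind: "\<bar>d r\<bar> \<le> M * K ^ k / fact k * r powr (real k * bexp) \<and> \<bar>h r\<bar> \<le> M * K ^ k / fact k * r powr (real k * bexp)"
    if "0 < r" "r \<le> R" for r k
    using that
  proof (induction k arbitrary: r)
    case 0
    then show ?case using M3(2)[of r] M4(2)[of r] by (auto simp: M_def le_max_iff_disj)
  next
    case (Suc k)
    define A where "A = M * K ^ k / fact k"
    have A: "0 \<le> A" using K by (simp add: A_def)
    have AL: "A \<le> L * A" using mult_right_mono[OF L(1) A] by simp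
    have IH: "\<bar>d s\<bar> \<le> A * s powr (real k * bexp)" "\<bar>h s\<bar> \<le> A * s powr (real k * bexp)" if "0 < s" "s \<le> R" for s
      using Suc.IH[OF that] by (auto simp: A_def)
    have F: "\<bar>nonlin N \<alpha> (f2 s) - nonlin N \<alpha> (f1 s)\<bar> \<le> (L * A) * s powr (real k * bexp)" if s: "0 < s" "s \<le> R" for s
    proof -
      have "\<bar>nonlin N \<alpha> (f2 s) - nonlin N \<alpha> (f1 s)\<bar> \<le> L * \<bar>d s\<bar>"
        unfolding d_def using M1(2)[OF s] M2(2)[OF s] by (intro L(2)) auto
      also have "\<dots> \<le> L * (A * s powr (real k * bexp))" using IH(1)[OF s] L(1) by (intro mult_left_mono) auto
      finally show ?thesis by (simp add: mult.assoc)
    qed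
    have eq: "L * A / (real N * bexp * real (Suc k)) = M * K ^ Suc k / fact (Suc k)"
      by (simp add: A_def K_def field_simps)
    have H: "\<bar>h s\<bar> \<le> (L * A) * s powr (real k * bexp)" if "0 < s" "s \<le> R" for s
    proof -
      have "A * s powr (real k * bexp) \<le> (L * A) * s powr (real k * bexp)" using AL by (intro mult_right_mono) auto
      then show ?thesis using IH(2)[OF that] by linarith
    qed
    have LA: "L * A \<ge> 0" using A AL by linarith
    show ?case
      using radial_sys_power_bound[OF R dd(1,2) lim(1,2) H LA Suc.prems]
        radial_sys_power_bound[OF R dd(3,4) lim(3,4) F LA Suc.prems]
      unfolding eq by blast
  qed
  have "d R = 0"
  proof -
    have "\<bar>d R\<bar> \<le> M * ((K * R powr bexp) ^ k /\<^sub>R fact k)" for k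
    proof -
      have "R powr (real k * bexp) = (R powr bexp) ^ k" using R by (simp add: powr_power)
      then show ?thesis using ind[OF R order_refl, of k]
        by (simp add: power_mult_distrib divide_inverse mult_ac)
    qed
    moreover have "(\<lambda>k. M * ((K * R powr bexp) ^ k /\<^sub>R fact k)) \<longlonglongrightarrow> M * 0"
      by (intro tendsto_mult_left summable_LIMSEQ_zero[OF summable_exp_generic])
    ultimately have "\<bar>d R\<bar> \<le> M * 0" by (intro LIMSEQ_le_const) auto
    then show ?thesis by simp
  qed
  then show ?thesis by (simp add: d_def)
qed

lemma regular_sol_unique:
  assumes s1: "regular_sol f1 P1 g1 Q1 f0 c1" and s2: "regular_sol f2 P2 g2 Q2 f0 c2"
    and L1: "(\<lambda>x::real^'n. g1 (norm x)) \<in> L2 lborel" and L2: "(\<lambda>x::real^'n. g2 (norm x)) \<in> L2 lborel"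
    and r: "r > 0"
  shows "f1 r = f2 r"
proof -
  have no: False if g: "\<And>r. r > 0 \<Longrightarrow> m \<le> g' r - g r" "m > 0" and L: "(\<lambda>x::real^'n. g (norm x)) \<in> L2 lborel" "(\<lambda>x::real^'n. g' (norm x)) \<in> L2 lborel"
    for g g' :: "real \<Rightarrow> real" and m
  proof -
    have i: "integrable lborel (\<lambda>x::real^'n. (g' (norm x) - g (norm x))\<^sup>2)"
      by (rule L2_integrable_sq[OF L2_diff[OF L(2,1)]])
    have "integrable lborel (\<lambda>x::real^'n. m\<^sup>2)"
    proof (rule Bochner_Integration.integrable_bound[OF i])
      show "AE x::real^'n in lborel. norm (m\<^sup>2) \<le> norm ((g' (norm x) - g (norm x))\<^sup>2)"
        using AE_lborel_not_zero by eventually_elim (use g in \<open>auto intro!: power_mono\<close>)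
    qed simp
    then show False using g(2) by (simp add: integrable_iff_bounded ennreal_mult_top)
  qed
  consider "c1 < c2" | "c2 < c1" | "c1 = c2" by linarith
  then show ?thesis
  proof cases
    case 1
    then show ?thesis using no[OF regular_sol_comparison[OF s1 s2 1] _ L1 L2] by auto
  next
    case 2
    then show ?thesis using no[OF regular_sol_comparison[OF s2 s1 2] _ L2 L1] by auto
  next
    case 3
    then show ?thesis using regular_sol_initial_unique[OF s1 _ r] s2 by blast
  qed
qed

end

subsection \<open>From weak solutions to the radial system\<close>

lemma L2_locally_integrable:
  fixes h :: "real^'n \<Rightarrow> real"
  assumes h: "h \<in> L2 lborel"
  shows "h absolutely_integrable_on cball 0 R"
proof (subst set_integrable_lborel_iff_lebesgue)
  have "(\<lambda>x::real^'n. indicator (cball 0 R) x) \<in> L2 lborel"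
    by (rule bounded_ball_L2[of _ 1 R]) (auto intro!: borel_measurable_indicator)
  from L2_mult_integrable[OF this h] show "integrable lborel (\<lambda>x. indicator (cball 0 R) x * h x)" .
qed (use L2_measurable[OF h] in auto)

lemma ball_integral_tendsto_0:
  fixes F :: "real^'n \<Rightarrow> real"
  assumes "\<And>R. F absolutely_integrable_on cball 0 R"
  shows "(ball_integral F \<longlongrightarrow> 0) (at_right 0)"
proof -
  have "AE x in lebesgue. indicator (cball (0::real^'n) 0) x * F x = 0"
    using AE_norm_neq[of 0] by eventually_elim auto
  then have "ball_integral F 0 = 0"
    unfolding ball_integral_def by (rule integral_eq_zero_AE)
  then show ?thesis
    using ball_integral_isCont[OF assms, of 0] by (auto simp: isCont_def intro: tendsto_within_subset)
qed

lemma locally_integrable_cong_AE: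
  fixes F G :: "real^'n \<Rightarrow> real"
  assumes ae: "AE x in lebesgue. F x = G x" and F: "\<And>R. F absolutely_integrable_on cball 0 R"
  shows "G absolutely_integrable_on cball 0 s" "ball_integral F s = ball_integral G s"
proof -
  have i: "integrable lebesgue (\<lambda>x. indicator (cball 0 s) x * F x)" using F by (simp add: set_integrable_def)
  have ae': "AE x in lebesgue. indicator (cball 0 s) x * F x = indicator (cball 0 s) x * G x"
    using ae by eventually_elim simp
  have m: "(\<lambda>x. indicator (cball 0 s) x * G x) \<in> borel_measurable lebesgue"
    by (rule borel_measurable_AE[OF borel_measurable_integrable[OF i] ae'])
  show "G absolutely_integrable_on cball 0 s"
    using i integrable_cong_AE[OF borel_measurable_integrable[OF i] m ae'] by (simp add: set_integrable_def)
  show "ball_integral F s = ball_integral G s"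
    unfolding ball_integral_def by (rule integral_cong_AE[OF borel_measurable_integrable[OF i] m ae'])
qed

lemma ball_integral_radial_deriv:
  fixes h :: "real \<Rightarrow> real"
  assumes h: "continuous_on {0<..} h" and int: "\<And>R. (\<lambda>x::real^'n. h (norm x)) absolutely_integrable_on cball 0 R"
    and r: "r > 0"
  shows "(ball_integral (\<lambda>x::real^'n. h (norm x)) has_field_derivative
      sphere_area CARD('n) * (r powr (real CARD('n) - 1) * h r)) (at r)"
proof -
  let ?N = "CARD('n)" and ?G = "ball_integral (\<lambda>x::real^'n. h (norm x))"
  define k where "k r = sphere_area ?N * (r ^ (?N - 1) * h r)" for r
  have hc: "isCont h x" if "x > 0" for x using h that by (simp add: continuous_on_eq_continuous_at)
  have kc: "isCont k x" if "x > 0" for x unfolding k_def using hc[OF that] by (intro continuous_intros)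
  have "\<exists>H. \<forall>x::real. 0 < ereal x \<longrightarrow> ereal x < \<infinity> \<longrightarrow> (H has_vector_derivative k x) (at x)"
    by (rule einterval_antiderivative) (auto intro: kc)
  then obtain H where H: "\<And>x. x > 0 \<Longrightarrow> (H has_field_derivative k x) (at x)"
    by (auto simp: has_real_derivative_iff_has_vector_derivative)
  \<comment> \<open>h may be unbounded near 0, so the fundamental theorem of calculus is applied
    from r / 2 only.\<close>
  define r0 where "r0 = r / 2"
  have r0: "0 < r0" "r0 < r" using r by (auto simp: r0_def)
  have m: "(\<lambda>x::real^'n. h (norm x)) \<in> borel_measurable borel" by (rule borel_measurable_norm_comp[OF h])
  have eq: "?G s = ?G r0 + (H s - H r0)" if s: "s > r0" for s
  proof -
    have i: "integrable lebesgue (\<lambda>x::real^'n. indicator (cball 0 R) x * h (norm x))" for R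
      using int by (simp add: set_integrable_def)
    have "?G s - ?G r0 = (\<integral>x. indicator (cball 0 s) x * h (norm (x::real^'n)) - indicator (cball 0 r0) x * h (norm x) \<partial>lebesgue)"
      unfolding ball_integral_def by (rule Bochner_Integration.integral_diff[symmetric, OF i i])
    also have "\<dots> = integral\<^sup>L lebesgue (\<lambda>x::real^'n. (indicator {r0<..s} (norm x) * h (norm x)))"
      by (intro Bochner_Integration.integral_cong) (use s in \<open>auto simp: indicator_def\<close>)
    also have "\<dots> = integral\<^sup>L lborel (\<lambda>x::real^'n. (indicator {r0<..s} (norm x) * h (norm x)))"
      using m by (intro integral_completion) auto
    also have "\<dots> = (\<integral>t. sphere_area ?N * t ^ (?N - 1) * indicator {0..} t * (indicator {r0<..s} t * h t) \<partial>lborel)"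
    proof (rule polar_integral)
      have "(\<lambda>t. indicator {r0<..s} t *\<^sub>R h t) \<in> borel_measurable borel"
        by (intro borel_measurable_continuous_on_indicator continuous_on_subset[OF h]) (use r0 in auto)
      then show "(\<lambda>t. indicator {r0<..s} t * h t) \<in> borel_measurable borel" by simp
    qed
    also have "\<dots> = (\<integral>t. k t * indicator {r0..s} t \<partial>lborel)"
    proof (rule integral_cong_AE)
      show "AE t in lborel. sphere_area ?N * t ^ (?N - 1) * indicator {0..} t * (indicator {r0<..s} t * h t) = k t * indicator {r0..s} t"
        using AE_lborel_singleton[of r0]
        by eventually_elim (use r0 in \<open>auto simp: indicator_def k_def\<close>)
      have "(\<lambda>t. indicator {r0<..s} t *\<^sub>R h t) \<in> borel_measurable borel"
        by (intro borel_measurable_continuous_on_indicator continuous_on_subset[OF h]) (use r0 in auto)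
      then have [measurable]: "(\<lambda>t. indicator {r0<..s} t * h t) \<in> borel_measurable borel" by simp
      show "(\<lambda>t. sphere_area ?N * t ^ (?N - 1) * indicator {0..} t * (indicator {r0<..s} t * h t)) \<in> borel_measurable lborel"
        by measurable
      have "continuous_on {r0..s} k" by (intro continuous_at_imp_continuous_on ballI kc) (use r0 in auto)
      then have "(\<lambda>t. indicator {r0..s} t *\<^sub>R k t) \<in> borel_measurable borel"
        by (intro borel_measurable_continuous_on_indicator) auto
      then show "(\<lambda>t. k t * indicator {r0..s} t) \<in> borel_measurable lborel" by (simp add: mult.commute)
    qed
    also have "\<dots> = H s - H r0"
      by (rule integral_FTC_Icc_real) (use s r0 H kc in auto)
    finally show ?thesis by simp
  qed
  have "(?G has_field_derivative k r) (at r)"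
  proof (rule has_field_derivative_transform_within_open)
    show "((\<lambda>s. ?G r0 + (H s - H r0)) has_field_derivative k r) (at r)"
      using H[OF r] by (auto intro!: derivative_eq_intros)
    show "r \<in> {r0<..}" using r0 by simp
  qed (use eq in auto)
  also have "k r = sphere_area ?N * (r powr (real ?N - 1) * h r)"
    using r by (simp add: k_def powr_realpow[symmetric] of_nat_diff Suc_leI)
  finally show ?thesis .
qed

context weight_range
begin

context
  fixes u :: "real^'n \<Rightarrow> real"
  assumes weak: "weak_solution \<alpha> u"
begin

lemma nonlin_comp: "nonlin N \<alpha> (u x) = \<bar>u x\<bar> powr (crit_exp CARD('n) \<alpha> - 2) * u x"
  by (simp add: nonlin_def card_dim)

text \<open>The weak formulation includes integrability of the nonlinear term against each test
  function, and a cutoff that is 1 on the ball is one.\<close>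

lemma weak_nonlin_integrable: "(\<lambda>x. nonlin N \<alpha> (u x)) absolutely_integrable_on cball 0 R"
proof -
  define R' where "R' = max R 1"
  have R': "R' > 0" "R \<le> R'" by (auto simp: R'_def)
  have "(\<lambda>x::real^'n. outer_cutoff R' (norm x)) \<in> test_fun \<alpha>"
  proof (rule test_fun_radial(1))
    show "smooth1 UNIV (outer_cutoff R')" by (rule smooth1_outer_cutoff) simp
    show "outer_cutoff R' r = outer_cutoff R' R'" if "r \<le> R'" for r
      using that R' by (simp add: outer_cutoff_1)
    show "outer_cutoff R' r = 0" if "2 * R' \<le> r" for r using that R' by (simp add: outer_cutoff_0)
  qed (rule R')
  from weak[unfolded weak_solution_def, THEN bspec, OF this]
  have "integrable lebesgue (\<lambda>x. \<bar>u x\<bar> powr (crit_exp CARD('n) \<alpha> - 2) * u x * outer_cutoff R' (norm x))"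
    by (rule conjunct1)
  then have "integrable lebesgue (\<lambda>x. nonlin N \<alpha> (u x) * outer_cutoff R' (norm x))" by (simp add: nonlin_comp)
  from integrable_mult_indicator[OF _ this, of "cball 0 R"]
  have "integrable lebesgue (\<lambda>x. indicator (cball 0 R) x *\<^sub>R (nonlin N \<alpha> (u x) * outer_cutoff R' (norm x)))" by simp
  also have "(\<lambda>x. indicator (cball 0 R) x *\<^sub>R (nonlin N \<alpha> (u x) * outer_cutoff R' (norm x))) =
     (\<lambda>x. indicator (cball 0 R) x *\<^sub>R nonlin N \<alpha> (u x))"
    using R' by (auto simp: fun_eq_iff indicator_def outer_cutoff_1)
  finally show ?thesis by (simp add: set_integrable_def)
qed

lemma weak_wdiv_limit:
  assumes w: "represents \<alpha> w u" and \<phi>: "\<phi> \<in> test_fun \<alpha>"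
  shows "wdiv_limit \<alpha> w (wdiv \<alpha> \<phi>) = (\<integral>x. nonlin N \<alpha> (u x) * \<phi> x \<partial>lebesgue)"
proof -
  have "wdiv_limit \<alpha> w (wdiv \<alpha> \<phi>) = D22_inner \<alpha> u \<phi>"
    using LIMSEQ_unique[OF wdiv_limit_LIMSEQ[OF w test_funD(3)[OF \<phi>]] D22_inner_test_fun_LIMSEQ[OF w \<phi>]] .
  then show ?thesis using weak \<phi> by (simp add: weak_solution_def nonlin_comp)
qed

end

lemma wdiv_limit_cong_AE:
  fixes f g :: "real^'n \<Rightarrow> real"
  assumes w: "represents \<alpha> w u" and f: "f \<in> L2 lborel" and g: "g \<in> L2 lborel" and "AE x in lborel. f x = g x"
  shows "wdiv_limit \<alpha> w f = wdiv_limit \<alpha> w g"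
proof -
  have [measurable]: "wdiv \<alpha> (w n) \<in> borel_measurable borel" for n by (rule wdiv_borel[OF test_funD(1)[OF representsD(1)[OF w]]])
  have "(\<integral>x. wdiv \<alpha> (w n) x * f x \<partial>lborel) = (\<integral>x. wdiv \<alpha> (w n) x * g x \<partial>lborel)" for n
    by (rule integral_cong_AE) (use L2_measurable[OF f] L2_measurable[OF g] assms(4) in \<open>auto elim!: eventually_mono\<close>)
  then show ?thesis by (simp add: wdiv_limit_def)
qed

lemma L2_norm_le_bound:
  assumes f: "f \<in> L2 M" and g: "g \<in> L2 M" and le: "\<And>x. \<bar>f x\<bar> \<le> e * \<bar>g x\<bar>" and e: "e \<ge> 0"
  shows "L2_norm M f \<le> e * L2_norm M g"
proof -
  have "(\<integral>x. (f x)\<^sup>2 \<partial>M) \<le> (\<integral>x. e\<^sup>2 * (g x)\<^sup>2 \<partial>M)"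
  proof (rule integral_mono)
    show "(f x)\<^sup>2 \<le> e\<^sup>2 * (g x)\<^sup>2" for x
      using power_mono[OF le[of x], of 2] by (simp add: power_mult_distrib)
  qed (use f g in \<open>auto simp: L2_def\<close>)
  also have "\<dots> = (e * L2_norm M g)\<^sup>2" by (simp add: power_mult_distrib L2_norm_sq)
  finally show ?thesis
    using e L2_norm_nonneg[of M g] by (simp add: L2_norm_def real_le_lsqrt)
qed

context
  fixes u :: "real^'n \<Rightarrow> real" and w
  assumes w: "represents \<alpha> w u"
begin

text \<open>Passes from bumps to continuous multiples of bumps, so that g times a bump, whose
  smoothness is unknown, can be inserted into the functional.\<close>

lemma wdiv_limit_bump_extend:
  assumes g: "continuous_on {0<..} g" and h: "continuous_on {0<..} h" and \<eta>: "bump \<eta>"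
    and eq: "\<And>\<Phi>. bump \<Phi> \<Longrightarrow> wdiv_limit \<alpha> w (\<lambda>x. \<Phi> (norm x)) = integral\<^sup>L lborel (\<lambda>x::real^'n. g (norm x) * \<Phi> (norm x))"
  shows "wdiv_limit \<alpha> w (\<lambda>x. h (norm x) * \<eta> (norm x)) = integral\<^sup>L lborel (\<lambda>x::real^'n. g (norm x) * (h (norm x) * \<eta> (norm x)))"
proof -
  obtain C where C: "C > 0" "\<And>f. f \<in> L2 lborel \<Longrightarrow> \<bar>wdiv_limit \<alpha> w f\<bar> \<le> C * L2_norm lborel f"
    using wdiv_limit_bound[OF w] by blast
  define C1 where "C1 = C * L2_norm lborel (\<lambda>x::real^'n. \<eta> (norm x))"
  define C2 where "C2 = integral\<^sup>L lborel (\<lambda>x::real^'n. \<bar>g (norm x) * \<eta> (norm x)\<bar>)"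
  have C12: "C1 \<ge> 0" "C2 \<ge> 0" using C by (auto simp: C1_def C2_def L2_norm_nonneg)
  show ?thesis
  proof (rule bump_functionals_eq[where ?T1.0 = "\<lambda>\<Phi>. wdiv_limit \<alpha> w (\<lambda>x. \<Phi> (norm x))"
        and ?T2.0 = "\<lambda>\<Phi>. integral\<^sup>L lborel (\<lambda>x::real^'n. g (norm x) * \<Phi> (norm x))" and C = "max C1 C2", OF eq h \<eta>])
    fix \<Psi> and e :: real assume b: "bump \<Psi>" and e: "e > 0" and d: "\<And>r. \<bar>\<Psi> r - h r * \<eta> r\<bar> \<le> e * \<bar>\<eta> r\<bar>"
    have L: "(\<lambda>x::real^'n. \<Psi> (norm x)) \<in> L2 lborel" "(\<lambda>x::real^'n. h (norm x) * \<eta> (norm x)) \<in> L2 lborel"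
      "(\<lambda>x::real^'n. \<eta> (norm x)) \<in> L2 lborel"
      by (intro bump_L2 continuous_mult_bump_L2 b h \<eta>)+
    have "\<bar>wdiv_limit \<alpha> w (\<lambda>x. \<Psi> (norm x) - h (norm x) * \<eta> (norm x))\<bar> \<le> C * L2_norm lborel (\<lambda>x::real^'n. \<Psi> (norm x) - h (norm x) * \<eta> (norm x))"
      by (intro C L2_diff L)
    also have "\<dots> \<le> C * (e * L2_norm lborel (\<lambda>x::real^'n. \<eta> (norm x)))"
      using C(1) e by (intro mult_left_mono L2_norm_le_bound L2_diff L d) auto
    also have "\<dots> = C1 * e" by (simp add: C1_def)
    also have "\<dots> \<le> max C1 C2 * e" using e by (intro mult_right_mono) auto
    finally show "\<bar>wdiv_limit \<alpha> w (\<lambda>x. \<Psi> (norm x)) - wdiv_limit \<alpha> w (\<lambda>x. h (norm x) * \<eta> (norm x))\<bar> \<le> max C1 C2 * e"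
      using wdiv_limit_diff[OF w L(1,2)] by simp
    have cgh: "continuous_on {0<..} (\<lambda>r. g r * h r)" by (intro continuous_on_mult g h)
    have i1: "integrable lborel (\<lambda>x::real^'n. g (norm x) * \<Psi> (norm x))" by (rule integrable_mult_bump(2)[OF g b])
    have i2: "integrable lborel (\<lambda>x::real^'n. g (norm x) * (h (norm x) * \<eta> (norm x)))"
      using integrable_mult_bump(2)[OF cgh \<eta>] by (simp add: mult.assoc)
    have i3: "integrable lborel (\<lambda>x::real^'n. \<bar>g (norm x) * \<eta> (norm x)\<bar>)" by (intro integrable_abs integrable_mult_bump(2)[OF g \<eta>])
    have "\<bar>integral\<^sup>L lborel (\<lambda>x::real^'n. g (norm x) * \<Psi> (norm x)) - integral\<^sup>L lborel (\<lambda>x::real^'n. g (norm x) * (h (norm x) * \<eta> (norm x)))\<bar>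
       = \<bar>integral\<^sup>L lborel (\<lambda>x::real^'n. g (norm x) * \<Psi> (norm x) - g (norm x) * (h (norm x) * \<eta> (norm x)))\<bar>"
      using i1 i2 by simp
    also have "\<dots> \<le> integral\<^sup>L lborel (\<lambda>x::real^'n. \<bar>g (norm x) * \<Psi> (norm x) - g (norm x) * (h (norm x) * \<eta> (norm x))\<bar>)"
      by (rule integral_abs_bound)
    also have "\<dots> \<le> integral\<^sup>L lborel (\<lambda>x::real^'n. e * \<bar>g (norm x) * \<eta> (norm x)\<bar>)"
    proof (rule integral_mono)
      fix x :: "real^'n"
      have "\<bar>g (norm x)\<bar> * \<bar>\<Psi> (norm x) - h (norm x) * \<eta> (norm x)\<bar> \<le> \<bar>g (norm x)\<bar> * (e * \<bar>\<eta> (norm x)\<bar>)"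
        by (intro mult_left_mono d) auto
      then show "\<bar>g (norm x) * \<Psi> (norm x) - g (norm x) * (h (norm x) * \<eta> (norm x))\<bar> \<le> e * \<bar>g (norm x) * \<eta> (norm x)\<bar>"
        unfolding right_diff_distrib[symmetric] abs_mult by (simp only: mult.left_commute)
    qed (use i1 i2 i3 in auto)
    also have "\<dots> = C2 * e" by (simp add: C2_def)
    also have "\<dots> \<le> max C1 C2 * e" using e by (intro mult_right_mono) auto
    finally show "\<bar>integral\<^sup>L lborel (\<lambda>x::real^'n. g (norm x) * \<Psi> (norm x)) - integral\<^sup>L lborel (\<lambda>x::real^'n. g (norm x) * (h (norm x) * \<eta> (norm x)))\<bar> \<le> max C1 C2 * e" .
  qed
qed

text \<open>Duality: inserting g times \<open>bump_seq n\<close> into the bounded functional gives I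
  n \<le> C sqrt (I n), hence I n \<le> C^2 for all n, and Fatou's lemma removes the cutoff.\<close>

lemma wdiv_limit_density_L2:
  assumes g: "continuous_on {0<..} g"
    and eq: "\<And>\<Phi>. bump \<Phi> \<Longrightarrow> wdiv_limit \<alpha> w (\<lambda>x. \<Phi> (norm x)) = integral\<^sup>L lborel (\<lambda>x::real^'n. g (norm x) * \<Phi> (norm x))"
  shows "(\<lambda>x::real^'n. g (norm x)) \<in> L2 lborel"
proof -
  obtain C where C: "C > 0" "\<And>f. f \<in> L2 lborel \<Longrightarrow> \<bar>wdiv_limit \<alpha> w f\<bar> \<le> C * L2_norm lborel f"
    using wdiv_limit_bound[OF w] by blast
  have gm[measurable]: "(\<lambda>x::real^'n. g (norm x)) \<in> borel_measurable borel" by (rule borel_measurable_norm_comp[OF g])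
  have [measurable]: "(\<lambda>x::real^'n. bump_seq n (norm x)) \<in> borel_measurable borel" for n
    by (rule smooth_borel[OF smooth_bump_norm[OF bump_bump_seq]])
  define I where "I n = integral\<^sup>L lborel (\<lambda>x::real^'n. (g (norm x))\<^sup>2 * bump_seq n (norm x))" for n
  have int: "integrable lborel (\<lambda>x::real^'n. (g (norm x))\<^sup>2 * bump_seq n (norm x))" for n
    by (rule integrable_mult_bump(2)[OF _ bump_bump_seq]) (intro continuous_intros g)
  have I0: "0 \<le> I n" for n unfolding I_def
    using bump_seq_bounds by (intro Bochner_Integration.integral_nonneg) auto
  have I: "I n \<le> C\<^sup>2" for n
  proof -
    have L: "(\<lambda>x::real^'n. g (norm x) * bump_seq n (norm x)) \<in> L2 lborel"
      by (rule continuous_mult_bump_L2[OF bump_bump_seq g])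
    have "I n = wdiv_limit \<alpha> w (\<lambda>x. g (norm x) * bump_seq n (norm x))"
      using wdiv_limit_bump_extend[OF g g bump_bump_seq eq, of n] by (simp add: I_def power2_eq_square mult.assoc)
    also have "\<dots> \<le> C * L2_norm lborel (\<lambda>x::real^'n. g (norm x) * bump_seq n (norm x))"
      using C(2)[OF L] by simp
    \<comment> \<open>The square of the cutoff is at most the cutoff, because its values lie between
      0 and 1.\<close>
    also have "L2_norm lborel (\<lambda>x::real^'n. g (norm x) * bump_seq n (norm x)) \<le> sqrt (I n)"
      unfolding L2_norm_def I_def
    proof (intro real_sqrt_le_mono integral_mono int L2_integrable_sq[OF L])
      fix x :: "real^'n"
      have "(bump_seq n (norm x))\<^sup>2 \<le> bump_seq n (norm x)"
        using bump_seq_bounds[of n "norm x"] by (simp add: power2_eq_square mult_left_le)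
      then show "(g (norm x) * bump_seq n (norm x))\<^sup>2 \<le> (g (norm x))\<^sup>2 * bump_seq n (norm x)"
        by (simp add: power_mult_distrib mult_left_mono)
    qed
    finally have "I n \<le> C * sqrt (I n)" using C(1) by simp
    then have le: "sqrt (I n) * sqrt (I n) \<le> C * sqrt (I n)" using I0[of n] by simp
    have "sqrt (I n) \<le> C"
    proof (cases "I n = 0")
      case False
      then have "0 < sqrt (I n)" using I0[of n] by simp
      with le show ?thesis by (rule mult_right_le_imp_le)
    qed (use C in simp)
    then show ?thesis using I0[of n] by (metis real_sqrt_ge_zero real_sqrt_pow2 power_mono)
  qed
  have "integral\<^sup>N lborel (\<lambda>x::real^'n. ennreal ((g (norm x))\<^sup>2)) \<le> integral\<^sup>N lborel (\<lambda>x::real^'n. liminf (\<lambda>n. ennreal ((g (norm x))\<^sup>2 * bump_seq n (norm x))))"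
  proof (rule nn_integral_mono_AE, use AE_lborel_not_zero in eventually_elim)
    case (elim x)
    then have "\<forall>\<^sub>F n in sequentially. bump_seq n (norm x) = 1" by (intro bump_seq_eventually_1) simp
    then have "\<forall>\<^sub>F n in sequentially. ennreal ((g (norm x))\<^sup>2 * bump_seq n (norm x)) = ennreal ((g (norm x))\<^sup>2)"
      by eventually_elim simp
    then have "(\<lambda>n. ennreal ((g (norm x))\<^sup>2 * bump_seq n (norm x))) \<longlonglongrightarrow> ennreal ((g (norm x))\<^sup>2)"
      by (rule tendsto_eventually)
    then show ?case using lim_imp_Liminf[OF sequentially_bot] by (metis order_refl)
  qed
  also have "\<dots> \<le> liminf (\<lambda>n. integral\<^sup>N lborel (\<lambda>x::real^'n. ennreal ((g (norm x))\<^sup>2 * bump_seq n (norm x))))"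
    by (rule nn_integral_liminf) measurable
  also have "(\<lambda>n. integral\<^sup>N lborel (\<lambda>x::real^'n. ennreal ((g (norm x))\<^sup>2 * bump_seq n (norm x)))) = (\<lambda>n. ennreal (I n))"
    unfolding I_def using bump_seq_bounds by (intro ext nn_integral_eq_integral int) auto
  also have "liminf (\<lambda>n. ennreal (I n)) \<le> liminf (\<lambda>n::nat. ennreal (C\<^sup>2))"
    by (intro Liminf_mono always_eventually allI ennreal_leI I)
  also have "\<dots> < \<infinity>" by (simp add: Liminf_const)
  finally have "integrable lborel (\<lambda>x::real^'n. (g (norm x))\<^sup>2)"
    by (intro integrableI_nonneg) auto
  then show ?thesis using gm by (simp add: L2_def)
qed

text \<open>Extends the representation to profiles that do not vanish at the origin. Once g is known
  to be in L^2, both sides are continuous in L^2 and the inner cutoffs of \<phi> converge to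
  it.\<close>

lemma wdiv_limit_const_near_0:
  assumes g: "continuous_on {0<..} g" and gL: "(\<lambda>x::real^'n. g (norm x)) \<in> L2 lborel"
    and eq: "\<And>\<Phi>. bump \<Phi> \<Longrightarrow> wdiv_limit \<alpha> w (\<lambda>x. \<Phi> (norm x)) = integral\<^sup>L lborel (\<lambda>x::real^'n. g (norm x) * \<Phi> (norm x))"
    and \<phi>: "smooth1 UNIV \<phi>" "0 < a" "\<And>r. r \<le> a \<Longrightarrow> \<phi> r = \<phi> a" "\<And>r. r \<ge> b \<Longrightarrow> \<phi> r = 0"
  shows "wdiv_limit \<alpha> w (\<lambda>x. \<phi> (norm x)) = integral\<^sup>L lborel (\<lambda>x::real^'n. g (norm x) * \<phi> (norm x))"
proof -
  have t: "smooth (\<lambda>x::real^'n. \<phi> (norm x))" "compactly_supported (\<lambda>x::real^'n. \<phi> (norm x))"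
    by (rule test_fun_radial(2)[of \<phi> a b]; fact \<phi>) (rule test_fun_radial(3)[of \<phi> a b]; fact \<phi>)
  have \<phi>L: "(\<lambda>x::real^'n. \<phi> (norm x)) \<in> L2 lborel"
  proof -
    obtain B where B: "B > 0" "\<And>x::real^'n. \<bar>\<phi> (norm x)\<bar> \<le> B"
      by (rule smooth_compactly_supported_bounded[OF t]) (rule that)
    show ?thesis
    proof (rule bounded_ball_L2[of _ B b])
      show "\<bar>\<phi> (norm x)\<bar> \<le> B * indicator (cball 0 b) x" for x :: "real^'n"
        using B(2)[of x] \<phi>(4)[of "norm x"] by (auto simp: indicator_def)
    qed (rule smooth_borel[OF t(1)])
  qed
  define e where "e k = 1 / (real k + 1)" for k
  have e: "e k > 0" for k by (simp add: e_def)
  define \<Phi> where "\<Phi> k r = inner_cutoff (e k) r * \<phi> r" for k r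
  have b\<Phi>: "bump (\<Phi> k)" for k
  proof -
    have "smooth1 UNIV (\<Phi> k)" unfolding \<Phi>_def[abs_def] by (intro smooth1_mult smooth1_inner_cutoff \<phi>(1)) auto
    moreover have "\<Phi> k r = 0" if "r \<notin> {e k..e k + \<bar>b\<bar> + 1}" for r
      using that inner_cutoff_0[OF e, of r k] \<phi>(4)[of r] e[of k] by (cases "r < e k") (auto simp: \<Phi>_def)
    moreover have "e k < e k + \<bar>b\<bar> + 1" by simp
    ultimately show ?thesis unfolding bump_def using e[of k] by blast
  qed
  have lim: "(\<lambda>k. L2_norm lborel (\<lambda>x::real^'n. \<phi> (norm x) - \<Phi> k (norm x))) \<longlonglongrightarrow> 0"
    using L2_cutoff_tendsto[OF \<phi>L] by (simp add: \<Phi>_def e_def)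
  obtain C where C: "C > 0" "\<And>f. f \<in> L2 lborel \<Longrightarrow> \<bar>wdiv_limit \<alpha> w f\<bar> \<le> C * L2_norm lborel f"
    using wdiv_limit_bound[OF w] by blast
  have "\<bar>wdiv_limit \<alpha> w (\<lambda>x. \<phi> (norm x)) - integral\<^sup>L lborel (\<lambda>x::real^'n. g (norm x) * \<phi> (norm x))\<bar>
     \<le> (C + L2_norm lborel (\<lambda>x::real^'n. g (norm x))) * L2_norm lborel (\<lambda>x::real^'n. \<phi> (norm x) - \<Phi> k (norm x))" for k
  proof -
    have L: "(\<lambda>x::real^'n. \<Phi> k (norm x)) \<in> L2 lborel" by (rule bump_L2[OF b\<Phi>])
    have 1: "\<bar>wdiv_limit \<alpha> w (\<lambda>x. \<phi> (norm x)) - wdiv_limit \<alpha> w (\<lambda>x. \<Phi> k (norm x))\<bar> \<le> C * L2_norm lborel (\<lambda>x::real^'n. \<phi> (norm x) - \<Phi> k (norm x))"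
      using C(2)[OF L2_diff[OF \<phi>L L]] wdiv_limit_diff[OF w \<phi>L L] by simp
    have "integral\<^sup>L lborel (\<lambda>x::real^'n. g (norm x) * \<phi> (norm x)) - integral\<^sup>L lborel (\<lambda>x::real^'n. g (norm x) * \<Phi> k (norm x))
      = integral\<^sup>L lborel (\<lambda>x::real^'n. g (norm x) * (\<phi> (norm x) - \<Phi> k (norm x)))"
      using L2_mult_integrable[OF gL \<phi>L] L2_mult_integrable[OF gL L] by (simp add: right_diff_distrib)
    then have 2: "\<bar>integral\<^sup>L lborel (\<lambda>x::real^'n. g (norm x) * \<phi> (norm x)) - integral\<^sup>L lborel (\<lambda>x::real^'n. g (norm x) * \<Phi> k (norm x))\<bar>
      \<le> L2_norm lborel (\<lambda>x::real^'n. g (norm x)) * L2_norm lborel (\<lambda>x::real^'n. \<phi> (norm x) - \<Phi> k (norm x))"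
      using L2_Cauchy_Schwarz[OF gL L2_diff[OF \<phi>L L]] by simp
    show ?thesis using 1 2 eq[OF b\<Phi>, of k] unfolding distrib_right by linarith
  qed
  moreover have "(\<lambda>k. (C + L2_norm lborel (\<lambda>x::real^'n. g (norm x))) * L2_norm lborel (\<lambda>x::real^'n. \<phi> (norm x) - \<Phi> k (norm x))) \<longlonglongrightarrow> 0"
    using tendsto_mult_left[OF lim] by simp
  ultimately have "\<bar>wdiv_limit \<alpha> w (\<lambda>x. \<phi> (norm x)) - integral\<^sup>L lborel (\<lambda>x::real^'n. g (norm x) * \<phi> (norm x))\<bar> \<le> 0"
    by (intro LIMSEQ_le_const) auto
  then show ?thesis by simp
qed

end

end

section \<open>Identifying a radial function with its continuous profile\<close>

lemma locally_integrable_measurable: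
  fixes u :: "real^'n \<Rightarrow> real"
  assumes "\<And>R. u absolutely_integrable_on cball 0 R"
  shows "u \<in> borel_measurable lebesgue"
proof (rule borel_measurable_LIMSEQ_real)
  show "(\<lambda>x. indicator (cball 0 (real n)) x * u x) \<in> borel_measurable lebesgue" for n
    using borel_measurable_integrable[OF assms[of "real n", unfolded set_integrable_def]] by simp
  fix x :: "real^'n"
  have "\<forall>\<^sub>F n in sequentially. real n \<ge> norm x"
    using filterlim_real_sequentially by (simp add: filterlim_at_top)
  then have "\<forall>\<^sub>F n in sequentially. indicator (cball 0 (real n)) x * u x = u x" by eventually_elim simp
  then show "(\<lambda>n. indicator (cball 0 (real n)) x * u x) \<longlonglongrightarrow> u x" by (rule tendsto_eventually)
qed

lemma locally_integrable_mult_bump: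
  fixes u :: "real^'n \<Rightarrow> real"
  assumes u: "\<And>R. u absolutely_integrable_on cball 0 R" and k: "continuous_on {0<..} k" and \<eta>: "bump \<eta>"
  shows "integrable lebesgue (\<lambda>x. u x * (k (norm x) * \<eta> (norm x)))"
proof -
  obtain a b where ab: "0 < a" "a < b" "\<And>r. r \<notin> {a..b} \<Longrightarrow> \<eta> r = 0" "smooth1 UNIV \<eta>"
    by (rule bumpE[OF \<eta>]) (rule that)
  have c: "continuous_on UNIV (\<lambda>r. k r * \<eta> r)" by (rule integrable_mult_bump(1)[OF k \<eta>])
  obtain B where B: "B \<ge> 0" "\<And>r. \<bar>k r * \<eta> r\<bar> \<le> B"
    using compact_support_bounded[OF c, of a b] ab(3) by auto
  show ?thesis
  proof (rule integral_mult_ball_le(1)[OF u _ _ B(1)])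
    have "(\<lambda>x::real^'n. k (norm x) * \<eta> (norm x)) \<in> borel_measurable borel"
      by (rule borel_measurable_continuous_onI) (auto intro!: continuous_on_compose2[OF c] continuous_on_norm_id)
    then show "(\<lambda>x::real^'n. k (norm x) * \<eta> (norm x)) \<in> borel_measurable lebesgue"
      by (intro measurable_completion) simp
    show "\<bar>k (norm x) * \<eta> (norm x)\<bar> \<le> B * indicator (cball 0 b) x" for x :: "real^'n"
      using B ab(3)[of "norm x"] by (auto simp: indicator_def)
  qed
qed

lemma locally_integrable_bump:
  fixes u :: "real^'n \<Rightarrow> real"
  assumes u: "\<And>R. u absolutely_integrable_on cball 0 R" and \<eta>: "bump \<eta>"
  shows "integrable lebesgue (\<lambda>x. u x * \<eta> (norm x))"
  using locally_integrable_mult_bump[OF u continuous_on_const[of _ 1] \<eta>] by simp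

text \<open>Testing a radial function against radial functions only suffices, although its profile is
  not assumed measurable: the radial hull of a compact subset of \<open>{D > 0}\<close> stays inside that set.\<close>

lemma AE_radial_nonpos:
  fixes D :: "real \<Rightarrow> real"
  assumes m: "(\<lambda>x::real^'n. D (norm x)) \<in> borel_measurable lebesgue"
    and z: "\<And>C. compact C \<Longrightarrow> C \<subseteq> {0<..} \<Longrightarrow> integrable lebesgue (\<lambda>x::real^'n. indicator C (norm x) * D (norm x))"
      "\<And>C. compact C \<Longrightarrow> C \<subseteq> {0<..} \<Longrightarrow> integral\<^sup>L lebesgue (\<lambda>x::real^'n. indicator C (norm x) * D (norm x)) = 0"
  shows "AE x::real^'n in lebesgue. D (norm x) \<le> 0"
proof -
  define E where "E = {x::real^'n. 0 < D (norm x)} \<inter> - {0}"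
  have "{x \<in> space lebesgue. 0 < D (norm (x::real^'n))} \<in> sets lebesgue" using m by measurable
  moreover have "- {0::real^'n} \<in> sets lebesgue" by (intro sets_completionI_sets) auto
  ultimately have E: "E \<in> sets lebesgue" unfolding E_def by (intro sets.Int) simp_all
  have "negligible E"
  proof (rule negligible_radial_set[OF E])
    show "y \<in> E" if "norm x = norm y" "x \<in> E" for x y using that by (auto simp: E_def)
    show "0 \<notin> E" by (simp add: E_def)
    fix C :: "real set" assume C: "compact C" "C \<subseteq> {0<..}" "{x. norm x \<in> C} \<subseteq> E"
    have nn: "AE x::real^'n in lebesgue. 0 \<le> indicator C (norm x) * D (norm x)"
      using C(3) by (intro AE_I2) (auto simp: indicator_def E_def)
    have "AE x::real^'n in lebesgue. indicator C (norm x) * D (norm x) = 0"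
      using integral_nonneg_eq_0_iff_AE[OF z(1)[OF C(1,2)] nn] z(2)[OF C(1,2)] by simp
    then have "AE x::real^'n in lebesgue. x \<notin> {x. norm x \<in> C}"
    proof eventually_elim
      case (elim x)
      then show ?case using C(3) by (auto simp: E_def)
    qed
    moreover have "closed {x::real^'n. norm x \<in> C}"
      using continuous_closed_vimage[OF compact_imp_closed[OF C(1)], of norm] by (simp add: vimage_def)
    then have "{x::real^'n. norm x \<in> C} \<in> sets lebesgue" by auto
    ultimately have "{x::real^'n. norm x \<in> C} \<in> null_sets lebesgue"
      by (subst (asm) AE_iff_null) auto
    then show "negligible {x::real^'n. norm x \<in> C}" by (simp add: negligible_iff_null_sets)
  qed
  then have "AE x in lebesgue. x \<notin> E" by (intro AE_not_in) (simp add: negligible_iff_null_sets)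
  then show ?thesis
    using AE_norm_neq[of 0] by eventually_elim (auto simp: E_def)
qed

text \<open>The class of test profiles is enlarged from bumps to continuous multiples of bumps and
  then, by dominated convergence, to indicators of compact sets of radii.
  \<open>AE_radial_nonpos\<close> is applied to the difference D and to its negative.\<close>

lemma AE_radial_eq:
  fixes u :: "real^'n \<Rightarrow> real"
  assumes u: "\<And>R. u absolutely_integrable_on cball 0 R" and rad: "radial u" and f: "continuous_on {0<..} f"
    and eq: "\<And>\<Phi>. bump \<Phi> \<Longrightarrow> (\<integral>x. u x * \<Phi> (norm x) \<partial>lebesgue) = integral\<^sup>L lborel (\<lambda>x::real^'n. f (norm x) * \<Phi> (norm x))"
  shows "AE x in lebesgue. u x = f (norm x)"
proof -
  obtain h where h: "AE x in lebesgue. u x = h (norm x)" using rad unfolding radial_def by blast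
  have um: "u \<in> borel_measurable lebesgue" by (rule locally_integrable_measurable[OF u])
  have fm: "(\<lambda>x::real^'n. f (norm x)) \<in> borel_measurable borel" by (rule borel_measurable_norm_comp[OF f])
  have fml: "(\<lambda>x::real^'n. f (norm x)) \<in> borel_measurable lebesgue" using fm by (intro measurable_completion) simp
  define D where "D r = h r - f r" for r
  have DAE: "AE x in lebesgue. u x - f (norm x) = D (norm x)" using h by eventually_elim (simp add: D_def)
  have Dm: "(\<lambda>x::real^'n. D (norm x)) \<in> borel_measurable lebesgue"
    using borel_measurable_AE[OF borel_measurable_diff[OF um fml] DAE] .
  have ext: "(\<integral>x. u x * (k (norm x) * \<eta> (norm x)) \<partial>lebesgue) = integral\<^sup>L lborel (\<lambda>x::real^'n. f (norm x) * (k (norm x) * \<eta> (norm x)))"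
    if k: "continuous_on {0<..} k" and \<eta>: "bump \<eta>" for k \<eta>
  proof -
    define C1 where "C1 = (\<integral>x. \<bar>u x * \<eta> (norm x)\<bar> \<partial>lebesgue)"
    define C2 where "C2 = integral\<^sup>L lborel (\<lambda>x::real^'n. \<bar>f (norm x) * \<eta> (norm x)\<bar>)"
    have close: "\<bar>integral\<^sup>L M (\<lambda>x::real^'n. v x * \<Psi> (norm x)) - integral\<^sup>L M (\<lambda>x. v x * (k (norm x) * \<eta> (norm x)))\<bar>
        \<le> integral\<^sup>L M (\<lambda>x. \<bar>v x * \<eta> (norm x)\<bar>) * e"
      if i: "integrable M (\<lambda>x. v x * \<Psi> (norm x))" "integrable M (\<lambda>x. v x * (k (norm x) * \<eta> (norm x)))"
        "integrable M (\<lambda>x. v x * \<eta> (norm x))" and d: "\<And>r. \<bar>\<Psi> r - k r * \<eta> r\<bar> \<le> e * \<bar>\<eta> r\<bar>"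
      for M v \<Psi> and e :: real
    proof -
      have "\<bar>integral\<^sup>L M (\<lambda>x. v x * \<Psi> (norm x)) - integral\<^sup>L M (\<lambda>x. v x * (k (norm x) * \<eta> (norm x)))\<bar>
        = \<bar>integral\<^sup>L M (\<lambda>x. v x * \<Psi> (norm x) - v x * (k (norm x) * \<eta> (norm x)))\<bar>" using i by simp
      also have "\<dots> \<le> integral\<^sup>L M (\<lambda>x. \<bar>v x * \<Psi> (norm x) - v x * (k (norm x) * \<eta> (norm x))\<bar>)"
        by (rule integral_abs_bound)
      also have "\<dots> \<le> integral\<^sup>L M (\<lambda>x. \<bar>v x * \<eta> (norm x)\<bar> * e)"
      proof (rule integral_mono)
        fix x
        have "\<bar>v x\<bar> * \<bar>\<Psi> (norm x) - k (norm x) * \<eta> (norm x)\<bar> \<le> \<bar>v x\<bar> * (e * \<bar>\<eta> (norm x)\<bar>)"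
          by (intro mult_left_mono d) auto
        then show "\<bar>v x * \<Psi> (norm x) - v x * (k (norm x) * \<eta> (norm x))\<bar> \<le> \<bar>v x * \<eta> (norm x)\<bar> * e"
          unfolding right_diff_distrib[symmetric] abs_mult by (simp only: mult_ac)
      qed (use i in auto)
      finally show ?thesis by simp
    qed
    show ?thesis
    proof (rule bump_functionals_eq[where ?T1.0 = "\<lambda>\<Phi>. \<integral>x. u x * \<Phi> (norm x) \<partial>lebesgue"
          and ?T2.0 = "\<lambda>\<Phi>. integral\<^sup>L lborel (\<lambda>x::real^'n. f (norm x) * \<Phi> (norm x))" and C = "max C1 C2", OF eq k \<eta>])
      fix \<Psi> and e :: real assume b: "bump \<Psi>" and e: "e > 0" and d: "\<And>r. \<bar>\<Psi> r - k r * \<eta> r\<bar> \<le> e * \<bar>\<eta> r\<bar>"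
      have fk: "continuous_on {0<..} (\<lambda>r. f r * k r)" by (intro continuous_on_mult f k)
      have "C1 * e \<le> max C1 C2 * e" "C2 * e \<le> max C1 C2 * e" using e by (auto intro!: mult_right_mono)
      moreover have "\<bar>(\<integral>x. u x * \<Psi> (norm x) \<partial>lebesgue) - (\<integral>x. u x * (k (norm x) * \<eta> (norm x)) \<partial>lebesgue)\<bar> \<le> C1 * e"
        unfolding C1_def by (intro close locally_integrable_bump locally_integrable_mult_bump u b k \<eta> d)
      moreover have "\<bar>integral\<^sup>L lborel (\<lambda>x::real^'n. f (norm x) * \<Psi> (norm x)) - integral\<^sup>L lborel (\<lambda>x::real^'n. f (norm x) * (k (norm x) * \<eta> (norm x)))\<bar> \<le> C2 * e"
        unfolding C2_def
      proof (rule close[OF _ _ _ d])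
        show "integrable lborel (\<lambda>x::real^'n. f (norm x) * (k (norm x) * \<eta> (norm x)))"
          using integrable_mult_bump(2)[OF fk \<eta>] by (simp add: mult.assoc)
      qed (intro integrable_mult_bump(2) f b \<eta>)+
      ultimately show "\<bar>(\<integral>x. u x * \<Psi> (norm x) \<partial>lebesgue) - (\<integral>x. u x * (k (norm x) * \<eta> (norm x)) \<partial>lebesgue)\<bar> \<le> max C1 C2 * e"
        "\<bar>integral\<^sup>L lborel (\<lambda>x::real^'n. f (norm x) * \<Psi> (norm x)) - integral\<^sup>L lborel (\<lambda>x::real^'n. f (norm x) * (k (norm x) * \<eta> (norm x)))\<bar> \<le> max C1 C2 * e"
        by linarith+
    qed
  qed
  have comp: "integrable lebesgue (\<lambda>x::real^'n. indicator C (norm x) * D (norm x)) \<and>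
     integral\<^sup>L lebesgue (\<lambda>x::real^'n. indicator C (norm x) * D (norm x)) = 0" if C: "compact C" "C \<subseteq> {0<..}" for C
  proof (cases "C = {}")
    case False
    obtain a where a: "a \<in> C" "\<And>c. c \<in> C \<Longrightarrow> a \<le> c" using compact_attains_inf[OF C(1) False] by blast
    obtain b where b: "b \<in> C" "\<And>c. c \<in> C \<Longrightarrow> c \<le> b" using compact_attains_sup[OF C(1) False] by blast
    have ab: "0 < a" "0 < b" using a(1) b(1) C(2) by auto
    \<comment> \<open>A bump equal to 1 on C, since a is the least and b the greatest element of
      C.\<close>
    define \<eta> where "\<eta> r = inner_cutoff (a/2) r * outer_cutoff b r" for r
    have \<eta>01: "0 \<le> \<eta> r" "\<eta> r \<le> 1" for r using cutoff_bounds by (auto simp: \<eta>_def mult_le_one)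
    have \<eta>1: "\<eta> r = 1" if "r \<in> C" for r using a(2)[OF that] b(2)[OF that] ab by (simp add: \<eta>_def inner_cutoff_1 outer_cutoff_1)
    have \<eta>: "bump \<eta>"
    proof -
      have "smooth1 UNIV \<eta>" unfolding \<eta>_def[abs_def] by (intro smooth1_mult smooth1_inner_cutoff smooth1_outer_cutoff) auto
      moreover have "\<eta> r = 0" if "r \<notin> {a/2..2*b}" for r
        using that ab by (auto simp: \<eta>_def inner_cutoff_0 outer_cutoff_0)
      moreover have "0 < a/2" "a/2 < 2 * b" using ab a(2)[OF b(1)] by auto
      ultimately show ?thesis unfolding bump_def by blast
    qed
    \<comment> \<open>Continuous functions decreasing to the indicator of C, as C is closed.\<close>
    define k where "k n r = max 0 (1 - real n * infdist r C)" for n r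
    have kc: "continuous_on A (k n)" for n A unfolding k_def by (intro continuous_intros)
    have k01: "0 \<le> k n r" "k n r \<le> 1" for n r by (auto simp: k_def infdist_nonneg)
    define J where "J n x = D (norm x) * (k n (norm x) * \<eta> (norm x))" for n and x :: "real^'n"
    have i\<eta>: "integrable lebesgue (\<lambda>x::real^'n. D (norm x) * \<eta> (norm x))"
    proof -
      have i: "integrable lborel (\<lambda>x::real^'n. f (norm x) * \<eta> (norm x))" by (rule integrable_mult_bump(2)[OF f \<eta>])
      then have "integrable lebesgue (\<lambda>x::real^'n. f (norm x) * \<eta> (norm x))"
        using integrable_completion[OF borel_measurable_integrable[OF i]] by simp
      then have "integrable lebesgue (\<lambda>x::real^'n. u x * \<eta> (norm x) - f (norm x) * \<eta> (norm x))"
        by (rule Bochner_Integration.integrable_diff[OF locally_integrable_bump[OF u \<eta>]])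
      moreover have ae: "AE x in lebesgue. u x * \<eta> (norm x) - f (norm x) * \<eta> (norm x) = D (norm x) * \<eta> (norm x)"
        using DAE by eventually_elim (simp add: algebra_simps flip: left_diff_distrib)
      ultimately show ?thesis
        using integrable_cong_AE_imp[OF _ _ ae] borel_measurable_AE[OF borel_measurable_integrable ae] integrable_cong_AE[OF _ _ ae] by blast
    qed
    have J0: "(\<integral>x. J n x \<partial>lebesgue) = 0" for n
    proof -
      have fk: "continuous_on {0<..} (\<lambda>r. f r * k n r)" by (intro continuous_on_mult f kc)
      have i1: "integrable lebesgue (\<lambda>x::real^'n. u x * (k n (norm x) * \<eta> (norm x)))"
        by (intro locally_integrable_mult_bump u kc \<eta>)
      have i2: "integrable lborel (\<lambda>x::real^'n. f (norm x) * (k n (norm x) * \<eta> (norm x)))"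
        using integrable_mult_bump(2)[OF fk \<eta>] by (simp add: mult.assoc)
      then have i2m: "(\<lambda>x::real^'n. f (norm x) * (k n (norm x) * \<eta> (norm x))) \<in> borel_measurable lborel"
        by (rule borel_measurable_integrable)
      have i2': "integrable lebesgue (\<lambda>x::real^'n. f (norm x) * (k n (norm x) * \<eta> (norm x)))"
        using i2 integrable_completion[OF i2m] by simp
      have ae: "AE x in lebesgue. u x * (k n (norm x) * \<eta> (norm x)) - f (norm x) * (k n (norm x) * \<eta> (norm x)) = J n x"
        using DAE by eventually_elim (simp add: J_def flip: left_diff_distrib)
      have "(\<integral>x. J n x \<partial>lebesgue) = (\<integral>x. u x * (k n (norm x) * \<eta> (norm x)) - f (norm x) * (k n (norm x) * \<eta> (norm x)) \<partial>lebesgue)"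
        using borel_measurable_AE[OF borel_measurable_integrable[OF Bochner_Integration.integrable_diff[OF i1 i2']] ae]
          borel_measurable_integrable[OF Bochner_Integration.integrable_diff[OF i1 i2']] ae
        by (intro integral_cong_AE) (auto elim!: eventually_mono)
      also have "\<dots> = (\<integral>x. u x * (k n (norm x) * \<eta> (norm x)) \<partial>lebesgue) - integral\<^sup>L lebesgue (\<lambda>x::real^'n. f (norm x) * (k n (norm x) * \<eta> (norm x)))"
        by (rule Bochner_Integration.integral_diff[OF i1 i2'])
      also have "\<dots> = 0" using ext[OF kc \<eta>] integral_completion[OF i2m] by simp
      finally show ?thesis .
    qed
    have lim: "(\<lambda>n. J n x) \<longlonglongrightarrow> indicator C (norm x) * D (norm x)" for x
    proof (cases "norm x \<in> C")
      case True
      then have "J n x = indicator C (norm x) * D (norm x)" for n by (simp add: J_def k_def \<eta>1)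
      then show ?thesis by simp
    next
      case False
      then have "infdist (norm x) C > 0"
        using in_closed_iff_infdist_zero[OF compact_imp_closed[OF C(1)] \<open>C \<noteq> {}\<close>] infdist_nonneg[of "norm x" C] by force
      then obtain n0 where n0: "1 / infdist (norm x) C < real n0" using reals_Archimedean2 by blast
      have "J n x = 0" if "n \<ge> n0" for n
      proof -
        have "1 / infdist (norm x) C < real n" using n0 that by (meson less_le_trans of_nat_le_iff)
        then have "1 < real n * infdist (norm x) C" using \<open>infdist (norm x) C > 0\<close> by (simp add: field_simps)
        then show ?thesis by (simp add: J_def k_def)
      qed
      then have "\<forall>\<^sub>F n in sequentially. J n x = 0" by (auto simp: eventually_sequentially)
      then show ?thesis using False by (simp add: tendsto_eventually)
    qed
    have Jm: "J n \<in> borel_measurable lebesgue" for n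
    proof -
      have "continuous_on UNIV (\<lambda>r. k n r * \<eta> r)" by (rule integrable_mult_bump(1)[OF kc \<eta>])
      then have "(\<lambda>x::real^'n. k n (norm x) * \<eta> (norm x)) \<in> borel_measurable borel"
        by (intro borel_measurable_continuous_onI) (auto intro!: continuous_on_compose2[of UNIV "\<lambda>r. k n r * \<eta> r"] continuous_on_norm_id)
      then have "(\<lambda>x::real^'n. k n (norm x) * \<eta> (norm x)) \<in> borel_measurable lebesgue" by (intro measurable_completion) simp
      then show ?thesis unfolding J_def[abs_def] using Dm by (rule borel_measurable_times[rotated])
    qed
    have lm: "(\<lambda>x::real^'n. indicator C (norm x) * D (norm x)) \<in> borel_measurable lebesgue"
      by (rule borel_measurable_LIMSEQ_real[OF lim Jm])
    have bound: "AE x in lebesgue. norm (J n x) \<le> \<bar>D (norm x) * \<eta> (norm x)\<bar>" for n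
    proof (rule AE_I2)
      fix x :: "real^'n"
      have "\<bar>k n (norm x) * \<eta> (norm x)\<bar> \<le> \<bar>\<eta> (norm x)\<bar>" using k01[of n "norm x"] by (simp add: abs_mult mult_left_le_one_le)
      then show "norm (J n x) \<le> \<bar>D (norm x) * \<eta> (norm x)\<bar>" by (simp add: J_def abs_mult mult_left_mono mult.assoc)
    qed
    note dom = lm Jm integrable_abs[OF i\<eta>] AE_I2[OF lim] bound
    have "integrable lebesgue (\<lambda>x::real^'n. indicator C (norm x) * D (norm x))"
      by (rule integrable_dominated_convergence[OF dom])
    moreover have "(\<lambda>n. \<integral>x. J n x \<partial>lebesgue) \<longlonglongrightarrow> integral\<^sup>L lebesgue (\<lambda>x::real^'n. indicator C (norm x) * D (norm x))"
      by (rule integral_dominated_convergence[OF dom])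
    ultimately show ?thesis by (simp add: J0 LIMSEQ_const_iff)
  qed simp
  have "AE x::real^'n in lebesgue. D (norm x) \<le> 0"
    by (rule AE_radial_nonpos[OF Dm]) (use comp in blast)+
  moreover have "AE x::real^'n in lebesgue. - D (norm x) \<le> 0"
    by (rule AE_radial_nonpos[of "\<lambda>r. - D r"]) (use comp Dm in auto)
  ultimately show ?thesis using DAE by eventually_elim simp
qed

subsection \<open>Regularity at the origin\<close>

context weight_range
begin

text \<open>Both powers \<open>r powr (- \<eta>)\<close> and \<open>r powr (- aexp)\<close> are propagated at once; the second one, with
  the small weight \<open>\<delta>\<close>, only makes the supremum in \<open>bootstrap_at_0\<close> finite a priori.\<close>

lemma bootstrap_step:
  assumes sys: "radial_sys N \<alpha> f P g" "radial_sys N \<alpha> g Q (\<lambda>r. nonlin N \<alpha> (f r))"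
    and lim: "(P \<longlongrightarrow> 0) (at_right 0)" "(Q \<longlongrightarrow> 0) (at_right 0)"
    and \<rho>: "0 < \<rho>" "\<rho> \<le> 1" and \<eta>: "0 < \<eta>" "\<eta> < aexp" and \<delta>: "\<delta> \<ge> 0" and e: "\<epsilon> \<ge> 0" and X: "X \<ge> 0"
    and V: "\<And>r. 0 < r \<Longrightarrow> r \<le> \<rho> \<Longrightarrow> \<bar>f r\<bar> powr pexp \<le> \<epsilon> * r powr (- (2 * bexp))"
    and f: "\<And>r. 0 < r \<Longrightarrow> r \<le> \<rho> \<Longrightarrow> \<bar>f r\<bar> \<le> X * (r powr (- \<eta>) + \<delta> * r powr (- aexp))"
    and r: "0 < r" "r \<le> \<rho>"
  shows "\<bar>f r\<bar> \<le> (\<bar>f \<rho>\<bar> + \<bar>g \<rho>\<bar> / (aexp * bexp) + \<epsilon> * X / (aexp\<^sup>2 * bexp * \<eta>)) * (r powr (- \<eta>) + \<delta> * r powr (- aexp))"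
proof -
  define a b where "a = aexp" and "b = bexp"
  have ab: "a > 0" "b > 0" "\<eta> < a" using exps \<eta> by (auto simp: a_def b_def)
  have eN: "real N - 1 = 2 * a + 2 * b - 1" "1 - real N - \<alpha> = -1 - 2 * a - b"
    using exps by (auto simp: a_def b_def)
  note V = V[folded b_def] and f = f[folded a_def]
  define Y where "Y = \<epsilon> * X"
  have Y: "Y \<ge> 0" using e X by (simp add: Y_def)
  have pw: "s powr x * s powr y = s powr (x + y)" for s x y :: real by (simp add: powr_add)
  have Q': "\<bar>s powr (real N - 1) * nonlin N \<alpha> (f s)\<bar> \<le> Y * (s powr (2 * a - \<eta> - 1) + \<delta> * s powr (a - 1))"
    if s: "0 < s" "s \<le> \<rho>" for s
  proof -
    have "\<bar>nonlin N \<alpha> (f s)\<bar> \<le> (\<epsilon> * s powr (- (2 * b))) * (X * (s powr (- \<eta>) + \<delta> * s powr (- a)))"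
      unfolding abs_nonlin(1) using V[OF s] f[OF s] e by (intro mult_mono) auto
    then have "\<bar>s powr (real N - 1) * nonlin N \<alpha> (f s)\<bar> \<le> s powr (real N - 1) * ((\<epsilon> * s powr (- (2 * b))) * (X * (s powr (- \<eta>) + \<delta> * s powr (- a))))"
      by (simp add: abs_mult mult_left_mono)
    also have "\<dots> = Y * (s powr (real N - 1) * s powr (- (2 * b)) * s powr (- \<eta>) + \<delta> * (s powr (real N - 1) * s powr (- (2 * b)) * s powr (- a)))"
      by (simp add: Y_def algebra_simps)
    also have "\<dots> = Y * (s powr (2 * a - \<eta> - 1) + \<delta> * s powr (a - 1))"
    proof -
      have ex: "real N - 1 + - (2 * b) + - \<eta> = 2 * a - \<eta> - 1" "real N - 1 + - (2 * b) + - a = a - 1"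
        unfolding eN by auto
      show ?thesis unfolding pw ex ..
    qed
    finally show ?thesis .
  qed
  \<comment> \<open>Each of the next integrations turns a combination of powers into another one
    with shifted exponents. The fluxes Q and P are integrated from 0, where they vanish; g and f are
    integrated from \<rho>, where their values enter the constants.\<close>
  have Qb: "\<bar>Q s\<bar> \<le> Y / a * (s powr (2 * a - \<eta>) + \<delta> * s powr a)" if s: "0 < s" "s \<le> \<rho>" for s
  proof -
    define B where "B t = Y * (t powr (2 * a - \<eta>) / (2 * a - \<eta>) + \<delta> * (t powr a / a))" for t
    have "\<bar>Q s - 0\<bar> \<le> B s - 0"
    proof (rule deriv_bound_from_0[OF s(1) radial_sysD(2)[OF sys(2)] _ _ lim(2)])
      fix t assume t: "0 < t" "t \<le> s"
      have t': "t \<le> \<rho>" using t s by simp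
      show "\<bar>t powr (real N - 1) * nonlin N \<alpha> (f t)\<bar> \<le> Y * (t powr (2 * a - \<eta> - 1) + \<delta> * t powr (a - 1))"
        by (rule Q'[OF t(1) t'])
      have "((\<lambda>t. t powr (2 * a - \<eta>)) has_field_derivative (2 * a - \<eta>) * t powr (2 * a - \<eta> - 1)) (at t)"
        "((\<lambda>t. t powr a) has_field_derivative a * t powr (a - 1)) (at t)"
        using t by (intro has_real_derivative_powr; simp)+
      from DERIV_cdivide[OF this(1), of "2 * a - \<eta>"] DERIV_cdivide[OF this(2), of a]
      have "((\<lambda>t. t powr (2 * a - \<eta>) / (2 * a - \<eta>)) has_field_derivative t powr (2 * a - \<eta> - 1)) (at t)"
        "((\<lambda>t. t powr a / a) has_field_derivative t powr (a - 1)) (at t)"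
        using ab by simp_all
      then show "(B has_field_derivative Y * (t powr (2 * a - \<eta> - 1) + \<delta> * t powr (a - 1))) (at t)"
        unfolding B_def by (intro DERIV_cmult DERIV_add)
    next
      have "((\<lambda>t. t powr (2 * a - \<eta>)) \<longlongrightarrow> 0) (at_right 0)" "((\<lambda>t. t powr a) \<longlongrightarrow> 0) (at_right 0)"
        using ab by (intro powr_tendsto_0; simp)+
      then have "(B \<longlongrightarrow> Y * (0 / (2 * a - \<eta>) + \<delta> * (0 / a))) (at_right 0)"
        unfolding B_def using ab by (intro tendsto_intros) auto
      then show "(B \<longlongrightarrow> 0) (at_right 0)" by simp
    qed
    then have "\<bar>Q s\<bar> \<le> B s" by simp
    \<comment> \<open>As \<eta> < a, the denominator 2 a - \<eta> is at least a.\<close>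
    also have "B s \<le> Y * (s powr (2 * a - \<eta>) / a + \<delta> * (s powr a / a))"
      unfolding B_def using ab Y \<delta> by (intro mult_left_mono add_mono divide_left_mono) auto
    finally show ?thesis by (simp add: algebra_simps add_divide_distrib)
  qed
  have g': "\<bar>s powr (1 - real N - \<alpha>) * Q s\<bar> \<le> Y / a * (s powr (- b - \<eta> - 1) + \<delta> * s powr (- b - a - 1))"
    if s: "0 < s" "s \<le> \<rho>" for s
  proof -
    have "\<bar>s powr (1 - real N - \<alpha>) * Q s\<bar> \<le> s powr (1 - real N - \<alpha>) * (Y / a * (s powr (2 * a - \<eta>) + \<delta> * s powr a))"
      using Qb[OF s] by (simp only: abs_mult abs_of_nonneg[OF powr_ge_zero]) (intro mult_left_mono, auto)
    also have "\<dots> = Y / a * (s powr (1 - real N - \<alpha>) * s powr (2 * a - \<eta>) + \<delta> * (s powr (1 - real N - \<alpha>) * s powr a))"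
      by (simp add: algebra_simps)
    also have "\<dots> = Y / a * (s powr (- b - \<eta> - 1) + \<delta> * s powr (- b - a - 1))"
    proof -
      have ex: "1 - real N - \<alpha> + (2 * a - \<eta>) = - b - \<eta> - 1" "1 - real N - \<alpha> + a = - b - a - 1"
        unfolding eN by auto
      show ?thesis unfolding pw ex ..
    qed
    finally show ?thesis .
  qed
  have gb: "\<bar>g s\<bar> \<le> \<bar>g \<rho>\<bar> + Y / (a * b) * (s powr (- b - \<eta>) + \<delta> * s powr (- b - a))" if s: "0 < s" "s \<le> \<rho>" for s
  proof -
    define B where "B t = Y / a * (t powr (- b - \<eta>) / (- b - \<eta>) + \<delta> * (t powr (- b - a) / (- b - a)))" for t
    have "\<bar>g \<rho> - g s\<bar> \<le> B \<rho> - B s"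
    proof (rule deriv_bound_diff[OF s(2) radial_sysD(1)[OF sys(2)]])
      fix t assume t: "s \<le> t" "t \<le> \<rho>"
      show t0: "0 < t" using t s by simp
      show "\<bar>t powr (1 - real N - \<alpha>) * Q t\<bar> \<le> Y / a * (t powr (- b - \<eta> - 1) + \<delta> * t powr (- b - a - 1))"
        by (rule g'[OF t0 t(2)])
      have "((\<lambda>t. t powr (- b - \<eta>)) has_field_derivative (- b - \<eta>) * t powr (- b - \<eta> - 1)) (at t)"
        "((\<lambda>t. t powr (- b - a)) has_field_derivative (- b - a) * t powr (- b - a - 1)) (at t)"
        using t0 by (intro has_real_derivative_powr; simp)+
      from DERIV_cdivide[OF this(1), of "- b - \<eta>"] DERIV_cdivide[OF this(2), of "- b - a"]
      have "((\<lambda>t. t powr (- b - \<eta>) / (- b - \<eta>)) has_field_derivative t powr (- b - \<eta> - 1)) (at t)"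
        "((\<lambda>t. t powr (- b - a) / (- b - a)) has_field_derivative t powr (- b - a - 1)) (at t)"
        using ab \<eta> by simp_all
      then show "(B has_field_derivative Y / a * (t powr (- b - \<eta> - 1) + \<delta> * t powr (- b - a - 1))) (at t)"
        unfolding B_def by (intro DERIV_cmult DERIV_add)
    qed
    moreover have "B \<rho> \<le> 0"
      unfolding B_def using ab Y \<delta> \<eta>
      by (intro mult_nonneg_nonpos add_nonpos_nonpos divide_nonneg_neg) auto
    moreover have "- B s \<le> Y / (a * b) * (s powr (- b - \<eta>) + \<delta> * s powr (- b - a))"
    proof -
      have "- B s = Y / a * (s powr (- b - \<eta>) / (b + \<eta>) + \<delta> * (s powr (- b - a) / (b + a)))"
      proof -
        have "- b - \<eta> = - (b + \<eta>)" "- b - a = - (b + a)" by simp_all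
        then have m: "x / (- b - \<eta>) = - (x / (b + \<eta>))" "x / (- b - a) = - (x / (b + a))" for x :: real
          by (simp_all only: divide_minus_right)
        show ?thesis unfolding B_def m by (simp add: algebra_simps)
      qed
      also have "\<dots> \<le> Y / a * (s powr (- b - \<eta>) / b + \<delta> * (s powr (- b - a) / b))"
        using ab Y \<delta> \<eta> by (intro mult_left_mono add_mono divide_left_mono) auto
      also have "\<dots> = Y / (a * b) * (s powr (- b - \<eta>) + \<delta> * s powr (- b - a))"
        using ab by (simp add: field_simps)
      finally show ?thesis .
    qed
    ultimately show ?thesis by linarith
  qed
  have Pb: "\<bar>P s\<bar> \<le> \<bar>g \<rho>\<bar> / a * s powr (2 * a + 2 * b) + Y / (a\<^sup>2 * b) * (s powr (2 * a + b - \<eta>) + \<delta> * s powr (a + b))"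
    if s: "0 < s" "s \<le> \<rho>" for s
  proof -
    define B where "B t = \<bar>g \<rho>\<bar> * (t powr (2 * a + 2 * b) / (2 * a + 2 * b)) +
       Y / (a * b) * (t powr (2 * a + b - \<eta>) / (2 * a + b - \<eta>) + \<delta> * (t powr (a + b) / (a + b)))" for t
    have "\<bar>P s - 0\<bar> \<le> B s - 0"
    proof (rule deriv_bound_from_0[OF s(1) radial_sysD(2)[OF sys(1)] _ _ lim(1)])
      fix t assume t: "0 < t" "t \<le> s"
      have t': "t \<le> \<rho>" using t s by simp
      have "\<bar>t powr (real N - 1) * g t\<bar> \<le> t powr (real N - 1) * (\<bar>g \<rho>\<bar> + Y / (a * b) * (t powr (- b - \<eta>) + \<delta> * t powr (- b - a)))"
        using gb[OF t(1) t'] by (simp only: abs_mult abs_of_nonneg[OF powr_ge_zero]) (intro mult_left_mono, auto)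
      also have "\<dots> = \<bar>g \<rho>\<bar> * t powr (real N - 1) + Y / (a * b) * (t powr (real N - 1) * t powr (- b - \<eta>) + \<delta> * (t powr (real N - 1) * t powr (- b - a)))"
        by (simp add: algebra_simps)
      also have "\<dots> = \<bar>g \<rho>\<bar> * t powr (2 * a + 2 * b - 1) + Y / (a * b) * (t powr (2 * a + b - \<eta> - 1) + \<delta> * t powr (a + b - 1))"
      proof -
        have ex: "real N - 1 + (- b - \<eta>) = 2 * a + b - \<eta> - 1" "real N - 1 + (- b - a) = a + b - 1"
          unfolding eN by auto
        show ?thesis unfolding pw ex unfolding eN ..
      qed
      finally show "\<bar>t powr (real N - 1) * g t\<bar> \<le> \<bar>g \<rho>\<bar> * t powr (2 * a + 2 * b - 1) + Y / (a * b) * (t powr (2 * a + b - \<eta> - 1) + \<delta> * t powr (a + b - 1))" .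
      have "((\<lambda>t. t powr (2 * a + 2 * b)) has_field_derivative (2 * a + 2 * b) * t powr (2 * a + 2 * b - 1)) (at t)"
        "((\<lambda>t. t powr (2 * a + b - \<eta>)) has_field_derivative (2 * a + b - \<eta>) * t powr (2 * a + b - \<eta> - 1)) (at t)"
        "((\<lambda>t. t powr (a + b)) has_field_derivative (a + b) * t powr (a + b - 1)) (at t)"
        using t by (intro has_real_derivative_powr; simp)+
      from DERIV_cdivide[OF this(1), of "2 * a + 2 * b"] DERIV_cdivide[OF this(2), of "2 * a + b - \<eta>"] DERIV_cdivide[OF this(3), of "a + b"]
      have "((\<lambda>t. t powr (2 * a + 2 * b) / (2 * a + 2 * b)) has_field_derivative t powr (2 * a + 2 * b - 1)) (at t)"
        "((\<lambda>t. t powr (2 * a + b - \<eta>) / (2 * a + b - \<eta>)) has_field_derivative t powr (2 * a + b - \<eta> - 1)) (at t)"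
        "((\<lambda>t. t powr (a + b) / (a + b)) has_field_derivative t powr (a + b - 1)) (at t)"
        using ab by simp_all
      then show "(B has_field_derivative \<bar>g \<rho>\<bar> * t powr (2 * a + 2 * b - 1) + Y / (a * b) * (t powr (2 * a + b - \<eta> - 1) + \<delta> * t powr (a + b - 1))) (at t)"
        unfolding B_def by (intro DERIV_cmult DERIV_add)
    next
      have "((\<lambda>t. t powr (2 * a + 2 * b)) \<longlongrightarrow> 0) (at_right 0)" "((\<lambda>t. t powr (2 * a + b - \<eta>)) \<longlongrightarrow> 0) (at_right 0)"
        "((\<lambda>t. t powr (a + b)) \<longlongrightarrow> 0) (at_right 0)"
        using ab by (intro powr_tendsto_0; simp)+
      then have "(B \<longlongrightarrow> \<bar>g \<rho>\<bar> * (0 / (2 * a + 2 * b)) + Y / (a * b) * (0 / (2 * a + b - \<eta>) + \<delta> * (0 / (a + b)))) (at_right 0)"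
        unfolding B_def using ab by (intro tendsto_intros) auto
      then show "(B \<longlongrightarrow> 0) (at_right 0)" by simp
    qed
    then have "\<bar>P s\<bar> \<le> B s" by simp
    also have "B s \<le> \<bar>g \<rho>\<bar> * (s powr (2 * a + 2 * b) / a) + Y / (a * b) * (s powr (2 * a + b - \<eta>) / a + \<delta> * (s powr (a + b) / a))"
      unfolding B_def using ab Y \<delta> by (intro mult_left_mono add_mono divide_left_mono) auto
    also have "\<dots> = \<bar>g \<rho>\<bar> / a * s powr (2 * a + 2 * b) + Y / (a\<^sup>2 * b) * (s powr (2 * a + b - \<eta>) + \<delta> * s powr (a + b))"
    proof -
      have "Y / (a * b) * (x / a + \<delta> * (y / a)) = Y / (a\<^sup>2 * b) * (x + \<delta> * y)" for x y
        using ab by (simp add: field_simps power2_eq_square)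
      then show ?thesis by simp
    qed
    finally show ?thesis .
  qed
  have f': "\<bar>s powr (1 - real N - \<alpha>) * P s\<bar> \<le> \<bar>g \<rho>\<bar> / a * s powr (b - 1) + Y / (a\<^sup>2 * b) * (s powr (- \<eta> - 1) + \<delta> * s powr (- a - 1))"
    if s: "0 < s" "s \<le> \<rho>" for s
  proof -
    have "\<bar>s powr (1 - real N - \<alpha>) * P s\<bar> \<le> s powr (1 - real N - \<alpha>) * (\<bar>g \<rho>\<bar> / a * s powr (2 * a + 2 * b) + Y / (a\<^sup>2 * b) * (s powr (2 * a + b - \<eta>) + \<delta> * s powr (a + b)))"
      using Pb[OF s] by (simp only: abs_mult abs_of_nonneg[OF powr_ge_zero]) (intro mult_left_mono, auto)
    also have "\<dots> = \<bar>g \<rho>\<bar> / a * (s powr (1 - real N - \<alpha>) * s powr (2 * a + 2 * b)) + Y / (a\<^sup>2 * b) * (s powr (1 - real N - \<alpha>) * s powr (2 * a + b - \<eta>) + \<delta> * (s powr (1 - real N - \<alpha>) * s powr (a + b)))"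
      by (simp add: algebra_simps)
    also have "\<dots> = \<bar>g \<rho>\<bar> / a * s powr (b - 1) + Y / (a\<^sup>2 * b) * (s powr (- \<eta> - 1) + \<delta> * s powr (- a - 1))"
    proof -
      have ex: "1 - real N - \<alpha> + (2 * a + 2 * b) = b - 1" "1 - real N - \<alpha> + (2 * a + b - \<eta>) = - \<eta> - 1" "1 - real N - \<alpha> + (a + b) = - a - 1"
        unfolding eN by auto
      show ?thesis unfolding pw ex ..
    qed
    finally show ?thesis .
  qed
  define B where "B t = \<bar>g \<rho>\<bar> / a * (t powr b / b) + Y / (a\<^sup>2 * b) * (t powr (- \<eta>) / (- \<eta>) + \<delta> * (t powr (- a) / (- a)))" for t
  have "\<bar>f \<rho> - f r\<bar> \<le> B \<rho> - B r"
  proof (rule deriv_bound_diff[OF r(2) radial_sysD(1)[OF sys(1)]])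
    fix t assume t: "r \<le> t" "t \<le> \<rho>"
    show t0: "0 < t" using t r by simp
    show "\<bar>t powr (1 - real N - \<alpha>) * P t\<bar> \<le> \<bar>g \<rho>\<bar> / a * t powr (b - 1) + Y / (a\<^sup>2 * b) * (t powr (- \<eta> - 1) + \<delta> * t powr (- a - 1))"
      by (rule f'[OF t0 t(2)])
    have "((\<lambda>t. t powr b) has_field_derivative b * t powr (b - 1)) (at t)"
      "((\<lambda>t. t powr (- \<eta>)) has_field_derivative (- \<eta>) * t powr (- \<eta> - 1)) (at t)"
      "((\<lambda>t. t powr (- a)) has_field_derivative (- a) * t powr (- a - 1)) (at t)"
      using t0 by (intro has_real_derivative_powr; simp)+
    from DERIV_cdivide[OF this(1), of b] DERIV_cdivide[OF this(2), of "- \<eta>"] DERIV_cdivide[OF this(3), of "- a"]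
    have "((\<lambda>t. t powr b / b) has_field_derivative t powr (b - 1)) (at t)"
      "((\<lambda>t. t powr (- \<eta>) / (- \<eta>)) has_field_derivative t powr (- \<eta> - 1)) (at t)"
      "((\<lambda>t. t powr (- a) / (- a)) has_field_derivative t powr (- a - 1)) (at t)"
      using ab \<eta> by simp_all
    then show "(B has_field_derivative \<bar>g \<rho>\<bar> / a * t powr (b - 1) + Y / (a\<^sup>2 * b) * (t powr (- \<eta> - 1) + \<delta> * t powr (- a - 1))) (at t)"
      unfolding B_def by (intro DERIV_cmult DERIV_add)
  qed
  moreover have "B \<rho> \<le> \<bar>g \<rho>\<bar> / (a * b)"
  proof -
    have "\<rho> powr b \<le> 1" using \<rho> ab by (simp add: powr_le1)
    then have "\<bar>g \<rho>\<bar> / a * (\<rho> powr b / b) \<le> \<bar>g \<rho>\<bar> / a * (1 / b)"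
      using ab by (intro mult_left_mono divide_right_mono) auto
    moreover have "Y / (a\<^sup>2 * b) * (\<rho> powr (- \<eta>) / (- \<eta>) + \<delta> * (\<rho> powr (- a) / (- a))) \<le> 0"
      using ab Y \<delta> \<eta> by (intro mult_nonneg_nonpos add_nonpos_nonpos divide_nonneg_neg) auto
    ultimately show ?thesis unfolding B_def by simp
  qed
  moreover have "- B r \<le> Y / (a\<^sup>2 * b * \<eta>) * (r powr (- \<eta>) + \<delta> * r powr (- a))"
  proof -
    have "0 \<le> \<bar>g \<rho>\<bar> / a * (r powr b / b)" using ab by simp
    then have "- B r \<le> Y / (a\<^sup>2 * b) * (r powr (- \<eta>) / \<eta> + \<delta> * (r powr (- a) / a))"
      using ab \<eta> by (simp add: B_def field_simps)
    \<comment> \<open>Replaces the denominator a by the smaller \<eta>, so that both powers carry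
      the same coefficient.\<close>
    also have "\<dots> \<le> Y / (a\<^sup>2 * b) * (r powr (- \<eta>) / \<eta> + \<delta> * (r powr (- a) / \<eta>))"
      using ab Y \<delta> \<eta> by (intro mult_left_mono add_mono divide_left_mono) auto
    also have "\<dots> = Y / (a\<^sup>2 * b * \<eta>) * (r powr (- \<eta>) + \<delta> * r powr (- a))"
      using ab \<eta> by (simp add: field_simps)
    finally show ?thesis .
  qed
  ultimately have "\<bar>f r\<bar> \<le> (\<bar>f \<rho>\<bar> + \<bar>g \<rho>\<bar> / (a * b)) * 1 + Y / (a\<^sup>2 * b * \<eta>) * (r powr (- \<eta>) + \<delta> * r powr (- a))"
    using abs_triangle_ineq2[of "f r" "f \<rho>"] abs_minus_commute[of "f r" "f \<rho>"] by simp
  \<comment> \<open>Since r is at most 1, r^(-\<eta>) is at least 1, so the boundary values at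
    \<rho> can be put under the common weight.\<close>
  also have "(\<bar>f \<rho>\<bar> + \<bar>g \<rho>\<bar> / (a * b)) * 1 \<le> (\<bar>f \<rho>\<bar> + \<bar>g \<rho>\<bar> / (a * b)) * (r powr (- \<eta>) + \<delta> * r powr (- a))"
  proof (rule mult_left_mono)
    have "r powr \<eta> \<le> 1" using r \<rho> \<eta> by (intro powr_le1) auto
    then have "1 \<le> r powr (- \<eta>)" using r by (simp add: powr_minus one_le_inverse)
    then show "1 \<le> r powr (- \<eta>) + \<delta> * r powr (- a)" using \<delta> by (simp add: add_increasing2)
    show "0 \<le> \<bar>f \<rho>\<bar> + \<bar>g \<rho>\<bar> / (a * b)" using ab by simp
  qed
  finally show ?thesis by (simp add: a_def b_def Y_def distrib_right)
qed

text \<open>The weak decay r^-aexp holds with an arbitrarily small factor. Hence the supremum X of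
  |f| over the weight r^(-\<eta>) + \<delta> r^(-aexp) is finite, and \<open>bootstrap_step\<close>
  gives X \<le> C + X / 2 with C independent of \<delta>. Letting \<delta> tend to 0 removes the
  singular part of the weight.\<close>

lemma bootstrap_at_0:
  assumes sys: "radial_sys N \<alpha> f P g" "radial_sys N \<alpha> g Q (\<lambda>r. nonlin N \<alpha> (f r))"
    and lim: "(P \<longlongrightarrow> 0) (at_right 0)" "(Q \<longlongrightarrow> 0) (at_right 0)"
    and Pe: "\<And>e. e > 0 \<Longrightarrow> \<exists>\<rho>>0. \<forall>r. 0 < r \<and> r < \<rho> \<longrightarrow> \<bar>P r\<bar> \<le> e * r powr (real N / 2)"
    and \<eta>: "0 < \<eta>" "\<eta> < aexp"
  obtains C \<rho> where "C > 0" "0 < \<rho>" "\<And>r. 0 < r \<Longrightarrow> r \<le> \<rho> \<Longrightarrow> \<bar>f r\<bar> \<le> C * r powr (- \<eta>)"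
proof -
  have small: "\<exists>\<rho>>0. \<rho> \<le> 1 \<and> (\<forall>r. 0 < r \<and> r \<le> \<rho> \<longrightarrow> \<bar>f r\<bar> \<le> e * r powr (- aexp))" if e: "e > 0" for e
  proof -
    \<comment> \<open>Integrating e1 s^(-aexp - 1) produces e1 / aexp, which is e / 2; the other
      half is left for the value of f at t.\<close>
    define e1 where "e1 = e * aexp / 2"
    have e1: "e1 > 0" using e exps by (simp add: e1_def)
    obtain \<rho>1 where \<rho>1: "\<rho>1 > 0" "\<And>r. 0 < r \<Longrightarrow> r < \<rho>1 \<Longrightarrow> \<bar>P r\<bar> \<le> e1 * r powr (real N / 2)" using Pe[OF e1] by blast
    define t where "t = \<rho>1 / 2"
    have t: "0 < t" "t < \<rho>1" using \<rho>1 by (auto simp: t_def)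
    have diff: "\<bar>f t - f r\<bar> \<le> e / 2 * r powr (- aexp)" if r: "0 < r" "r \<le> t" for r
    proof -
      define B where "B s = e1 * (s powr (- aexp) / (- aexp))" for s
      have "\<bar>f t - f r\<bar> \<le> B t - B r"
      proof (rule deriv_bound_diff[OF r(2) radial_sysD(1)[OF sys(1)]])
        fix s assume s: "r \<le> s" "s \<le> t"
        show s0: "0 < s" using s r by simp
        have "\<bar>s powr (1 - real N - \<alpha>) * P s\<bar> \<le> s powr (1 - real N - \<alpha>) * (e1 * s powr (real N / 2))"
          using \<rho>1(2)[of s] s s0 t by (simp add: abs_mult mult_left_mono)
        also have "\<dots> = e1 * s powr (1 - real N - \<alpha> + real N / 2)"
          unfolding powr_add[of s "1 - real N - \<alpha>" "real N / 2"] by (rule mult.left_commute)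
        also have "1 - real N - \<alpha> + real N / 2 = - aexp - 1" using exps(4,6) by linarith
        finally show "\<bar>s powr (1 - real N - \<alpha>) * P s\<bar> \<le> e1 * s powr (- aexp - 1)" .
        have "((\<lambda>s. s powr (- aexp)) has_field_derivative (- aexp) * s powr (- aexp - 1)) (at s)"
          using s0 by (rule has_real_derivative_powr)
        from DERIV_cdivide[OF this, of "- aexp"]
        show "(B has_field_derivative e1 * s powr (- aexp - 1)) (at s)"
          unfolding B_def using exps(1) by (intro DERIV_cmult) simp
      qed
      also have "\<dots> \<le> - B r" using e1 exps(1) by (simp add: B_def)
      also have "- B r = e / 2 * r powr (- aexp)" using exps(1) by (simp add: B_def e1_def)
      finally show ?thesis .
    qed
    have "((\<lambda>r. \<bar>f t\<bar> * r powr aexp) \<longlongrightarrow> \<bar>f t\<bar> * 0) (at_right 0)" by (intro tendsto_mult_left powr_tendsto_0 exps)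
    then have "\<forall>\<^sub>F r in at_right 0. \<bar>f t\<bar> * r powr aexp < e / 2" using e by (intro order_tendstoD(2)) auto
    then obtain \<rho>2 where \<rho>2: "\<rho>2 > 0" "\<And>r. 0 < r \<Longrightarrow> r < \<rho>2 \<Longrightarrow> \<bar>f t\<bar> * r powr aexp < e / 2"
      unfolding eventually_at_right_field by blast
    define \<rho> where "\<rho> = min 1 (min t (\<rho>2 / 2))"
    have "\<rho> > 0" "\<rho> \<le> 1" using t \<rho>2 by (auto simp: \<rho>_def)
    moreover have "\<bar>f r\<bar> \<le> e * r powr (- aexp)" if r: "0 < r" "r \<le> \<rho>" for r
    proof -
      have r': "r \<le> t" "r < \<rho>2" using r \<rho>2(1) by (auto simp: \<rho>_def)
      have "\<bar>f t\<bar> = \<bar>f t\<bar> * r powr aexp * r powr (- aexp)" using r by (simp add: powr_minus)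
      also have "\<dots> \<le> e / 2 * r powr (- aexp)" using \<rho>2(2)[OF r(1) r'(2)] by (intro mult_right_mono) auto
      finally have "\<bar>f r\<bar> \<le> e / 2 * r powr (- aexp) + e / 2 * r powr (- aexp)" using diff[OF r(1) r'(1)] by linarith
      then show ?thesis by simp
    qed
    ultimately show ?thesis by blast
  qed
  \<comment> \<open>Makes the coefficient of X in \<open>bootstrap_step\<close> equal to
    1/2.\<close>
  define \<epsilon> where "\<epsilon> = aexp\<^sup>2 * bexp * \<eta> / 2"
  have \<epsilon>: "\<epsilon> > 0" using exps \<eta> by (simp add: \<epsilon>_def)
  \<comment> \<open>Raising the decay bound with factor e to the power pexp gives the potential the
    coefficient \<epsilon>.\<close>
  define e where "e = \<epsilon> powr (1 / pexp)"
  have e: "e > 0" "e powr pexp = \<epsilon>" using \<epsilon> exps(3) by (auto simp: e_def powr_powr)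
  obtain \<rho> where \<rho>: "\<rho> > 0" "\<rho> \<le> 1" "\<And>r. 0 < r \<Longrightarrow> r \<le> \<rho> \<Longrightarrow> \<bar>f r\<bar> \<le> e * r powr (- aexp)"
    using small[OF e(1)] by blast
  have V: "\<bar>f r\<bar> powr pexp \<le> \<epsilon> * r powr (- (2 * bexp))" if r: "0 < r" "r \<le> \<rho>" for r
  proof -
    have "\<bar>f r\<bar> powr pexp \<le> (e * r powr (- aexp)) powr pexp" using \<rho>(3)[OF r] exps(3) by (intro powr_mono2) auto
    also have "\<dots> = \<epsilon> * r powr (- (aexp * pexp))" using e r by (simp add: powr_mult powr_powr)
    finally show ?thesis by (simp add: exps(5))
  qed
  define C where "C = \<bar>f \<rho>\<bar> + \<bar>g \<rho>\<bar> / (aexp * bexp)"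
  have C: "C \<ge> 0" using exps by (simp add: C_def)
  have main: "\<bar>f r\<bar> \<le> 2 * C * (r powr (- \<eta>) + \<delta> * r powr (- aexp))" if \<delta>: "\<delta> > 0" and r: "0 < r" "r \<le> \<rho>" for \<delta> r
  proof -
    define W where "W r = r powr (- \<eta>) + \<delta> * r powr (- aexp)" for r
    have W: "W r > 0" if "r > 0" for r using that \<delta> by (simp add: W_def add_pos_pos)
    \<comment> \<open>Finite because \<delta> > 0: the known bound e r^(-aexp) is at most e /
      \<delta> times the weight.\<close>
    define X where "X = (SUP r\<in>{0<..\<rho>}. \<bar>f r\<bar> / W r)"
    have bdd: "bdd_above ((\<lambda>r. \<bar>f r\<bar> / W r) ` {0<..\<rho>})"
    proof (rule bdd_aboveI2)
      fix r assume r: "r \<in> {0<..\<rho>}"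
      have "\<bar>f r\<bar> \<le> e * r powr (- aexp)" using \<rho>(3) r by simp
      also have "\<dots> = e / \<delta> * (\<delta> * r powr (- aexp))" using \<delta> by simp
      also have "\<dots> \<le> e / \<delta> * W r" using e \<delta> by (intro mult_left_mono) (auto simp: W_def)
      finally show "\<bar>f r\<bar> / W r \<le> e / \<delta>" using W[of r] r by (simp add: divide_le_eq)
    qed
    have fX: "\<bar>f r\<bar> \<le> X * W r" if "0 < r" "r \<le> \<rho>" for r
    proof -
      have "\<bar>f r\<bar> / W r \<le> X" unfolding X_def using that by (intro cSUP_upper bdd) auto
      then show ?thesis using W[of r] that by (simp add: divide_le_eq)
    qed
    have "0 \<le> \<bar>f \<rho>\<bar> / W \<rho>" using W[OF \<rho>(1)] by simp
    also have "\<dots> \<le> X" unfolding X_def using \<rho> by (intro cSUP_upper bdd) auto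
    finally have X0: "X \<ge> 0" .
    have "\<bar>f s\<bar> / W s \<le> C + X / 2" if s: "s \<in> {0<..\<rho>}" for s
    proof -
      have s': "0 < s" "s \<le> \<rho>" using s by auto
      have "\<bar>f s\<bar> \<le> (C + \<epsilon> * X / (aexp\<^sup>2 * bexp * \<eta>)) * W s"
        using bootstrap_step[OF sys lim \<rho>(1,2) \<eta> less_imp_le[OF \<delta>] less_imp_le[OF \<epsilon>] X0 V fX[unfolded W_def] s']
        by (simp add: C_def W_def)
      also have "\<epsilon> * X / (aexp\<^sup>2 * bexp * \<eta>) = X / 2" using exps \<eta> by (simp add: \<epsilon>_def)
      finally show ?thesis using W[OF s'(1)] by (simp add: divide_le_eq)
    qed
    then have "X \<le> C + X / 2" unfolding X_def[symmetric] by (subst X_def, intro cSUP_least) (use \<rho>(1) in auto)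
    then have "X \<le> 2 * C" by simp
    then have "X * W r \<le> 2 * C * W r" using W[OF r(1)] by (intro mult_right_mono) auto
    then show ?thesis using fX[OF r] by (simp add: W_def)
  qed
  have "\<bar>f r\<bar> \<le> (2 * C + 1) * r powr (- \<eta>)" if r: "0 < r" "r \<le> \<rho>" for r
  proof -
    have "\<bar>f r\<bar> \<le> 2 * C * (r powr (- \<eta>) + 1 / (real n + 1) * r powr (- aexp))" for n
      by (rule main[OF _ r]) simp
    moreover have "(\<lambda>n. 2 * C * (r powr (- \<eta>) + 1 / (real n + 1) * r powr (- aexp))) \<longlonglongrightarrow> 2 * C * (r powr (- \<eta>) + 0 * r powr (- aexp))"
    proof -
      have "(\<lambda>n. 1 / (real n + 1)) \<longlonglongrightarrow> 0" using LIMSEQ_inverse_real_of_nat by (simp add: inverse_eq_divide add.commute)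
      then show ?thesis by (intro tendsto_intros)
    qed
    ultimately have "\<bar>f r\<bar> \<le> 2 * C * (r powr (- \<eta>) + 0 * r powr (- aexp))" by (intro LIMSEQ_le_const) auto
    also have "\<dots> \<le> (2 * C + 1) * r powr (- \<eta>)" by (simp add: mult_right_mono)
    finally show ?thesis .
  qed
  \<comment> \<open>The summand 1 makes the constant positive, since C may vanish.\<close>
  then show ?thesis using that[of "2 * C + 1" \<rho>] C \<rho>(1) by simp
qed

text \<open>With |f| at most C r^(-\<eta>) for a small \<eta>, the nonlinearity is O(r^-\<theta>)
  and the derivative of g is O(r^(bexp - \<theta> - 1)), so g has a limit. Bounded g then gives a
  flux P = O(r^N) and a derivative of f of order r^(bexp - 1), so f has a limit too.\<close>

lemma regular_at_0:
  assumes sys: "radial_sys N \<alpha> f P g" "radial_sys N \<alpha> g Q (\<lambda>r. nonlin N \<alpha> (f r))"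
    and lim: "(P \<longlongrightarrow> 0) (at_right 0)" "(Q \<longlongrightarrow> 0) (at_right 0)"
    and Pe: "\<And>e. e > 0 \<Longrightarrow> \<exists>\<rho>>0. \<forall>r. 0 < r \<and> r < \<rho> \<longrightarrow> \<bar>P r\<bar> \<le> e * r powr (real N / 2)"
  obtains f0 g0 where "regular_sol f P g Q f0 g0"
proof -
  \<comment> \<open>The second entry makes \<theta> = \<eta> (pexp + 1) at most bexp / 2, hence the
    derivative of g integrable at 0; the first keeps \<eta> below aexp.\<close>
  define \<eta> where "\<eta> = min (aexp / 2) (bexp / (2 * (pexp + 1)))"
  define \<theta> where "\<theta> = \<eta> * (pexp + 1)"
  have \<eta>: "0 < \<eta>" "\<eta> < aexp" using exps by (auto simp: \<eta>_def)
  have "\<eta> * (pexp + 1) \<le> bexp / (2 * (pexp + 1)) * (pexp + 1)"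
    using exps by (intro mult_right_mono) (auto simp: \<eta>_def)
  also have "\<dots> = bexp / 2"
  proof -
    have "x / (2 * c) * c = x / 2" if "c \<noteq> 0" for x c :: real using that by simp
    then show ?thesis using exps(3) by (metis add_pos_pos less_numeral_extra(1) less_irrefl)
  qed
  finally have \<theta>: "0 < \<theta>" "\<theta> < bexp" using \<eta> exps unfolding \<theta>_def by auto
  obtain C \<rho> where C: "C > 0" "0 < \<rho>" "\<And>r. 0 < r \<Longrightarrow> r \<le> \<rho> \<Longrightarrow> \<bar>f r\<bar> \<le> C * r powr (- \<eta>)"
    using bootstrap_at_0[OF sys lim Pe \<eta>] by blast
  define D where "D = C powr (pexp + 1)"
  have F: "\<bar>nonlin N \<alpha> (f r)\<bar> \<le> D * r powr (- \<theta>)" if r: "0 < r" "r \<le> \<rho>" for r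
  proof -
    have "\<bar>f r\<bar> powr (pexp + 1) \<le> (C * r powr (- \<eta>)) powr (pexp + 1)"
      using C(3)[OF r] exps(3) by (intro powr_mono2) auto
    also have "\<dots> = D * r powr (- \<theta>)" using C r by (simp add: powr_mult powr_powr D_def \<theta>_def)
    finally show ?thesis by (simp add: abs_nonlin(2))
  qed
  have Nth: "real N - \<theta> > 0" using \<theta> exps by simp
  have Q: "\<bar>Q r\<bar> \<le> D / (real N - \<theta>) * r powr (real N - \<theta>)" if r: "0 < r" "r \<le> \<rho>" for r
  proof -
    have "\<bar>Q r - 0\<bar> \<le> D / (real N - \<theta>) * r powr (real N - \<theta>) - 0"
    proof (rule deriv_bound_from_0[OF r(1) radial_sysD(2)[OF sys(2)] _ _ lim(2)])
      fix t assume t: "0 < t" "t \<le> r"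
      show "((\<lambda>t. D / (real N - \<theta>) * t powr (real N - \<theta>)) has_field_derivative D * t powr (real N - \<theta> - 1)) (at t)"
        using DERIV_cmult[OF has_real_derivative_powr[OF t(1), of "real N - \<theta>"], of "D / (real N - \<theta>)"] Nth by simp
      have "\<bar>t powr (real N - 1) * nonlin N \<alpha> (f t)\<bar> \<le> t powr (real N - 1) * (D * t powr (- \<theta>))"
        using F[of t] t r by (simp add: abs_mult mult_left_mono)
      also have "\<dots> = D * t powr (real N - 1 + - \<theta>)"
        unfolding powr_add[of t "real N - 1" "- \<theta>"] by (rule mult.left_commute)
      also have "real N - 1 + - \<theta> = real N - \<theta> - 1" by simp
      finally show "\<bar>t powr (real N - 1) * nonlin N \<alpha> (f t)\<bar> \<le> D * t powr (real N - \<theta> - 1)" .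
    next
      show "((\<lambda>t. D / (real N - \<theta>) * t powr (real N - \<theta>)) \<longlongrightarrow> 0) (at_right 0)"
        using tendsto_mult_left[OF powr_tendsto_0[OF Nth], of "D / (real N - \<theta>)"] by simp
    qed
    then show ?thesis by simp
  qed
  have g': "\<bar>r powr (1 - real N - \<alpha>) * Q r\<bar> \<le> D / (real N - \<theta>) * r powr (bexp - \<theta> - 1)" if r: "0 < r" "r \<le> \<rho>" for r
  proof -
    have "\<bar>r powr (1 - real N - \<alpha>) * Q r\<bar> \<le> r powr (1 - real N - \<alpha>) * (D / (real N - \<theta>) * r powr (real N - \<theta>))"
      unfolding abs_mult using Q[OF r] by (intro mult_mono) auto
    also have "\<dots> = D / (real N - \<theta>) * r powr (1 - real N - \<alpha> + (real N - \<theta>))"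
      unfolding powr_add[of r "1 - real N - \<alpha>" "real N - \<theta>"] by (rule mult.left_commute)
    also have "1 - real N - \<alpha> + (real N - \<theta>) = bexp - \<theta> - 1" using exps(7) by linarith
    finally show ?thesis .
  qed
  obtain g0 where g0: "(g \<longlongrightarrow> g0) (at_right 0)"
  proof (rule deriv_power_limit[OF C(2) _ radial_sysD(1)[OF sys(2)] g'])
    show "0 < bexp - \<theta>" using \<theta> by simp
  qed
  obtain M where M: "M > 0" "\<And>r. 0 < r \<Longrightarrow> r \<le> \<rho> \<Longrightarrow> \<bar>g r\<bar> \<le> M"
    using tendsto_at_right_bounded[OF g0 radial_sys_isCont(1)[OF sys(2)]] by metis
  have P: "\<bar>P r\<bar> \<le> M / real N * r powr real N" if r: "0 < r" "r \<le> \<rho>" for r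
  proof -
    have "\<bar>P r - 0\<bar> \<le> M / real N * r powr real N - 0"
    proof (rule deriv_bound_from_0[OF r(1) radial_sysD(2)[OF sys(1)] _ _ lim(1)])
      fix t assume t: "0 < t" "t \<le> r"
      show "((\<lambda>t. M / real N * t powr real N) has_field_derivative M * t powr (real N - 1)) (at t)"
        using DERIV_cmult[OF has_real_derivative_powr[OF t(1), of "real N"], of "M / real N"] N_pos by simp
      show "\<bar>t powr (real N - 1) * g t\<bar> \<le> M * t powr (real N - 1)"
        using M(2)[of t] t r by (simp add: abs_mult mult_left_mono mult.commute)
    next
      show "((\<lambda>t. M / real N * t powr real N) \<longlongrightarrow> 0) (at_right 0)"
        using tendsto_mult_left[OF powr_tendsto_0[OF N_pos(1)], of "M / real N"] by simp
    qed
    then show ?thesis by simp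
  qed
  have f': "\<bar>r powr (1 - real N - \<alpha>) * P r\<bar> \<le> M / real N * r powr (bexp - 1)" if r: "0 < r" "r \<le> \<rho>" for r
  proof -
    have "\<bar>r powr (1 - real N - \<alpha>) * P r\<bar> \<le> r powr (1 - real N - \<alpha>) * (M / real N * r powr real N)"
      unfolding abs_mult using P[OF r] by (intro mult_mono) auto
    also have "\<dots> = M / real N * r powr (1 - real N - \<alpha> + real N)"
      unfolding powr_add[of r "1 - real N - \<alpha>" "real N"] by (rule mult.left_commute)
    also have "1 - real N - \<alpha> + real N = bexp - 1" using exps(7) by linarith
    finally show ?thesis .
  qed
  obtain f0 where f0: "(f \<longlongrightarrow> f0) (at_right 0)"
    by (rule deriv_power_limit[OF C(2) exps(2) radial_sysD(1)[OF sys(1)] f']) 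
  show ?thesis by (rule that[of f0 g0]) (simp add: regular_sol_def sys lim f0 g0)
qed


text \<open>The norm of the indicator of the ball supplies the power r^(N/2), and the factor tending
  to 0 is the L^2 norm of g over the shrinking ball. This is the smallness from which the bootstrap
  starts.\<close>

lemma ball_integral_Cauchy_Schwarz:
  fixes g :: "real \<Rightarrow> real"
  assumes g: "(\<lambda>x::real^'n. g (norm x)) \<in> L2 lborel" and e: "e > 0"
  shows "\<exists>\<rho>>0. \<forall>r. 0 < r \<and> r < \<rho> \<longrightarrow> \<bar>ball_integral (\<lambda>x::real^'n. g (norm x)) r\<bar> \<le> e * r powr (real N / 2)"
proof -
  define V where "V = unit_ball_vol (real N)"
  have V: "V > 0" by (simp add: V_def)
  have sq: "(\<lambda>x::real^'n. (g (norm x))\<^sup>2) absolutely_integrable_on cball 0 R" for R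
  proof (subst set_integrable_lborel_iff_lebesgue)
    show m: "(\<lambda>x::real^'n. (g (norm x))\<^sup>2) \<in> borel_measurable borel"
      using borel_measurable_integrable[OF L2_integrable_sq[OF g]] by simp
    show "integrable lborel (\<lambda>x::real^'n. indicator (cball 0 R) x * (g (norm x))\<^sup>2)"
      by (rule Bochner_Integration.integrable_bound[OF L2_integrable_sq[OF g]])
         (use m in \<open>auto simp: indicator_def intro!: borel_measurable_times borel_measurable_indicator\<close>)
  qed auto
  \<comment> \<open>Chosen so that sqrt (V d) = e, where V r^N is the volume of the ball of radius
    r.\<close>
  define d where "d = e\<^sup>2 / V"
  have d: "d > 0" using e V by (simp add: d_def)
  have "\<forall>\<^sub>F r in at_right 0. ball_integral (\<lambda>x::real^'n. (g (norm x))\<^sup>2) r < d"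
    by (rule order_tendstoD(2)[OF ball_integral_tendsto_0[OF sq] d])
  then obtain \<rho> where \<rho>: "\<rho> > 0" "\<And>r. 0 < r \<Longrightarrow> r < \<rho> \<Longrightarrow> ball_integral (\<lambda>x::real^'n. (g (norm x))\<^sup>2) r < d"
    unfolding eventually_at_right_field by blast
  have "\<bar>ball_integral (\<lambda>x::real^'n. g (norm x)) r\<bar> \<le> e * r powr (real N / 2)" if r: "0 < r" "r < \<rho>" for r
  proof -
    let ?I = "\<lambda>x::real^'n. indicator (cball 0 r) x :: real"
    have Im: "?I \<in> borel_measurable borel" by (intro borel_measurable_indicator) auto
    have IL: "?I \<in> L2 lborel" by (rule bounded_ball_L2[of _ 1 r]) (use Im in auto)
    have gm: "(\<lambda>x::real^'n. g (norm x)) \<in> borel_measurable borel" using L2_measurable[OF g] by simp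
    have IgL: "(\<lambda>x::real^'n. ?I x * g (norm x)) \<in> L2 lborel"
      by (rule L2_dominated[OF g]) (use Im gm in \<open>auto simp: indicator_def intro!: borel_measurable_times\<close>)
    have "ball_integral (\<lambda>x::real^'n. g (norm x)) r = integral\<^sup>L lborel (\<lambda>x. ?I x * (?I x * g (norm x)))"
    proof -
      have "(\<lambda>x::real^'n. ?I x * g (norm x)) \<in> borel_measurable lborel" using Im gm by (intro borel_measurable_times) auto
      then have "ball_integral (\<lambda>x::real^'n. g (norm x)) r = integral\<^sup>L lborel (\<lambda>x. ?I x * g (norm x))"
        unfolding ball_integral_def by (intro integral_completion) 
      also have "(\<lambda>x. ?I x * g (norm x)) = (\<lambda>x. ?I x * (?I x * g (norm x)))" by (auto simp: indicator_def)
      finally show ?thesis .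
    qed
    then have "\<bar>ball_integral (\<lambda>x::real^'n. g (norm x)) r\<bar> \<le> L2_norm lborel ?I * L2_norm lborel (\<lambda>x. ?I x * g (norm x))"
      using L2_Cauchy_Schwarz[OF IL IgL] by simp
    also have "\<dots> \<le> sqrt (V * r powr real N) * sqrt d"
    proof (intro mult_mono)
      have "(\<lambda>x. (?I x)\<^sup>2) = ?I" by (auto simp: indicator_def)
      then have "L2_norm lborel ?I = sqrt (measure lborel (cball (0::real^'n) r))"
        by (simp add: L2_norm_def)
      also have "measure lborel (cball (0::real^'n) r) = V * r ^ N"
        using r by (simp add: content_cball V_def card_dim)
      also have "r ^ N = r powr real N" using r by (simp add: powr_realpow)
      finally show "L2_norm lborel ?I \<le> sqrt (V * r powr real N)" by simp
      have "(\<integral>x. (?I x * g (norm x))\<^sup>2 \<partial>lborel) = ball_integral (\<lambda>x::real^'n. (g (norm x))\<^sup>2) r"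
      proof -
        have "(\<lambda>x::real^'n. ?I x * (g (norm x))\<^sup>2) \<in> borel_measurable lborel" using Im gm by (intro borel_measurable_times borel_measurable_power) auto
        then have "ball_integral (\<lambda>x::real^'n. (g (norm x))\<^sup>2) r = integral\<^sup>L lborel (\<lambda>x. ?I x * (g (norm x))\<^sup>2)"
          unfolding ball_integral_def by (intro integral_completion)
        also have "(\<lambda>x. ?I x * (g (norm x))\<^sup>2) = (\<lambda>x. (?I x * g (norm x))\<^sup>2)" by (auto simp: indicator_def)
        finally show ?thesis by simp
      qed
      then show "L2_norm lborel (\<lambda>x. ?I x * g (norm x)) \<le> sqrt d"
        using \<rho>(2)[OF r] by (simp add: L2_norm_def)
    qed (auto simp: L2_norm_nonneg V less_imp_le)
    also have "\<dots> = sqrt (V * d) * sqrt (r powr real N)" by (simp add: real_sqrt_mult)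
    also have "sqrt (V * d) = e" using V e by (simp add: d_def)
    also have "sqrt (r powr real N) = r powr (real N / 2)"
      using r by (simp add: powr_half_sqrt[symmetric] powr_powr)
    finally show ?thesis .
  qed
  then show ?thesis using \<rho>(1) by blast
qed

text \<open>\<open>radial_du_Bois_Reymond\<close> is applied twice: to the limit functional, whose
  source is the nonlinear term by the weak equation, which yields g; then to integration against u,
  whose source is g by integration by parts for the approximating test functions, which yields f.
  Local integrability of each source makes its ball integrals tend to 0.\<close>

lemma weak_solution_regular:
  fixes u :: "real^'n \<Rightarrow> real"
  assumes u: "u \<in> D22 \<alpha>" and weak: "weak_solution \<alpha> u" and rad: "radial u"
  obtains f P g Q f0 g0 where "regular_sol f P g Q f0 g0"
    "(\<lambda>x::real^'n. g (norm x)) \<in> L2 lborel" "AE x in lebesgue. u x = f (norm x)"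
proof -
  obtain w where w: "represents \<alpha> w u" using u by (auto simp: D22_def)
  define \<omega> where "\<omega> = sphere_area N"
  have \<omega>: "\<omega> > 0" using N_pos by (simp add: \<omega>_def)
  note uint = representsD(3)[OF w]
  note Fint = weak_nonlin_integrable[OF weak]
  have wd: "wdiv \<alpha> (\<lambda>x. \<phi> (norm x)) x = \<Phi> (norm x)" if "radial_sys N \<alpha> \<phi> P \<Phi>" "x \<noteq> 0" for \<phi> P \<Phi> and x :: "real^'n"
    using wdiv_radial[of \<alpha> \<phi> P \<Phi> x] that by (simp add: card_dim)
  obtain g where g: "\<And>r. r > 0 \<Longrightarrow> (g has_field_derivative r powr (1 - real N - \<alpha>) * (ball_integral (\<lambda>x. nonlin N \<alpha> (u x)) r / \<omega>)) (at r)"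
    and geq: "\<And>\<Phi>. bump \<Phi> \<Longrightarrow> wdiv_limit \<alpha> w (\<lambda>x. \<Phi> (norm x)) = integral\<^sup>L lborel (\<lambda>x::real^'n. g (norm x) * \<Phi> (norm x))"
    unfolding \<omega>_def
  proof (rule radial_du_Bois_Reymond[OF Fint, of "\<lambda>\<Phi>. wdiv_limit \<alpha> w (\<lambda>x. \<Phi> (norm x))"])
    fix \<Phi> \<Psi> and c :: real assume b: "bump \<Phi>" "bump \<Psi>"
    show "wdiv_limit \<alpha> w (\<lambda>x. c * \<Phi> (norm x) + \<Psi> (norm x)) = c * wdiv_limit \<alpha> w (\<lambda>x. \<Phi> (norm x)) + wdiv_limit \<alpha> w (\<lambda>x. \<Psi> (norm x))"
      by (rule wdiv_limit_linear[OF w bump_L2[OF b(1)] bump_L2[OF b(2)]])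
  next
    fix \<Phi> \<phi> P and a b :: real
    assume ab: "0 < a" "a < b" and bu: "bump \<Phi>" and \<phi>: "smooth1 UNIV \<phi>" and sys: "radial_sys N \<alpha> \<phi> P \<Phi>"
      and c: "\<And>r. r \<le> a \<Longrightarrow> \<phi> r = \<phi> a" and z: "\<And>r. b \<le> r \<Longrightarrow> \<phi> r = 0"
    have t: "(\<lambda>x::real^'n. \<phi> (norm x)) \<in> test_fun \<alpha>"
      by (rule test_fun_radial(1)[OF \<phi> ab(1), of b]) (fact c, fact z)
    have "AE x in lborel. wdiv \<alpha> (\<lambda>x. \<phi> (norm x)) x = \<Phi> (norm (x::real^'n))"
      using AE_lborel_not_zero by eventually_elim (rule wd[OF sys])
    from wdiv_limit_cong_AE[OF w test_funD(3)[OF t] bump_L2[OF bu] this] weak_wdiv_limit[OF weak w t]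
    show "wdiv_limit \<alpha> w (\<lambda>x. \<Phi> (norm x)) = (\<integral>x. nonlin N \<alpha> (u x) * \<phi> (norm x) \<partial>lebesgue)" by simp
  qed blast
  have gc: "continuous_on {0<..} g"
    by (intro continuous_at_imp_continuous_on ballI DERIV_isCont[OF g]) auto
  have gL: "(\<lambda>x::real^'n. g (norm x)) \<in> L2 lborel" by (rule wdiv_limit_density_L2[OF w gc geq])
  have gint: "(\<lambda>x::real^'n. g (norm x)) absolutely_integrable_on cball 0 R" for R by (rule L2_locally_integrable[OF gL])
  obtain f where f: "\<And>r. r > 0 \<Longrightarrow> (f has_field_derivative r powr (1 - real N - \<alpha>) * (ball_integral (\<lambda>x::real^'n. g (norm x)) r / \<omega>)) (at r)"
    and feq: "\<And>\<Phi>. bump \<Phi> \<Longrightarrow> (\<integral>x. u x * \<Phi> (norm x) \<partial>lebesgue) = integral\<^sup>L lborel (\<lambda>x::real^'n. f (norm x) * \<Phi> (norm x))"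
    unfolding \<omega>_def
  proof (rule radial_du_Bois_Reymond[OF gint, of "\<lambda>\<Phi>. \<integral>x. u x * \<Phi> (norm x) \<partial>lebesgue"])
    fix \<Phi> \<Psi> and c :: real assume b: "bump \<Phi>" "bump \<Psi>"
    have "(\<integral>x. u x * (c * \<Phi> (norm x) + \<Psi> (norm x)) \<partial>lebesgue) = (\<integral>x. c * (u x * \<Phi> (norm x)) + u x * \<Psi> (norm x) \<partial>lebesgue)"
      by (intro Bochner_Integration.integral_cong) (auto simp: algebra_simps)
    then show "(\<integral>x. u x * (c * \<Phi> (norm x) + \<Psi> (norm x)) \<partial>lebesgue) = c * (\<integral>x. u x * \<Phi> (norm x) \<partial>lebesgue) + (\<integral>x. u x * \<Psi> (norm x) \<partial>lebesgue)"
      using locally_integrable_bump[OF uint b(1)] locally_integrable_bump[OF uint b(2)] by simp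
  next
    fix \<Phi> \<phi> P and a b :: real
    assume ab: "0 < a" "a < b" and bu: "bump \<Phi>" and \<phi>: "smooth1 UNIV \<phi>" and sys: "radial_sys N \<alpha> \<phi> P \<Phi>"
      and c: "\<And>r. r \<le> a \<Longrightarrow> \<phi> r = \<phi> a" and z: "\<And>r. b \<le> r \<Longrightarrow> \<phi> r = 0"
    have t: "(\<lambda>x::real^'n. \<phi> (norm x)) \<in> test_fun \<alpha>" "smooth (\<lambda>x::real^'n. \<phi> (norm x))" "compactly_supported (\<lambda>x::real^'n. \<phi> (norm x))"
      by (rule test_fun_radial(1)[OF \<phi> ab(1), of b], fact c, fact z)
         (rule test_fun_radial(2)[OF \<phi> ab(1), of b], fact c, fact z,
          rule test_fun_radial(3)[OF \<phi> ab(1), of b], fact c, fact z)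
    obtain a' b' where b': "0 < a'" "a' < b'" "\<And>r. r \<notin> {a'..b'} \<Longrightarrow> \<Phi> r = 0" "smooth1 UNIV \<Phi>"
      by (rule bumpE[OF bu]) (rule that)
    obtain B where B: "B \<ge> 0" "\<And>r. \<bar>\<Phi> r\<bar> \<le> B"
      using compact_support_bounded[OF smooth1_continuous_on[OF b'(4)] b'(3)] by blast
    have \<Phi>m: "(\<lambda>x::real^'n. \<Phi> (norm x)) \<in> borel_measurable borel" by (rule smooth_borel[OF smooth_bump_norm[OF bu]])
    have "\<bar>\<Phi> (norm x)\<bar> \<le> B * indicator (cball 0 b') x" for x :: "real^'n"
      using B b'(3)[of "norm x"] by (auto simp: indicator_def)
    then have "(\<lambda>n. \<integral>x. w n x * \<Phi> (norm x) \<partial>lborel) \<longlonglongrightarrow> (\<integral>x. u x * \<Phi> (norm x) \<partial>lebesgue)"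
      by (intro integral_represents_LIMSEQ[OF w \<Phi>m _ B(1)]) 
    moreover have "(\<integral>x. w n x * \<Phi> (norm x) \<partial>lborel) = (\<integral>x. wdiv \<alpha> (w n) x * \<phi> (norm x) \<partial>lborel)" for n
    proof -
      have "(\<integral>x. wdiv \<alpha> (w n) x * \<phi> (norm x) \<partial>lborel) = (\<integral>x. w n x * wdiv \<alpha> (\<lambda>x. \<phi> (norm x)) x \<partial>lborel)"
        by (rule wdiv_by_parts[OF representsD(1)[OF w] t(2) ab(1), of "\<phi> a"]) (rule c, simp)
      also have "\<dots> = (\<integral>x. w n x * \<Phi> (norm x) \<partial>lborel)"
      proof (rule integral_cong_AE)
        have wm: "w n \<in> borel_measurable borel" by (rule smooth_borel[OF test_funD(1)[OF representsD(1)[OF w]]])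
        show "(\<lambda>x. w n x * wdiv \<alpha> (\<lambda>x. \<phi> (norm x)) x) \<in> borel_measurable lborel" "(\<lambda>x. w n x * \<Phi> (norm x)) \<in> borel_measurable lborel"
          using wm wdiv_borel[OF t(2)] \<Phi>m by auto
        show "AE x in lborel. w n x * wdiv \<alpha> (\<lambda>x. \<phi> (norm x)) x = w n x * \<Phi> (norm x)"
          using AE_lborel_not_zero by eventually_elim (simp add: wd[OF sys])
      qed
      finally show ?thesis by simp
    qed
    ultimately have 1: "(\<lambda>n. \<integral>x. wdiv \<alpha> (w n) x * \<phi> (norm x) \<partial>lborel) \<longlonglongrightarrow> (\<integral>x. u x * \<Phi> (norm x) \<partial>lebesgue)" by simp
    have \<phi>m: "(\<lambda>x::real^'n. \<phi> (norm x)) \<in> borel_measurable borel" by (rule smooth_borel[OF t(2)])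
    have \<phi>L: "(\<lambda>x::real^'n. \<phi> (norm x)) \<in> L2 lborel"
    proof -
      obtain B where B: "B > 0" "\<And>x::real^'n. \<bar>\<phi> (norm x)\<bar> \<le> B"
        by (rule smooth_compactly_supported_bounded[OF t(2,3)]) (rule that)
      show ?thesis
        by (rule bounded_ball_L2[OF \<phi>m, of B b]) (use B z in \<open>auto simp: indicator_def\<close>)
    qed
    \<comment> \<open>\<phi> is constant but possibly nonzero near the origin, hence not a bump, so
      \<open>geq\<close> does not apply to it directly.\<close>
    have "wdiv_limit \<alpha> w (\<lambda>x. \<phi> (norm x)) = integral\<^sup>L lborel (\<lambda>x::real^'n. g (norm x) * \<phi> (norm x))"
      by (rule wdiv_limit_const_near_0[OF w gc gL geq \<phi> ab(1), of b]) (assumption, fact c, fact z)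
    then have "(\<integral>x. u x * \<Phi> (norm x) \<partial>lebesgue) = integral\<^sup>L lborel (\<lambda>x::real^'n. g (norm x) * \<phi> (norm x))"
      using LIMSEQ_unique[OF 1 wdiv_limit_LIMSEQ[OF w \<phi>L]] by simp
    also have "\<dots> = integral\<^sup>L lebesgue (\<lambda>x::real^'n. g (norm x) * \<phi> (norm x))"
    proof (rule integral_completion[symmetric])
      have "(\<lambda>x::real^'n. g (norm x)) \<in> borel_measurable borel" by (rule borel_measurable_norm_comp[OF gc])
      from borel_measurable_times[OF this \<phi>m]
      show "(\<lambda>x::real^'n. g (norm x) * \<phi> (norm x)) \<in> borel_measurable lborel" by simp
    qed
    finally show "(\<integral>x. u x * \<Phi> (norm x) \<partial>lebesgue) = integral\<^sup>L lebesgue (\<lambda>x::real^'n. g (norm x) * \<phi> (norm x))" .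
  qed blast
  have fc: "continuous_on {0<..} f"
    by (intro continuous_at_imp_continuous_on ballI DERIV_isCont[OF f]) auto
  have uf: "AE x in lebesgue. u x = f (norm x)" by (rule AE_radial_eq[OF uint rad fc feq])
  then have aeF: "AE x in lebesgue. nonlin N \<alpha> (u x) = nonlin N \<alpha> (f (norm x))" by eventually_elim simp
  define P where "P r = ball_integral (\<lambda>x::real^'n. g (norm x)) r / \<omega>" for r
  define Q where "Q r = ball_integral (\<lambda>x::real^'n. nonlin N \<alpha> (f (norm x))) r / \<omega>" for r
  note fint = locally_integrable_cong_AE[OF aeF Fint]
  have hc: "continuous_on {0<..} (\<lambda>r. nonlin N \<alpha> (f r))"
    by (rule continuous_on_compose2[OF continuous_at_imp_continuous_on[of UNIV] fc]) (auto simp: nonlin_continuous)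
  have P': "(P has_field_derivative r powr (real N - 1) * g r) (at r)" if "r > 0" for r
    unfolding P_def using DERIV_cdivide[OF ball_integral_radial_deriv[OF gc gint that], of \<omega>] \<omega>
    by (simp add: card_dim \<omega>_def)
  have Q': "(Q has_field_derivative r powr (real N - 1) * nonlin N \<alpha> (f r)) (at r)" if "r > 0" for r
    unfolding Q_def using DERIV_cdivide[OF ball_integral_radial_deriv[OF hc fint(1) that], of \<omega>] \<omega>
    by (simp add: card_dim \<omega>_def)
  have sys: "radial_sys N \<alpha> f P g" "radial_sys N \<alpha> g Q (\<lambda>r. nonlin N \<alpha> (f r))"
    unfolding radial_sys_def using f g P' Q' by (auto simp: P_def Q_def fint(2))
  have lim: "(P \<longlongrightarrow> 0) (at_right 0)" "(Q \<longlongrightarrow> 0) (at_right 0)"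
    unfolding P_def Q_def
    using tendsto_divide[OF ball_integral_tendsto_0[OF gint] tendsto_const, of \<omega>]
      tendsto_divide[OF ball_integral_tendsto_0[OF fint(1)] tendsto_const, of \<omega>] \<omega> by simp_all
  have Pe: "\<exists>\<rho>>0. \<forall>r. 0 < r \<and> r < \<rho> \<longrightarrow> \<bar>P r\<bar> \<le> e * r powr (real N / 2)" if e: "e > 0" for e
  proof -
    have "e * \<omega> > 0" using e \<omega> by simp
    from ball_integral_Cauchy_Schwarz[OF gL this] show ?thesis
      using \<omega> by (auto simp: P_def field_simps abs_divide)
  qed
  obtain f0 g0 where "regular_sol f P g Q f0 g0" by (rule regular_at_0[OF sys lim Pe]) (assumption, rule that)
  then show ?thesis using that gL uf by blast
qed

end

subsection \<open>From the radial system to weak solutions\<close>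

lemma radial_sys_cmult:
  assumes "radial_sys N \<alpha> f P g"
  shows "radial_sys N \<alpha> (\<lambda>r. c * f r) (\<lambda>r. c * P r) (\<lambda>r. c * g r)"
  unfolding radial_sys_def
proof (intro conjI allI impI)
  fix r :: real assume r: "r > 0"
  show "((\<lambda>r. c * f r) has_real_derivative r powr (1 - real N - \<alpha>) * (c * P r)) (at r)"
    using DERIV_cmult[OF radial_sysD(1)[OF assms r], of c] by (simp add: mult.left_commute)
  show "((\<lambda>r. c * P r) has_real_derivative r powr (real N - 1) * (c * g r)) (at r)"
    using DERIV_cmult[OF radial_sysD(2)[OF assms r], of c] by (simp add: mult.left_commute)
qed

lemma radial_sys_add:
  assumes "radial_sys N \<alpha> f P g" "radial_sys N \<alpha> f' P' g'"
  shows "radial_sys N \<alpha> (\<lambda>r. f r + f' r) (\<lambda>r. P r + P' r) (\<lambda>r. g r + g' r)"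
  unfolding radial_sys_def
proof (intro conjI allI impI)
  fix r :: real assume r: "r > 0"
  show "((\<lambda>r. f r + f' r) has_real_derivative r powr (1 - real N - \<alpha>) * (P r + P' r)) (at r)"
    using DERIV_add[OF radial_sysD(1)[OF assms(1) r] radial_sysD(1)[OF assms(2) r]] by (simp add: distrib_left)
  show "((\<lambda>r. P r + P' r) has_real_derivative r powr (real N - 1) * (g r + g' r)) (at r)"
    using DERIV_add[OF radial_sysD(2)[OF assms(1) r] radial_sysD(2)[OF assms(2) r]] by (simp add: distrib_left)
qed

lemma radial_sys_cong:
  assumes "radial_sys N \<alpha> f P g" "\<And>r. r > 0 \<Longrightarrow> g r = g' r"
  shows "radial_sys N \<alpha> f P g'"
  using assms by (auto simp: radial_sys_def)

text \<open>The quantity r times the derivative is invariant under scaling. In either transition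
  region r is at most twice the scale of the cutoff, whence 2 S from each of the two
  factors.\<close>

lemma bump_seq_deriv_bound:
  obtains B where "B \<ge> 0" "\<And>n r. r > 0 \<Longrightarrow> \<bar>r * deriv (bump_seq n) r\<bar> \<le> B"
proof -
  obtain S where S: "S \<ge> 0" "\<And>x. \<bar>deriv smooth_step x\<bar> \<le> S" "\<And>x. \<bar>deriv (deriv smooth_step) x\<bar> \<le> S"
    using smooth_step_derivs_bounded by blast
  have "\<bar>r * deriv (bump_seq n) r\<bar> \<le> 4 * S" if r: "r > 0" for n r
  proof -
    define e R where "e = 1 / (real n + 1)" and "R = real n + 1"
    have eR: "e > 0" "R > 0" by (auto simp: e_def R_def)
    have d1: "(inner_cutoff e has_field_derivative deriv smooth_step (r / e - 1) * (1 / e)) (at r)"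
      unfolding inner_cutoff_def[abs_def]
      by (rule DERIV_chain2[OF smooth1_DERIV[OF smooth1_smooth_step UNIV_I]])
         (use eR in \<open>auto intro!: derivative_eq_intros\<close>)
    have d2: "(outer_cutoff R has_field_derivative deriv smooth_step (2 - r / R) * (- (1 / R))) (at r)"
      unfolding outer_cutoff_def[abs_def]
      by (rule DERIV_chain2[OF smooth1_DERIV[OF smooth1_smooth_step UNIV_I]])
         (use eR in \<open>auto intro!: derivative_eq_intros\<close>)
    have D: "deriv (bump_seq n) r = deriv smooth_step (r / e - 1) * (1 / e) * outer_cutoff R r +
        deriv smooth_step (2 - r / R) * (- (1 / R)) * inner_cutoff e r"
    proof -
      have "bump_seq n = (\<lambda>r. inner_cutoff e r * outer_cutoff R r)"
        by (simp add: bump_seq_def e_def R_def fun_eq_iff)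
      then show ?thesis using DERIV_imp_deriv[OF DERIV_mult[OF d1 d2]] by simp
    qed
    have i: "\<bar>r / e * deriv smooth_step (r / e - 1)\<bar> \<le> 2 * S"
    proof (cases "r / e - 1 \<le> 1")
      case True
      then show ?thesis using S(2)[of "r / e - 1"] r eR unfolding abs_mult by (intro mult_mono) auto
    next
      case False
      then show ?thesis using S(1) by (simp add: smooth_step_deriv_outside)
    qed
    have o: "\<bar>r / R * deriv smooth_step (2 - r / R)\<bar> \<le> 2 * S"
    proof (cases "2 - r / R \<ge> 0")
      case True
      then show ?thesis using S(2)[of "2 - r / R"] r eR unfolding abs_mult by (intro mult_mono) auto
    next
      case False
      then show ?thesis using S(1) by (simp add: smooth_step_deriv_outside)
    qed
    have "r * deriv (bump_seq n) r = (r / e * deriv smooth_step (r / e - 1)) * outer_cutoff R r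
        - (r / R * deriv smooth_step (2 - r / R)) * inner_cutoff e r"
      unfolding D by (simp add: algebra_simps)
    then have "\<bar>r * deriv (bump_seq n) r\<bar> \<le> \<bar>(r / e * deriv smooth_step (r / e - 1)) * outer_cutoff R r\<bar>
        + \<bar>(r / R * deriv smooth_step (2 - r / R)) * inner_cutoff e r\<bar>"
      by (simp only: abs_triangle_ineq4)
    also have "\<dots> \<le> (2 * S) * 1 + (2 * S) * 1"
    proof (rule add_mono)
      show "\<bar>(r / e * deriv smooth_step (r / e - 1)) * outer_cutoff R r\<bar> \<le> (2 * S) * 1"
        unfolding abs_mult[of "_ * _" "outer_cutoff R r"]
        by (rule mult_mono[OF i]) (use S(1) cutoff_bounds[of R r] in auto)
      show "\<bar>(r / R * deriv smooth_step (2 - r / R)) * inner_cutoff e r\<bar> \<le> (2 * S) * 1"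
        unfolding abs_mult[of "_ * _" "inner_cutoff e r"]
        by (rule mult_mono[OF o]) (use S(1) cutoff_bounds[of e r] in auto)
    qed
    finally show ?thesis by simp
  qed
  then show ?thesis using that[of "4 * S"] S(1) by simp
qed

lemma bump_seq_eq_1: "2 / (real n + 1) \<le> r \<Longrightarrow> r \<le> real n + 1 \<Longrightarrow> bump_seq n r = 1"
  by (simp add: bump_seq_def inner_cutoff_1 outer_cutoff_1)

lemma bump_seq_eq_0: "r \<notin> {1 / (real n + 1)..2 * (real n + 1)} \<Longrightarrow> bump_seq n r = 0"
  using inner_cutoff_0[of "1 / (real n + 1)" r] outer_cutoff_0[of "real n + 1" r]
  by (auto simp: bump_seq_def)

lemma smooth1_bump_seq: "smooth1 UNIV (bump_seq n)"
  using bump_bump_seq[of n] by (simp add: bump_def)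

text \<open>Cutting off the derivative, rather than the function, keeps the approximants constant near
  the origin, hence smooth, even though the profile itself is not.\<close>

lemma radial_approximation:
  assumes sys: "radial_sys N \<alpha> f P g" and sP: "smooth1 {0<..} P" and P: "\<And>r. r > 0 \<Longrightarrow> P r \<le> 0"
    and f0: "(f \<longlongrightarrow> f0) (at_right 0)" and finf: "(f \<longlongrightarrow> 0) at_top"
  obtains F G err B where
    "\<And>n. smooth1 UNIV (F n)" "\<And>n. \<exists>a>0. \<exists>b. (\<forall>r\<le>a. F n r = F n a) \<and> (\<forall>r\<ge>b. F n r = 0)"
    "\<And>n. \<exists>P'. radial_sys N \<alpha> (F n) P' (G n)" "\<And>n r. r > 0 \<Longrightarrow> \<bar>F n r - f r\<bar> \<le> err n" "err \<longlonglongrightarrow> 0"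
    "B \<ge> 0" "\<And>n r. r > 0 \<Longrightarrow> \<bar>G n r\<bar> \<le> \<bar>g r\<bar> + B * (r powr (- real N) * \<bar>P r\<bar>)"
    "\<And>r. r > 0 \<Longrightarrow> \<forall>\<^sub>F n in sequentially. G n r = g r"
proof -
  obtain B where B: "B \<ge> 0" "\<And>n r. r > 0 \<Longrightarrow> \<bar>r * deriv (bump_seq n) r\<bar> \<le> B"
    using bump_seq_deriv_bound by blast
  define a b where "a n = 1 / (real n + 1)" and "b n = 2 * (real n + 1)" for n
  have ab: "0 < a n" "a n \<le> b n" for n
  proof -
    have "1 / (real n + 1) \<le> 1" "1 \<le> 2 * (real n + 1)" by auto
    then have "1 / (real n + 1) \<le> 2 * (real n + 1)" by (rule order_trans)
    then show "0 < a n" "a n \<le> b n" by (auto simp: a_def b_def)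
  qed
  \<comment> \<open>The derivative of f with its flux cut off at both ends; its antiderivative F n
    is constant near 0 and zero far out.\<close>
  define \<psi> where "\<psi> n r = r powr (1 - real N - \<alpha>) * (bump_seq n r * P r)" for n r
  have \<psi>0: "\<psi> n r = 0" if "r \<notin> {a n..b n}" for n r
    using bump_seq_eq_0[of r n] that by (simp add: \<psi>_def a_def b_def)
  have s\<psi>: "smooth1 UNIV (\<psi> n)" for n
  proof (rule smooth1_glue_0[OF _ ab(1)])
    show "smooth1 {0<..} (\<psi> n)" unfolding \<psi>_def[abs_def]
      by (intro smooth1_mult smooth1_powr sP smooth1_mono[OF smooth1_bump_seq]) auto
    show "\<psi> n r = 0" if "r < a n" for r using \<psi>0[of r n] that by simp
  qed
  have "\<exists>H. smooth1 UNIV H \<and> (\<forall>r. (H has_field_derivative \<psi> n r) (at r)) \<and> (\<forall>r\<ge>b n. H r = 0) \<and> (\<forall>r\<le>a n. H r = H (a n))" for n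
    by (rule compact_antiderivative[OF s\<psi> \<psi>0 ab(2)]) blast+
  then obtain F where F: "\<And>n. smooth1 UNIV (F n)" "\<And>n r. (F n has_field_derivative \<psi> n r) (at r)"
    "\<And>n r. r \<ge> b n \<Longrightarrow> F n r = 0" "\<And>n r. r \<le> a n \<Longrightarrow> F n r = F n (a n)" by metis
  \<comment> \<open>The derivative of the cut-off flux divided by r^(N-1). The second term is the
    cost of the cutoff.\<close>
  define G where "G n r = bump_seq n r * g r + r powr (1 - real N) * (deriv (bump_seq n) r * P r)" for n r
  have sysF: "radial_sys N \<alpha> (F n) (\<lambda>r. bump_seq n r * P r) (G n)" for n
    unfolding radial_sys_def
  proof (intro conjI allI impI)
    fix r :: real assume r: "r > 0"
    show "(F n has_real_derivative r powr (1 - real N - \<alpha>) * (bump_seq n r * P r)) (at r)"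
      using F(2)[of n r] by (simp add: \<psi>_def)
    have "((\<lambda>r. bump_seq n r * P r) has_real_derivative deriv (bump_seq n) r * P r + (r powr (real N - 1) * g r) * bump_seq n r) (at r)"
      by (intro DERIV_mult smooth1_DERIV[OF smooth1_bump_seq UNIV_I] radial_sysD(2)[OF sys r])
    also have "deriv (bump_seq n) r * P r + (r powr (real N - 1) * g r) * bump_seq n r = r powr (real N - 1) * G n r"
    proof -
      have "r powr (real N - 1) * r powr (1 - real N) = 1" using r by (simp add: powr_add[symmetric])
      then have "r powr (real N - 1) * (r powr (1 - real N) * (deriv (bump_seq n) r * P r)) = deriv (bump_seq n) r * P r"
        by (simp add: mult.assoc[symmetric])
      then show ?thesis by (simp add: G_def distrib_left mult_ac)
    qed
    finally show "((\<lambda>r. bump_seq n r * P r) has_real_derivative r powr (real N - 1) * G n r) (at r)" .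
  qed
  have Gle: "\<bar>G n r\<bar> \<le> \<bar>g r\<bar> + B * (r powr (- real N) * \<bar>P r\<bar>)" if r: "r > 0" for n r
  proof -
    have "r powr (1 - real N) = r * r powr (- real N)" using r powr_add[of r 1 "- real N"] by simp
    then have "r powr (1 - real N) * (deriv (bump_seq n) r * P r) = (r * deriv (bump_seq n) r) * (r powr (- real N) * P r)" by simp
    moreover have "\<bar>(r * deriv (bump_seq n) r) * (r powr (- real N) * P r)\<bar> \<le> B * (r powr (- real N) * \<bar>P r\<bar>)"
      unfolding abs_mult[of "r * deriv (bump_seq n) r"] abs_mult[of "r powr (- real N)"] using B(2)[OF r, of n] B(1) by (intro mult_mono) auto
    moreover have "\<bar>bump_seq n r * g r\<bar> \<le> \<bar>g r\<bar>"
      using bump_seq_bounds[of n r] by (simp add: abs_mult mult_left_le_one_le)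
    ultimately show ?thesis unfolding G_def by linarith
  qed
  have lim2: "(\<lambda>n. 2 / (real n + 1)) \<longlonglongrightarrow> 0"
  proof -
    have "(\<lambda>n. 2 * inverse (real (Suc n))) \<longlonglongrightarrow> 2 * 0" by (intro tendsto_mult_left LIMSEQ_inverse_real_of_nat)
    then show ?thesis by (simp add: divide_inverse add.commute)
  qed
  have limn: "filterlim (\<lambda>n. real n + 1) at_top sequentially"
  proof -
    have "filterlim (\<lambda>n. 1 + real n) at_top sequentially"
      by (rule filterlim_tendsto_add_at_top[OF tendsto_const filterlim_real_sequentially])
    then show ?thesis by (simp only: add.commute)
  qed
  have Gev: "\<forall>\<^sub>F n in sequentially. G n r = g r" if r: "r > 0" for r
  proof -
    have "\<forall>\<^sub>F n in sequentially. 2 / (real n + 1) < r" using order_tendstoD(2)[OF lim2 r] .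
    moreover have "\<forall>\<^sub>F n in sequentially. r < real n + 1" using limn by (simp add: filterlim_at_top_dense)
    ultimately show ?thesis
    proof eventually_elim
      case (elim n)
      have "deriv (bump_seq n) r = 0"
        by (rule deriv_locally_const[of "{2 / (real n + 1)<..<real n + 1}" _ _ 1]) (use elim bump_seq_eq_1 in auto)
      moreover have "bump_seq n r = 1" using elim by (intro bump_seq_eq_1) auto
      ultimately show ?case by (simp add: G_def)
    qed
  qed
  have f_anti: "f t \<le> f s" if "0 < s" "s \<le> t" for s t
    by (rule DERIV_nonpos_imp_nonincreasing[OF that(2)])
       (use radial_sysD(1)[OF sys] P that in \<open>metis less_le_trans mult_nonneg_nonpos powr_ge_zero\<close>)
  have F_anti: "F n t \<le> F n s" if "0 < s" "s \<le> t" for n s t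
  proof (rule DERIV_nonpos_imp_nonincreasing[OF that(2)])
    fix x assume x: "s \<le> x" "x \<le> t"
    have "\<psi> n x \<le> 0" unfolding \<psi>_def using x that P[of x] bump_seq_bounds[of n x]
      by (intro mult_nonneg_nonpos) (auto intro: mult_nonneg_nonpos)
    then show "\<exists>y. (F n has_real_derivative y) (at x) \<and> y \<le> 0" using F(2) by blast
  qed
  \<comment> \<open>The derivative of the error is -(1 - cutoff) times the nonpositive derivative of
    f. The error is therefore nondecreasing, and it ends at -f, which is nonpositive.\<close>
  have E_mono: "F n s - f s \<le> F n t - f t" if "0 < s" "s \<le> t" for n s t
  proof (rule DERIV_nonneg_imp_nondecreasing[OF that(2), of "\<lambda>r. F n r - f r"])
    fix x assume x: "s \<le> x" "x \<le> t"
    have x0: "x > 0" using x that by simp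
    have "((\<lambda>r. F n r - f r) has_real_derivative \<psi> n x - x powr (1 - real N - \<alpha>) * P x) (at x)"
      by (intro DERIV_diff F(2) radial_sysD(1)[OF sys x0])
    moreover have "\<psi> n x - x powr (1 - real N - \<alpha>) * P x = (1 - bump_seq n x) * (x powr (1 - real N - \<alpha>) * (- P x))"
      by (simp add: \<psi>_def algebra_simps)
    moreover have "0 \<le> (1 - bump_seq n x) * (x powr (1 - real N - \<alpha>) * (- P x))"
      using P[OF x0] bump_seq_bounds[of n x] by (intro mult_nonneg_nonneg) auto
    ultimately show "\<exists>y. ((\<lambda>r. F n r - f r) has_real_derivative y) (at x) \<and> 0 \<le> y" by metis
  qed
  have f_nn: "0 \<le> f r" if r: "r > 0" for r
  proof (rule tendsto_upperbound[OF finf])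
    show "\<forall>\<^sub>F t in at_top. f t \<le> f r" using eventually_ge_at_top[of r] by eventually_elim (rule f_anti[OF r])
  qed simp
  have f_le: "f r \<le> f0" if r: "r > 0" for r
  proof (rule tendsto_lowerbound[OF f0])
    show "\<forall>\<^sub>F t in at_right 0. f r \<le> f t"
      unfolding eventually_at_right_field using r f_anti by (intro exI[of _ r]) auto
  qed simp
  have F_nn: "0 \<le> F n r" if r: "r > 0" for n r
    using F_anti[OF r, of "max r (b n)" n] F(3)[of n "max r (b n)"] by simp
  have E_np: "F n r - f r \<le> 0" if r: "r > 0" for n r
    using E_mono[OF r, of "max r (b n)" n] F(3)[of n "max r (b n)"] f_nn[OF less_le_trans[OF r max.cobounded1[of r "b n"]]] by simp
  \<comment> \<open>Beyond n + 1 the error is at most f(n + 1); on the plateau it is constant;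
    towards 0 it grows by at most the oscillation of f below 2/(n + 1). The minimum matters for n =
    0, where 2/(n + 1) exceeds n + 1 and there is no plateau.\<close>
  define err where "err n = f (real n + 1) + (f0 - f (min (2 / (real n + 1)) (real n + 1)))" for n
  have err: "\<bar>F n r - f r\<bar> \<le> err n" if r: "r > 0" for n r
  proof -
    define C A where "C = real n + 1" and "A = min (2 / (real n + 1)) (real n + 1)"
    have AC: "0 < A" "A \<le> C" "0 < C" by (auto simp: A_def C_def)
    have C: "- f C \<le> F n t - f t" if t: "C \<le> t" for t
      using F_nn[OF less_le_trans[OF AC(3) t], of n] f_anti[OF AC(3) t] by simp
    have mid: "- f C \<le> F n t - f t" if t: "A \<le> t" "t \<le> C" for t
    proof (cases "t = C")
      case False
      have tp: "t > 0" using t AC by simp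
      have "t < C" using t False by simp
      have d: "((\<lambda>r. F n r - f r) has_real_derivative \<psi> n x - x powr (1 - real N - \<alpha>) * P x) (at x)" if "t \<le> x" "x \<le> C" for x
        by (rule DERIV_diff[OF F(2) radial_sysD(1)[OF sys]]) (use that tp in linarith)
      have "\<exists>z>t. z < C \<and> (F n C - f C) - (F n t - f t) = (C - t) * (\<psi> n z - z powr (1 - real N - \<alpha>) * P z)"
        by (rule MVT2[OF \<open>t < C\<close>]) (rule d)
      then obtain z where z: "t < z" "z < C" "(F n C - f C) - (F n t - f t) = (C - t) * (\<psi> n z - z powr (1 - real N - \<alpha>) * P z)" by blast
      have b1: "bump_seq n z = 1"
      proof (rule bump_seq_eq_1)
        have "A < C" using t \<open>t < C\<close> by linarith
        then have "A = 2 / (real n + 1)" unfolding A_def C_def min_def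
          by (cases "2 / (real n + 1) \<le> real n + 1") (simp_all only: if_True if_False less_irrefl)
        then show "2 / (real n + 1) \<le> z" using z(1) t(1) by linarith
        show "z \<le> real n + 1" using z(2) by (simp add: C_def)
      qed
      have "\<psi> n z - z powr (1 - real N - \<alpha>) * P z = 0" unfolding \<psi>_def b1 by simp
      then have "F n C - f C = F n t - f t" using z(3) by simp
      then show ?thesis using C[OF order_refl] by simp
    qed (use C in simp)
    have f0': "f0 - f A \<ge> 0" using f_le[OF AC(1)] by simp
    have "- (f C + (f0 - f A)) \<le> F n r - f r"
    proof (cases "r < A")
      case True
      have "F n A \<le> F n r" using F_anti[OF r, of A n] True by simp
      moreover have "f r \<le> f0" by (rule f_le[OF r])
      ultimately show ?thesis using mid[of A] AC by linarith
    next
      case False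
      then have "- f C \<le> F n r - f r" using mid[of r] C[of r] by (cases "r \<le> C") (simp_all only: not_less not_le less_imp_le simp_thms)
      then show ?thesis using f0' by linarith
    qed
    then show ?thesis using E_np[OF r, of n] by (simp add: err_def A_def C_def)
  qed
  have "(\<lambda>n. f (real n + 1)) \<longlonglongrightarrow> 0" by (rule filterlim_compose[OF finf limn])
  moreover have "(\<lambda>n. f (min (2 / (real n + 1)) (real n + 1))) \<longlonglongrightarrow> f0"
  proof (rule filterlim_compose[OF f0])
    have "(\<lambda>n. min (2 / (real n + 1)) (real n + 1)) \<longlonglongrightarrow> 0"
    proof (rule Lim_null_comparison[OF _ lim2])
      show "\<forall>\<^sub>F n in sequentially. norm (min (2 / (real n + 1)) (real n + 1)) \<le> 2 / (real n + 1)" by (auto simp: min_def)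
    qed
    then show "filterlim (\<lambda>n. min (2 / (real n + 1)) (real n + 1)) (at_right 0) sequentially"
      unfolding filterlim_at by (auto simp: min_def intro!: always_eventually)
  qed
  ultimately have "err \<longlonglongrightarrow> 0 + (f0 - f0)" unfolding err_def[abs_def] by (intro tendsto_intros)
  then have err0: "err \<longlonglongrightarrow> 0" by simp
  have const: "\<exists>a>0. \<exists>b. (\<forall>r\<le>a. F n r = F n a) \<and> (\<forall>r\<ge>b. F n r = 0)" for n
    by (intro exI[of _ "a n"] conjI exI[of _ "b n"] allI impI ab F(3) F(4))
  show ?thesis by (rule that[OF F(1) const _ err err0 B(1) Gle Gev]) (use sysF in blast)+
qed

subsection \<open>Profiles and bubbles\<close>

lemma represents_cong_AE:
  assumes r: "represents \<alpha> w u" and ae: "AE x in lebesgue. u x = v x"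
  shows "represents \<alpha> w (v :: real^'n \<Rightarrow> real)"
  unfolding represents_def
proof (intro conjI allI impI)
  show "w n \<in> test_fun \<alpha>" for n using r by (simp add: represents_def)
  show "\<exists>M. \<forall>m\<ge>M. \<forall>n\<ge>M. test_norm \<alpha> (\<lambda>x. w m x - w n x) < e" if "e > 0" for e
    using r that by (simp add: represents_def)
  fix K :: "(real^'n) set" assume K: "compact K"
  have uK: "u absolutely_integrable_on K" and lim: "(\<lambda>n. LINT x:K|lebesgue. \<bar>w n x - u x\<bar>) \<longlonglongrightarrow> 0"
    using r K by (auto simp: represents_def)
  have ae': "AE x in lebesgue. indicator K x *\<^sub>R u x = indicator K x *\<^sub>R v x" using ae by eventually_elim simp
  have um: "(\<lambda>x. indicator K x *\<^sub>R u x) \<in> borel_measurable lebesgue"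
    using uK by (intro borel_measurable_integrable) (simp add: set_integrable_def)
  show vK: "v absolutely_integrable_on K"
    using uK integrable_cong_AE[OF um borel_measurable_AE[OF um ae'] ae'] by (simp add: set_integrable_def)
  have "(LINT x:K|lebesgue. \<bar>w n x - v x\<bar>) = (LINT x:K|lebesgue. \<bar>w n x - u x\<bar>)" for n
    unfolding set_lebesgue_integral_def
  proof (rule integral_cong_AE)
    have Km: "indicator K \<in> borel_measurable lebesgue" using K by (intro borel_measurable_indicator) (simp add: borel_compact)
    have "w n \<in> borel_measurable lborel" using smooth_borel[OF test_funD(1)[OF representsD(1)[OF r]], of n] by simp
    then have wm: "w n \<in> borel_measurable lebesgue" by (rule measurable_completion)
    have e: "(\<lambda>x. indicator K x *\<^sub>R \<bar>w n x - z x\<bar>) = (\<lambda>x. \<bar>indicator K x * w n x - indicator K x *\<^sub>R z x\<bar>)" for z :: "real^'n \<Rightarrow> real"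
      by (auto simp: indicator_def)
    show "(\<lambda>x. indicator K x *\<^sub>R \<bar>w n x - v x\<bar>) \<in> borel_measurable lebesgue"
      unfolding e using borel_measurable_AE[OF um ae'] Km wm by (intro borel_measurable_abs borel_measurable_diff borel_measurable_times)
    show "(\<lambda>x. indicator K x *\<^sub>R \<bar>w n x - u x\<bar>) \<in> borel_measurable lebesgue"
      unfolding e using um Km wm by (intro borel_measurable_abs borel_measurable_diff borel_measurable_times)
    show "AE x in lebesgue. indicator K x *\<^sub>R \<bar>w n x - v x\<bar> = indicator K x *\<^sub>R \<bar>w n x - u x\<bar>"
      using ae by eventually_elim simp
  qed
  then show "(\<lambda>n. LINT x:K|lebesgue. \<bar>w n x - v x\<bar>) \<longlonglongrightarrow> 0" using lim by simp
qed

text \<open>Uniform convergence off the origin gives L^1 convergence on compact sets. The Cauchy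
  property follows from convergence of the weighted divergences to some h in L^2, without
  identifying h in terms of u.\<close>

lemma represents_uniform_limit:
  fixes u :: "real^'n \<Rightarrow> real" and err :: "nat \<Rightarrow> real"
  assumes t: "\<And>n::nat. w n \<in> test_fun \<alpha>" and h: "h \<in> L2 lborel"
    and lim: "(\<lambda>n. L2_norm lborel (\<lambda>x. wdiv \<alpha> (w n) x - h x)) \<longlonglongrightarrow> 0"
    and um: "u \<in> borel_measurable borel" and err: "\<And>n x. x \<noteq> 0 \<Longrightarrow> \<bar>w n x - u x\<bar> \<le> err n" "err \<longlonglongrightarrow> 0"
  shows "represents \<alpha> w u"
  unfolding represents_def
proof (intro conjI allI impI)
  show "w n \<in> test_fun \<alpha>" for n by (rule t)
  note wL = test_funD(3)[OF t]
  fix e :: real assume e: "e > 0"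
  have "\<forall>\<^sub>F n in sequentially. L2_norm lborel (\<lambda>x. wdiv \<alpha> (w n) x - h x) < e / 2"
    using e by (intro order_tendstoD(2)[OF lim]) simp
  then obtain k where k: "\<And>n. n \<ge> k \<Longrightarrow> L2_norm lborel (\<lambda>x. wdiv \<alpha> (w n) x - h x) < e / 2"
    by (auto simp: eventually_sequentially)
  have "test_norm \<alpha> (\<lambda>x. w m x - w n x) < e" if "m \<ge> k" "n \<ge> k" for m n
  proof -
    have "test_norm \<alpha> (\<lambda>x. w m x - w n x) = L2_norm lborel (\<lambda>x. (wdiv \<alpha> (w m) x - h x) + (h x - wdiv \<alpha> (w n) x))"
      unfolding test_fun_diff(2)[OF t t] by simp
    also have "\<dots> \<le> L2_norm lborel (\<lambda>x. wdiv \<alpha> (w m) x - h x) + L2_norm lborel (\<lambda>x. h x - wdiv \<alpha> (w n) x)"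
      by (intro L2_norm_triangle L2_diff wL h)
    also have "L2_norm lborel (\<lambda>x. h x - wdiv \<alpha> (w n) x) = L2_norm lborel (\<lambda>x. wdiv \<alpha> (w n) x - h x)"
      by (rule L2_norm_diff_commute)
    finally show ?thesis using k[OF that(1)] k[OF that(2)] by simp
  qed
  then show "\<exists>M. \<forall>m\<ge>M. \<forall>n\<ge>M. test_norm \<alpha> (\<lambda>x. w m x - w n x) < e" by blast
next
  fix K :: "(real^'n) set" assume K: "compact K"
  have Kb: "K \<in> sets borel" using K by (simp add: borel_compact)
  have Km: "indicator K \<in> borel_measurable borel" using Kb by (intro borel_measurable_indicator)
  have Ki: "integrable lborel (\<lambda>x. indicator K x :: real)"
    using emeasure_compact_finite[OF K] Kb by (intro integrable_real_indicator) auto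
  have wm: "w n \<in> borel_measurable borel" for n by (rule smooth_borel[OF test_funD(1)[OF t]])
  have di: "integrable lborel (\<lambda>x. indicator K x * (w n x - u x))" for n
  proof (rule Bochner_Integration.integrable_bound)
    show "integrable lborel (\<lambda>x. indicator K x * err n)" using Ki by simp
    show "(\<lambda>x. indicator K x * (w n x - u x)) \<in> borel_measurable lborel"
      using Km wm um by (intro borel_measurable_times borel_measurable_diff) auto
    show "AE x in lborel. norm (indicator K x * (w n x - u x)) \<le> norm (indicator K x * err n)"
      using AE_lborel_not_zero
    proof eventually_elim
      case (elim x)
      show ?case using err(1)[OF elim, of n] by (auto simp: indicator_def intro: order_trans[OF _ abs_ge_self])
    qed
  qed
  have d: "(\<lambda>x. w n x - u x) absolutely_integrable_on K" for n
    by (subst set_integrable_lborel_iff_lebesgue) (use di wm um Kb in \<open>auto intro!: borel_measurable_diff\<close>)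
  obtain R where "K \<subseteq> cball 0 R" using compact_imp_bounded[OF K] by (auto simp: bounded_iff subset_iff)
  then have wK: "w 0 absolutely_integrable_on K"
    using set_integrable_subset[OF test_fun_absolutely_integrable[OF t[of 0], of R]] K by (auto simp: borel_compact)
  have "(\<lambda>x. w 0 x - (w 0 x - u x)) absolutely_integrable_on K" by (rule set_integral_diff(1)[OF wK d])
  then show "u absolutely_integrable_on K" by simp
  show "(\<lambda>n. LINT x:K|lebesgue. \<bar>w n x - u x\<bar>) \<longlonglongrightarrow> 0"
  proof (rule tendsto_sandwich[OF _ _ tendsto_const])
    show "\<forall>\<^sub>F n in sequentially. 0 \<le> (LINT x:K|lebesgue. \<bar>w n x - u x\<bar>)"
      by (intro always_eventually allI) (simp add: set_lebesgue_integral_def)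
    have "(LINT x:K|lebesgue. \<bar>w n x - u x\<bar>) \<le> measure lborel K * err n" for n
    proof -
      have "(LINT x:K|lebesgue. \<bar>w n x - u x\<bar>) = (\<integral>x. \<bar>indicator K x * (w n x - u x)\<bar> \<partial>lborel)"
      proof -
        have "(\<lambda>x. \<bar>indicator K x * (w n x - u x)\<bar>) \<in> borel_measurable lborel"
          using borel_measurable_integrable[OF di] by (intro borel_measurable_abs)
        from integral_completion[OF this] show ?thesis
          by (simp add: set_lebesgue_integral_def abs_mult)
      qed
      also have "\<dots> \<le> (\<integral>x. indicator K x * err n \<partial>lborel)"
      proof (rule integral_mono_AE)
        show "AE x in lborel. \<bar>indicator K x * (w n x - u x)\<bar> \<le> indicator K x * err n"
          using AE_lborel_not_zero
        proof eventually_elim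
          case (elim x)
          show ?case using err(1)[OF elim, of n] by (auto simp: indicator_def)
        qed
      qed (use di Ki in auto)
      also have "\<dots> = measure lborel K * err n" using Kb by simp
      finally show ?thesis .
    qed
    then show "\<forall>\<^sub>F n in sequentially. (LINT x:K|lebesgue. \<bar>w n x - u x\<bar>) \<le> measure lborel K * err n" by simp
    show "(\<lambda>n. measure lborel K * err n) \<longlonglongrightarrow> 0" using tendsto_mult_left[OF err(2), of "measure lborel K"] by simp
  qed
qed

context weight_range
begin

section \<open>Powers of 1 + \<kappa> r^(2-\<alpha>)\<close>

text \<open>A bubble is a multiple of the profile with q = 2 aexp / bexp and \<kappa> =
  \<lambda>^bexp. The exponent q is left free because the weighted divergence maps profiles to
  combinations of profiles with larger q.\<close>

definition profile :: "real \<Rightarrow> real \<Rightarrow> real \<Rightarrow> real" where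
  "profile \<kappa> q r = (1 + \<kappa> * r powr bexp) powr (- q)"

context
  fixes \<kappa> :: real assumes \<kappa>: "\<kappa> > 0"
begin

lemma profile_base: "1 + \<kappa> * r powr bexp \<ge> 1"
  using \<kappa> by simp

lemma profile_pos: "profile \<kappa> q r > 0"
  using profile_base[of r] unfolding profile_def powr_gt_zero by linarith

lemma profile_antimono: "q \<le> s \<Longrightarrow> profile \<kappa> s r \<le> profile \<kappa> q r"
  using profile_base[of r] unfolding profile_def by (intro powr_mono) auto

lemma profile_le_1: "q \<ge> 0 \<Longrightarrow> profile \<kappa> q r \<le> 1"
  using profile_antimono[of 0 q r] profile_base[of r] by (simp add: profile_def)

lemma profile_mult: "profile \<kappa> q r * profile \<kappa> s r = profile \<kappa> (q + s) r"
  by (simp add: profile_def powr_add[symmetric])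

lemma profile_powr: "profile \<kappa> q r powr s = profile \<kappa> (q * s) r"
  using profile_base[of r] by (simp add: profile_def powr_powr)

lemma DERIV_profile:
  assumes r: "r > 0"
  shows "(profile \<kappa> q has_field_derivative r powr (1 - real N - \<alpha>) * (- (q * \<kappa> * bexp) * (r powr real N * profile \<kappa> (q + 1) r))) (at r)"
proof -
  have X: "1 + \<kappa> * r powr bexp > 0" using profile_base[of r] by linarith
  have "((\<lambda>r. 1 + \<kappa> * r powr bexp) has_field_derivative 0 + \<kappa> * (bexp * r powr (bexp - 1))) (at r)"
    by (intro DERIV_add DERIV_const DERIV_cmult has_real_derivative_powr r)
  from DERIV_chain2[OF has_real_derivative_powr[OF X, of "- q"] this]
  have "(profile \<kappa> q has_field_derivative - q * (1 + \<kappa> * r powr bexp) powr (- q - 1) * (0 + \<kappa> * (bexp * r powr (bexp - 1)))) (at r)"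
    unfolding profile_def[abs_def] .
  also have "(1 + \<kappa> * r powr bexp) powr (- q - 1) = profile \<kappa> (q + 1) r" by (simp add: profile_def)
  also have "r powr (bexp - 1) = r powr (1 - real N - \<alpha>) * r powr real N"
    unfolding powr_add[symmetric] by (rule arg_cong[where f = "(powr) r"]) (use exps(7) in linarith)
  finally show ?thesis by (simp add: mult_ac)
qed

text \<open>Differentiating the flux produces a factor \<kappa> r^bexp. Written as (1 + \<kappa>
  r^bexp) - 1 it only shifts the exponent q, so two profiles suffice.\<close>

lemma radial_sys_profile:
  "radial_sys N \<alpha> (profile \<kappa> q) (\<lambda>r. - (q * \<kappa> * bexp) * (r powr real N * profile \<kappa> (q + 1) r))
     (\<lambda>r. - (q * \<kappa> * bexp) * ((real N - (q + 1) * bexp) * profile \<kappa> (q + 1) r + (q + 1) * bexp * profile \<kappa> (q + 2) r))"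
  unfolding radial_sys_def
proof (intro conjI allI impI DERIV_profile)
  fix r :: real assume r: "r > 0"
  let ?X = "1 + \<kappa> * r powr bexp"
  have pr: "profile \<kappa> (q + 1) r = ?X * profile \<kappa> (q + 2) r"
    proof -
      have e: "- (q + 1) = 1 + - (q + 2)" by simp
      show ?thesis unfolding profile_def e powr_add using profile_base[of r] by simp
    qed
  have eN: "r powr real N * (r powr (1 - real N - \<alpha>) * r powr real N) = r powr (real N - 1) * r powr bexp"
    unfolding powr_add[symmetric] by (rule arg_cong[where f = "(powr) r"]) (use exps(7) in linarith)
  have "((\<lambda>r. r powr real N * profile \<kappa> (q + 1) r) has_field_derivative
     (real N * r powr (real N - 1)) * profile \<kappa> (q + 1) r +
     (r powr (1 - real N - \<alpha>) * (- ((q + 1) * \<kappa> * bexp) * (r powr real N * profile \<kappa> (q + 1 + 1) r))) * r powr real N) (at r)"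
    by (intro DERIV_mult has_real_derivative_powr r DERIV_profile)
  also have "(real N * r powr (real N - 1)) * profile \<kappa> (q + 1) r +
     (r powr (1 - real N - \<alpha>) * (- ((q + 1) * \<kappa> * bexp) * (r powr real N * profile \<kappa> (q + 1 + 1) r))) * r powr real N =
     real N * r powr (real N - 1) * profile \<kappa> (q + 1) r - (q + 1) * \<kappa> * bexp * profile \<kappa> (q + 2) r * (r powr real N * (r powr (1 - real N - \<alpha>) * r powr real N))"
    by (simp add: mult_ac add.commute[of 2 q])
  also have "\<dots> = r powr (real N - 1) * ((real N - (q + 1) * bexp) * profile \<kappa> (q + 1) r + (q + 1) * bexp * profile \<kappa> (q + 2) r)"
    unfolding eN pr by (simp add: algebra_simps)
  finally have "((\<lambda>r. r powr real N * profile \<kappa> (q + 1) r) has_field_derivative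
     r powr (real N - 1) * ((real N - (q + 1) * bexp) * profile \<kappa> (q + 1) r + (q + 1) * bexp * profile \<kappa> (q + 2) r)) (at r)" .
  from DERIV_cmult[OF this, of "- (q * \<kappa> * bexp)"]
  show "((\<lambda>r. - (q * \<kappa> * bexp) * (r powr real N * profile \<kappa> (q + 1) r)) has_real_derivative
     r powr (real N - 1) * (- (q * \<kappa> * bexp) * ((real N - (q + 1) * bexp) * profile \<kappa> (q + 1) r + (q + 1) * bexp * profile \<kappa> (q + 2) r))) (at r)"
    by (simp only: mult.left_commute[of "- (q * \<kappa> * bexp)"])
qed

lemma profile_tendsto_1: "(profile \<kappa> q \<longlongrightarrow> 1) (at_right 0)"
proof -
  have "((\<lambda>r. (1 + \<kappa> * r powr bexp) powr (- q)) \<longlongrightarrow> (1 + \<kappa> * 0) powr (- q)) (at_right 0)"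
    by (intro tendsto_intros powr_tendsto_0 exps) auto
  then show ?thesis by (simp add: profile_def[abs_def])
qed

lemma profile_le_powr:
  assumes "q \<ge> 0" "r > 0" shows "profile \<kappa> q r \<le> \<kappa> powr (- q) * r powr (- (q * bexp))"
proof -
  have "profile \<kappa> q r \<le> (\<kappa> * r powr bexp) powr (- q)"
    unfolding profile_def using assms \<kappa> by (intro powr_mono2') auto
  also have "\<dots> = \<kappa> powr (- q) * r powr (- (q * bexp))"
    using \<kappa> assms by (simp add: powr_mult powr_powr mult.commute)
  finally show ?thesis .
qed

lemma profile_tendsto_0: assumes "q > 0" shows "(profile \<kappa> q \<longlongrightarrow> 0) at_top"
proof (rule tendsto_sandwich[OF _ _ tendsto_const])
  show "\<forall>\<^sub>F r in at_top. 0 \<le> profile \<kappa> q r" using profile_pos less_imp_le by (intro always_eventually) blast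
  show "\<forall>\<^sub>F r in at_top. profile \<kappa> q r \<le> \<kappa> powr (- q) * r powr (- (q * bexp))"
    using eventually_gt_at_top[of 0] by eventually_elim (rule profile_le_powr, use assms in auto)
  have "((\<lambda>r. r powr (- (q * bexp))) \<longlongrightarrow> 0) at_top"
    using assms exps by (intro tendsto_neg_powr filterlim_ident) auto
  from tendsto_mult_left[OF this, of "\<kappa> powr (- q)"]
  show "((\<lambda>r. \<kappa> powr (- q) * r powr (- (q * bexp))) \<longlongrightarrow> 0) at_top" by simp
qed

lemma smooth1_profile: "smooth1 {0<..} (profile \<kappa> q)"
  unfolding profile_def[abs_def]
proof (rule smooth1_powr_comp)
  show "smooth1 {0<..} (\<lambda>r. 1 + \<kappa> * r powr bexp)"
    by (intro smooth1_add smooth1_const smooth1_cmult smooth1_powr) auto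
  show "0 < 1 + \<kappa> * r powr bexp" for r using profile_base[of r] by linarith
qed simp

lemma profile_borel: "(\<lambda>x::real^'n. profile \<kappa> q (norm x)) \<in> borel_measurable borel"
  by (rule borel_measurable_norm_comp[OF smooth1_continuous_on[OF smooth1_profile]])

text \<open>The profile is bounded near the origin and of size r^(-q bexp) at infinity; the
  hypothesis is the condition for its square to be integrable there.\<close>

lemma profile_L2:
  assumes "real N < 2 * (q * bexp)"
  shows "(\<lambda>x::real^'n. profile \<kappa> q (norm x)) \<in> L2 lborel"
proof -
  have q: "q > 0" using assms exps(2) N_pos by (smt (verit) mult_nonpos_nonneg)
  define C where "C = \<kappa> powr (- (2 * q))"
  have "integrable lborel (\<lambda>x::real^'n. indicator (cball 0 1) x * norm x powr 0 + C * (indicator {x. norm x \<ge> 1} x * norm x powr (- (2 * q * bexp))))"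
  proof (intro Bochner_Integration.integrable_add integrable_mult_right)
    show "integrable lborel (\<lambda>x::real^'n. indicator (cball 0 1) x * norm x powr 0)"
      by (rule integrable_norm_powr_ball) simp
    show "integrable lborel (\<lambda>x::real^'n. indicator {x. norm x \<ge> 1} x * norm x powr (- (2 * q * bexp)))"
      by (rule integrable_norm_powr_outside) (use assms card_dim in simp)
  qed
  then have "integrable lborel (\<lambda>x::real^'n. (profile \<kappa> q (norm x))\<^sup>2)"
  proof (rule Bochner_Integration.integrable_bound)
    show "(\<lambda>x::real^'n. (profile \<kappa> q (norm x))\<^sup>2) \<in> borel_measurable lborel" using profile_borel by simp
    show "AE x in lborel. norm ((profile \<kappa> q (norm x))\<^sup>2) \<le> norm (indicator (cball 0 1) (x::real^'n) * norm x powr 0 + C * (indicator {x. norm x \<ge> 1} x * norm x powr (- (2 * q * bexp))))"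
      using AE_lborel_not_zero
    proof eventually_elim
      case (elim x)
      have r: "norm x > 0" using elim by simp
      have sq: "(profile \<kappa> q (norm x))\<^sup>2 = profile \<kappa> (2 * q) (norm x)"
        unfolding power2_eq_square profile_mult mult_2 ..
      have C0: "C \<ge> 0" by (simp add: C_def)
      have P0: "profile \<kappa> (2 * q) (norm x) > 0" by (rule profile_pos)
      show ?case
      proof (cases "norm x \<le> 1")
        case True
        have "profile \<kappa> (2 * q) (norm x) \<le> 1" using q by (intro profile_le_1) simp
        moreover have "0 \<le> C * (indicator {x. norm x \<ge> 1} x * norm x powr (- (2 * q * bexp)))" using C0 by simp
        ultimately show ?thesis unfolding sq using True r P0 by simp
      next
        case False
        have "profile \<kappa> (2 * q) (norm x) \<le> C * norm x powr (- (2 * q * bexp))"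
          using profile_le_powr[of "2 * q" "norm x"] q r by (simp add: C_def)
        then show ?thesis unfolding sq using False P0 C0 by simp
      qed
    qed
  qed
  then show ?thesis using profile_borel by (simp add: L2_def)
qed

end

end

section \<open>Invariance under null sets and change of sign\<close>

text \<open>The definition sees u only through \<open>represents\<close>, which does not distinguish
  functions equal almost everywhere.\<close>

lemma D22_inner_cong_AE:
  fixes u v :: "real^'n \<Rightarrow> real"
  assumes "AE x in lebesgue. u x = v x"
  shows "D22_inner \<alpha> u = D22_inner \<alpha> v"
proof -
  have "AE x in lebesgue. v x = u x" using assms by eventually_elim simp
  then have "represents \<alpha> w u = represents \<alpha> w v" for w
    using represents_cong_AE[OF _ assms] represents_cong_AE[of \<alpha> w v u] by blast
  then show ?thesis unfolding D22_inner_def[abs_def] by presburger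
qed

lemma radial_nontrivial_solution_cong_AE:
  fixes u v :: "real^'n \<Rightarrow> real"
  assumes s: "radial_nontrivial_solution \<alpha> u" and ae: "AE x in lebesgue. u x = v x"
  shows "radial_nontrivial_solution \<alpha> v"
  unfolding radial_nontrivial_solution_def
proof (intro conjI)
  show "v \<in> D22 \<alpha>"
    using s represents_cong_AE[OF _ ae] unfolding radial_nontrivial_solution_def D22_def by blast
  obtain f where f: "AE x in lebesgue. u x = f (norm x)"
    using s unfolding radial_nontrivial_solution_def radial_def by blast
  have "AE x in lebesgue. v x = f (norm x)" using ae f by eventually_elim simp
  then show "radial v" unfolding radial_def by blast
  show "\<not> (AE x in lebesgue. v x = 0)"
  proof
    assume "AE x in lebesgue. v x = 0"
    then have "AE x in lebesgue. u x = 0" using ae by eventually_elim simp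
    then show False using s unfolding radial_nontrivial_solution_def by blast
  qed
  show "weak_solution \<alpha> v"
    unfolding weak_solution_def
  proof (intro ballI conjI)
    fix \<phi> :: "real^'n \<Rightarrow> real" assume \<phi>: "\<phi> \<in> test_fun \<alpha>"
    let ?U = "\<lambda>x. \<bar>u x\<bar> powr (crit_exp CARD('n) \<alpha> - 2) * u x * \<phi> x"
    let ?V = "\<lambda>x. \<bar>v x\<bar> powr (crit_exp CARD('n) \<alpha> - 2) * v x * \<phi> x"
    have U: "integrable lebesgue ?U" "D22_inner \<alpha> u \<phi> = integral\<^sup>L lebesgue ?U"
      using s \<phi> unfolding radial_nontrivial_solution_def weak_solution_def by blast+
    have aeUV: "AE x in lebesgue. ?U x = ?V x" using ae by eventually_elim simp
    then have aeVU: "AE x in lebesgue. ?V x = ?U x" by eventually_elim (rule sym)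
    have Um: "?U \<in> borel_measurable lebesgue" using U(1) by (rule borel_measurable_integrable)
    have Vm: "?V \<in> borel_measurable lebesgue" by (rule borel_measurable_AE[OF Um aeUV])
    show "integrable lebesgue ?V" by (rule Bochner_Integration.integrable_cong_AE_imp[OF U(1) Vm aeUV])
    have "integral\<^sup>L lebesgue ?U = integral\<^sup>L lebesgue ?V" by (rule integral_cong_AE[OF Um Vm aeUV])
    then show "D22_inner \<alpha> v \<phi> = integral\<^sup>L lebesgue ?V"
      using U(2) unfolding D22_inner_cong_AE[OF ae] by (rule trans[rotated])
  qed
qed

lemma test_fun_minus:
  fixes u :: "real^'n \<Rightarrow> real"
  assumes "u \<in> test_fun \<alpha>"
  shows "(\<lambda>x. - u x) \<in> test_fun \<alpha>" "AE x in lborel. wdiv \<alpha> (\<lambda>x. - u x) x = - wdiv \<alpha> u x"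
proof -
  note u = test_funD[OF assms]
  show ae: "AE x in lborel. wdiv \<alpha> (\<lambda>x. - u x) x = - wdiv \<alpha> u x"
    using AE_lborel_not_zero
  proof eventually_elim
    case (elim x)
    show ?case using wdiv_cmult[OF u(1) elim, of \<alpha> "-1"] by simp
  qed
  obtain R where R: "R > 0" "\<And>x. norm x \<ge> R \<Longrightarrow> u x = 0" by (rule compactly_supportedE[OF u(2)]) (rule that)
  show "(\<lambda>x. - u x) \<in> test_fun \<alpha>"
  proof (rule test_funI[OF smooth_minus[OF u(1)]])
    show "compactly_supported (\<lambda>x. - u x)" by (rule compactly_supportedI[of R]) (simp add: R(2))
    have "(\<lambda>x. (-1) * wdiv \<alpha> u x) \<in> L2 lborel" by (rule L2_cmult[OF u(3)])
    then show "wdiv \<alpha> (\<lambda>x. - u x) \<in> L2 lborel"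
    proof (rule L2_cong_AE)
      show "wdiv \<alpha> (\<lambda>x. - u x) \<in> borel_measurable lborel" using wdiv_borel[OF smooth_minus[OF u(1)]] by simp
      show "AE x in lborel. (-1) * wdiv \<alpha> u x = wdiv \<alpha> (\<lambda>x. - u x) x" using ae by eventually_elim simp
    qed
  qed
qed

lemma represents_minus:
  fixes u :: "real^'n \<Rightarrow> real"
  assumes w: "represents \<alpha> w u"
  shows "represents \<alpha> (\<lambda>n x. - w n x) (\<lambda>x. - u x)"
proof -
  have t: "w n \<in> test_fun \<alpha>" for n by (rule representsD(1)[OF w])
  have e: "\<bar>- w n x - - u x\<bar> = \<bar>w n x - u x\<bar>" for n x by linarith
  have n: "test_norm \<alpha> (\<lambda>x. - w m x - - w n x) = test_norm \<alpha> (\<lambda>x. w m x - w n x)" for m n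
  proof -
    have d: "(\<lambda>x. - w m x - - w n x) = (\<lambda>x. w n x - w m x)" by (auto simp: fun_eq_iff)
    show ?thesis unfolding d test_fun_diff(2)[OF t t] by (rule L2_norm_diff_commute)
  qed
  show ?thesis
    using w set_integrable_mult_right[of "-1" lebesgue _ u]
    unfolding represents_def e n using test_fun_minus(1)[OF t] by simp
qed

lemma D22_inner_minus:
  fixes u :: "real^'n \<Rightarrow> real"
  assumes w: "represents \<alpha> w u" and \<phi>: "\<phi> \<in> test_fun \<alpha>"
  shows "D22_inner \<alpha> (\<lambda>x. - u x) \<phi> = - D22_inner \<alpha> u \<phi>"
proof (rule LIMSEQ_unique)
  have e: "(\<integral>x. wdiv \<alpha> (\<lambda>x. - w n x) x * wdiv \<alpha> \<phi> x \<partial>lborel) = - (\<integral>x. wdiv \<alpha> (w n) x * wdiv \<alpha> \<phi> x \<partial>lborel)" for n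
  proof -
    note t = representsD(1)[OF w, of n]
    have m: "wdiv \<alpha> (\<lambda>x. - w n x) \<in> borel_measurable borel" "wdiv \<alpha> (w n) \<in> borel_measurable borel" "wdiv \<alpha> \<phi> \<in> borel_measurable borel"
      by (rule wdiv_borel, rule test_funD(1), rule test_fun_minus(1)[OF t])
         (rule wdiv_borel, rule test_funD(1), rule t, rule wdiv_borel, rule test_funD(1), rule \<phi>)
    have "(\<integral>x. wdiv \<alpha> (\<lambda>x. - w n x) x * wdiv \<alpha> \<phi> x \<partial>lborel) = (\<integral>x. - (wdiv \<alpha> (w n) x * wdiv \<alpha> \<phi> x) \<partial>lborel)"
    proof (rule integral_cong_AE)
      show "AE x in lborel. wdiv \<alpha> (\<lambda>x. - w n x) x * wdiv \<alpha> \<phi> x = - (wdiv \<alpha> (w n) x * wdiv \<alpha> \<phi> x)"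
        using test_fun_minus(2)[OF t] by eventually_elim simp
    qed (use m in auto)
    then show ?thesis by simp
  qed
  show "(\<lambda>n. - (\<integral>x. wdiv \<alpha> (w n) x * wdiv \<alpha> \<phi> x \<partial>lborel)) \<longlonglongrightarrow> D22_inner \<alpha> (\<lambda>x. - u x) \<phi>"
    using D22_inner_test_fun_LIMSEQ[OF represents_minus[OF w] \<phi>] unfolding e .
  show "(\<lambda>n. - (\<integral>x. wdiv \<alpha> (w n) x * wdiv \<alpha> \<phi> x \<partial>lborel)) \<longlonglongrightarrow> - D22_inner \<alpha> u \<phi>"
    by (rule tendsto_minus[OF D22_inner_test_fun_LIMSEQ[OF w \<phi>]])
qed

lemma radial_nontrivial_solution_minus:
  fixes u :: "real^'n \<Rightarrow> real"
  assumes s: "radial_nontrivial_solution \<alpha> u"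
  shows "radial_nontrivial_solution \<alpha> (\<lambda>x. - u x)"
  unfolding radial_nontrivial_solution_def
proof (intro conjI)
  obtain w where w: "represents \<alpha> w u" using s unfolding radial_nontrivial_solution_def D22_def by blast
  show "(\<lambda>x. - u x) \<in> D22 \<alpha>" using represents_minus[OF w] unfolding D22_def by blast
  obtain f where f: "AE x in lebesgue. u x = f (norm x)"
    using s unfolding radial_nontrivial_solution_def radial_def by blast
  then have "AE x in lebesgue. - u x = (\<lambda>r. - f r) (norm x)" by eventually_elim simp
  then show "radial (\<lambda>x. - u x)" unfolding radial_def by (rule exI[of _ "\<lambda>r. - f r"])
  show "\<not> (AE x in lebesgue. - u x = 0)" using s unfolding radial_nontrivial_solution_def by simp
  show "weak_solution \<alpha> (\<lambda>x. - u x)"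
    using s D22_inner_minus[OF w] unfolding radial_nontrivial_solution_def weak_solution_def by simp
qed

section \<open>Regular solutions as weak solutions\<close>

context weight_range
begin

lemma wdiv_radial_sys:
  "radial_sys N \<alpha> \<phi> P \<Phi> \<Longrightarrow> x \<noteq> 0 \<Longrightarrow> wdiv \<alpha> (\<lambda>x. \<phi> (norm x)) x = \<Phi> (norm (x::real^'n))"
  using wdiv_radial[of \<alpha> \<phi> P \<Phi> x] by (simp add: card_dim)

text \<open>The hypothesis on r^(-N) |P| controls the extra term in the weighted divergence of the
  approximants that comes from differentiating the cutoff, and so supplies the dominating function
  for convergence in L^2.\<close>

lemma radial_represents:
  assumes sys: "radial_sys N \<alpha> f P g" and sP: "smooth1 {0<..} P" and P: "\<And>r. r > 0 \<Longrightarrow> P r \<le> 0"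
    and f0: "(f \<longlongrightarrow> f0) (at_right 0)" and finf: "(f \<longlongrightarrow> 0) at_top"
    and gL: "(\<lambda>x::real^'n. g (norm x)) \<in> L2 lborel"
    and PL: "(\<lambda>x::real^'n. norm x powr (- real N) * \<bar>P (norm x)\<bar>) \<in> L2 lborel"
  obtains w where "represents \<alpha> w (\<lambda>x::real^'n. f (norm x))"
    "(\<lambda>n. L2_norm lborel (\<lambda>x. wdiv \<alpha> (w n) x - g (norm x))) \<longlonglongrightarrow> 0"
proof -
  obtain F G err B where F: "\<And>n. smooth1 UNIV (F n)" "\<And>n. \<exists>a>0. \<exists>b. (\<forall>r\<le>a. F n r = F n a) \<and> (\<forall>r\<ge>b. F n r = 0)"
    "\<And>n. \<exists>P'. radial_sys N \<alpha> (F n) P' (G n)" and err: "\<And>n r. r > 0 \<Longrightarrow> \<bar>F n r - f r\<bar> \<le> err n" "err \<longlonglongrightarrow> 0"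
    and B: "B \<ge> 0" "\<And>n r. r > 0 \<Longrightarrow> \<bar>G n r\<bar> \<le> \<bar>g r\<bar> + B * (r powr (- real N) * \<bar>P r\<bar>)"
    and Gg: "\<And>r. r > 0 \<Longrightarrow> \<forall>\<^sub>F n in sequentially. G n r = g r"
    by (rule radial_approximation[OF sys sP P f0 finf]) (assumption, rule that)
  define w where "w n x = F n (norm x)" for n and x :: "real^'n"
  have t: "w n \<in> test_fun \<alpha>" for n
  proof -
    obtain a b where ab: "a > 0" "\<And>r. r \<le> a \<Longrightarrow> F n r = F n a" "\<And>r. r \<ge> b \<Longrightarrow> F n r = 0" using F(2)[of n] by blast
    show ?thesis unfolding w_def[abs_def] by (rule test_fun_radial(1)[OF F(1) ab(1)]) (fact ab)+
  qed
  have wG: "wdiv \<alpha> (w n) x = G n (norm x)" if "x \<noteq> 0" for n x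
    using F(3)[of n] wdiv_radial_sys[OF _ that] unfolding w_def[abs_def] by blast
  \<comment> \<open>One |g| comes from the bound on G n and the other from subtracting g.\<close>
  define k where "k x = 2 * \<bar>g (norm x)\<bar> + B * (norm x powr (- real N) * \<bar>P (norm x)\<bar>)" for x :: "real^'n"
  have k: "k \<in> L2 lborel"
    unfolding k_def[abs_def]
  proof (intro L2_add L2_cmult PL)
    show "(\<lambda>x::real^'n. \<bar>g (norm x)\<bar>) \<in> L2 lborel" using gL by (auto simp: L2_def)
  qed
  have wm: "wdiv \<alpha> (w n) \<in> borel_measurable lborel" for n
    using wdiv_borel[OF test_funD(1)[OF t]] by simp
  have gm: "(\<lambda>x::real^'n. g (norm x)) \<in> borel_measurable lborel" by (rule L2_measurable[OF gL])
  have "(\<lambda>n. \<integral>x. (wdiv \<alpha> (w n) x - g (norm x))\<^sup>2 \<partial>lborel) \<longlonglongrightarrow> integral\<^sup>L lborel (\<lambda>x::real^'n. 0::real)"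
  proof (rule integral_dominated_convergence[where w = "\<lambda>x. (k x)\<^sup>2"])
    show "integrable lborel (\<lambda>x. (k x)\<^sup>2)" by (rule L2_integrable_sq[OF k])
    show "(\<lambda>x. (wdiv \<alpha> (w n) x - g (norm x))\<^sup>2) \<in> borel_measurable lborel" for n
      by (intro borel_measurable_power borel_measurable_diff wm gm)
    show "AE x in lborel. (\<lambda>n. (wdiv \<alpha> (w n) x - g (norm x))\<^sup>2) \<longlonglongrightarrow> 0"
      using AE_lborel_not_zero
    proof eventually_elim
      case (elim x)
      have "norm x > 0" using elim by simp
      from Gg[OF this] have "\<forall>\<^sub>F n in sequentially. (wdiv \<alpha> (w n) x - g (norm x))\<^sup>2 = 0"
        unfolding wG[OF elim] by eventually_elim simp
      then show ?case by (rule tendsto_eventually)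
    qed
    show "AE x in lborel. norm ((wdiv \<alpha> (w n) x - g (norm x))\<^sup>2) \<le> (k x)\<^sup>2" for n
      using AE_lborel_not_zero
    proof eventually_elim
      case (elim x)
      have "norm x > 0" using elim by simp
      from B(2)[OF this, of n] have "\<bar>wdiv \<alpha> (w n) x - g (norm x)\<bar> \<le> k x"
        unfolding wG[OF elim] k_def by linarith
      then have "\<bar>wdiv \<alpha> (w n) x - g (norm x)\<bar>\<^sup>2 \<le> (k x)\<^sup>2" by (intro power_mono) auto
      then show ?case by simp
    qed
  qed simp
  from tendsto_real_sqrt[OF this]
  have lim: "(\<lambda>n. L2_norm lborel (\<lambda>x. wdiv \<alpha> (w n) x - g (norm x))) \<longlonglongrightarrow> 0" by (simp add: L2_norm_def)
  have "represents \<alpha> w (\<lambda>x::real^'n. f (norm x))"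
  proof (rule represents_uniform_limit[OF t gL lim _ _ err(2)])
    have "continuous_on {0<..} f"
      by (intro continuous_at_imp_continuous_on ballI radial_sys_isCont(1)[OF sys]) auto
    then show "(\<lambda>x::real^'n. f (norm x)) \<in> borel_measurable borel" by (rule borel_measurable_norm_comp)
    show "\<bar>w n x - f (norm x)\<bar> \<le> err n" if "x \<noteq> 0" for n x
      unfolding w_def by (rule err(1)) (use that in simp)
  qed
  then show ?thesis using that lim by blast
qed

text \<open>Double integration by parts against a profile that is regular at the origin but not smooth
  there.\<close>

lemma wdiv_by_parts_radial:
  fixes \<phi> :: "real^'n \<Rightarrow> real"
  assumes sys: "radial_sys N \<alpha> f P g" and sP: "smooth1 {0<..} P" and P: "\<And>r. r > 0 \<Longrightarrow> P r \<le> 0"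
    and f0: "(f \<longlongrightarrow> f0) (at_right 0)" and finf: "(f \<longlongrightarrow> 0) at_top"
    and gb: "\<And>r. r > 0 \<Longrightarrow> \<bar>g r\<bar> \<le> M" and Pb: "\<And>r. r > 0 \<Longrightarrow> r powr (- real N) * \<bar>P r\<bar> \<le> M"
    and gc: "continuous_on {0<..} g" and fb: "\<And>r. \<bar>f r\<bar> \<le> M"
    and \<phi>: "\<phi> \<in> test_fun \<alpha>"
  shows "(\<integral>x. wdiv \<alpha> \<phi> x * f (norm x) \<partial>lborel) = (\<integral>x. \<phi> x * g (norm x) \<partial>lborel)"
proof -
  obtain F G err B where F: "\<And>n. smooth1 UNIV (F n)" "\<And>n. \<exists>a>0. \<exists>b. (\<forall>r\<le>a. F n r = F n a) \<and> (\<forall>r\<ge>b. F n r = 0)"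
    "\<And>n. \<exists>P'. radial_sys N \<alpha> (F n) P' (G n)" and err: "\<And>n r. r > 0 \<Longrightarrow> \<bar>F n r - f r\<bar> \<le> err n" "err \<longlonglongrightarrow> 0"
    and B: "B \<ge> 0" "\<And>n r. r > 0 \<Longrightarrow> \<bar>G n r\<bar> \<le> \<bar>g r\<bar> + B * (r powr (- real N) * \<bar>P r\<bar>)"
    and Gg: "\<And>r. r > 0 \<Longrightarrow> \<forall>\<^sub>F n in sequentially. G n r = g r"
    by (rule radial_approximation[OF sys sP P f0 finf]) (assumption, rule that)
  define \<psi> where "\<psi> n x = F n (norm x)" for n and x :: "real^'n"
  have \<psi>s: "smooth (\<psi> n)" and \<psi>c: "compactly_supported (\<psi> n)"
    and by_parts: "(\<integral>x. wdiv \<alpha> \<phi> x * \<psi> n x \<partial>lborel) = (\<integral>x. \<phi> x * wdiv \<alpha> (\<psi> n) x \<partial>lborel)" for n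
  proof -
    obtain a b where ab: "a > 0" "\<And>r. r \<le> a \<Longrightarrow> F n r = F n a" "\<And>r. r \<ge> b \<Longrightarrow> F n r = 0" using F(2)[of n] by blast
    show s: "smooth (\<psi> n)" unfolding \<psi>_def[abs_def] by (rule test_fun_radial(2)[OF F(1) ab(1)]) (fact ab)+
    show "compactly_supported (\<psi> n)" unfolding \<psi>_def[abs_def] by (rule test_fun_radial(3)[OF F(1) ab(1)]) (fact ab)+
    show "(\<integral>x. wdiv \<alpha> \<phi> x * \<psi> n x \<partial>lborel) = (\<integral>x. \<phi> x * wdiv \<alpha> (\<psi> n) x \<partial>lborel)"
      by (rule wdiv_by_parts[OF \<phi> s ab(1), of "F n a"]) (unfold \<psi>_def, rule ab(2), simp)
  qed
  have wG: "wdiv \<alpha> (\<psi> n) x = G n (norm x)" if "x \<noteq> 0" for n x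
    using F(3)[of n] wdiv_radial_sys[OF _ that] unfolding \<psi>_def[abs_def] by blast
  have fm: "(\<lambda>x::real^'n. f (norm x)) \<in> borel_measurable borel"
    by (intro borel_measurable_norm_comp continuous_at_imp_continuous_on ballI radial_sys_isCont(1)[OF sys]) auto
  have gm: "(\<lambda>x::real^'n. g (norm x)) \<in> borel_measurable borel" by (rule borel_measurable_norm_comp[OF gc])
  have \<phi>m: "\<phi> \<in> borel_measurable borel" by (rule smooth_borel[OF test_funD(1)[OF \<phi>]])
  have fi: "integrable lborel (\<lambda>x. wdiv \<alpha> \<phi> x * f (norm x))"
    by (rule test_fun_wdiv_mult_integrable[OF \<phi> fm]) (rule fb)
  have "integrable lborel (\<lambda>x. wdiv \<alpha> \<phi> x * 1)"
    by (rule test_fun_wdiv_mult_integrable[OF \<phi>, of _ 1]) auto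
  then have \<phi>i: "integrable lborel (\<lambda>x. \<bar>wdiv \<alpha> \<phi> x\<bar>)" by simp
  have \<psi>i: "integrable lborel (\<lambda>x. wdiv \<alpha> \<phi> x * \<psi> n x)" for n
  proof -
    obtain D where "D > 0" and D: "\<And>x. \<bar>\<psi> n x\<bar> \<le> D"
      by (rule smooth_compactly_supported_bounded[OF \<psi>s \<psi>c]) (rule that)
    show ?thesis by (rule test_fun_wdiv_mult_integrable[OF \<phi> smooth_borel[OF \<psi>s]]) (rule D)
  qed
  have l1: "(\<lambda>n. \<integral>x. wdiv \<alpha> \<phi> x * \<psi> n x \<partial>lborel) \<longlonglongrightarrow> (\<integral>x. wdiv \<alpha> \<phi> x * f (norm x) \<partial>lborel)"
  proof (rule LIM_zero_cancel, rule Lim_null_comparison)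
    let ?A = "\<integral>x. \<bar>wdiv \<alpha> \<phi> x\<bar> \<partial>lborel"
    show "(\<lambda>n. err n * ?A) \<longlonglongrightarrow> 0" using tendsto_mult_right[OF err(2), of ?A] by simp
    have "norm ((\<integral>x. wdiv \<alpha> \<phi> x * \<psi> n x \<partial>lborel) - (\<integral>x. wdiv \<alpha> \<phi> x * f (norm x) \<partial>lborel)) \<le> err n * ?A" for n
    proof -
      have "norm ((\<integral>x. wdiv \<alpha> \<phi> x * \<psi> n x \<partial>lborel) - (\<integral>x. wdiv \<alpha> \<phi> x * f (norm x) \<partial>lborel))
          = \<bar>\<integral>x. wdiv \<alpha> \<phi> x * \<psi> n x - wdiv \<alpha> \<phi> x * f (norm x) \<partial>lborel\<bar>"
        using \<psi>i[of n] fi by simp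
      also have "\<dots> \<le> (\<integral>x. \<bar>wdiv \<alpha> \<phi> x * \<psi> n x - wdiv \<alpha> \<phi> x * f (norm x)\<bar> \<partial>lborel)" by (rule integral_abs_bound)
      also have "\<dots> \<le> (\<integral>x. err n * \<bar>wdiv \<alpha> \<phi> x\<bar> \<partial>lborel)"
      proof (rule integral_mono_AE)
        show "AE x in lborel. \<bar>wdiv \<alpha> \<phi> x * \<psi> n x - wdiv \<alpha> \<phi> x * f (norm x)\<bar> \<le> err n * \<bar>wdiv \<alpha> \<phi> x\<bar>"
          using AE_lborel_not_zero
        proof eventually_elim
          case (elim x)
          have "norm x > 0" using elim by simp
          from mult_right_mono[OF err(1)[OF this, of n] abs_ge_zero[of "wdiv \<alpha> \<phi> x"]]
          show ?case unfolding right_diff_distrib[symmetric] abs_mult \<psi>_def by (simp only: mult.commute)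
        qed
      qed (use \<psi>i[of n] fi \<phi>i in auto)
      finally show ?thesis by simp
    qed
    then show "\<forall>\<^sub>F n in sequentially. norm ((\<integral>x. wdiv \<alpha> \<phi> x * \<psi> n x \<partial>lborel) - (\<integral>x. wdiv \<alpha> \<phi> x * f (norm x) \<partial>lborel)) \<le> err n * ?A"
      by (intro always_eventually allI)
  qed
  have l2: "(\<lambda>n. \<integral>x. \<phi> x * wdiv \<alpha> (\<psi> n) x \<partial>lborel) \<longlonglongrightarrow> (\<integral>x. \<phi> x * g (norm x) \<partial>lborel)"
  proof (rule integral_dominated_convergence[where w = "\<lambda>x. \<bar>\<phi> x\<bar> * (M + B * M)"])
    show "integrable lborel (\<lambda>x. \<bar>\<phi> x\<bar> * (M + B * M))"
      using integrable_smooth[OF test_funD(1,2)[OF \<phi>]] by simp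
    show "(\<lambda>x. \<phi> x * g (norm x)) \<in> borel_measurable lborel" using borel_measurable_times[OF \<phi>m gm] by simp
    show "(\<lambda>x. \<phi> x * wdiv \<alpha> (\<psi> n) x) \<in> borel_measurable lborel" for n
      using borel_measurable_times[OF \<phi>m wdiv_borel[OF \<psi>s]] by simp
    show "AE x in lborel. (\<lambda>n. \<phi> x * wdiv \<alpha> (\<psi> n) x) \<longlonglongrightarrow> \<phi> x * g (norm x)"
      using AE_lborel_not_zero
    proof eventually_elim
      case (elim x)
      have "norm x > 0" using elim by simp
      from Gg[OF this] have "\<forall>\<^sub>F n in sequentially. \<phi> x * wdiv \<alpha> (\<psi> n) x = \<phi> x * g (norm x)"
        unfolding wG[OF elim] by eventually_elim simp
      then show ?case by (rule tendsto_eventually)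
    qed
    show "AE x in lborel. norm (\<phi> x * wdiv \<alpha> (\<psi> n) x) \<le> \<bar>\<phi> x\<bar> * (M + B * M)" for n
      using AE_lborel_not_zero
    proof eventually_elim
      case (elim x)
      have r: "norm x > 0" using elim by simp
      have "\<bar>G n (norm x)\<bar> \<le> M + B * M"
        using B(2)[OF r, of n] gb[OF r] mult_left_mono[OF Pb[OF r] B(1)] by linarith
      then show ?case unfolding wG[OF elim] by (simp add: abs_mult mult_left_mono)
    qed
  qed
  show ?thesis using LIMSEQ_unique[OF l1] l2 unfolding by_parts by blast
qed

text \<open>The weighted divergences of the approximants converge to g in L^2, so the inner product
  with \<phi> is \<integral> g wdiv \<phi>; moving the divergence onto g turns g into the nonlinear
  term.\<close>

lemma regular_sol_weak_solution:
  assumes reg: "regular_sol f P g Q f0 g0" and sm: "smooth1 {0<..} P" "smooth1 {0<..} Q"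
    and sgn: "\<And>r. r > 0 \<Longrightarrow> P r \<le> 0" "\<And>r. r > 0 \<Longrightarrow> 0 \<le> Q r"
    and inf: "(f \<longlongrightarrow> 0) at_top" "(g \<longlongrightarrow> 0) at_top"
    and gL: "(\<lambda>x::real^'n. g (norm x)) \<in> L2 lborel"
    and PL: "(\<lambda>x::real^'n. norm x powr (- real N) * \<bar>P (norm x)\<bar>) \<in> L2 lborel"
    and gb: "\<And>r. \<bar>g r\<bar> \<le> M" and hb: "\<And>r. \<bar>nonlin N \<alpha> (f r)\<bar> \<le> M"
    and Qb: "\<And>r. r > 0 \<Longrightarrow> r powr (- real N) * \<bar>Q r\<bar> \<le> M"
  shows "(\<lambda>x::real^'n. f (norm x)) \<in> D22 \<alpha>" "weak_solution \<alpha> (\<lambda>x::real^'n. f (norm x))"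
proof -
  have sys: "radial_sys N \<alpha> f P g" "radial_sys N \<alpha> g Q (\<lambda>r. nonlin N \<alpha> (f r))"
    and lim: "(f \<longlongrightarrow> f0) (at_right 0)" "(g \<longlongrightarrow> g0) (at_right 0)"
    using reg by (auto simp: regular_sol_def)
  obtain w where w: "represents \<alpha> w (\<lambda>x::real^'n. f (norm x))"
    and wl: "(\<lambda>n. L2_norm lborel (\<lambda>x. wdiv \<alpha> (w n) x - g (norm x))) \<longlonglongrightarrow> 0"
    by (rule radial_represents[OF sys(1) sm(1) sgn(1) lim(1) inf(1) gL PL]) (assumption, rule that)
  show "(\<lambda>x::real^'n. f (norm x)) \<in> D22 \<alpha>" using w unfolding D22_def by blast
  have fc: "continuous_on {0<..} f"
    by (intro continuous_at_imp_continuous_on ballI radial_sys_isCont(1)[OF sys(1)]) auto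
  have hc: "continuous_on {0<..} (\<lambda>r. nonlin N \<alpha> (f r))"
    by (rule continuous_on_compose2[OF continuous_at_imp_continuous_on[of UNIV] fc]) (auto simp: nonlin_continuous)
  have hm: "(\<lambda>x::real^'n. nonlin N \<alpha> (f (norm x))) \<in> borel_measurable borel" by (rule borel_measurable_norm_comp[OF hc])
  show "weak_solution \<alpha> (\<lambda>x::real^'n. f (norm x))"
    unfolding weak_solution_def card_dim nonlin_def[symmetric]
  proof (intro ballI conjI)
    fix \<phi> :: "real^'n \<Rightarrow> real" assume \<phi>: "\<phi> \<in> test_fun \<alpha>"
    note \<phi>L = test_funD(3)[OF \<phi>]
    have \<phi>m: "\<phi> \<in> borel_measurable borel" by (rule smooth_borel[OF test_funD(1)[OF \<phi>]])
    have m: "(\<lambda>x. nonlin N \<alpha> (f (norm x)) * \<phi> x) \<in> borel_measurable lborel"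
      using borel_measurable_times[OF hm \<phi>m] by simp
    have "integrable lborel (\<lambda>x. nonlin N \<alpha> (f (norm x)) * \<phi> x)"
    proof (rule Bochner_Integration.integrable_bound[OF _ m])
      show "integrable lborel (\<lambda>x. M * \<phi> x)" using integrable_smooth[OF test_funD(1,2)[OF \<phi>]] by simp
      have "norm (nonlin N \<alpha> (f (norm x)) * \<phi> x) \<le> norm (M * \<phi> x)" for x
        unfolding real_norm_def abs_mult
        by (rule mult_right_mono[OF order_trans[OF hb abs_ge_self]]) simp
      then show "AE x in lborel. norm (nonlin N \<alpha> (f (norm x)) * \<phi> x) \<le> norm (M * \<phi> x)" by simp
    qed
    then show "integrable lebesgue (\<lambda>x. nonlin N \<alpha> (f (norm x)) * \<phi> x)"
      by (simp only: integrable_completion[OF m])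
    have "D22_inner \<alpha> (\<lambda>x. f (norm x)) \<phi> = (\<integral>x. g (norm x) * wdiv \<alpha> \<phi> x \<partial>lborel)"
    proof (rule LIMSEQ_unique[OF D22_inner_test_fun_LIMSEQ[OF w \<phi>]])
      show "(\<lambda>n. \<integral>x. wdiv \<alpha> (w n) x * wdiv \<alpha> \<phi> x \<partial>lborel) \<longlonglongrightarrow> (\<integral>x. g (norm x) * wdiv \<alpha> \<phi> x \<partial>lborel)"
      proof (rule LIM_zero_cancel, rule Lim_null_comparison)
        show "(\<lambda>n. L2_norm lborel (\<lambda>x. wdiv \<alpha> (w n) x - g (norm x)) * L2_norm lborel (wdiv \<alpha> \<phi>)) \<longlonglongrightarrow> 0"
          using tendsto_mult_right[OF wl, of "L2_norm lborel (wdiv \<alpha> \<phi>)"] by simp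
        have "norm ((\<integral>x. wdiv \<alpha> (w n) x * wdiv \<alpha> \<phi> x \<partial>lborel) - (\<integral>x. g (norm x) * wdiv \<alpha> \<phi> x \<partial>lborel))
          \<le> L2_norm lborel (\<lambda>x. wdiv \<alpha> (w n) x - g (norm x)) * L2_norm lborel (wdiv \<alpha> \<phi>)" for n
        proof -
          note wL = test_funD(3)[OF representsD(1)[OF w, of n]]
          have "(\<integral>x. wdiv \<alpha> (w n) x * wdiv \<alpha> \<phi> x \<partial>lborel) - (\<integral>x. g (norm x) * wdiv \<alpha> \<phi> x \<partial>lborel)
            = (\<integral>x. (wdiv \<alpha> (w n) x - g (norm x)) * wdiv \<alpha> \<phi> x \<partial>lborel)"
            unfolding left_diff_distrib
            by (rule Bochner_Integration.integral_diff[OF L2_mult_integrable[OF wL \<phi>L] L2_mult_integrable[OF gL \<phi>L], symmetric])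
          then show ?thesis using L2_Cauchy_Schwarz[OF L2_diff[OF wL gL] \<phi>L] by simp
        qed
        then show "\<forall>\<^sub>F n in sequentially. norm ((\<integral>x. wdiv \<alpha> (w n) x * wdiv \<alpha> \<phi> x \<partial>lborel) - (\<integral>x. g (norm x) * wdiv \<alpha> \<phi> x \<partial>lborel))
          \<le> L2_norm lborel (\<lambda>x. wdiv \<alpha> (w n) x - g (norm x)) * L2_norm lborel (wdiv \<alpha> \<phi>)"
          by (intro always_eventually allI)
      qed
    qed
    \<comment> \<open>\<open>wdiv_by_parts_radial\<close> asks for a nonpositive flux while that of
      g is nonnegative, so it is applied to - g.\<close>
    also have "\<dots> = - (\<integral>x. wdiv \<alpha> \<phi> x * ((-1) * g (norm x)) \<partial>lborel)" by (simp add: mult.commute)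
    also have "(\<integral>x. wdiv \<alpha> \<phi> x * ((-1) * g (norm x)) \<partial>lborel) = (\<integral>x. \<phi> x * ((-1) * nonlin N \<alpha> (f (norm x))) \<partial>lborel)"
    proof (rule wdiv_by_parts_radial[OF radial_sys_cmult[OF sys(2), of "-1"], of "-1 * g0" M])
      show "smooth1 {0<..} (\<lambda>r. (-1) * Q r)" by (rule smooth1_cmult[OF _ sm(2)]) simp
      show "((\<lambda>r. (-1) * g r) \<longlongrightarrow> (-1) * g0) (at_right 0)" by (rule tendsto_mult_left[OF lim(2)])
      show "((\<lambda>r. (-1) * g r) \<longlongrightarrow> 0) at_top" using tendsto_mult_left[OF inf(2), of "-1"] by simp
      show "continuous_on {0<..} (\<lambda>r. (-1) * nonlin N \<alpha> (f r))" by (rule continuous_on_mult_left[OF hc])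
    qed (use \<phi> gb hb Qb sgn(2) in simp_all)
    also have "- \<dots> = (\<integral>x. nonlin N \<alpha> (f (norm x)) * \<phi> x \<partial>lborel)" by (simp add: mult.commute)
    also have "\<dots> = (\<integral>x. nonlin N \<alpha> (f (norm x)) * \<phi> x \<partial>lebesgue)" by (rule integral_completion[OF m, symmetric])
    finally show "D22_inner \<alpha> (\<lambda>x. f (norm x)) \<phi> = (\<integral>x. nonlin N \<alpha> (f (norm x)) * \<phi> x \<partial>lebesgue)" .
  qed
qed


text \<open>With \<open>q = 2 * aexp / bexp\<close>, the weighted divergence maps
  \<open>profile \<kappa> q\<close> to a combination of \<open>profile \<kappa> (q + 1)\<close> and \<open>profile \<kappa> (q + 2)\<close>, and that combination
  to a multiple of \<open>profile \<kappa> (q + 4)\<close>, which is the nonlinearity because \<open>q * pexp = 4\<close>.\<close>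

lemma profile_solution:
  assumes \<kappa>: "\<kappa> > 0" and C: "C > 0"
    and Cp: "C powr pexp = \<kappa>\<^sup>2 * (2 * aexp * (2 * aexp + bexp) * real N * (real N + bexp))"
  defines "f \<equiv> \<lambda>r. C * profile \<kappa> (2 * aexp / bexp) r"
  shows "(\<lambda>x::real^'n. f (norm x)) \<in> D22 \<alpha>" "weak_solution \<alpha> (\<lambda>x::real^'n. f (norm x))"
    "\<exists>P g Q g0. regular_sol f P g Q C g0 \<and> (\<lambda>x::real^'n. g (norm x)) \<in> L2 lborel"
proof -
  define q where "q = 2 * aexp / bexp"
  note ex = exps(1-4)
  have q0: "q > 0" using ex by (simp add: q_def)
  have qb: "q * bexp = 2 * aexp" using ex by (simp add: q_def)
  then have qb1: "(q + 1) * bexp = 2 * aexp + bexp" and qb2: "(q + 2) * bexp = real N" and qb3: "(q + 3) * bexp = real N + bexp"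
    using ex(4) by (simp_all add: algebra_simps)
  have qp: "q * pexp = 4" 
  proof -
    have "q * pexp = 2 * (aexp * pexp) / bexp" by (simp add: q_def)
    then show ?thesis unfolding exps(5) using ex(2) by simp
  qed
  have kb: "s * \<kappa> * bexp = \<kappa> * (s * bexp)" for s by simp
  have e: "q + 1 + 1 = q + 2" "q + 1 + 2 = q + 3" "q + 2 + 1 = q + 3" "q + 2 + 2 = q + 4" by auto
  \<comment> \<open>The two coefficients of \<open>radial_sys_profile\<close> times C, with q bexp =
    2 aexp and N - (q + 1) bexp = bexp.\<close>
  define c1 c2 where "c1 = - (2 * aexp * \<kappa> * C * bexp)" and "c2 = - (2 * aexp * \<kappa> * C * (2 * aexp + bexp))"
  have c: "c1 \<le> 0" "c2 \<le> 0" using ex \<kappa> C by (auto simp: c1_def c2_def)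
  define P where "P r = C * (- (q * \<kappa> * bexp) * (r powr real N * profile \<kappa> (q + 1) r))" for r
  define g where "g r = c1 * profile \<kappa> (q + 1) r + c2 * profile \<kappa> (q + 2) r" for r
  define Q where "Q r = c1 * (- ((q + 1) * \<kappa> * bexp) * (r powr real N * profile \<kappa> (q + 2) r))
    + c2 * (- ((q + 2) * \<kappa> * bexp) * (r powr real N * profile \<kappa> (q + 3) r))" for r
  have f: "f = (\<lambda>r. C * profile \<kappa> q r)" by (simp add: f_def q_def)
  have p0: "0 < profile \<kappa> s r" for s r by (rule profile_pos[OF \<kappa>])
  have p1: "s \<ge> 0 \<Longrightarrow> profile \<kappa> s r \<le> 1" for s r by (rule profile_le_1[OF \<kappa>])
  have sys1: "radial_sys N \<alpha> f P g"
    unfolding f P_def[abs_def]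
  proof (rule radial_sys_cong[OF radial_sys_cmult[OF radial_sys_profile[OF \<kappa>, of q]]])
    have Nb: "real N - (2 * aexp + bexp) = bexp" using ex(4) by simp
    show "C * (- (q * \<kappa> * bexp) * ((real N - (q + 1) * bexp) * profile \<kappa> (q + 1) r + (q + 1) * bexp * profile \<kappa> (q + 2) r)) = g r" for r
      unfolding kb qb qb1 Nb g_def c1_def c2_def by (simp add: algebra_simps)
  qed
  have fp: "nonlin N \<alpha> (f r) = C powr pexp * C * profile \<kappa> (q + 4) r" for r
  proof -
    have "nonlin N \<alpha> (f r) = (C powr pexp * profile \<kappa> (q * pexp) r) * (C * profile \<kappa> q r)"
      using C p0[of q r] by (simp add: nonlin_eq f abs_mult powr_mult profile_powr[OF \<kappa>])
    also have "\<dots> = C powr pexp * C * (profile \<kappa> q r * profile \<kappa> (q * pexp) r)" by simp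
    finally show ?thesis unfolding profile_mult[OF \<kappa>] qp .
  qed
  \<comment> \<open>Two cancellations occur. The profile with exponent q + 2 drops out because N =
    (q + 2) bexp, and the contributions with exponent q + 3 from c1 and c2 are opposite. The
    coefficient left at q + 4 is matched by the hypothesis on C.\<close>
  have sys2: "radial_sys N \<alpha> g Q (\<lambda>r. nonlin N \<alpha> (f r))"
    unfolding g_def[abs_def] Q_def[abs_def]
  proof (rule radial_sys_cong[OF radial_sys_add[OF radial_sys_cmult[OF radial_sys_profile[OF \<kappa>, of "q + 1", unfolded e]]
        radial_sys_cmult[OF radial_sys_profile[OF \<kappa>, of "q + 2", unfolded e]]]])
    fix r :: real
    show "c1 * (- ((q + 1) * \<kappa> * bexp) * ((real N - (q + 2) * bexp) * profile \<kappa> (q + 2) r + (q + 2) * bexp * profile \<kappa> (q + 3) r)) +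
      c2 * (- ((q + 2) * \<kappa> * bexp) * ((real N - (q + 3) * bexp) * profile \<kappa> (q + 3) r + (q + 3) * bexp * profile \<kappa> (q + 4) r)) = nonlin N \<alpha> (f r)"
      unfolding fp Cp kb qb1 qb2 qb3 c1_def c2_def by (simp add: algebra_simps power2_eq_square)
  qed
  have rp: "((\<lambda>r. k * (r powr real N * profile \<kappa> s r)) \<longlongrightarrow> 0) (at_right 0)" for k s
  proof -
    have "((\<lambda>r. k * (r powr real N * profile \<kappa> s r)) \<longlongrightarrow> k * (0 * 1)) (at_right 0)"
      by (intro tendsto_mult tendsto_const powr_tendsto_0 profile_tendsto_1[OF \<kappa>] N_pos)
    then show ?thesis by simp
  qed
  have P0: "(P \<longlongrightarrow> 0) (at_right 0)" using rp[of "C * - (q * \<kappa> * bexp)" "q + 1"] by (simp only: P_def[abs_def] mult.assoc)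
  have Q0: "(Q \<longlongrightarrow> 0) (at_right 0)"
    using tendsto_add[OF rp[of "c1 * - ((q + 1) * \<kappa> * bexp)" "q + 2"] rp[of "c2 * - ((q + 2) * \<kappa> * bexp)" "q + 3"]]
    by (simp only: Q_def[abs_def] mult.assoc add_0)
  have "(f \<longlongrightarrow> C * 1) (at_right 0)" unfolding f by (intro tendsto_mult tendsto_const profile_tendsto_1[OF \<kappa>])
  moreover have "(g \<longlongrightarrow> c1 * 1 + c2 * 1) (at_right 0)" unfolding g_def[abs_def]
    by (intro tendsto_add tendsto_mult tendsto_const profile_tendsto_1[OF \<kappa>])
  ultimately have reg: "regular_sol f P g Q C (c1 * 1 + c2 * 1)"
    unfolding regular_sol_def using sys1 sys2 P0 Q0 by simp
  have pL: "(\<lambda>x::real^'n. profile \<kappa> (q + 1) (norm x)) \<in> L2 lborel" "(\<lambda>x::real^'n. profile \<kappa> (q + 2) (norm x)) \<in> L2 lborel"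
  proof -
    show "(\<lambda>x::real^'n. profile \<kappa> (q + 1) (norm x)) \<in> L2 lborel"
    proof (rule profile_L2[OF \<kappa>])
      \<comment> \<open>g decays like r^-(2 aexp + bexp), and N = 2 aexp + 2 bexp is below twice
        that exponent because aexp > 0.\<close>
      show "real N < 2 * ((q + 1) * bexp)" using ex(1) unfolding qb1 ex(4) by simp
    qed
    show "(\<lambda>x::real^'n. profile \<kappa> (q + 2) (norm x)) \<in> L2 lborel"
    proof (rule profile_L2[OF \<kappa>])
      show "real N < 2 * ((q + 2) * bexp)" unfolding qb2 using N_pos by linarith
    qed
  qed
  have gL: "(\<lambda>x::real^'n. g (norm x)) \<in> L2 lborel" unfolding g_def by (intro L2_add L2_cmult pL)
  show "\<exists>P g Q g0. regular_sol f P g Q C g0 \<and> (\<lambda>x::real^'n. g (norm x)) \<in> L2 lborel" using reg gL by blast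
  have rs: "smooth1 {0<..} (\<lambda>r. k * (r powr real N * profile \<kappa> s r))" for k s
    by (intro smooth1_cmult smooth1_mult smooth1_powr smooth1_profile[OF \<kappa>]) auto
  have Ps: "smooth1 {0<..} P" using rs[of "C * - (q * \<kappa> * bexp)" "q + 1"] by (simp only: P_def[abs_def] mult.assoc)
  have Qs: "smooth1 {0<..} Q"
    using smooth1_add[OF _ rs[of "c1 * - ((q + 1) * \<kappa> * bexp)" "q + 2"] rs[of "c2 * - ((q + 2) * \<kappa> * bexp)" "q + 3"]]
    by (simp only: Q_def[abs_def] mult.assoc open_greaterThan)
  have rr: "r powr (- real N) * (r powr real N * t) = t" if "r > 0" for r t
    using that by (simp add: powr_minus)
  have PL: "(\<lambda>x::real^'n. norm x powr (- real N) * \<bar>P (norm x)\<bar>) \<in> L2 lborel"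
  proof (rule L2_cong_AE[OF L2_cmult[OF pL(1), of "C * (q * \<kappa> * bexp)"]])
    have "continuous_on {0<..} (\<lambda>r. r powr (- real N) * \<bar>P r\<bar>)"
      by (intro continuous_on_mult continuous_on_rabs smooth1_continuous_on[OF Ps] smooth1_continuous_on[OF smooth1_powr]) auto
    from borel_measurable_norm_comp[OF this]
    show "(\<lambda>x::real^'n. norm x powr (- real N) * \<bar>P (norm x)\<bar>) \<in> borel_measurable lborel" by simp
    show "AE x in lborel. C * (q * \<kappa> * bexp) * profile \<kappa> (q + 1) (norm x) = norm x powr (- real N) * \<bar>P (norm (x::real^'n))\<bar>"
      using AE_lborel_not_zero
    proof eventually_elim
      case (elim x)
      have "\<bar>P (norm x)\<bar> = norm x powr real N * (C * (q * \<kappa> * bexp) * profile \<kappa> (q + 1) (norm x))"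
        using C \<kappa> ex q0 p0[of "q + 1" "norm x"] by (simp add: P_def abs_mult)
      then show ?case using elim by (simp add: rr)
    qed
  qed
  define M1 M2 M3 where "M1 = \<bar>c1\<bar> + \<bar>c2\<bar>" and "M2 = C powr pexp * C"
    and "M3 = \<bar>c1\<bar> * ((q + 1) * \<kappa> * bexp) + \<bar>c2\<bar> * ((q + 2) * \<kappa> * bexp)"
  have M: "M1 \<ge> 0" "M2 \<ge> 0" "M3 \<ge> 0" using C \<kappa> q0 ex unfolding M1_def M2_def M3_def
    by (auto intro!: add_nonneg_nonneg mult_nonneg_nonneg)
  have abs_profile: "\<bar>k * profile \<kappa> s r\<bar> \<le> \<bar>k\<bar>" if "s \<ge> 0" for k s r
    using p0[of s r] p1[OF that, of r] unfolding abs_mult by (intro mult_left_le) auto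
  have gb: "\<bar>g r\<bar> \<le> M1 + M2 + M3" for r
  proof -
    have "\<bar>g r\<bar> \<le> \<bar>c1\<bar> + \<bar>c2\<bar>" unfolding g_def
      by (rule order_trans[OF abs_triangle_ineq add_mono[OF abs_profile abs_profile]]) (use q0 in auto)
    then show ?thesis using M unfolding M1_def by linarith
  qed
  have hb: "\<bar>nonlin N \<alpha> (f r)\<bar> \<le> M1 + M2 + M3" for r
  proof -
    have "\<bar>nonlin N \<alpha> (f r)\<bar> \<le> \<bar>C powr pexp * C\<bar>" unfolding fp by (rule abs_profile) (use q0 in simp)
    then show ?thesis using M C unfolding M2_def by simp
  qed
  have Qeq: "Q r = r powr real N * ((\<bar>c1\<bar> * ((q + 1) * \<kappa> * bexp)) * profile \<kappa> (q + 2) r + (\<bar>c2\<bar> * ((q + 2) * \<kappa> * bexp)) * profile \<kappa> (q + 3) r)" for r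
    unfolding Q_def abs_of_nonpos[OF c(1)] abs_of_nonpos[OF c(2)] by (simp add: algebra_simps)
  have co: "0 \<le> \<bar>c1\<bar> * ((q + 1) * \<kappa> * bexp)" "0 \<le> \<bar>c2\<bar> * ((q + 2) * \<kappa> * bexp)" using \<kappa> q0 ex by auto
  have Qn: "0 \<le> Q r" for r
    unfolding Qeq
    by (rule mult_nonneg_nonneg[OF powr_ge_zero add_nonneg_nonneg[OF mult_nonneg_nonneg[OF co(1) less_imp_le[OF p0]]
          mult_nonneg_nonneg[OF co(2) less_imp_le[OF p0]]]])
  have Qb: "r powr (- real N) * \<bar>Q r\<bar> \<le> M1 + M2 + M3" if "r > 0" for r
  proof -
    have "r powr (- real N) * \<bar>Q r\<bar> = (\<bar>c1\<bar> * ((q + 1) * \<kappa> * bexp)) * profile \<kappa> (q + 2) r + (\<bar>c2\<bar> * ((q + 2) * \<kappa> * bexp)) * profile \<kappa> (q + 3) r"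
      unfolding abs_of_nonneg[OF Qn] unfolding Qeq by (rule rr[OF that])
    also have "\<dots> \<le> \<bar>c1\<bar> * ((q + 1) * \<kappa> * bexp) + \<bar>c2\<bar> * ((q + 2) * \<kappa> * bexp)"
      by (intro add_mono mult_left_le p1 co) (use q0 in auto)
    finally show ?thesis using M unfolding M3_def by linarith
  qed
  have Pn: "P r \<le> 0" for r unfolding P_def using C \<kappa> q0 ex p0[of "q + 1" r]
    by (intro mult_nonneg_nonpos mult_nonpos_nonneg mult_nonneg_nonneg) auto
  have inf: "(f \<longlongrightarrow> 0) at_top" "(g \<longlongrightarrow> 0) at_top"
  proof -
    have pt: "((\<lambda>r. k * profile \<kappa> s r) \<longlongrightarrow> 0) at_top" if "s > 0" for k s
      using tendsto_mult_left[OF profile_tendsto_0[OF \<kappa> that], of k] by simp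
    show "(f \<longlongrightarrow> 0) at_top" unfolding f by (rule pt[OF q0])
    show "(g \<longlongrightarrow> 0) at_top" unfolding g_def[abs_def]
      using tendsto_add[OF pt[of "q + 1" c1] pt[of "q + 2" c2]] q0 by simp
  qed
  note ws = regular_sol_weak_solution[OF reg Ps Qs Pn Qn inf gL PL gb hb Qb]
  show "(\<lambda>x::real^'n. f (norm x)) \<in> D22 \<alpha>" "weak_solution \<alpha> (\<lambda>x::real^'n. f (norm x))" by (rule ws, assumption)+
qed

section \<open>The bubbles as solutions\<close>

text \<open>The exponent in the definition is 1 / pexp, so the pexp-th power of the constant is the
  product that \<open>profile_solution\<close> requires for \<kappa> = 1.\<close>

lemma bubble_const_eq:
  "bubble_const N \<alpha> = (2 * aexp * (2 * aexp + bexp) * real N * (real N + bexp)) powr (1 / pexp)"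
proof -
  have e: "(real N - 4 + 2 * \<alpha>) / (8 - 4 * \<alpha>) = 1 / pexp"
  proof -
    have p: "pexp = 2 * bexp / aexp" using exps(1,5) by (simp add: field_simps)
    show ?thesis unfolding p unfolding aexp_def bexp_def by simp
  qed
  have "real N - 4 + 2 * \<alpha> = 2 * aexp" "real N - 2 + \<alpha> = 2 * aexp + bexp" "real N + 2 - \<alpha> = real N + bexp"
    by (simp_all add: aexp_def bexp_def field_simps)
  then show ?thesis unfolding bubble_const_def e by (simp only:)
qed

lemma bubble_const_pos: "bubble_const N \<alpha> > 0"
  using exps by (simp add: bubble_const_eq)

lemma bubble_eq:
  fixes x :: "real^'n"
  shows "bubble \<alpha> l x = bubble_const N \<alpha> * l powr aexp * profile (l powr bexp) (2 * aexp / bexp) (norm x)"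
proof -
  have "2 * aexp = real N - 4 + 2 * \<alpha>" by (simp add: aexp_def)
  then have "(real N - 4 + 2 * \<alpha>) / (2 - \<alpha>) = 2 * aexp / bexp" "(real N - 4 + 2 * \<alpha>) / 2 = aexp" "2 - \<alpha> = bexp"
    by (simp_all only: aexp_def bexp_def)
  then show ?thesis unfolding bubble_def card_dim profile_def powr_minus_divide by (simp only: times_divide_eq_right mult_1_right)
qed

lemma bubble_pos: "l > 0 \<Longrightarrow> bubble \<alpha> l (x::real^'n) > 0"
  using bubble_const_pos profile_pos[of "l powr bexp"] by (simp add: bubble_eq)

lemma bubble_profile:
  assumes l: "l > 0"
  shows "radial_nontrivial_solution \<alpha> (bubble \<alpha> l :: real^'n \<Rightarrow> real)"
    "\<exists>P g Q g0. regular_sol (\<lambda>r. bubble_const N \<alpha> * l powr aexp * profile (l powr bexp) (2 * aexp / bexp) r)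
        P g Q (bubble_const N \<alpha> * l powr aexp) g0 \<and> (\<lambda>x::real^'n. g (norm x)) \<in> L2 lborel"
proof -
  have \<kappa>: "l powr bexp > 0" and C: "bubble_const N \<alpha> * l powr aexp > 0" using l bubble_const_pos by auto
  have K: "2 * aexp * (2 * aexp + bexp) * real N * (real N + bexp) > 0" using exps(1,2) N_pos by simp
  \<comment> \<open>Criticality, aexp pexp = 2 bexp, lets one amplitude condition hold for every
    scale l at once.\<close>
  have 1: "(l powr aexp) powr pexp = (l powr bexp)\<^sup>2"
    unfolding powr_powr exps(5) using l by (simp add: power2_eq_square powr_add[symmetric])
  have 2: "bubble_const N \<alpha> powr pexp = 2 * aexp * (2 * aexp + bexp) * real N * (real N + bexp)"
    unfolding bubble_const_eq powr_powr using exps(3) K by simp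
  have Cp: "(bubble_const N \<alpha> * l powr aexp) powr pexp
      = (l powr bexp)\<^sup>2 * (2 * aexp * (2 * aexp + bexp) * real N * (real N + bexp))"
    using bubble_const_pos by (simp only: powr_mult 1 2 mult.commute)
  note s = profile_solution[OF \<kappa> C Cp]
  show "\<exists>P g Q g0. regular_sol (\<lambda>r. bubble_const N \<alpha> * l powr aexp * profile (l powr bexp) (2 * aexp / bexp) r)
        P g Q (bubble_const N \<alpha> * l powr aexp) g0 \<and> (\<lambda>x::real^'n. g (norm x)) \<in> L2 lborel" by (rule s(3))
  have b: "bubble \<alpha> l = (\<lambda>x::real^'n. bubble_const N \<alpha> * l powr aexp * profile (l powr bexp) (2 * aexp / bexp) (norm x))"
    by (simp add: fun_eq_iff bubble_eq)
  show "radial_nontrivial_solution \<alpha> (bubble \<alpha> l :: real^'n \<Rightarrow> real)"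
    unfolding radial_nontrivial_solution_def
  proof (intro conjI)
    show "bubble \<alpha> l \<in> (D22 \<alpha> :: (real^'n \<Rightarrow> real) set)" unfolding b by (rule s(1))
    show "weak_solution \<alpha> (bubble \<alpha> l :: real^'n \<Rightarrow> real)" unfolding b by (rule s(2))
    show "radial (bubble \<alpha> l :: real^'n \<Rightarrow> real)" unfolding b radial_def
      by (intro exI[of _ "\<lambda>r. bubble_const N \<alpha> * l powr aexp * profile (l powr bexp) (2 * aexp / bexp) r"]) simp
    show "\<not> (AE x in lebesgue. bubble \<alpha> l (x::real^'n) = 0)"
    proof
      assume "AE x in lebesgue. bubble \<alpha> l (x::real^'n) = 0"
      then have "AE x in (lebesgue :: (real^'n) measure). False"
      proof eventually_elim
        case (elim x)
        then show ?case using bubble_pos[OF l, of x] by simp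
      qed
      then have "UNIV \<in> null_sets (lebesgue :: (real^'n) measure)" by (simp add: AE_iff_null_sets[of UNIV lebesgue])
      then show False using negligible_iff_null_sets[of "UNIV :: (real^'n) set"] by simp
    qed
  qed
qed

end

subsection \<open>Classification\<close>

lemma AE_lebesgue_scale:
  fixes l :: real
  assumes l: "l \<noteq> 0" and ae: "AE y in lebesgue. Q (y :: 'a::euclidean_space)"
  shows "AE x in lebesgue. Q (l *\<^sub>R x)"
proof -
  obtain S where S: "negligible S" "{y. \<not> Q y} \<subseteq> S"
    using ae unfolding eventually_ae_filter_negligible by blast
  have "negligible ((\<lambda>y. (1 / l) *\<^sub>R y) ` S)"
    by (rule negligible_differentiable_image_negligible[OF order_refl S(1)])
      (intro linear_imp_differentiable_on linear_scaleR)
  moreover have "{x. \<not> Q (l *\<^sub>R x)} \<subseteq> (\<lambda>y. (1 / l) *\<^sub>R y) ` S"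
  proof
    fix x assume "x \<in> {x. \<not> Q (l *\<^sub>R x)}"
    then have "l *\<^sub>R x \<in> S" using S(2) by blast
    moreover have "x = (1 / l) *\<^sub>R (l *\<^sub>R x)" using l by simp
    ultimately show "x \<in> (\<lambda>y. (1 / l) *\<^sub>R y) ` S" by (rule rev_image_eqI)
  qed
  ultimately show ?thesis unfolding eventually_ae_filter_negligible by blast
qed

context weight_range
begin

lemma bubble_scale:
  fixes x :: "real^'n"
  assumes "l > 0" "m > 0"
  shows "l powr aexp * bubble \<alpha> m (l *\<^sub>R x) = bubble \<alpha> (l * m) x"
proof -
  have "m powr bexp * (l * norm x) powr bexp = (l * m) powr bexp * norm x powr bexp"
    using assms by (simp add: powr_mult)
  then have p: "profile (m powr bexp) s (norm (l *\<^sub>R x)) = profile ((l * m) powr bexp) s (norm x)" for s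
    using assms by (simp add: profile_def)
  have "(l * m) powr aexp = l powr aexp * m powr aexp" using assms by (simp add: powr_mult)
  then show ?thesis unfolding bubble_eq p by simp
qed

lemma AE_lebesgue_not_zero: "AE x in lebesgue. x \<noteq> (0::real^'n)"
  by (rule AE_completion[OF AE_lborel_not_zero])

lemma regular_sol_minus:
  assumes "regular_sol f P g Q f0 g0"
  shows "regular_sol (\<lambda>r. - f r) (\<lambda>r. - P r) (\<lambda>r. - g r) (\<lambda>r. - Q r) (- f0) (- g0)"
  using assms radial_sys_cmult[of N \<alpha> f P g "-1"] radial_sys_cmult[of N \<alpha> g Q "\<lambda>r. nonlin N \<alpha> (f r)" "-1"]
  unfolding regular_sol_def by (auto simp: nonlin_minus tendsto_minus intro: tendsto_eq_intros)

lemma regular_sol_zero: "regular_sol (\<lambda>r. 0) (\<lambda>r. 0) (\<lambda>r. 0) (\<lambda>r. 0) 0 0"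
  unfolding regular_sol_def radial_sys_def nonlin_eq by simp

lemma regular_sol_pos_bubble:
  assumes reg: "regular_sol f P g Q f0 g0" and gL: "(\<lambda>x::real^'n. g (norm x)) \<in> L2 lborel" and f0: "f0 > 0"
  shows "\<exists>l>0. \<forall>x::real^'n. x \<noteq> 0 \<longrightarrow> f (norm x) = bubble \<alpha> l x"
proof -
  \<comment> \<open>Solves bubble constant times l^aexp = f0, so the bubble has the value f0 at the
    origin.\<close>
  define l where "l = (f0 / bubble_const N \<alpha>) powr (1 / aexp)"
  have l: "l > 0" using f0 bubble_const_pos by (simp add: l_def)
  have "l powr aexp = f0 / bubble_const N \<alpha>"
    unfolding l_def powr_powr using f0 bubble_const_pos exps(1) by simp
  then have e: "bubble_const N \<alpha> * l powr aexp = f0" using bubble_const_pos by simp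
  obtain P' g' Q' g0' where r: "regular_sol (\<lambda>r. bubble_const N \<alpha> * l powr aexp * profile (l powr bexp) (2 * aexp / bexp) r) P' g' Q' f0 g0'"
    and L: "(\<lambda>x::real^'n. g' (norm x)) \<in> L2 lborel"
    using bubble_profile(2)[OF l] unfolding e by blast
  have "f (norm x) = bubble \<alpha> l x" if "x \<noteq> 0" for x :: "real^'n"
    unfolding bubble_eq by (rule regular_sol_unique[OF reg r gL L]) (use that in simp)
  then show ?thesis using l by blast
qed

lemma radial_nontrivial_solution_is_bubble:
  fixes u :: "real^'n \<Rightarrow> real"
  assumes u: "radial_nontrivial_solution \<alpha> u"
  shows "\<exists>l>0. (AE x in lebesgue. u x = bubble \<alpha> l x) \<or> (AE x in lebesgue. u x = - bubble \<alpha> l x)"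
proof -
  have "u \<in> D22 \<alpha>" "weak_solution \<alpha> u" "radial u" and nz: "\<not> (AE x in lebesgue. u x = 0)"
    using u unfolding radial_nontrivial_solution_def by blast+
  from this(1-3) obtain f P g Q f0 g0 where reg: "regular_sol f P g Q f0 g0"
    and gL: "(\<lambda>x::real^'n. g (norm x)) \<in> L2 lborel" and uf: "AE x in lebesgue. u x = f (norm x)"
    by (rule weak_solution_regular) (rule that)
  consider "f0 = 0" | "f0 > 0" | "- f0 > 0" by linarith
  then show ?thesis
  proof cases
    case 1
    \<comment> \<open>With f0 = 0 the comparison is with the zero solution, which contradicts
      nontriviality.\<close>
    have zero: "regular_sol (\<lambda>r. 0) (\<lambda>r. 0) (\<lambda>r. 0) (\<lambda>r. 0) f0 0" unfolding 1 by (rule regular_sol_zero)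
    have z: "(\<lambda>x::real^'n. 0) \<in> L2 lborel" by (simp add: L2_def)
    have "AE x in lebesgue. u x = 0"
      using uf AE_lebesgue_not_zero
    proof eventually_elim
      case (elim x)
      have "f (norm x) = 0"
        by (rule regular_sol_unique[OF reg zero gL z]) (use elim(2) in simp)
      then show ?case using elim(1) by simp
    qed
    then show ?thesis using nz by blast
  next
    case 2
    from regular_sol_pos_bubble[OF reg gL this] obtain l where l: "l > 0" "\<And>x::real^'n. x \<noteq> 0 \<Longrightarrow> f (norm x) = bubble \<alpha> l x" by blast
    have "AE x in lebesgue. u x = bubble \<alpha> l x"
      using uf AE_lebesgue_not_zero
    proof eventually_elim
      case (elim x)
      show ?case using elim(1) l(2)[OF elim(2)] by simp
    qed
    then show ?thesis using l(1) by blast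
  next
    case 3
    have "(\<lambda>x::real^'n. - g (norm x)) \<in> L2 lborel" using L2_cmult[OF gL, of "-1"] by simp
    from regular_sol_pos_bubble[OF regular_sol_minus[OF reg] this 3] obtain l
      where l: "l > 0" "\<And>x::real^'n. x \<noteq> 0 \<Longrightarrow> - f (norm x) = bubble \<alpha> l x" by blast
    have "AE x in lebesgue. u x = - bubble \<alpha> l x"
      using uf AE_lebesgue_not_zero
    proof eventually_elim
      case (elim x)
      show ?case using elim(1) l(2)[OF elim(2)] by simp
    qed
    then show ?thesis using l(1) by blast
  qed
qed

lemma radial_nontrivial_solution_iff:
  fixes u :: "real^'n \<Rightarrow> real"
  shows "radial_nontrivial_solution \<alpha> u \<longleftrightarrow>
    (\<exists>l>0. (AE x in lebesgue. u x = bubble \<alpha> l x) \<or> (AE x in lebesgue. u x = - bubble \<alpha> l x))"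
proof
  assume "\<exists>l>0. (AE x in lebesgue. u x = bubble \<alpha> l x) \<or> (AE x in lebesgue. u x = - bubble \<alpha> l x)"
  then obtain l where l: "l > 0" "(AE x in lebesgue. u x = bubble \<alpha> l x) \<or> (AE x in lebesgue. u x = - bubble \<alpha> l x)" by blast
  note b = bubble_profile(1)[OF l(1)]
  from l(2) show "radial_nontrivial_solution \<alpha> u"
  proof
    assume "AE x in lebesgue. u x = bubble \<alpha> l x"
    then have "AE x in lebesgue. bubble \<alpha> l x = u x" by eventually_elim simp
    from radial_nontrivial_solution_cong_AE[OF b this] show ?thesis .
  next
    assume "AE x in lebesgue. u x = - bubble \<alpha> l x"
    then have "AE x in lebesgue. - bubble \<alpha> l x = u x" by eventually_elim simp
    from radial_nontrivial_solution_cong_AE[OF radial_nontrivial_solution_minus[OF b] this] show ?thesis .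
  qed
qed (rule radial_nontrivial_solution_is_bubble)

lemma radial_nontrivial_solution_unique:
  fixes u v :: "real^'n \<Rightarrow> real"
  assumes u: "radial_nontrivial_solution \<alpha> u" and v: "radial_nontrivial_solution \<alpha> v"
  shows "\<exists>l>0. \<exists>s\<in>{1, -1}. AE x in lebesgue. v x = s * (l powr aexp * u (l *\<^sub>R x))"
proof -
  have sgn: "\<exists>l>0. \<exists>s\<in>{1, -1}. AE x in lebesgue. w x = s * bubble \<alpha> l x"
    if w: "radial_nontrivial_solution \<alpha> w" for w :: "real^'n \<Rightarrow> real"
  proof -
    obtain l where l: "l > 0" "(AE x in lebesgue. w x = bubble \<alpha> l x) \<or> (AE x in lebesgue. w x = - bubble \<alpha> l x)"
      using radial_nontrivial_solution_is_bubble[OF w] by blast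
    then have "(AE x in lebesgue. w x = 1 * bubble \<alpha> l x) \<or> (AE x in lebesgue. w x = (-1) * bubble \<alpha> l x)" by simp
    then show ?thesis using l(1) by blast
  qed
  obtain l1 s1 where 1: "l1 > 0" "s1 \<in> {1, -1}" "AE x in lebesgue. u x = s1 * bubble \<alpha> l1 x" using sgn[OF u] by blast
  obtain l2 s2 where 2: "l2 > 0" "s2 \<in> {1, -1}" "AE x in lebesgue. v x = s2 * bubble \<alpha> l2 x" using sgn[OF v] by blast
  \<comment> \<open>Scalings compose multiplicatively, so this factor carries the bubble of
    parameter l1 to that of l2; the signs combine to s2 s1.\<close>
  define l where "l = l2 / l1"
  have l: "l > 0" "l * l1 = l2" using 1(1) 2(1) by (auto simp: l_def)
  have s: "s2 * s1 \<in> {1, -1}" "s2 * s1 * s1 = s2" using 1(2) 2(2) by auto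
  have "l \<noteq> 0" using l(1) by simp
  from AE_lebesgue_scale[OF this 1(3)] 2(3)
  have "AE x in lebesgue. v x = (s2 * s1) * (l powr aexp * u (l *\<^sub>R x))"
  proof eventually_elim
    case (elim x)
    have "(s2 * s1) * (l powr aexp * u (l *\<^sub>R x)) = (s2 * s1 * s1) * (l powr aexp * bubble \<alpha> l1 (l *\<^sub>R x))"
      unfolding elim(1) by (simp only: mult_ac)
    also have "\<dots> = s2 * bubble \<alpha> l2 x" unfolding s(2) bubble_scale[OF l(1) 1(1)] l(2) ..
    finally have "(s2 * s1) * (l powr aexp * u (l *\<^sub>R x)) = s2 * bubble \<alpha> l2 x" .
    then show ?case using elim(2) by (simp only:)
  qed
  then show ?thesis using l(1) s(1) by blast
qed

end

theorem theorem1p1: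
  fixes \<alpha> :: real
  assumes "CARD('n::finite) \<ge> 2"
    and "(4 - real CARD('n)) / 2 < \<alpha>" and "\<alpha> < 2"
  shows "(\<exists>u :: real ^ 'n \<Rightarrow> real. radial_nontrivial_solution \<alpha> u) \<and>
    (\<forall>u v :: real ^ 'n \<Rightarrow> real.
       radial_nontrivial_solution \<alpha> u \<and> radial_nontrivial_solution \<alpha> v \<longrightarrow>
       (\<exists>l>0. \<exists>s\<in>{1, -1}. AE x in lebesgue.
          v x = s * (l powr ((real CARD('n) - 4 + 2 * \<alpha>) / 2) * u (l *\<^sub>R x)))) \<and>
    (\<forall>u :: real ^ 'n \<Rightarrow> real.
       radial_nontrivial_solution \<alpha> u \<longleftrightarrow>
       (\<exists>l>0. (AE x in lebesgue. u x = bubble \<alpha> l x) \<or> (AE x in lebesgue. u x = - bubble \<alpha> l x)))"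
proof -
  interpret weight_range \<alpha> "CARD('n)" "TYPE('n)"
    by unfold_locales (use assms in auto)
  have "radial_nontrivial_solution \<alpha> (bubble \<alpha> 1 :: real^'n \<Rightarrow> real)" by (rule bubble_profile(1)) simp
  then show ?thesis
    using radial_nontrivial_solution_unique[unfolded aexp_def] radial_nontrivial_solution_iff by blast
qed

end
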